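(* Let $X$ be any r.i. space on $(-1,1)$ such that $0<\underline{\alpha}_X\le\overline{\alpha}_X<1$, and let $T_X\colon X\to X$ be the finite Hilbert transform on $X$. (a) Each of the spectra $\sigma(T_X)$, $\sigma_{\mathrm{pt}}(T_X)$, $\sigma_{\mathrm{c}}(T_X)$ and $\sigma_{\mathrm{r}}(T_X)$ is symmetric with respect to both the real axis and the imaginary axis in $\mathbb{C}$. In particular, these spectra are also symmetric with respect to reflection through $0$. (b) The set $\sigma_{\mathrm{pt}}(T_X)$ is $\mathbb{R}$-balanced, that is, $\alpha\lambda\in\sigma_{\mathrm{pt}}(T_X)$ for each $\lambda\in\sigma_{\mathrm{pt}}(T_X)$ and every $\alpha\in\mathbb{R}$ satisfying $|\alpha|\le 1$.
   Context: The interval $(-1,1)$ carries Lebesgue measure; $L^0$ is the space of (equivalence classes of) complex-valued measurable functions on $(-1,1)$, and $L^p=L^p(-1,1)$. For $f\in L^0$, $f^*\colon[0,2]\to[0,\infty]$ denotes its decreasing rearrangement. A rearrangement invariant (r.i.) space $X$ on $(-1,1)$ is a (nonzero) Banach space $X\subseteq L^0$ such that if $g\in L^0$, $f\in X$ and $g^*\le f^*$, then $g\in X$ and $\|g\|_X\le\|f\|_X$; all r.i. spaces are assumed to satisfy the Fatou property: if $(f_n)\subseteq X$, $0\le f_n\uparrow f$ a.e. and $\sup_n\|f_n\|_X<\infty$, then $f\in X$ and $\|f_n\|_X\to\|f\|_X$. For $t>0$ the dilation operator $E_t\colon X\to X$ is $E_t(f)(s):=f(st)$ if $-1\le st\le1$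 and $0$ otherwise. The lower and upper Boyd indices of $X$ are $\underline{\alpha}_X:=\sup_{0<t<1}\frac{\log\|E_{1/t}\|_{X\to X}}{\log t}$ and $\overline{\alpha}_X:=\inf_{1<t<\infty}\frac{\log\|E_{1/t}\|_{X\to X}}{\log t}$. The finite Hilbert transform of $f\in L^1(-1,1)$ is $(T(f))(t)=\lim_{\varepsilon\to0^+}\frac{1}{\pi i}\left(\int_{-1}^{t-\varepsilon}+\int_{t+\varepsilon}^1\right)\frac{f(x)}{x-t}\,dx$, which exists for a.e. $t\in(-1,1)$. If $0<\underline{\alpha}_X\le\overline{\alpha}_X<1$, then $T$ maps $X$ boundedly into $X$ (Boyd); this operator is denoted $T_X$. For a bounded operator $B$ on a Banach space $Y$, with spectrum $\sigma(B)$: $\sigma_{\mathrm{pt}}(B)$ is the set of eigenvalues; $\sigma_{\mathrm{c}}(B)$ is the set of $\lambda\in\sigma(B)$ for which $\lambda I-B$ is injective with dense range; $\sigma_{\mathrm{r}}(B)$ is the set of $\lambda\in\sigma(B)$ for which $\lambda I-B$ is injective and its range is not dense. *)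

theory Defs
  imports "HOL-Analysis.Analysis"
begin

text \<open>
  Elements of \<open>L\<^sup>0(-1,1)\<close> are represented by functions \<^typ>\<open>real \<Rightarrow> complex\<close> whose values
  outside \<open>(-1,1)\<close> are irrelevant; equality of elements is the relation \<open>ae_eq\<close> below.
\<close>

abbreviation M11 :: "real measure" where
  "M11 \<equiv> lebesgue_on {-1<..<1}"

abbreviation L0 :: "(real \<Rightarrow> complex) set" where
  "L0 \<equiv> borel_measurable M11"

definition ae_eq :: "(real \<Rightarrow> complex) \<Rightarrow> (real \<Rightarrow> complex) \<Rightarrow> bool" where
  "ae_eq f g \<longleftrightarrow> (AE x in M11. f x = g x)"

text \<open>Used for \<open>0 \<le> t \<le> 2\<close>. The infimum is taken in \<open>[0,\<infinity>]\<close>, where the infimum of the empty set is \<open>\<infinity>\<close>.\<close>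

definition rearr :: "(real \<Rightarrow> complex) \<Rightarrow> real \<Rightarrow> ennreal" where
  "rearr f t =
     (INF s \<in> {s::real. 0 \<le> s \<and> emeasure M11 {x \<in> space M11. s < norm (f x)} \<le> ennreal t}. ennreal s)"

text \<open>
  A complex Banach space of a.e.-equivalence classes: \<open>X\<close> is the set of all chosen representatives,
  \<open>N\<close> the norm as a function of the representative. For \<open>f \<in> X\<close>, \<open>N f = 0\<close> means that \<open>f\<close> is the
  zero class.
\<close>

locale banach_fun_space =
  fixes X :: "(real \<Rightarrow> complex) set" and N :: "(real \<Rightarrow> complex) \<Rightarrow> real"
  assumes subset_L0: "X \<subseteq> L0"
    and ae_closed: "\<And>f g. f \<in> X \<Longrightarrow> g \<in> L0 \<Longrightarrow> ae_eq f g \<Longrightarrow> g \<in> X"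
    and zero_mem: "(\<lambda>x. 0) \<in> X"
    and add_mem: "\<And>f g. f \<in> X \<Longrightarrow> g \<in> X \<Longrightarrow> (\<lambda>x. f x + g x) \<in> X"
    and scale_mem: "\<And>c f. f \<in> X \<Longrightarrow> (\<lambda>x. c * f x) \<in> X"
    and norm_nonneg: "\<And>f. f \<in> X \<Longrightarrow> 0 \<le> N f"
    and norm_zero_iff: "\<And>f. f \<in> X \<Longrightarrow> N f = 0 \<longleftrightarrow> ae_eq f (\<lambda>x. 0)"
    and norm_triangle: "\<And>f g. f \<in> X \<Longrightarrow> g \<in> X \<Longrightarrow> N (\<lambda>x. f x + g x) \<le> N f + N g"
    and norm_scale: "\<And>c f. f \<in> X \<Longrightarrow> N (\<lambda>x. c * f x) = cmod c * N f"
    and complete: "\<And>F :: nat \<Rightarrow> real \<Rightarrow> complex.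
          (\<And>n. F n \<in> X) \<Longrightarrow>
          (\<forall>e>0. \<exists>K. \<forall>m\<ge>K. \<forall>n\<ge>K. N (\<lambda>x. F m x - F n x) < e) \<Longrightarrow>
          \<exists>f\<in>X. (\<lambda>n. N (\<lambda>x. F n x - f x)) \<longlonglongrightarrow> 0"

locale ri_space = banach_fun_space +
  assumes nonzero: "\<exists>f\<in>X. \<not> ae_eq f (\<lambda>x. 0)"
    and rearr_mem: "\<And>f g. g \<in> L0 \<Longrightarrow> f \<in> X \<Longrightarrow> (\<forall>t\<in>{0..2}. rearr g t \<le> rearr f t) \<Longrightarrow> g \<in> X"
    and rearr_norm: "\<And>f g. g \<in> L0 \<Longrightarrow> f \<in> X \<Longrightarrow> (\<forall>t\<in>{0..2}. rearr g t \<le> rearr f t) \<Longrightarrow> N g \<le> N f"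
    and Fatou: "\<And>(F :: nat \<Rightarrow> real \<Rightarrow> complex) f.
          (\<And>n. F n \<in> X) \<Longrightarrow> f \<in> L0 \<Longrightarrow>
          (AE x in M11. (\<forall>n. Im (F n x) = 0 \<and> 0 \<le> Re (F n x)) \<and> incseq (\<lambda>n. Re (F n x)) \<and>
                        (\<lambda>n. F n x) \<longlonglongrightarrow> f x) \<Longrightarrow>
          bdd_above (range (\<lambda>n. N (F n))) \<Longrightarrow>
          f \<in> X \<and> (\<lambda>n. N (F n)) \<longlonglongrightarrow> N f"

definition opnorm ::
  "(real \<Rightarrow> complex) set \<Rightarrow> ((real \<Rightarrow> complex) \<Rightarrow> real) \<Rightarrow> ((real \<Rightarrow> complex) \<Rightarrow> real \<Rightarrow> complex) \<Rightarrow> real" where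
  "opnorm X N B = (SUP f\<in>{f \<in> X. N f \<le> 1}. N (B f))"

definition dilation :: "real \<Rightarrow> (real \<Rightarrow> complex) \<Rightarrow> real \<Rightarrow> complex" where
  "dilation t f = (\<lambda>s. if -1 \<le> s * t \<and> s * t \<le> 1 then f (s * t) else 0)"

text \<open>The indices are extended reals, so that the supremum and the infimum are always meaningful.\<close>

definition lower_Boyd :: "(real \<Rightarrow> complex) set \<Rightarrow> ((real \<Rightarrow> complex) \<Rightarrow> real) \<Rightarrow> ereal" where
  "lower_Boyd X N = (SUP t\<in>{0<..<1}. ereal (ln (opnorm X N (dilation (1 / t))) / ln t))"

definition upper_Boyd :: "(real \<Rightarrow> complex) set \<Rightarrow> ((real \<Rightarrow> complex) \<Rightarrow> real) \<Rightarrow> ereal" where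
  "upper_Boyd X N = (INF t\<in>{1<..}. ereal (ln (opnorm X N (dilation (1 / t))) / ln t))"

text \<open>At the points where the limit does not exist the value is unspecified; for integrable \<open>f\<close> they
  form a null set.\<close>

definition finite_Hilbert :: "(real \<Rightarrow> complex) \<Rightarrow> real \<Rightarrow> complex" where
  "finite_Hilbert f t =
     Lim (at_right 0) (\<lambda>e::real. 1 / (complex_of_real pi * \<i>) *
       (set_lebesgue_integral lebesgue {-1<..<t - e} (\<lambda>x. f x / complex_of_real (x - t)) +
        set_lebesgue_integral lebesgue {t + e<..<1} (\<lambda>x. f x / complex_of_real (x - t))))"

text \<open>
  Operators on \<open>X\<close> act on representatives, so linearity, injectivity and inverses are understood up
  to \<open>ae_eq\<close>.
\<close>

definition bounded_op ::
  "(real \<Rightarrow> complex) set \<Rightarrow> ((real \<Rightarrow> complex) \<Rightarrow> real) \<Rightarrow> ((real \<Rightarrow> complex) \<Rightarrow> real \<Rightarrow> complex) \<Rightarrow> bool" where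
  "bounded_op X N B \<longleftrightarrow>
     (\<forall>f\<in>X. B f \<in> X) \<and>
     (\<forall>f\<in>X. \<forall>g\<in>X. ae_eq (B (\<lambda>x. f x + g x)) (\<lambda>x. B f x + B g x)) \<and>
     (\<forall>c. \<forall>f\<in>X. ae_eq (B (\<lambda>x. c * f x)) (\<lambda>x. c * B f x)) \<and>
     (\<exists>C. \<forall>f\<in>X. N (B f) \<le> C * N f)"

definition shifted ::
  "complex \<Rightarrow> ((real \<Rightarrow> complex) \<Rightarrow> real \<Rightarrow> complex) \<Rightarrow> (real \<Rightarrow> complex) \<Rightarrow> real \<Rightarrow> complex" where
  "shifted z B f = (\<lambda>x. z * f x - B f x)"

definition spectrum ::
  "(real \<Rightarrow> complex) set \<Rightarrow> ((real \<Rightarrow> complex) \<Rightarrow> real) \<Rightarrow> ((real \<Rightarrow> complex) \<Rightarrow> real \<Rightarrow> complex) \<Rightarrow> complex set" where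
  "spectrum X N B =
     {z. \<not> (\<exists>S. bounded_op X N S \<and>
             (\<forall>f\<in>X. ae_eq (S (shifted z B f)) f \<and> ae_eq (shifted z B (S f)) f))}"

definition inj_op :: "(real \<Rightarrow> complex) set \<Rightarrow> ((real \<Rightarrow> complex) \<Rightarrow> real \<Rightarrow> complex) \<Rightarrow> bool" where
  "inj_op X B \<longleftrightarrow> (\<forall>f\<in>X. \<forall>g\<in>X. ae_eq (B f) (B g) \<longrightarrow> ae_eq f g)"

definition dense_range ::
  "(real \<Rightarrow> complex) set \<Rightarrow> ((real \<Rightarrow> complex) \<Rightarrow> real) \<Rightarrow> ((real \<Rightarrow> complex) \<Rightarrow> real \<Rightarrow> complex) \<Rightarrow> bool" where
  "dense_range X N B \<longleftrightarrow> (\<forall>g\<in>X. \<forall>e>0. \<exists>f\<in>X. N (\<lambda>x. g x - B f x) < e)"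

definition point_spectrum ::
  "(real \<Rightarrow> complex) set \<Rightarrow> ((real \<Rightarrow> complex) \<Rightarrow> real \<Rightarrow> complex) \<Rightarrow> complex set" where
  "point_spectrum X B = {z. \<exists>f\<in>X. \<not> ae_eq f (\<lambda>x. 0) \<and> ae_eq (B f) (\<lambda>x. z * f x)}"

definition continuous_spectrum ::
  "(real \<Rightarrow> complex) set \<Rightarrow> ((real \<Rightarrow> complex) \<Rightarrow> real) \<Rightarrow> ((real \<Rightarrow> complex) \<Rightarrow> real \<Rightarrow> complex) \<Rightarrow> complex set" where
  "continuous_spectrum X N B =
     {z \<in> spectrum X N B. inj_op X (shifted z B) \<and> dense_range X N (shifted z B)}"

definition residual_spectrum ::
  "(real \<Rightarrow> complex) set \<Rightarrow> ((real \<Rightarrow> complex) \<Rightarrow> real) \<Rightarrow> ((real \<Rightarrow> complex) \<Rightarrow> real \<Rightarrow> complex) \<Rightarrow> complex set" where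
  "residual_spectrum X N B =
     {z \<in> spectrum X N B. inj_op X (shifted z B) \<and> \<not> dense_range X N (shifted z B)}"

definition axes_symmetric :: "complex set \<Rightarrow> bool" where
  "axes_symmetric S \<longleftrightarrow> cnj ` S = S \<and> (\<lambda>z. - cnj z) ` S = S"

end

theory Submission
  imports Defs "HOL-Complex_Analysis.Complex_Analysis"
begin

text \<open>
  Part (a): conjugation and reflection \<open>f(x) \<mapsto> f(-x)\<close> preserve \<open>X\<close> and its norm and anticommute with \<open>T\<close>.
  That \<open>T\<close> acts on \<open>X\<close> comes from Riesz's \<open>L\<^sup>p\<close> bound for the conjugate function, applied to a splitting of \<open>f\<close> at the level of
  its rearrangement and summed up with the Boyd indices.

  Part (b): the Cauchy integral \<open>F\<close> of an eigenfunction \<open>f\<close> with eigenvalue \<open>\<lambda>\<close> has boundary values \<open>(\<lambda> \<plusminus> 1) f\<close>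
  on \<open>(-1,1)\<close>. Multiplied by \<open>(z + 1) ((z - 1) / (z + 1))\<^sup>a\<close> with \<open>exp (2 \<pi> \<i> a) = (\<lambda> - 1) / (\<lambda> + 1)\<close> the two boundary values agree,
  so the product is constant and \<open>f\<close> is a multiple of an explicit function \<open>w\<^sub>a\<close> with \<open>0 < Re a < 1\<close>. Conversely \<open>w\<^sub>a\<close> is an
  eigenfunction as soon as it lies in \<open>X\<close>. Shrinking \<open>\<lambda>\<close> to \<open>\<alpha> \<lambda>\<close> moves \<open>Re a\<close> towards \<open>1 / 2\<close>, and then
  \<open>\<bar>w(x)\<bar>\<close> is dominated by \<open>\<bar>w\<^sub>a(x)\<bar> + \<bar>w\<^sub>a(-x)\<bar>\<close>.
\<close>

text \<open>Riesz's argument integrates \<open>Re (F powr p)\<close> along a line and needs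
  \<open>cos (p * pi / 2)\<close> to be nonzero. This shapes the choice of exponents: one in (1,2),
  close enough to 1 for the upper index, and one even integer, large enough for the lower index.
  What comes out is a majorant for the distribution function of the transform, the only information
  about a function that rearrangement invariance can use.

  Boundary values of Cauchy integrals in general decay only like 1/x, and eigenfunctions are
  unbounded near the end points. Limits are therefore taken a.e. and also in L^1 of dx/(1+x^2), a
  mode of convergence that passes through Poisson integrals. Holomorphic functions are recovered
  from their boundary values by Poisson's formula, in place of gluing across the line.

  The exponent degenerates for the eigenvalues 1 and -1, and at \<open>Re a = 1\<close> the
  candidate eigenfunction stops being integrable. Both cases have to be excluded before
  \<open>\<lambda>\<close> is shrunk, and the shrunk value must be shown to avoid them too.\<close>

abbreviation BM :: "('a::topological_space => 'b::topological_space) set" where "BM \<equiv> borel_measurable borel"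

abbreviation cr :: "real => complex" where "cr \<equiv> of_real"

section \<open>Poisson and Cauchy integrals\<close>

text \<open>Vitali covering: in any open \<open>U\<close> containing \<open>S\<close>, almost all of
  \<open>S\<close> is covered by countably many disjoint intervals on which \<open>\<nu>\<close> is
  at least \<open>s\<close> times the length. Summing gives the bound with \<open>\<nu> U\<close>,
  and outer regularity of the finite measure \<open>\<nu>\<close> replaces \<open>U\<close> by
  \<open>S\<close>.\<close>

lemma vitali_ratio_bound:
 fixes S :: "real set" and \<nu> :: "real measure"
 assumes sets: "sets \<nu> = sets borel" and fin: "finite_measure \<nu>"
  and S: "S \<in> sets borel"
  and s: "0 <= s"
  and cov: "\<And>x d. x \<in> S ==> 0 < d ==> \<exists>u v. u < x \<and> x < v \<and> v - u < d \<and>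
     ennreal (s * (v - u)) <= emeasure \<nu> {u..v}"
 shows "ennreal s * emeasure lborel S <= emeasure \<nu> S"
proof -
 interpret finite_measure \<nu> by fact
 have key: "ennreal s * emeasure lborel S <= emeasure \<nu> U" if U: "open U" "S \<subseteq> U" for U
 proof -
  define K where "K = {(u, v). u < v \<and> {u..v} \<subseteq> U \<and> ennreal (s * (v - u)) <= emeasure \<nu> {u..v}}"
  define a where "a = (%(u::real, v::real). (u + v) / 2)"
  define r where "r = (%(u::real, v::real). (v - u) / 2)"
  have cb: "cball (a i) (r i) = {fst i..snd i}" for i
   by (cases i) (auto simp: a_def r_def cball_eq_atLeastAtMost field_simps)
  obtain C where C: "countable C" "C \<subseteq> K"
   and disj: "pairwise (%i j. disjnt (cball (a i) (r i)) (cball (a j) (r j))) C"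
   and neg: "negligible (S - (\<Union>i\<in>C. cball (a i) (r i)))"
  proof (rule Vitali_covering_theorem_cballs[of K r S a])
   show "0 < r i" if "i \<in> K" for i using that by (auto simp: K_def r_def)
   show "\<exists>i. i \<in> K \<and> x \<in> cball (a i) (r i) \<and> r i < d" if xd: "x \<in> S" "0 < d" for x d
   proof -
    obtain e where e: "0 < e" "ball x e \<subseteq> U"
     using U xd by (meson openE subsetD)
    obtain u v where uv: "u < x" "x < v" "v - u < min d e"
      "ennreal (s * (v - u)) <= emeasure \<nu> {u..v}"
     using cov[OF xd(1), of "min d e"] e xd(2) by auto
    have "{u..v} \<subseteq> ball x e"
     using uv by (auto simp: dist_real_def)
    then have "(u, v) \<in> K" using uv e by (auto simp: K_def)
    moreover have "x \<in> cball (a (u, v)) (r (u, v))" unfolding cb using uv by auto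
    moreover have "r (u, v) < d" using uv by (auto simp: r_def)
    ultimately show ?thesis by blast
   qed
  qed blast
  let ?I = "%i::real\<times>real. {fst i..snd i}"
  have disj': "disjoint_family_on ?I C"
   using disj unfolding pairwise_def cb disjoint_family_on_def disjnt_def by blast
  have mU: "(\<Union>i\<in>C. ?I i) \<in> sets borel"
   using C(1) by (intro sets.countable_UN') auto
  have null: "S - (\<Union>i\<in>C. ?I i) \<in> null_sets lborel"
   using neg S mU unfolding cb negligible_iff_null_sets
   by (auto simp: null_sets_completion_iff)
  have "emeasure lborel S <= emeasure lborel (((\<Union>i\<in>C. ?I i)) \<union> (S - (\<Union>i\<in>C. ?I i)))"
   using S mU by (intro emeasure_mono) auto
  also have "\<dots> = emeasure lborel (\<Union>i\<in>C. ?I i)"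
   using null mU by (subst emeasure_Un_null_set) auto
  also have "\<dots> = (\<integral>\<^sup>+i. emeasure lborel (?I i) \<partial>count_space C)"
   using C(1) disj' by (intro emeasure_UN_countable) auto
  finally have "ennreal s * emeasure lborel S <= ennreal s * (\<integral>\<^sup>+i. emeasure lborel (?I i) \<partial>count_space C)"
   by (intro mult_left_mono) auto
  also have "\<dots> = (\<integral>\<^sup>+i. ennreal s * emeasure lborel (?I i) \<partial>count_space C)"
   by (subst nn_integral_cmult) auto
  also have "\<dots> <= (\<integral>\<^sup>+i. emeasure \<nu> (?I i) \<partial>count_space C)"
  proof (intro nn_integral_mono)
   fix i assume "i \<in> space (count_space C)"
   then have "i \<in> K" using C by auto
   then show "ennreal s * emeasure lborel (?I i) <= emeasure \<nu> (?I i)"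
    using s by (auto simp: K_def ennreal_mult)
  qed
  also have "\<dots> = emeasure \<nu> (\<Union>i\<in>C. ?I i)"
   using C(1) disj' sets by (intro emeasure_UN_countable[symmetric]) auto
  also have "\<dots> <= emeasure \<nu> U"
   using C(2) U(1) sets
  proof (intro emeasure_mono UN_least)
   fix i assume "i \<in> C"
   then have "i \<in> K" using C(2) by auto
   then show "?I i \<subseteq> U" by (auto simp: K_def split_beta)
  qed auto
  finally show ?thesis .
 qed
 have "emeasure \<nu> S = (INF U \<in> {U. S \<subseteq> U \<and> open U}. emeasure \<nu> U)"
  using S by (intro outer_regular[OF sets]) auto
 then show ?thesis using key by (auto intro!: INF_greatest)
qed

text \<open>The upper half of Lebesgue's differentiation theorem, for intervals that need not be
  centred at \<open>x\<close>. A bad point has \<open>g x < r\<close> but averages above some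
  rational \<open>s > r\<close> on arbitrarily short intervals. On the set of such points the
  covering bound for the measure with density \<open>g\<close> contradicts the trivial bound unless
  the set is null.\<close>

lemma averages_eventually_le:
 fixes g :: "real => real"
 assumes g[measurable]: "g \<in> BM" and nn: "\<And>x. 0 <= g x"
  and loc: "\<And>M. (\<integral>\<^sup>+t\<in>{-M..M}. ennreal (g t) \<partial>lborel) < \<infinity>"
 shows "AE x in lborel. \<forall>s>g x. \<exists>\<delta>>0. \<forall>u v. u < x \<and> x < v \<and> v - u < \<delta> -->
      (\<integral>\<^sup>+t\<in>{u..v}. ennreal (g t) \<partial>lborel) <= ennreal (s * (v - u))"
proof -
 define A where "A = (%u v. \<integral>\<^sup>+t\<in>{u..v}. ennreal (g t) \<partial>lborel)"
 define B where "B = (%(s::real) (k::nat). \<Union>{{u<..<v} |u v. v - u < 1 / (real k + 1) \<and> ennreal (s * (v - u)) < A u v})"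
 define S where "S = (%(M::nat) r s. {-real M<..<real M} \<inter> {x. g x < r} \<inter> (\<Inter>k. B s k))"
 have oB: "open (B s k)" for s k unfolding B_def by auto
 have Sb: "S M r s \<in> sets borel" for M r s
 proof -
  have "{x. g x < r} \<in> sets borel" by measurable
  moreover have "(\<Inter>k. B s k) \<in> sets borel" using oB by (intro sets.countable_INT) auto
  ultimately show ?thesis unfolding S_def by auto
 qed
 have null: "S M r s \<in> null_sets lborel" if "0 <= r" "r < s" for M r s
 proof -
  \<comment> \<open>The density is cut off one unit beyond \<open>M\<close>: the measure becomes
    finite, and intervals of length below 1 around points of \<open>S M r s\<close> do not see the
    cut.\<close>
  define \<nu> where "\<nu> = density lborel (%t. ennreal (g t) * indicator {-(real M + 1)..real M + 1} t)"
  have "finite_measure \<nu>"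
   by (rule finite_measureI) (use loc[of "real M + 1"] in \<open>auto simp: \<nu>_def emeasure_density\<close>)
  moreover have sets: "sets \<nu> = sets borel" by (simp add: \<nu>_def)
  ultimately have "ennreal s * emeasure lborel (S M r s) <= emeasure \<nu> (S M r s)"
  proof (intro vitali_ratio_bound Sb)
   show "0 <= s" using that by simp
   fix x d :: real assume x: "x \<in> S M r s" and d: "0 < d"
   obtain k where k: "1 / (real k + 1) < min d 1"
    using reals_Archimedean[of "min d 1"] d by (auto simp: inverse_eq_divide add.commute)
   have "x \<in> B s k" using x unfolding S_def by auto
   then obtain u v where uv: "u < x" "x < v" "v - u < 1 / (real k + 1)" "ennreal (s * (v - u)) < A u v"
    unfolding B_def by auto
   have xM: "- real M < x" "x < real M" using x unfolding S_def by auto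
   have "1 / (real k + 1) < 1" using k by linarith
   then have "- (real M + 1) <= u" "v <= real M + 1" using xM uv by linarith+
   then have sub: "{u..v} \<subseteq> {-(real M + 1)..real M + 1}" by auto
   have "emeasure \<nu> {u..v} = A u v"
    unfolding \<nu>_def A_def using sub
    by (subst emeasure_density) (auto intro!: nn_integral_cong split: split_indicator)
   then show "\<exists>u v. u < x \<and> x < v \<and> v - u < d \<and> ennreal (s * (v - u)) <= emeasure \<nu> {u..v}"
    using uv k by (intro exI[of _ u] exI[of _ v]) auto
  qed
  also have "emeasure \<nu> (S M r s) <= (\<integral>\<^sup>+t. ennreal r * indicator (S M r s) t \<partial>lborel)"
   unfolding \<nu>_def using Sb
   by (subst emeasure_density)
     (auto intro!: nn_integral_mono ennreal_leI simp: S_def split: split_indicator)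
  also have "\<dots> = ennreal r * emeasure lborel (S M r s)"
   using Sb by (subst nn_integral_cmult_indicator) auto
  finally have le: "ennreal s * emeasure lborel (S M r s) <= ennreal r * emeasure lborel (S M r s)" .
  have "emeasure lborel (S M r s) <= emeasure lborel {-real M<..<real M}"
   by (intro emeasure_mono) (auto simp: S_def)
  then have "emeasure lborel (S M r s) < \<infinity>" by (auto intro: le_less_trans)
  then obtain m where m: "emeasure lborel (S M r s) = ennreal m" "0 <= m"
   by (metis ennreal_cases infinity_ennreal_def less_irrefl)
  have "s * m <= r * m" using le m that by (simp add: ennreal_mult[symmetric])
  then have "m = 0" using m that by (metis antisym mult_le_cancel_right not_le)
  then show ?thesis using m Sb by (auto simp: null_sets_def)
 qed
 have "AE x in lborel. \<forall>M::nat. \<forall>r\<in>\<rat>. \<forall>s\<in>\<rat>. 0 <= r --> r < s --> x \<notin> S M r s"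
  unfolding AE_all_countable
 proof (intro allI AE_ball_countable'[OF _ countable_rat] impI)
  fix M :: nat and r s :: real
  show "AE x in lborel. 0 <= r --> r < s --> x \<notin> S M r s"
   using AE_not_in[OF null[of r s M]] by (cases "0 <= r \<and> r < s") auto
 qed
 then show ?thesis
 proof (rule AE_mp, intro AE_I2 impI allI)
  fix x s0 assume *: "\<forall>M::nat. \<forall>r\<in>\<rat>. \<forall>s\<in>\<rat>. 0 <= r --> r < s --> x \<notin> S M r s" and s0: "g x < s0"
  obtain r where r: "r \<in> \<rat>" "g x < r" "r < s0" using Rats_dense_in_real[OF s0] by blast
  obtain s where s: "s \<in> \<rat>" "r < s" "s < s0" using Rats_dense_in_real[OF r(3)] by blast
  obtain M :: nat where M: "\<bar>x\<bar> < real M" using reals_Archimedean2 by blast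
  have r0: "0 <= r" using nn[of x] r by simp
  have "x \<notin> S M r s" using * r s r0 by blast
  then obtain k where k: "x \<notin> B s k" using M r unfolding S_def by auto
  show "\<exists>\<delta>>0. \<forall>u v. u < x \<and> x < v \<and> v - u < \<delta> -->
      (\<integral>\<^sup>+t\<in>{u..v}. ennreal (g t) \<partial>lborel) <= ennreal (s0 * (v - u))"
  proof (intro exI[of _ "1 / (real k + 1)"] conjI allI impI)
   fix u v assume uv: "u < x \<and> x < v \<and> v - u < 1 / (real k + 1)"
   have "\<not> ennreal (s * (v - u)) < A u v"
   proof
    assume "ennreal (s * (v - u)) < A u v"
    then have "x \<in> B s k" unfolding B_def using uv
     by (intro UnionI[of "{u<..<v}"]) auto
    then show False using k by simp
   qed
   then have "A u v <= ennreal (s * (v - u))" by (simp add: not_less)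
   also have "\<dots> <= ennreal (s0 * (v - u))"
    using uv s by (intro ennreal_leI mult_right_mono) auto
   finally show "(\<integral>\<^sup>+t\<in>{u..v}. ennreal (g t) \<partial>lborel) <= ennreal (s0 * (v - u))"
    unfolding A_def .
  qed auto
 qed
qed

definition leb_pt :: "(real => complex) => real => bool" where
 "leb_pt f x \<longleftrightarrow> (\<forall>\<eta>>0. \<exists>\<delta>>0. \<forall>r. 0 < r \<and> r < \<delta> -->
   (\<integral>\<^sup>+t\<in>{x-r..x+r}. ennreal (norm (f t - f x)) \<partial>lborel) <= ennreal (\<eta> * r))"

text \<open>The bound for averages is applied to \<open>norm (f t - c)\<close> for the countably
  many \<open>c\<close> of a dense set. Outside the union of the exceptional null sets some
  \<open>c\<close> lies within \<open>\<eta>/8\<close> of \<open>f x\<close>, and the oscillation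
  around \<open>f x\<close> is controlled by the one around \<open>c\<close>.\<close>

theorem AE_leb_pt:
 fixes f :: "real => complex"
 assumes f[measurable]: "f \<in> BM"
  and loc: "\<And>M. (\<integral>\<^sup>+t\<in>{-M..M}. ennreal (norm (f t)) \<partial>lborel) < \<infinity>"
 shows "AE x in lborel. leb_pt f x"
proof -
 obtain D :: "complex set" where D: "countable D" "\<And>U. open U ==> U \<noteq> {} ==> \<exists>d\<in>D. d \<in> U"
  by (rule countable_dense_setE) blast
 have "AE x in lborel. \<forall>c\<in>D. \<forall>s>norm (f x - c). \<exists>\<delta>>0. \<forall>u v. u < x \<and> x < v \<and> v - u < \<delta> -->
      (\<integral>\<^sup>+t\<in>{u..v}. ennreal (norm (f t - c)) \<partial>lborel) <= ennreal (s * (v - u))"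
 proof (intro AE_ball_countable' D averages_eventually_le)
  fix c M
  have "(\<integral>\<^sup>+t\<in>{-M..M}. ennreal (norm (f t - c)) \<partial>lborel) <=
     (\<integral>\<^sup>+t. ennreal (norm (f t)) * indicator {-M..M} t + ennreal (norm c) * indicator {-M..M} t \<partial>lborel)"
   by (intro nn_integral_mono)
     (auto simp: ennreal_plus[symmetric] norm_triangle_ineq4 simp del: ennreal_plus split: split_indicator)
  also have "\<dots> = (\<integral>\<^sup>+t\<in>{-M..M}. ennreal (norm (f t)) \<partial>lborel) + ennreal (norm c) * emeasure lborel {-M..M}"
   by (subst nn_integral_add) (auto simp: nn_integral_cmult_indicator)
  also have "\<dots> < \<infinity>" using loc[of M] emeasure_bounded_finite[of "{-M..M}"]
   by (auto simp: ennreal_mult_less_top)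
  finally show "(\<integral>\<^sup>+t\<in>{-M..M}. ennreal (norm (f t - c)) \<partial>lborel) < \<infinity>" .
 qed auto
 then show ?thesis
 proof (rule AE_mp, intro AE_I2 impI)
  fix x assume *: "\<forall>c\<in>D. \<forall>s>norm (f x - c). \<exists>\<delta>>0. \<forall>u v. u < x \<and> x < v \<and> v - u < \<delta> -->
      (\<integral>\<^sup>+t\<in>{u..v}. ennreal (norm (f t - c)) \<partial>lborel) <= ennreal (s * (v - u))"
  show "leb_pt f x" unfolding leb_pt_def
  proof (intro allI impI)
   fix \<eta> :: real assume \<eta>: "0 < \<eta>"
   obtain c where c: "c \<in> D" "c \<in> ball (f x) (\<eta>/8)" using D(2)[of "ball (f x) (\<eta>/8)"] \<eta> by auto
   then have nc: "norm (f x - c) < \<eta>/8" by (simp add: dist_norm)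
   with * c obtain \<delta> where \<delta>: "\<delta> > 0" "\<And>u v. u < x \<and> x < v \<and> v - u < \<delta> ==>
      (\<integral>\<^sup>+t\<in>{u..v}. ennreal (norm (f t - c)) \<partial>lborel) <= ennreal (\<eta>/8 * (v - u))"
    by meson
   show "\<exists>\<delta>>0. \<forall>r. 0 < r \<and> r < \<delta> -->
     (\<integral>\<^sup>+t\<in>{x-r..x+r}. ennreal (norm (f t - f x)) \<partial>lborel) <= ennreal (\<eta> * r)"
   proof (intro exI[of _ "\<delta>/2"] conjI allI impI)
    fix r assume r: "0 < r \<and> r < \<delta>/2"
    have nt: "norm (f t - f x) <= norm (f t - c) + \<eta>/8" for t
     using nc norm_triangle_ineq[of "f t - c" "c - f x"] by (simp add: norm_minus_commute)
    have "(\<integral>\<^sup>+t\<in>{x-r..x+r}. ennreal (norm (f t - f x)) \<partial>lborel) <=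
     (\<integral>\<^sup>+t. ennreal (norm (f t - c)) * indicator {x-r..x+r} t + ennreal (\<eta>/8) * indicator {x-r..x+r} t \<partial>lborel)"
     using nt \<eta>
     by (intro nn_integral_mono)
       (auto simp: ennreal_plus[symmetric] intro!: ennreal_leI simp del: ennreal_plus split: split_indicator)
    also have "\<dots> = (\<integral>\<^sup>+t\<in>{x-r..x+r}. ennreal (norm (f t - c)) \<partial>lborel) + ennreal (\<eta>/8) * emeasure lborel {x-r..x+r}"
     by (subst nn_integral_add) (auto simp: nn_integral_cmult_indicator)
    also have "\<dots> <= ennreal (\<eta>/8 * ((x + r) - (x - r))) + ennreal (\<eta>/8 * (2*r))"
     using r \<eta> by (intro add_mono \<delta>(2)) (auto simp: ennreal_mult[symmetric])
    also have "\<dots> = ennreal (\<eta>/2 * r)"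
     using r \<eta> by (subst ennreal_plus[symmetric]) (auto simp: algebra_simps)
    also have "\<dots> <= ennreal (\<eta> * r)" using r \<eta> by (intro ennreal_leI) auto
    finally show "(\<integral>\<^sup>+t\<in>{x-r..x+r}. ennreal (norm (f t - f x)) \<partial>lborel) <= ennreal (\<eta> * r)" .
   qed (use \<delta> in auto)
  qed
 qed
qed

section \<open>The Poisson kernel and its action at Lebesgue points\<close>

lemma nn_integral_poisson:
 fixes x y :: real
 assumes y: "0 < y"
 shows "(\<integral>\<^sup>+t. ennreal (y / ((t - x)\<^sup>2 + y\<^sup>2)) \<partial>lborel) = ennreal pi"
proof -
 let ?k = "%t. y / (t\<^sup>2 + y\<^sup>2)"
 have pos: "t\<^sup>2 + y\<^sup>2 > 0" for t using y by (simp add: add_nonneg_pos)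
 have half: "(\<integral>\<^sup>+t. ennreal (?k t) * indicator {0..} t \<partial>lborel) = ennreal (pi/2 - arctan (0 / y))"
 proof (rule nn_integral_FTC_atLeast)
  show "DERIV (%t. arctan (t / y)) t :> ?k t" for t
  proof -
   have "1 + (t / y)\<^sup>2 = (t\<^sup>2 + y\<^sup>2) / y\<^sup>2" using y by (simp add: field_simps)
   moreover have "((%t. arctan (t / y)) has_real_derivative (1 / y) * inverse (1 + (t/y)\<^sup>2)) (at t)"
    using y by (auto intro!: derivative_eq_intros)
   moreover have "y \<noteq> 0" using y by simp
   ultimately show ?thesis using pos[of t] by (simp add: field_simps power2_eq_square)
  qed
  show "((%t. arctan (t / y)) \<longlongrightarrow> pi/2) at_top"
   by (rule tendsto_arctan_at_top[THEN filterlim_compose])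
     (use y in \<open>auto simp: divide_inverse intro: filterlim_at_top_mult_tendsto_pos[OF tendsto_const _ filterlim_ident]\<close>)
 qed (use y in auto)
 have half': "(\<integral>\<^sup>+t. ennreal (?k t) * indicator {..0} t \<partial>lborel) = ennreal (pi/2)"
  using half by (subst nn_integral_real_affine[where c="-1" and t=0])
    (auto simp: indicator_def if_distrib cong: if_cong)
 have "(\<integral>\<^sup>+t. ennreal (y / ((t - x)\<^sup>2 + y\<^sup>2)) \<partial>lborel) = (\<integral>\<^sup>+t. ennreal (?k t) \<partial>lborel)"
  by (subst nn_integral_real_affine[where c=1 and t=x]) auto
 also have "\<dots> = (\<integral>\<^sup>+t. ennreal (?k t) * indicator {0..} t + ennreal (?k t) * indicator {..0} t \<partial>lborel)"
  by (rule nn_integral_cong_AE, rule AE_mp[OF AE_lborel_singleton[of 0]], rule AE_I2) (auto split: split_indicator)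
 also have "\<dots> = ennreal (pi/2) + ennreal (pi/2)"
  using half half' by (subst nn_integral_add) auto
 also have "\<dots> = ennreal pi" by (subst ennreal_plus[symmetric]) auto
 finally show ?thesis .
qed

lemma integral_poisson:
 fixes x y :: real
 assumes y: "0 < y"
 shows "integrable lborel (%t. y / ((t - x)\<^sup>2 + y\<^sup>2))" "integral\<^sup>L lborel (%t. y / ((t - x)\<^sup>2 + y\<^sup>2)) = pi"
proof -
 have "has_bochner_integral lborel (%t. y / ((t - x)\<^sup>2 + y\<^sup>2)) pi"
  using y nn_integral_poisson[OF y, of x] by (intro has_bochner_integral_nn_integral) auto
 then show "integrable lborel (%t. y / ((t - x)\<^sup>2 + y\<^sup>2))" "integral\<^sup>L lborel (%t. y / ((t - x)\<^sup>2 + y\<^sup>2)) = pi"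
  by (auto simp: has_bochner_integral_iff)
qed

text \<open>At distance about \<open>2^k * y\<close> the kernel is at most
  \<open>4 * (1/4)^k / y\<close>, while the Lebesgue point bounds the oscillation integral by
  \<open>\<eta> * 2^k * y\<close>; the products form a geometric series. Beyond a fixed distance the
  kernel is at most \<open>y / (t - x)\<^sup>2\<close>, whose integral against the oscillation is
  finite by \<open>W\<close> and carries the factor \<open>y\<close>.\<close>

theorem leb_pt_poisson:
 fixes f :: "real => complex"
 assumes f[measurable]: "f \<in> BM" and lp: "leb_pt f x"
  and W: "(\<integral>\<^sup>+t. ennreal (norm (f t) / (1 + t\<^sup>2)) \<partial>lborel) < \<infinity>"
 shows "((%y. \<integral>\<^sup>+t. ennreal (y / ((t - x)\<^sup>2 + y\<^sup>2) * norm (f t - f x)) \<partial>lborel) \<longlongrightarrow> 0) (at_right 0)"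
proof -
 let ?h = "%t. norm (f t - f x)"
 let ?I = "%y. \<integral>\<^sup>+t. ennreal (y / ((t - x)\<^sup>2 + y\<^sup>2) * ?h t) \<partial>lborel"
 have main: "eventually (%y. ?I y <= ennreal \<epsilon>) (at_right 0)" if \<epsilon>: "0 < \<epsilon>" for \<epsilon>
 proof -
  \<comment> \<open>The dyadic sum is \<open>4 * \<eta> * 2\<close>, which is half of
    \<open>\<epsilon>\<close>; the far part gets the other half.\<close>
  define \<eta> where "\<eta> = \<epsilon> / 16"
  have \<eta>: "0 < \<eta>" using \<epsilon> by (simp add: \<eta>_def)
  obtain \<delta> where \<delta>: "0 < \<delta>" and lpd: "\<And>r. 0 < r ==> r < \<delta> ==> (\<integral>\<^sup>+t\<in>{x-r..x+r}. ennreal (?h t) \<partial>lborel) <= ennreal (\<eta> * r)"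
   using lp \<eta> unfolding leb_pt_def by meson
  define d where "d = \<delta> / 2"
  have d: "0 < d" using \<delta> by (simp add: d_def)
  define B where "B = (\<integral>\<^sup>+t\<in>{t. d <= \<bar>t - x\<bar>}. ennreal (?h t / (t - x)\<^sup>2) \<partial>lborel)"
  \<comment> \<open>Comes from \<open>t\<^sup>2 \<le> 2 * (t - x)\<^sup>2 + 2 * x\<^sup>2\<close>
    and \<open>d \<le> \<bar>t - x\<bar>\<close>; it compares \<open>1 / (t - x)\<^sup>2\<close>
    with the weight in \<open>W\<close>.\<close>
  define K where "K = 2 + (1 + 2 * x\<^sup>2) / d\<^sup>2"
  have K: "K > 0" using d by (auto simp: K_def intro!: add_pos_nonneg)
  have far: "1 / (t - x)\<^sup>2 <= K / (1 + t\<^sup>2)" if "d <= \<bar>t - x\<bar>" for t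
  proof -
   have d2: "d\<^sup>2 <= (t - x)\<^sup>2" using that d by (metis abs_le_square_iff abs_of_pos power2_abs)
   have pos: "(t - x)\<^sup>2 > 0" using d2 d by (smt (verit) zero_less_power)
   have "t\<^sup>2 <= 2 * (t - x)\<^sup>2 + 2 * x\<^sup>2" using sum_squares_bound[of "t - x" x] zero_le_power2[of "t - 2*x"]
    by (simp add: power2_eq_square algebra_simps)
   moreover have "1 + 2 * x\<^sup>2 <= (1 + 2 * x\<^sup>2) / d\<^sup>2 * (t - x)\<^sup>2"
    using mult_left_mono[OF d2, of "1 + 2 * x\<^sup>2"] d by (simp add: field_simps)
   ultimately have "1 + t\<^sup>2 <= K * (t - x)\<^sup>2" unfolding K_def by (simp add: algebra_simps)
   then show ?thesis using pos by (simp add: divide_simps add_pos_nonneg not_less sum_power2_gt_zero_iff)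
  qed
  have "B <= (\<integral>\<^sup>+t. ennreal K * ennreal (norm (f t) / (1 + t\<^sup>2)) + ennreal (K * norm (f x)) * ennreal (1 / ((t - 0)\<^sup>2 + 1\<^sup>2)) \<partial>lborel)"
   unfolding B_def
  proof (intro nn_integral_mono)
   fix t
   have "?h t / (t - x)\<^sup>2 <= K * (norm (f t) / (1 + t\<^sup>2)) + K * norm (f x) * (1 / (1 + t\<^sup>2))" if t: "d <= \<bar>t - x\<bar>"
   proof -
    have "?h t * (1 / (t - x)\<^sup>2) <= (norm (f t) + norm (f x)) * (K / (1 + t\<^sup>2))"
     using far[OF t] K by (intro mult_mono norm_triangle_ineq4) auto
    then show ?thesis by (simp add: field_simps add_divide_distrib)
   qed
   then show "ennreal (?h t / (t - x)\<^sup>2) * indicator {t. d <= \<bar>t - x\<bar>} t <=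
     ennreal K * ennreal (norm (f t) / (1 + t\<^sup>2)) + ennreal (K * norm (f x)) * ennreal (1 / ((t - 0)\<^sup>2 + 1\<^sup>2))"
    using K by (auto simp: ennreal_mult[symmetric] ennreal_plus[symmetric] add.commute intro!: ennreal_leI simp del: ennreal_plus split: split_indicator)
  qed
  also have "\<dots> = ennreal K * (\<integral>\<^sup>+t. ennreal (norm (f t) / (1 + t\<^sup>2)) \<partial>lborel) + ennreal (K * norm (f x)) * ennreal pi"
   using nn_integral_poisson[of 1 0] by (subst nn_integral_add) (auto simp: nn_integral_cmult)
  also have "\<dots> < \<infinity>" using W by (auto simp: ennreal_mult_less_top)
  finally obtain b where b: "B = ennreal b" "0 <= b"
   by (metis ennreal_cases infinity_ennreal_def less_irrefl)
  define y0 where "y0 = min d (\<epsilon> / (2 * (b + 1)))"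
  have y0: "0 < y0" using d \<epsilon> b by (auto simp: y0_def)
  have "?I y <= ennreal \<epsilon>" if y: "0 < y" "y < y0" for y
  proof -
   define c where "c = (%k::nat. 4 * (1/4)^k / y)"
   \<comment> \<open>The condition \<open>2^k * y < \<delta>\<close> empties \<open>T k\<close> as
     soon as the radius leaves the range of \<open>lpd\<close>. Points closer than
     \<open>d = \<delta> / 2\<close> are still covered, because their least dyadic radius is
     \<open>y\<close> itself or less than twice their distance.\<close>
   define T where "T = (%k::nat. {t. \<bar>t - x\<bar> <= 2^k * y \<and> 2^k * y < \<delta>})"
   have Tm[measurable]: "T k \<in> sets borel" for k unfolding T_def by measurable
   have yd: "y < d" "y < \<epsilon> / (2 * (b + 1))" using y by (auto simp: y0_def)
   have near: "\<exists>k. t \<in> T k \<and> y / ((t - x)\<^sup>2 + y\<^sup>2) <= c k" if "\<bar>t - x\<bar> < d" for t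
   proof (cases "\<bar>t - x\<bar> <= y")
    case True
    have "y / ((t - x)\<^sup>2 + y\<^sup>2) <= y / y\<^sup>2" using y by (intro divide_left_mono) (auto simp: add_nonneg_pos)
    also have "\<dots> <= c 0" using y by (simp add: c_def power2_eq_square divide_right_mono)
    finally show ?thesis using True yd d by (intro exI[of _ 0]) (auto simp: T_def d_def)
   next
    case False
    define k where "k = (LEAST k::nat. \<bar>t - x\<bar> <= 2^k * y)"
    obtain n :: nat where "\<bar>t - x\<bar> / y < 2^n" using real_arch_pow[of 2 "\<bar>t - x\<bar> / y"] by auto
    then have ex: "\<bar>t - x\<bar> <= 2^n * y" using y by (simp add: divide_simps)
    have k: "\<bar>t - x\<bar> <= 2^k * y" unfolding k_def by (rule LeastI[of _ n]) (fact ex)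
    have k0: "k \<noteq> 0" using k False by (metis mult_1 power_0)
    then have k1: "\<bar>t - x\<bar> > 2^(k-1) * y"
     using not_less_Least[of "k-1" "%k. \<bar>t - x\<bar> <= 2^k * y"] unfolding k_def[symmetric] by simp
    have p2: "2^k = 2 * (2::real)^(k-1)" using k0 by (metis power_eq_if)
    have p4: "(1/4::real)^k * (2^k)\<^sup>2 = 1"
     by (simp add: power2_eq_square power_mult_distrib[symmetric])
    have sq: "(2^k * y / 2)\<^sup>2 <= (t - x)\<^sup>2"
    proof -
     have "2^k * y / 2 <= \<bar>t - x\<bar>" using k1 p2 by simp
     then have "(2^k * y / 2)\<^sup>2 <= \<bar>t - x\<bar>\<^sup>2" using y by (intro power_mono) auto
     then show ?thesis by simp
    qed
    have "y / ((t - x)\<^sup>2 + y\<^sup>2) <= y / (2^k * y / 2)\<^sup>2"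
     using y sq by (intro divide_left_mono) (auto simp: add_nonneg_pos add_increasing2)
    also have "\<dots> = c k"
     using p4 y by (simp add: c_def field_simps power2_eq_square)
    finally show ?thesis using k k1 p2 that by (intro exI[of _ k]) (auto simp: T_def d_def)
   qed
   have pt: "ennreal (y / ((t - x)\<^sup>2 + y\<^sup>2) * ?h t) <=
      (\<Sum>k. ennreal (c k) * (ennreal (?h t) * indicator (T k) t)) + ennreal y * (ennreal (?h t / (t - x)\<^sup>2) * indicator {t. d <= \<bar>t - x\<bar>} t)" for t
   proof (cases "\<bar>t - x\<bar> < d")
    case True
    then obtain k where k: "t \<in> T k" "y / ((t - x)\<^sup>2 + y\<^sup>2) <= c k" using near by blast
    have "ennreal (y / ((t - x)\<^sup>2 + y\<^sup>2) * ?h t) <= ennreal (c k * ?h t)"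
     using k by (intro ennreal_leI mult_right_mono) auto
    also have "\<dots> = ennreal (c k) * (ennreal (?h t) * indicator (T k) t)"
     using k y by (subst ennreal_mult) (auto simp: c_def)
    also have "\<dots> <= (\<Sum>k. ennreal (c k) * (ennreal (?h t) * indicator (T k) t))"
     using sum_le_suminf[of "%k. ennreal (c k) * (ennreal (?h t) * indicator (T k) t)" "{k}"] by simp
    finally show ?thesis by (simp add: add_increasing2)
   next
    case False
    have "y / ((t - x)\<^sup>2 + y\<^sup>2) * ?h t <= y / (t - x)\<^sup>2 * ?h t"
     using y False d by (intro mult_right_mono divide_left_mono) (auto simp: add_nonneg_pos)
    then have "ennreal (y / ((t - x)\<^sup>2 + y\<^sup>2) * ?h t) <= ennreal y * (ennreal (?h t / (t - x)\<^sup>2) * indicator {t. d <= \<bar>t - x\<bar>} t)"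
     using False y by (auto simp: ennreal_mult[symmetric] intro!: ennreal_leI)
    then show ?thesis by (simp add: add_increasing)
   qed
   have "?I y <= (\<integral>\<^sup>+t. (\<Sum>k. ennreal (c k) * (ennreal (?h t) * indicator (T k) t)) + ennreal y * (ennreal (?h t / (t - x)\<^sup>2) * indicator {t. d <= \<bar>t - x\<bar>} t) \<partial>lborel)"
    using pt by (intro nn_integral_mono)
   also have "\<dots> = (\<Sum>k. ennreal (c k) * (\<integral>\<^sup>+t\<in>T k. ennreal (?h t) \<partial>lborel)) + ennreal y * B"
    unfolding B_def by (subst nn_integral_add) (auto simp: nn_integral_suminf nn_integral_cmult)
   also have "(\<Sum>k. ennreal (c k) * (\<integral>\<^sup>+t\<in>T k. ennreal (?h t) \<partial>lborel)) <= (\<Sum>k. ennreal (4 * \<eta> * (1/2)^k))"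
   proof (intro suminf_le allI)
    fix k
    have "(\<integral>\<^sup>+t\<in>T k. ennreal (?h t) \<partial>lborel) <= ennreal (\<eta> * (2^k * y))"
    proof (cases "2^k * y < \<delta>")
     case True
     have "(\<integral>\<^sup>+t\<in>T k. ennreal (?h t) \<partial>lborel) <= (\<integral>\<^sup>+t\<in>{x - 2^k*y..x + 2^k*y}. ennreal (?h t) \<partial>lborel)"
      by (intro nn_integral_mono) (auto simp: T_def split: split_indicator)
     also have "\<dots> <= ennreal (\<eta> * (2^k * y))" using True y by (intro lpd) auto
     finally show ?thesis .
    qed (auto simp: T_def)
    then have "ennreal (c k) * (\<integral>\<^sup>+t\<in>T k. ennreal (?h t) \<partial>lborel) <= ennreal (c k) * ennreal (\<eta> * (2^k * y))"
     by (intro mult_left_mono) auto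
    also have "\<dots> = ennreal (4 * \<eta> * (1/2)^k)"
    proof -
     have "(1/4::real)^k * 2^k = (1/2)^k" by (simp add: power_mult_distrib[symmetric])
     then have "c k * (\<eta> * (2^k * y)) = 4 * \<eta> * (1/2)^k"
      using y unfolding c_def by (simp add: field_simps)
     then show ?thesis using y \<eta> by (subst ennreal_mult[symmetric]) (auto simp: c_def)
    qed
    finally show "ennreal (c k) * (\<integral>\<^sup>+t\<in>T k. ennreal (?h t) \<partial>lborel) <= ennreal (4 * \<eta> * (1/2)^k)" .
   qed auto
   also have "(\<Sum>k. ennreal (4 * \<eta> * (1/2)^k)) = ennreal (\<epsilon>/2)"
   proof -
    have "(%k. 4 * \<eta> * (1/2::real)^k) sums (4 * \<eta> * 2)" 
     using geometric_sums[of "1/2::real"] by (intro sums_mult) auto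
    then show ?thesis using \<eta> by (subst suminf_ennreal_eq[where x="8*\<eta>"]) (auto simp: \<eta>_def)
   qed
   also have "ennreal y * B <= ennreal (\<epsilon>/2)"
   proof -
    have "y * (b + 1) <= \<epsilon>/2" using yd b by (simp add: field_simps)
    then have "y * b <= \<epsilon>/2" using y b by (smt (verit) mult_left_mono)
    then show ?thesis using b y by (auto simp: ennreal_mult[symmetric] intro!: ennreal_leI)
   qed
   finally show ?thesis using \<epsilon> by (simp add: ennreal_plus[symmetric] add_mono del: ennreal_plus)
  qed
  then show ?thesis using y0 by (auto simp: eventually_at_right_field intro!: exI[of _ y0])
 qed
 show ?thesis
 proof (rule order_tendstoI)
  fix a :: ennreal assume "0 < a"
  then obtain e where e: "0 < e" "e < a" using dense by blast
  then have "e < top" by (metis less_le_trans top_greatest)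
  then obtain \<epsilon> where "e = ennreal \<epsilon>" "0 < \<epsilon>"
   using e by (cases e) auto
  then show "eventually (%y. ?I y < a) (at_right 0)"
   using main[of \<epsilon>] e by (auto elim!: eventually_mono)
 qed auto
qed

text \<open>The functions whose Poisson integrals converge absolutely. Plain integrability would be
  too strong for the boundary values below.\<close>

definition winteg :: "(real => complex) => bool" where
 "winteg f \<longleftrightarrow> integrable lborel (%t. (1 / (1 + t\<^sup>2)) *\<^sub>R f t)"

definition poisson :: "real => (real => complex) => real => complex" where
 "poisson y f x = (1 / pi) *\<^sub>R (\<integral>t. (y / ((t - x)\<^sup>2 + y\<^sup>2)) *\<^sub>R f t \<partial>lborel)"

text \<open>The factor is \<open>1 / (pi * \<i>)\<close> instead of half of it, to match
  \<open>finite_Hilbert\<close>: the boundary values on (-1,1) are then the transform plus or minus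
  \<open>f\<close>.\<close>

definition cauchyF :: "(real => complex) => complex => complex" where
 "cauchyF f z = (1 / (cr pi * \<i>)) * (\<integral>s. f s / (cr s - z) \<partial>lborel)"

lemma poisson_kernel_le:
 fixes x y :: real
 assumes "0 < y"
 shows "y / ((t - x)\<^sup>2 + y\<^sup>2) <= (y + (1 + 2 * x\<^sup>2) / y) * 2 * (1 / (1 + t\<^sup>2))"
proof -
 have pos: "(t - x)\<^sup>2 + y\<^sup>2 > 0" "1 + t\<^sup>2 > 0" using assms by (auto simp: add_nonneg_pos add_pos_nonneg)
 have t2: "t\<^sup>2 <= 2 * (t - x)\<^sup>2 + 2 * x\<^sup>2"
  using zero_le_power2[of "t - 2*x"] by (simp add: power2_eq_square algebra_simps)
 have "y * (1 + t\<^sup>2) <= y * (2 * (t - x)\<^sup>2 + (1 + 2 * x\<^sup>2))"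
  using t2 assms by (intro mult_left_mono) auto
 also have "\<dots> <= (y + (1 + 2 * x\<^sup>2) / y) * 2 * ((t - x)\<^sup>2 + y\<^sup>2)"
 proof -
  have "(1 + 2 * x\<^sup>2) / y * 2 * ((t - x)\<^sup>2 + y\<^sup>2) \<ge> (1 + 2 * x\<^sup>2) / y * 2 * y\<^sup>2"
   using assms by (intro mult_left_mono) (auto intro: add_pos_nonneg)
  moreover have "(1 + 2 * x\<^sup>2) / y * 2 * y\<^sup>2 = 2 * y * (1 + 2 * x\<^sup>2)"
   using assms by (simp add: power2_eq_square)
  moreover have "y * (1 + 2 * x\<^sup>2) \<ge> 0" "y * y\<^sup>2 \<ge> 0" using assms by auto
  ultimately show ?thesis by (simp add: algebra_simps)
 qed
 finally show ?thesis using pos by (simp add: field_simps)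
qed

lemma wintegD:
 assumes "winteg f"
 shows "f \<in> BM" "(\<integral>\<^sup>+t. ennreal (norm (f t) / (1 + t\<^sup>2)) \<partial>lborel) < \<infinity>"
proof -
 have [measurable]: "(%t. (1 / (1 + t\<^sup>2)) *\<^sub>R f t) \<in> BM"
  using borel_measurable_integrable[OF assms[unfolded winteg_def]] by simp
 have nz: "1 + t\<^sup>2 \<noteq> 0" for t :: real by (metis add_pos_nonneg less_irrefl zero_le_power2 zero_less_one)
 have "(%t. (1 + t\<^sup>2) *\<^sub>R ((1 / (1 + t\<^sup>2)) *\<^sub>R f t)) \<in> BM" by measurable
 then show "f \<in> BM" using nz by simp
 have "norm ((1 / (1 + t\<^sup>2)) *\<^sub>R f t) = norm (f t) / (1 + t\<^sup>2)" for t by simp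
 then show "(\<integral>\<^sup>+t. ennreal (norm (f t) / (1 + t\<^sup>2)) \<partial>lborel) < \<infinity>"
  using assms unfolding winteg_def integrable_iff_bounded by simp
qed

lemma winteg_iff:
 assumes "f \<in> BM"
 shows "winteg f \<longleftrightarrow> (\<integral>\<^sup>+t. ennreal (norm (f t) / (1 + t\<^sup>2)) \<partial>lborel) < \<infinity>"
 using wintegD(2)[of f] assms unfolding winteg_def integrable_iff_bounded by auto

lemma winteg_poisson_integrable:
 assumes f: "winteg f" and y: "0 < y"
 shows "integrable lborel (%t. (y / ((t - x)\<^sup>2 + y\<^sup>2)) *\<^sub>R f t)"
proof (rule Bochner_Integration.integrable_bound)
 note [measurable] = wintegD(1)[OF f]
 let ?C = "(y + (1 + 2 * x\<^sup>2) / y) * 2"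
 show "integrable lborel (%t. ?C *\<^sub>R ((1 / (1 + t\<^sup>2)) *\<^sub>R f t))"
  using f unfolding winteg_def by (rule integrable_scaleR_right)
 show "(%t. (y / ((t - x)\<^sup>2 + y\<^sup>2)) *\<^sub>R f t) \<in> borel_measurable lborel" by measurable
 show "AE t in lborel. norm ((y / ((t - x)\<^sup>2 + y\<^sup>2)) *\<^sub>R f t) <= norm (?C *\<^sub>R ((1 / (1 + t\<^sup>2)) *\<^sub>R f t))"
 proof (intro AE_I2)
  fix t
  have C: "0 <= ?C" using y by (auto intro!: add_nonneg_nonneg)
  have "y / ((t - x)\<^sup>2 + y\<^sup>2) * norm (f t) <= ?C * (1 / (1 + t\<^sup>2)) * norm (f t)"
   using poisson_kernel_le[OF y] by (intro mult_right_mono) auto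
  then show "norm ((y / ((t - x)\<^sup>2 + y\<^sup>2)) *\<^sub>R f t) <= norm (?C *\<^sub>R ((1 / (1 + t\<^sup>2)) *\<^sub>R f t))"
   using y C by (simp add: abs_mult mult.assoc)
 qed
qed

lemma winteg_AE_leb_pt:
 assumes "winteg f"
 shows "AE x in lborel. leb_pt f x"
proof (rule AE_leb_pt)
 note [measurable] = wintegD(1)[OF assms]
 show "f \<in> BM" by measurable
 fix M :: real
 have "(\<integral>\<^sup>+t\<in>{-M..M}. ennreal (norm (f t)) \<partial>lborel) <=
    (\<integral>\<^sup>+t. ennreal (1 + M\<^sup>2) * ennreal (norm (f t) / (1 + t\<^sup>2)) \<partial>lborel)"
 proof (intro nn_integral_mono)
  fix t
  have "norm (f t) <= (1 + M\<^sup>2) * (norm (f t) / (1 + t\<^sup>2))" if "-M <= t" "t <= M"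
  proof -
   have "t\<^sup>2 <= M\<^sup>2" using that by (simp add: abs_le_square_iff[symmetric])
   then have "norm (f t) * (1 + t\<^sup>2) <= norm (f t) * (1 + M\<^sup>2)" by (intro mult_left_mono) auto
   then show ?thesis by (simp add: pos_le_divide_eq add_pos_nonneg mult.commute)
  qed
  then show "ennreal (norm (f t)) * indicator {-M..M} t <= ennreal (1 + M\<^sup>2) * ennreal (norm (f t) / (1 + t\<^sup>2))"
   by (subst ennreal_mult'[symmetric])
     (auto intro!: ennreal_leI simp del: times_divide_eq_right split: split_indicator)
 qed
 also have "\<dots> < \<infinity>" using wintegD(2)[OF assms]
  by (subst nn_integral_cmult) (auto simp: ennreal_mult_less_top)
 finally show "(\<integral>\<^sup>+t\<in>{-M..M}. ennreal (norm (f t)) \<partial>lborel) < \<infinity>" .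
qed

lemma tendsto_0_ennreal_bound:
 fixes g :: "real => complex"
 assumes "(I \<longlongrightarrow> (0::ennreal)) F" "eventually (%y. ennreal (norm (g y)) <= I y) F"
 shows "(g \<longlongrightarrow> 0) F"
proof (rule tendstoI)
 fix e :: real assume "0 < e"
 then have "eventually (%y. I y < ennreal e) F" by (intro order_tendstoD[OF assms(1)]) auto
 with assms(2) show "eventually (%y. dist (g y) 0 < e) F"
 proof eventually_elim
  case (elim y)
  then have "ennreal (norm (g y)) < ennreal e" by order
  then show ?case by (simp add: ennreal_less_iff)
 qed
qed

theorem poisson_tendsto:
 assumes f: "winteg f" and lp: "leb_pt f x"
 shows "((%y. poisson y f x) \<longlongrightarrow> f x) (at_right 0)"
proof -
 note [measurable] = wintegD(1)[OF f]
 have "((%y. pi *\<^sub>R (poisson y f x - f x)) \<longlongrightarrow> 0) (at_right 0)"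
 proof (rule tendsto_0_ennreal_bound[OF leb_pt_poisson[OF _ lp]])
  have "ennreal (norm (pi *\<^sub>R (poisson y f x - f x))) <=
     (\<integral>\<^sup>+ t. ennreal (y / ((t - x)\<^sup>2 + y\<^sup>2) * cmod (f t - f x)) \<partial>lborel)" if y: "0 < y" for y
  proof -
   have i1: "integrable lborel (%t. (y / ((t - x)\<^sup>2 + y\<^sup>2)) *\<^sub>R f t)"
    by (rule winteg_poisson_integrable[OF f y])
   have i2: "integrable lborel (%t. (y / ((t - x)\<^sup>2 + y\<^sup>2)) *\<^sub>R f x)"
    using integral_poisson(1)[OF y] by (rule integrable_scaleR_left)
   have "pi *\<^sub>R (poisson y f x - f x) = (\<integral>t. (y / ((t - x)\<^sup>2 + y\<^sup>2)) *\<^sub>R f t \<partial>lborel) - (\<integral>t. (y / ((t - x)\<^sup>2 + y\<^sup>2)) *\<^sub>R f x \<partial>lborel)"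
    using integral_poisson[OF y, of x] by (simp add: poisson_def scaleR_diff_right)
   also have "\<dots> = (\<integral>t. (y / ((t - x)\<^sup>2 + y\<^sup>2)) *\<^sub>R (f t - f x) \<partial>lborel)"
    using i1 i2 by (subst Bochner_Integration.integral_diff[symmetric]) (auto simp: scaleR_diff_right)
   finally have eq: "pi *\<^sub>R (poisson y f x - f x) = (\<integral>t. (y / ((t - x)\<^sup>2 + y\<^sup>2)) *\<^sub>R (f t - f x) \<partial>lborel)" .
   have "ennreal (norm (pi *\<^sub>R (poisson y f x - f x))) <= (\<integral>\<^sup>+t. ennreal (norm ((y / ((t - x)\<^sup>2 + y\<^sup>2)) *\<^sub>R (f t - f x))) \<partial>lborel)"
    unfolding eq using i1 i2 by (intro integral_norm_bound_ennreal) (auto simp: scaleR_diff_right)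
   also have "\<dots> = (\<integral>\<^sup>+ t. ennreal (y / ((t - x)\<^sup>2 + y\<^sup>2) * cmod (f t - f x)) \<partial>lborel)"
    using y by (intro nn_integral_cong) simp
   finally show ?thesis .
  qed
  then show "\<forall>\<^sub>F y in at_right 0. ennreal (norm (pi *\<^sub>R (poisson y f x - f x))) <=
     (\<integral>\<^sup>+ t. ennreal (y / ((t - x)\<^sup>2 + y\<^sup>2) * cmod (f t - f x)) \<partial>lborel)"
   by (auto simp: eventually_at_right_field intro!: exI[of _ 1])
 qed (use wintegD(2)[OF f] in auto)
 from tendsto_scaleR[OF tendsto_const[of "1/pi"] this] show ?thesis
  by (simp add: LIM_zero_iff)
qed

lemma integrable_imp_winteg:
 assumes "integrable lborel f"
 shows "winteg f"
proof -
 have [measurable]: "f \<in> BM" using borel_measurable_integrable[OF assms] by simp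
 show ?thesis unfolding winteg_def
 proof (rule Bochner_Integration.integrable_bound[OF assms])
  show "AE t in lborel. norm ((1 / (1 + t\<^sup>2)) *\<^sub>R f t) <= norm (f t)"
   by (intro AE_I2) (auto simp: divide_simps add_pos_nonneg mult_left_le_one_le mult_le_cancel_right1 mult_le_cancel_left1)
 qed auto
qed

text \<open>The truncated kernel \<open>1 / (s - x)\<close> minus the conjugate Poisson kernel is
  odd about \<open>x\<close> and bounded by the Poisson kernel. Its integral vanishes, so
  \<open>f s\<close> may be replaced by \<open>f s - f x\<close>, and the estimate at Lebesgue
  points applies. Cauchy integral minus Poisson integral is the conjugate Poisson integral up to a
  constant factor.\<close>

theorem truncation_tendsto:
 assumes f: "integrable lborel f" and lp: "leb_pt f x"
 shows "((%e. (1 / (cr pi * \<i>)) * (\<integral>s. indicator {s. e < \<bar>s - x\<bar>} s *\<^sub>R (f s / cr (s - x)) \<partial>lborel)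
      - (cauchyF f (Complex x e) - poisson e f x)) \<longlongrightarrow> 0) (at_right 0)"
proof -
 have fm[measurable]: "f \<in> BM" using borel_measurable_integrable[OF f] by simp
 have w: "winteg f" by (rule integrable_imp_winteg[OF f])
 define k where "k = (%e s. indicator {s. e < \<bar>s - x\<bar>} s * (1 / (s - x)) - (s - x) / ((s - x)\<^sup>2 + e\<^sup>2))"
 have [measurable]: "k e \<in> BM" for e unfolding k_def by measurable
 have kb: "\<bar>k e s\<bar> <= e / ((s - x)\<^sup>2 + e\<^sup>2)" if e: "0 < e" for e s
 proof (cases "e < \<bar>s - x\<bar>")
  case True
  then have nz: "s - x \<noteq> 0" using e by auto
  have p: "(s - x)\<^sup>2 + e\<^sup>2 > 0" using e by (simp add: add_nonneg_pos)
  have "k e s = e\<^sup>2 / ((s - x) * ((s - x)\<^sup>2 + e\<^sup>2))"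
   using True nz p unfolding k_def by (simp add: divide_simps) (simp add: power2_eq_square algebra_simps)
  then have "\<bar>k e s\<bar> = (e / \<bar>s - x\<bar>) * (e / ((s - x)\<^sup>2 + e\<^sup>2))"
   using p e by (simp add: abs_mult power2_eq_square)
  also have "\<dots> <= 1 * (e / ((s - x)\<^sup>2 + e\<^sup>2))"
   using True e p by (intro mult_right_mono) auto
  finally show ?thesis by simp
 next
  case False
  have p: "(s - x)\<^sup>2 + e\<^sup>2 > 0" using e by (simp add: add_nonneg_pos)
  then have "\<bar>k e s\<bar> = \<bar>s - x\<bar> / ((s - x)\<^sup>2 + e\<^sup>2)" using False unfolding k_def by simp
  also have "\<dots> <= e / ((s - x)\<^sup>2 + e\<^sup>2)" using False p by (intro divide_right_mono) auto
  finally show ?thesis .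
 qed
 have ki: "integrable lborel (k e)" if "0 < e" for e
  using integral_poisson(1)[OF that, of x] 
  by (rule Bochner_Integration.integrable_bound) (use kb[OF that] that in \<open>auto intro!: AE_I2\<close>)
 have k0: "integral\<^sup>L lborel (k e) = 0" if "0 < e" for e
 proof -
  have "k e (2 * x + (-1) * s) = - k e s" for s
  proof -
   have "2 * x + -1 * s - x = - (s - x)" by simp
   then have "k e (2 * x + (-1) * s) = indicator {s. e < \<bar>s\<bar>} (- (s - x)) * (1 / (- (s - x))) - (- (s - x)) / ((- (s - x))\<^sup>2 + e\<^sup>2)"
    unfolding k_def indicator_def by (simp only: mem_Collect_eq)
   also have "\<dots> = - k e s"
   proof -
    have "indicator {s. e < \<bar>s\<bar>} (- u) * (1 / (- u)) - (- u) / ((- u)\<^sup>2 + e\<^sup>2)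
     = - (indicator {s. e < \<bar>s\<bar>} u * (1 / u) - u / (u\<^sup>2 + e\<^sup>2))" for u :: real
     by (simp add: indicator_def)
    from this[of "s - x"] show ?thesis unfolding k_def by (simp add: indicator_def)
   qed
   finally show ?thesis .
  qed
  then have "integral\<^sup>L lborel (k e) = - integral\<^sup>L lborel (k e)"
   using lborel_integral_real_affine[of "-1" "k e" "2 * x"] by simp
  then show ?thesis by simp
 qed
 have "((%e. (\<integral>s. k e s *\<^sub>R f s \<partial>lborel)) \<longlongrightarrow> 0) (at_right 0)"
 proof (rule tendsto_0_ennreal_bound[OF leb_pt_poisson[OF fm lp wintegD(2)[OF w]]])
  have "ennreal (norm (\<integral>s. k e s *\<^sub>R f s \<partial>lborel)) <=
     (\<integral>\<^sup>+ t. ennreal (e / ((t - x)\<^sup>2 + e\<^sup>2) * cmod (f t - f x)) \<partial>lborel)" if e: "0 < e" for e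
  proof -
   have i1: "integrable lborel (%s. k e s *\<^sub>R f s)"
    by (rule Bochner_Integration.integrable_bound[OF winteg_poisson_integrable[OF w e, of x]])
      (use kb[OF e] e in \<open>auto intro!: AE_I2 mult_right_mono simp del: times_divide_eq_left\<close>)
   have i2: "integrable lborel (%s. k e s *\<^sub>R f x)" using ki[OF e] by (rule integrable_scaleR_left)
   have "(\<integral>s. k e s *\<^sub>R f s \<partial>lborel) = (\<integral>s. k e s *\<^sub>R (f s - f x) \<partial>lborel)"
    using i1 i2 k0[OF e] ki[OF e] by (simp add: scaleR_diff_right)
   also have "ennreal (norm \<dots>) <= (\<integral>\<^sup>+s. ennreal (norm (k e s *\<^sub>R (f s - f x))) \<partial>lborel)"
    using i1 i2 by (intro integral_norm_bound_ennreal) (auto simp: scaleR_diff_right)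
   also have "\<dots> <= (\<integral>\<^sup>+ t. ennreal (e / ((t - x)\<^sup>2 + e\<^sup>2) * cmod (f t - f x)) \<partial>lborel)"
    using kb[OF e] by (intro nn_integral_mono ennreal_leI) (auto intro!: mult_right_mono simp del: times_divide_eq_left)
   finally show ?thesis .
  qed
  then show "\<forall>\<^sub>F e in at_right 0. ennreal (norm (\<integral>s. k e s *\<^sub>R f s \<partial>lborel)) <=
     (\<integral>\<^sup>+ t. ennreal (e / ((t - x)\<^sup>2 + e\<^sup>2) * cmod (f t - f x)) \<partial>lborel)"
   by (auto simp: eventually_at_right_field intro!: exI[of _ 1])
 qed
 from tendsto_mult[OF tendsto_const[of "1 / (cr pi * \<i>)"] this]
 have "((%e. (1 / (cr pi * \<i>)) * (\<integral>s. k e s *\<^sub>R f s \<partial>lborel)) \<longlongrightarrow> 0) (at_right 0)" by simp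
 moreover have "eventually (%e. (1 / (cr pi * \<i>)) * (\<integral>s. k e s *\<^sub>R f s \<partial>lborel) =
   (1 / (cr pi * \<i>)) * (\<integral>s. indicator {s. e < \<bar>s - x\<bar>} s *\<^sub>R (f s / cr (s - x)) \<partial>lborel)
      - (cauchyF f (Complex x e) - poisson e f x)) (at_right 0)"
 proof -
  have "(1 / (cr pi * \<i>)) * (\<integral>s. k e s *\<^sub>R f s \<partial>lborel) =
   (1 / (cr pi * \<i>)) * (\<integral>s. indicator {s. e < \<bar>s - x\<bar>} s *\<^sub>R (f s / cr (s - x)) \<partial>lborel)
      - (cauchyF f (Complex x e) - poisson e f x)" if e: "0 < e" for e
  proof -
   let ?A = "%s. indicator {s. e < \<bar>s - x\<bar>} s *\<^sub>R (f s / cr (s - x))"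
   let ?B = "%s. f s / (cr s - Complex x e)"
   let ?P = "%s. (e / ((s - x)\<^sup>2 + e\<^sup>2)) *\<^sub>R f s"
   have iA: "integrable lborel ?A"
   proof (rule Bochner_Integration.integrable_bound[OF integrable_scaleR_right[OF f, of "1/e"]])
    show "AE s in lborel. norm (?A s) <= norm ((1/e) *\<^sub>R f s)"
    proof (rule AE_I2)
     fix s
     have "norm (f s) / \<bar>s - x\<bar> <= norm (f s) / e" if "e < \<bar>s - x\<bar>"
      using e that by (intro divide_left_mono) auto
     then show "norm (?A s) <= norm ((1/e) *\<^sub>R f s)"
      using e by (auto simp: norm_divide indicator_def simp del: of_real_diff)
    qed
   qed auto
   have iB: "integrable lborel ?B"
   proof (rule Bochner_Integration.integrable_bound[OF integrable_scaleR_right[OF f, of "1/e"]])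
    show "AE s in lborel. norm (?B s) <= norm ((1/e) *\<^sub>R f s)"
    proof (rule AE_I2)
     fix s
     have "e <= norm (cr s - Complex x e)"
      using abs_Im_le_cmod[of "cr s - Complex x e"] e by simp
     then have "norm (f s) / norm (cr s - Complex x e) <= norm (f s) / e"
      using e by (intro divide_left_mono) (auto intro!: mult_pos_pos)
     then show "norm (?B s) <= norm ((1/e) *\<^sub>R f s)" using e by (simp add: norm_divide)
    qed
   qed auto
   have iP: "integrable lborel ?P" by (rule winteg_poisson_integrable[OF w e])
   have "k e s *\<^sub>R f s = ?A s - (?B s - \<i> * ?P s)" for s
   proof -
    have p: "(s - x)\<^sup>2 + e\<^sup>2 > 0" using e by (simp add: add_nonneg_pos)
    have "1 / (cr s - Complex x e) = Complex ((s - x) / ((s - x)\<^sup>2 + e\<^sup>2)) (e / ((s - x)\<^sup>2 + e\<^sup>2))"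
     by (simp add: complex_eq_iff Re_divide Im_divide)
    then have "?B s = f s * Complex ((s - x) / ((s - x)\<^sup>2 + e\<^sup>2)) (e / ((s - x)\<^sup>2 + e\<^sup>2))"
     by (metis mult.right_neutral times_divide_eq_right)
    then have "?B s - \<i> * ?P s = ((s - x) / ((s - x)\<^sup>2 + e\<^sup>2)) *\<^sub>R f s"
     by (simp add: complex_eq_iff algebra_simps)
    moreover have "?A s = (indicator {s. e < \<bar>s - x\<bar>} s * (1 / (s - x))) *\<^sub>R f s"
     by (simp add: scaleR_conv_of_real field_simps)
    ultimately show ?thesis unfolding k_def by (simp add: scaleR_diff_left)
   qed
   then have "(\<integral>s. k e s *\<^sub>R f s \<partial>lborel) = (\<integral>s. ?A s - (?B s - \<i> * ?P s) \<partial>lborel)" by presburger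
   also have "\<dots> = integral\<^sup>L lborel ?A - (\<integral>s. ?B s - \<i> * ?P s \<partial>lborel)"
    using iA iB iP by (intro Bochner_Integration.integral_diff Bochner_Integration.integrable_diff integrable_mult_right)
   also have "(\<integral>s. ?B s - \<i> * ?P s \<partial>lborel) = integral\<^sup>L lborel ?B - (\<integral>s. \<i> * ?P s \<partial>lborel)"
    using iB iP by (intro Bochner_Integration.integral_diff integrable_mult_right)
   also have "(\<integral>s. \<i> * ?P s \<partial>lborel) = \<i> * integral\<^sup>L lborel ?P" by (rule integral_mult_right_zero)
   finally have "(\<integral>s. k e s *\<^sub>R f s \<partial>lborel) = integral\<^sup>L lborel ?A - (integral\<^sup>L lborel ?B - \<i> * integral\<^sup>L lborel ?P)" .
   moreover have "(1 / (cr pi * \<i>)) * (a - (b - \<i> * p)) = (1 / (cr pi * \<i>)) * a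
     - ((1 / (cr pi * \<i>)) * b - (1 / pi) *\<^sub>R p)" for a b p
    by (simp add: scaleR_conv_of_real field_simps)
   ultimately show ?thesis unfolding cauchyF_def poisson_def by presburger
  qed
  then show ?thesis by (auto simp: eventually_at_right_field intro!: exI[of _ 1])
 qed
 ultimately show ?thesis by (rule Lim_transform_eventually)
qed

section \<open>Contour integration in the upper half plane\<close>

lemma integrable_powr_decay:
 fixes p :: real
 assumes p: "1 < p"
 shows "integrable lborel (%x::real. (1 + \<bar>x\<bar>) powr (-p))"
proof -
 let ?g = "%x::real. (1 + \<bar>x\<bar>) powr (-p)"
 have half: "(\<integral>\<^sup>+t. ennreal (?g t) * indicator {0..} t \<partial>lborel) = ennreal (0 - (- ((1 + 0) powr (1 - p)) / (p - 1)))"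
 proof -
  have "(\<integral>\<^sup>+t. ennreal ((1 + t) powr (-p)) * indicator {0..} t \<partial>lborel) = ennreal (0 - (- ((1 + 0) powr (1 - p)) / (p - 1)))"
  proof (rule nn_integral_FTC_atLeast)
   show "DERIV (%t. - ((1 + t) powr (1 - p)) / (p - 1)) t :> (1 + t) powr (-p)" if "0 <= t" for t
   proof -
    have "((%t. (1 + t) powr (1 - p)) has_real_derivative (1 - p) * (1 + t) powr (1 - p - 1) * (0 + 1)) (at t)"
     using that by (auto intro!: derivative_eq_intros)
    from DERIV_cmult[OF this, of "- 1 / (p - 1)"]
    have "((%t. - ((1 + t) powr (1 - p)) / (p - 1)) has_real_derivative
     - 1 / (p - 1) * ((1 - p) * (1 + t) powr (1 - p - 1) * (0 + 1))) (at t)" by simp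
    moreover have "- 1 / (p - 1) * ((1 - p) * (1 + t) powr (1 - p - 1) * (0 + 1)) = (1 + t) powr (- p)"
     using p by (simp add: divide_simps) (simp add: algebra_simps)
    ultimately show ?thesis by simp
   qed
   have "((%t. (1 + t) powr (1 - p)) \<longlongrightarrow> 0) at_top"
    using p by (intro tendsto_neg_powr filterlim_tendsto_add_at_top[OF tendsto_const filterlim_ident]) auto
   then show "((%t. - ((1 + t) powr (1 - p)) / (p - 1)) \<longlongrightarrow> 0) at_top"
    using tendsto_divide[OF tendsto_minus[of _ 0] tendsto_const[of "p - 1"]] p by force
  qed auto
  moreover have "(\<integral>\<^sup>+t. ennreal (?g t) * indicator {0..} t \<partial>lborel) = (\<integral>\<^sup>+t. ennreal ((1 + t) powr (-p)) * indicator {0..} t \<partial>lborel)"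
   by (intro nn_integral_cong) (auto split: split_indicator)
  ultimately show ?thesis by simp
 qed
 have half': "(\<integral>\<^sup>+t. ennreal (?g t) * indicator {..0} t \<partial>lborel) < \<infinity>"
  using half by (subst nn_integral_real_affine[where c="-1" and t=0])
    (auto simp: indicator_def if_distrib cong: if_cong)
 have "(\<integral>\<^sup>+t. ennreal (?g t) \<partial>lborel) <= (\<integral>\<^sup>+t. ennreal (?g t) * indicator {0..} t + ennreal (?g t) * indicator {..0} t \<partial>lborel)"
  by (intro nn_integral_mono) (auto split: split_indicator)
 also have "\<dots> < \<infinity>"
  using half half' by (subst nn_integral_add) (auto simp: ennreal_add_eq_top less_top[symmetric])
 finally show ?thesis by (intro integrableI_bounded) auto
qed

text \<open>Cauchy's theorem on the triangle with vertices \<open>- R\<close>, \<open>R\<close> and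
  \<open>\<i> * R\<close>. On the two upper sides \<open>\<bar>Re z\<bar> + Im z = R\<close>, so
  \<open>norm z \<ge> R / 2\<close>, and the decay with \<open>p > 1\<close> beats the length of the
  sides. Holomorphy slightly below the real line keeps the closed triangle inside the
  domain.\<close>

lemma halfplane_integral_zero:
 assumes hol: "\<Psi> holomorphic_on {z. - \<delta> < Im z}" and \<delta>: "0 < \<delta>" and p: "1 < p"
  and bd: "\<And>z. 0 <= Im z ==> norm (\<Psi> z) <= C * (1 + norm z) powr (- p)"
 shows "integrable lborel (%x::real. \<Psi> (cr x))" "(\<integral>x. \<Psi> (cr x) \<partial>lborel) = 0"
proof -
 have cont: "continuous_on UNIV (%x::real. \<Psi> (cr x))"
  by (rule continuous_on_compose2[OF holomorphic_on_imp_continuous_on[OF hol]]) (use \<delta> in \<open>auto intro!: continuous_intros\<close>)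
 then have [measurable]: "(%x::real. \<Psi> (cr x)) \<in> BM"
  by (rule borel_measurable_continuous_onI)
 have C: "0 <= C" using order_trans[OF norm_ge_zero bd[of 0]] by simp
 show int: "integrable lborel (%x::real. \<Psi> (cr x))"
 proof (rule Bochner_Integration.integrable_bound)
  show "integrable lborel (%x::real. C * (1 + \<bar>x\<bar>) powr (-p))"
   using integrable_powr_decay[OF p] by (rule integrable_mult_right)
  show "AE x in lborel. norm (\<Psi> (cr x)) <= norm (C * (1 + \<bar>x\<bar>) powr (-p))"
   using bd[of "of_real _"] C by (intro AE_I2) (auto simp: abs_mult)
 qed simp
 let ?I = "%n::nat. \<integral>x. indicator {-real n..real n} x *\<^sub>R \<Psi> (cr x) \<partial>lborel"
 have lim: "?I \<longlonglongrightarrow> (\<integral>x. \<Psi> (cr x) \<partial>lborel)"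
 proof (rule integral_dominated_convergence[where w="%x. norm (\<Psi> (cr x))"])
  show "integrable lborel (%x. norm (\<Psi> (cr x)))" using int by (rule integrable_norm)
  show "AE x in lborel. (%n. indicator {- real n..real n} x *\<^sub>R \<Psi> (cr x)) \<longlonglongrightarrow> \<Psi> (cr x)"
  proof (rule AE_I2)
   fix x :: real
   obtain N :: nat where N: "\<bar>x\<bar> < real N" using reals_Archimedean2 by blast
   have "eventually (%n. indicator {- real n..real n} x *\<^sub>R \<Psi> (cr x) = \<Psi> (cr x)) sequentially"
    using eventually_ge_at_top[of N]
   proof eventually_elim
    case (elim n)
    then have "x \<in> {- real n..real n}" using N by auto
    then show ?case by simp
   qed
   then show "(%n. indicator {- real n..real n} x *\<^sub>R \<Psi> (cr x)) \<longlonglongrightarrow> \<Psi> (cr x)"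
    by (rule tendsto_eventually)
  qed
  show "AE x in lborel. norm (indicator {- real n..real n} x *\<^sub>R \<Psi> (cr x)) <= norm (\<Psi> (cr x))" for n
   by (intro AE_I2) (auto split: split_indicator)
 qed auto
 have bound: "norm (?I n) <= 8 * C * (1 + real n / 2) powr (1 - p)" if n: "0 < n" for n
 proof -
  define R where "R = real n"
  have R: "0 < R" using n by (simp add: R_def)
  let ?a = "cr (- R)" and ?b = "cr R" and ?c = "Complex 0 R"
  have sub: "convex hull {?a, ?b, ?c} \<subseteq> {z. 0 <= Im z}"
   using R by (intro hull_minimal) (auto simp: convex_halfspace_Im_ge)
  have "\<Psi> holomorphic_on convex hull {?a, ?b, ?c}"
   by (rule holomorphic_on_subset[OF hol]) (use sub \<delta> in auto)
  then have z: "(\<Psi> has_contour_integral 0) (linepath ?a ?b +++ linepath ?b ?c +++ linepath ?c ?a)"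
   by (rule Cauchy_theorem_triangle)
  have segs: "closed_segment ?a ?b \<subseteq> {z. - \<delta> < Im z}" "closed_segment ?b ?c \<subseteq> {z. - \<delta> < Im z}" "closed_segment ?c ?a \<subseteq> {z. - \<delta> < Im z}"
  proof -
   have cs: "closed_segment u v \<subseteq> {z. - \<delta> < Im z}" if "{u, v} \<subseteq> {?a, ?b, ?c}" for u v
   proof -
    have "closed_segment u v \<subseteq> convex hull {?a, ?b, ?c}"
     unfolding segment_convex_hull by (rule hull_mono[OF that])
    also note sub
    also have "{z. 0 <= Im z} \<subseteq> {z. - \<delta> < Im z}" using \<delta> by auto
    finally show ?thesis .
   qed
   show "closed_segment ?a ?b \<subseteq> {z. - \<delta> < Im z}" "closed_segment ?b ?c \<subseteq> {z. - \<delta> < Im z}" "closed_segment ?c ?a \<subseteq> {z. - \<delta> < Im z}"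
    by (rule cs, blast)+
  qed
  have ci: "\<Psi> contour_integrable_on linepath ?a ?b" "\<Psi> contour_integrable_on linepath ?b ?c" "\<Psi> contour_integrable_on linepath ?c ?a"
   using segs by (auto intro!: contour_integrable_continuous_linepath continuous_on_subset[OF holomorphic_on_imp_continuous_on[OF hol]])
  have sum0: "contour_integral (linepath ?a ?b) \<Psi> + contour_integral (linepath ?b ?c) \<Psi> + contour_integral (linepath ?c ?a) \<Psi> = 0"
   by (rule has_chain_integral_chain_integral3[OF z])
  have side: "norm (contour_integral (linepath u v) \<Psi>) <= C * (1 + R / 2) powr (-p) * (2 * R)"
   if uv: "(u, v) \<in> {(?b, ?c), (?c, ?a)}" for u v
  proof -
   have "norm (contour_integral (linepath u v) \<Psi>) <= C * (1 + R / 2) powr (-p) * norm (v - u)"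
   proof (rule contour_integral_bound_linepath)
    show "\<Psi> contour_integrable_on linepath u v" using ci uv by auto
    fix z assume "z \<in> closed_segment u v"
    then obtain t where t: "0 <= t" "t <= 1" "z = (1 - t) *\<^sub>R u + t *\<^sub>R v" by (auto simp: in_segment)
    have "Im z \<ge> 0 \<and> \<bar>Re z\<bar> + Im z = R"
    proof -
     have tR: "0 <= t * R" "t * R <= R" "(1 - t) * R = R - t * R"
      using t R mult_right_mono[of t 1 R] by (auto simp: algebra_simps)
     from uv consider "Re z = (1 - t) * R" "Im z = t * R" | "Re z = - (t * R)" "Im z = (1 - t) * R"
      using t by auto
     then show ?thesis using tR by cases auto
    qed
    then have iz: "Im z \<ge> 0" and "R / 2 <= norm z" using abs_Re_le_cmod[of z] abs_Im_le_cmod[of z] by linarith+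
    have "norm (\<Psi> z) <= C * (1 + norm z) powr (-p)" by (rule bd[OF iz])
    also have "\<dots> <= C * (1 + R / 2) powr (-p)"
     using \<open>R / 2 <= norm z\<close> C R p by (intro mult_left_mono powr_mono2') auto
    finally show "norm (\<Psi> z) <= C * (1 + R / 2) powr (-p)" .
   qed (use C in auto)
   also have "\<dots> <= C * (1 + R / 2) powr (-p) * (2 * R)"
   proof (intro mult_left_mono)
    have "norm u = R" "norm v = R" using uv R by (auto simp: cmod_def)
    then show "norm (v - u) <= 2 * R" using norm_triangle_ineq4[of v u] by simp
   qed (use C in auto)
   finally show ?thesis .
  qed
  have "?I n = integral {-R..R} (%x. \<Psi> (cr x))"
   unfolding R_def
   using set_borel_integral_eq_integral(2)[of "{-real n..real n}" "%x. \<Psi> (cr x)"]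
    borel_integrable_atLeastAtMost'[OF continuous_on_subset[OF cont, of "{-real n..real n}"]]
   by (simp add: set_lebesgue_integral_def)
  also have "\<dots> = contour_integral (linepath ?a ?b) \<Psi>"
   using R by (subst contour_integral_linepath_Reals_eq) auto
  also have "\<dots> = - (contour_integral (linepath ?b ?c) \<Psi> + contour_integral (linepath ?c ?a) \<Psi>)"
   using sum0 unfolding eq_neg_iff_add_eq_0 add.assoc[symmetric] .
  finally have "norm (?I n) <= norm (contour_integral (linepath ?b ?c) \<Psi>) + norm (contour_integral (linepath ?c ?a) \<Psi>)"
   using norm_minus_cancel norm_triangle_ineq by metis
  also have "\<dots> <= C * (1 + R / 2) powr (-p) * (2 * R) + C * (1 + R / 2) powr (-p) * (2 * R)"
   by (intro add_mono side) auto
  also have "\<dots> = C * (1 + R / 2) powr (-p) * (4 * R)" by (simp add: algebra_simps)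
  also have "\<dots> <= C * (1 + R / 2) powr (-p) * (8 * (1 + R / 2))" using C R by (intro mult_left_mono) auto
  also have "\<dots> = 8 * C * ((1 + R / 2) powr (-p) * (1 + R / 2) powr 1)" using R by simp
  also have "\<dots> = 8 * C * (1 + R / 2) powr (1 - p)" unfolding powr_add[symmetric] by simp
  finally show ?thesis by (simp add: R_def)
 qed
 have "?I \<longlonglongrightarrow> 0"
 proof (rule tendsto_0_le[where K=1])
  have "filterlim (%n::nat. 1 + real n * (1/2)) at_top sequentially"
   by (intro filterlim_tendsto_add_at_top[OF tendsto_const] filterlim_at_top_mult_tendsto_pos[OF tendsto_const _ filterlim_real_sequentially]) auto
  then have "(%n::nat. (1 + real n / 2) powr (1 - p)) \<longlonglongrightarrow> 0"
   using p by (intro tendsto_neg_powr) auto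
  then show "(%n::nat. 8 * C * (1 + real n / 2) powr (1 - p)) \<longlonglongrightarrow> 0" by (rule tendsto_mult_right_zero)
  show "\<forall>\<^sub>F n in sequentially. norm (?I n) <= norm (8 * C * (1 + real n / 2) powr (1 - p)) * 1"
   using eventually_gt_at_top[of 0] by eventually_elim (use bound C in \<open>auto simp: abs_mult\<close>)
 qed
 then show "(\<integral>x. \<Psi> (cr x) \<partial>lborel) = 0" using lim LIMSEQ_unique by blast
qed

text \<open>The function \<open>(\<Psi> w - \<Psi> z) / ((w - z) * (w - cnj z))\<close> has a
  removable singularity at \<open>z\<close> and decays quadratically, so its integral over the real
  line is zero. There the denominator is \<open>(u - x)\<^sup>2 + s\<^sup>2\<close>, and the
  vanishing of the integral is Poisson's formula.\<close>

lemma halfplane_poisson: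
 assumes hol: "\<Psi> holomorphic_on {z. - \<delta> < Im z}" and \<delta>: "0 < \<delta>"
  and bd: "\<And>z. 0 <= Im z ==> norm (\<Psi> z) <= M" and s: "0 < s"
 shows "\<Psi> (Complex x s) = poisson s (%u. \<Psi> (cr u)) x"
proof -
 define z where "z = Complex x s"
 \<comment> \<open>Stopping at height \<open>- s\<close> at the latest keeps the zero
   \<open>cnj z\<close> of the denominator outside \<open>S\<close>.\<close>
 define S where "S = {w. - min \<delta> s < Im w}"
 have S: "open S" unfolding S_def by (rule open_halfspace_Im_gt)
 have zS: "z \<in> S" using s \<delta> by (auto simp: S_def z_def)
 have holS: "\<Psi> holomorphic_on S" by (rule holomorphic_on_subset[OF hol]) (auto simp: S_def)
 define G where "G = (%w. if w = z then deriv \<Psi> z else (\<Psi> w - \<Psi> z) / (w - z))"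
 have G: "G holomorphic_on S" unfolding G_def by (rule pole_lemma_open[OF holS S])
 define H where "H = (%w. G w / (w - cnj z))"
 have H: "H holomorphic_on S" unfolding H_def
  using s by (intro holomorphic_intros G) (auto simp: S_def z_def complex_eq_iff)
 have M: "0 <= M" using order_trans[OF norm_ge_zero bd[of 0]] by simp
 have cpt: "compact (cball z 1 \<inter> {w. 0 <= Im w})"
  by (intro compact_Int_closed closed_halfspace_Im_ge) auto
 have "continuous_on (cball z 1 \<inter> {w. 0 <= Im w}) H"
  by (rule continuous_on_subset[OF holomorphic_on_imp_continuous_on[OF H]]) (use s \<delta> in \<open>auto simp: S_def\<close>)
 then have "bounded (H ` (cball z 1 \<inter> {w. 0 <= Im w}))"
  using cpt compact_continuous_image compact_imp_bounded by blast
 then obtain B where B: "0 < B" "\<And>w. w \<in> cball z 1 ==> 0 <= Im w ==> norm (H w) <= B"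
  unfolding bounded_pos by auto
 \<comment> \<open>\<open>B\<close> bounds \<open>H\<close> within distance 1 of \<open>z\<close>,
   where the quotient estimate degenerates. Outside, \<open>2 * M\<close> bounds the numerator, and
   \<open>1 + norm w\<close> is at most \<open>2 + norm z\<close> times the distance to
   \<open>z\<close>.\<close>
 define C where "C = (2 * M + B) * (2 + norm z)\<^sup>2"
 have bound: "norm (H w) <= C * (1 + norm w) powr (-2)" if w: "0 <= Im w" for w
 proof -
  have pw: "(1 + norm w) powr (-2) = 1 / (1 + norm w)\<^sup>2" by (simp add: powr_minus divide_inverse powr_realpow add_pos_nonneg)
  have pos: "0 < (1 + norm w)\<^sup>2" by (intro zero_less_power add_pos_nonneg) auto
  show ?thesis
  proof (cases "norm (w - z) <= 1")
   case True
   then have "norm w <= 1 + norm z" using norm_triangle_ineq[of "w - z" z] by simp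
   then have "(1 + norm w)\<^sup>2 <= (2 + norm z)\<^sup>2" by (intro power_mono) auto
   then have "B * (1 + norm w)\<^sup>2 <= (2 * M + B) * (2 + norm z)\<^sup>2" using B M by (intro mult_mono) auto
   then have "B <= C / (1 + norm w)\<^sup>2" using pos by (simp add: C_def pos_le_divide_eq)
   then show ?thesis using B(2)[of w] True w pw by (simp add: dist_norm norm_minus_commute)
  next
   case False
   then have nz: "w \<noteq> z" and d: "1 < norm (w - z)" by auto
   have "norm w <= norm (w - z) + norm z" using norm_triangle_ineq[of "w - z" z] by simp
   also have "1 + (norm (w - z) + norm z) <= (2 + norm z) * norm (w - z)"
    using d mult_left_mono[of 1 "norm (w - z)" "norm z"] by (simp add: algebra_simps)
   finally have le: "1 + norm w <= (2 + norm z) * norm (w - z)" by simp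
   have "norm (w - z) <= norm (w - cnj z)"
    unfolding cmod_def using w s by (intro real_sqrt_le_mono add_left_mono) (auto simp: z_def abs_le_square_iff[symmetric])
   then have "norm (w - z) * norm (w - z) <= norm (w - z) * norm (w - cnj z)" by (intro mult_left_mono) auto
   have "norm (H w) = norm (\<Psi> w - \<Psi> z) / (norm (w - z) * norm (w - cnj z))"
    using nz by (simp add: H_def G_def norm_divide norm_mult)
   also have "\<dots> <= (2 * M) / (norm (w - z) * norm (w - z))"
   proof (intro frac_le)
    show "norm (\<Psi> w - \<Psi> z) <= 2 * M"
     using norm_triangle_ineq4[of "\<Psi> w" "\<Psi> z"] bd[OF w] bd[of z] s by (simp add: z_def)
   qed (use M nz in \<open>auto simp: \<open>norm (w - z) * norm (w - z) <= norm (w - z) * norm (w - cnj z)\<close>\<close>)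
   also have "\<dots> <= C / (1 + norm w)\<^sup>2"
   proof -
    have "(1 + norm w)\<^sup>2 <= ((2 + norm z) * norm (w - z))\<^sup>2" using le by (intro power_mono) auto
    then have "2 * M * (1 + norm w)\<^sup>2 <= (2 * M + B) * ((2 + norm z) * norm (w - z))\<^sup>2"
     using M B by (intro mult_mono) auto
    then show ?thesis using pos nz by (simp add: C_def divide_simps power2_eq_square mult_ac)
   qed
   finally show ?thesis using pw by simp
  qed
 qed
 have i: "integrable lborel (%u::real. H (cr u))" "(\<integral>u. H (cr u) \<partial>lborel) = 0"
  using halfplane_integral_zero[OF H[unfolded S_def] _ _ bound] s \<delta> by auto
 have Hu: "cr s * H (cr u) = (s / ((u - x)\<^sup>2 + s\<^sup>2)) *\<^sub>R \<Psi> (cr u) - (s / ((u - x)\<^sup>2 + s\<^sup>2)) *\<^sub>R \<Psi> z" for u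
 proof -
  have nz: "of_real u \<noteq> z" using s by (auto simp: z_def complex_eq_iff)
  have "(of_real u - z) * (of_real u - cnj z) = of_real ((u - x)\<^sup>2 + s\<^sup>2)"
   by (simp add: z_def complex_eq_iff power2_eq_square algebra_simps)
  then have "H (cr u) = (\<Psi> (cr u) - \<Psi> z) / of_real ((u - x)\<^sup>2 + s\<^sup>2)"
   using nz by (simp add: H_def G_def)
  then show ?thesis by (simp only: scaleR_conv_of_real diff_divide_distrib right_diff_distrib of_real_divide times_divide_eq_left times_divide_eq_right)
 qed
 have cont: "continuous_on UNIV (%x::real. \<Psi> (cr x))"
  by (rule continuous_on_compose2[OF holomorphic_on_imp_continuous_on[OF hol]]) (use \<delta> in \<open>auto intro!: continuous_intros\<close>)
 then have m[measurable]: "(%x::real. \<Psi> (cr x)) \<in> BM"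
  by (rule borel_measurable_continuous_onI)
 have i2: "integrable lborel (%u. (s / ((u - x)\<^sup>2 + s\<^sup>2)) *\<^sub>R \<Psi> z)"
  using integral_poisson(1)[OF s] by (rule integrable_scaleR_left)
 have i1: "integrable lborel (%u. (s / ((u - x)\<^sup>2 + s\<^sup>2)) *\<^sub>R \<Psi> (cr u))"
  using Bochner_Integration.integrable_add[OF integrable_mult_right[OF i(1), of "cr s"] i2]
  unfolding Hu by simp
 have "0 = (\<integral>u. cr s * H (cr u) \<partial>lborel)" using i by simp
 also have "\<dots> = (\<integral>u. (s / ((u - x)\<^sup>2 + s\<^sup>2)) *\<^sub>R \<Psi> (cr u) \<partial>lborel) - pi *\<^sub>R \<Psi> z"
  unfolding Hu using i1 i2 integral_poisson[OF s, of x] by simp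
 finally show ?thesis by (simp add: poisson_def z_def)
qed

section \<open>Riesz bounds\<close>

lemma norm_integral_le:
 fixes f :: "'a => complex"
 assumes "integrable M f" "integrable M g" "\<And>x. norm (f x) <= g x"
 shows "norm (integral\<^sup>L M f) <= integral\<^sup>L M g"
proof -
 have "norm (integral\<^sup>L M f) <= (\<integral>x. norm (f x) \<partial>M)" by (rule integral_norm_bound)
 also have "\<dots> <= integral\<^sup>L M g" using assms by (intro integral_mono) auto
 finally show ?thesis .
qed

lemma norm_of_real_minus_ge: "\<bar>Im z\<bar> <= norm (cr s - z)"
 using abs_Im_le_cmod[of "cr s - z"] by simp

lemma cauchy_kernel_integrable:
 assumes f: "integrable lborel f" and z: "Im z \<noteq> 0"
 shows "integrable lborel (%s. f s / (cr s - z))"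
proof (rule Bochner_Integration.integrable_bound[OF integrable_scaleR_right[OF f, of "1/\<bar>Im z\<bar>"]])
 have [measurable]: "f \<in> BM" using borel_measurable_integrable[OF f] by simp
 show "(%s. f s / (cr s - z)) \<in> borel_measurable lborel" by measurable
 show "AE s in lborel. norm (f s / (cr s - z)) <= norm ((1/\<bar>Im z\<bar>) *\<^sub>R f s)"
 proof (rule AE_I2)
  fix s
  have "norm (f s) / norm (cr s - z) <= norm (f s) / \<bar>Im z\<bar>"
   using norm_of_real_minus_ge[of z s] z by (intro divide_left_mono) (auto intro!: mult_pos_pos)
  then show "norm (f s / (cr s - z)) <= norm ((1/\<bar>Im z\<bar>) *\<^sub>R f s)" by (simp add: norm_divide)
 qed
qed

lemma cauchyF_bound:
 assumes f: "integrable lborel f" and z: "0 < d" and d: "\<And>s. f s \<noteq> 0 ==> d <= norm (cr s - z)"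
 shows "norm (cauchyF f z) <= (\<integral>s. norm (f s) \<partial>lborel) / (pi * d)"
proof -
 have [measurable]: "f \<in> BM" using borel_measurable_integrable[OF f] by simp
 have b: "norm (f s / (cr s - z)) <= (1/d) * norm (f s)" for s
 proof (cases "f s = 0")
  case False
  have "norm (f s) / norm (cr s - z) <= norm (f s) / d"
   using d[OF False] z by (intro divide_left_mono) (auto intro!: mult_pos_pos)
  then show ?thesis by (simp add: norm_divide)
 qed auto
 have "norm (\<integral>s. f s / (cr s - z) \<partial>lborel) <= (\<integral>s. (1/d) * norm (f s) \<partial>lborel)"
 proof (rule norm_integral_le)
  show i: "integrable lborel (%s. 1 / d * norm (f s))" using f by auto
  show "integrable lborel (%s. f s / (cr s - z))"
  proof (rule Bochner_Integration.integrable_bound[OF i])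
   show "AE s in lborel. norm (f s / (cr s - z)) <= norm (1 / d * norm (f s))"
    using b z by (intro AE_I2) (auto simp: abs_mult)
  qed measurable
 qed (use b in auto)
 then show ?thesis using z unfolding cauchyF_def by (simp add: norm_mult norm_divide field_simps)
qed

text \<open>The error of the difference quotient has the exact integrand
  \<open>(w - z) * f s / ((s - w) * (s - z)\<^sup>2)\<close>. For \<open>w\<close> within half the
  distance of \<open>z\<close> to the real line both denominators are bounded below, so the error is
  of order \<open>norm (w - z)\<close>.\<close>

lemma cauchyF_deriv:
 assumes f: "integrable lborel f" and z: "Im z \<noteq> 0"
 shows "(cauchyF f has_field_derivative (1 / (cr pi * \<i>)) * (\<integral>s. f s / (cr s - z)\<^sup>2 \<partial>lborel)) (at z)"
proof -
 have [measurable]: "f \<in> BM" using borel_measurable_integrable[OF f] by simp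
 define y where "y = \<bar>Im z\<bar>"
 have y: "0 < y" using z by (simp add: y_def)
 let ?J = "%w. \<integral>s. f s / (cr s - w) \<partial>lborel"
 let ?D = "\<integral>s. f s / (cr s - z)\<^sup>2 \<partial>lborel"
 define N where "N = (\<integral>s. norm (f s) \<partial>lborel)"
 have iD: "integrable lborel (%s. f s / (cr s - z)\<^sup>2)"
 proof (rule Bochner_Integration.integrable_bound[OF integrable_scaleR_right[OF f, of "1/y\<^sup>2"]])
  show "AE s in lborel. norm (f s / (cr s - z)\<^sup>2) <= norm ((1/y\<^sup>2) *\<^sub>R f s)"
  proof (rule AE_I2)
   fix s
   have "y\<^sup>2 <= (norm (cr s - z))\<^sup>2"
    using norm_of_real_minus_ge[of z s] y by (intro power_mono) (auto simp: y_def)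
   then have "norm (f s) / (norm (cr s - z))\<^sup>2 <= norm (f s) / y\<^sup>2"
    using y by (intro divide_left_mono) (auto intro!: mult_pos_pos)
   then show "norm (f s / (cr s - z)\<^sup>2) <= norm ((1/y\<^sup>2) *\<^sub>R f s)" by (simp add: norm_divide norm_power)
  qed
 qed measurable
 have est: "norm ((?J w - ?J z) / (w - z) - ?D) <= norm (w - z) * (N * (2 / y ^ 3))"
  if w: "w \<noteq> z" "norm (w - z) < y / 2" for w
 proof -
  have "\<bar>Im w - Im z\<bar> < y/2" using abs_Im_le_cmod[of "w - z"] w by simp
  then have iw: "y/2 <= \<bar>Im w\<bar>" unfolding y_def by linarith
  then have iw0: "Im w \<noteq> 0" using y by auto
  have nz: "cr s - z \<noteq> 0" "cr s - w \<noteq> 0" for s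
   using z iw0 by (auto simp: complex_eq_iff)
  let ?R = "%s. (w - z) * (f s / ((cr s - w) * (cr s - z)\<^sup>2))"
  have eq: "f s / (cr s - w) / (w - z) - f s / (cr s - z) / (w - z) - f s / (cr s - z)\<^sup>2 = ?R s" for s
  proof -
   define a b where "a = cr s - w" and "b = cr s - z"
   have ab: "a \<noteq> 0" "b \<noteq> 0" "w - z = b - a" "b - a \<noteq> 0" using nz w by (auto simp: a_def b_def)
   have "f s / a / (b - a) - f s / b / (b - a) - f s / b\<^sup>2 = (b - a) * (f s / (a * b\<^sup>2))"
    using ab(1,2,4) by (simp add: divide_simps) (simp add: algebra_simps power2_eq_square)
   then show ?thesis unfolding ab(3) a_def b_def .
  qed
  have iR: "integrable lborel ?R"
   unfolding eq[symmetric]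
   by (intro Bochner_Integration.integrable_diff iD integrable_divide cauchy_kernel_integrable f z iw0)
  have "(?J w - ?J z) / (w - z) - ?D = (\<integral>s. ?R s \<partial>lborel)"
  proof -
   have i: "integrable lborel (%s. f s / (cr s - w) / (w - z))" "integrable lborel (%s. f s / (cr s - z) / (w - z))"
    by (intro integrable_divide cauchy_kernel_integrable f z iw0)+
   show ?thesis
    unfolding eq[symmetric] diff_divide_distrib integral_divide_zero[symmetric]
    using i iD by (simp only: Bochner_Integration.integral_diff Bochner_Integration.integrable_diff)
  qed
  also have "norm \<dots> <= (\<integral>s. (norm (w - z) * (2 / y ^ 3)) * norm (f s) \<partial>lborel)"
  proof (rule norm_integral_le[OF iR])
   fix s
   have 1: "y/2 <= norm (cr s - w)" using norm_of_real_minus_ge[of w s] iw by linarith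
   have 2: "y\<^sup>2 <= (norm (cr s - z))\<^sup>2"
    using norm_of_real_minus_ge[of z s] y by (intro power_mono) (auto simp: y_def)
   have "y/2 * y\<^sup>2 <= norm (cr s - w) * (norm (cr s - z))\<^sup>2"
    using 1 2 y by (intro mult_mono) auto
   then have "norm (f s) / (norm (cr s - w) * (norm (cr s - z))\<^sup>2) <= norm (f s) / (y/2 * y\<^sup>2)"
    using y nz[of s] by (intro divide_left_mono) (auto intro!: mult_pos_pos)
   also have "\<dots> = (2 / y ^ 3) * norm (f s)" using y by (simp add: power3_eq_cube power2_eq_square mult_ac)
   finally have "norm (w - z) * (norm (f s) / (norm (cr s - w) * (norm (cr s - z))\<^sup>2)) <= norm (w - z) * ((2 / y ^ 3) * norm (f s))"
    by (intro mult_left_mono) auto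
   then show "norm (?R s) <= (norm (w - z) * (2 / y ^ 3)) * norm (f s)"
    by (simp add: norm_mult norm_divide norm_power mult.assoc)
  qed (use f in auto)
  also have "\<dots> = norm (w - z) * (N * (2 / y ^ 3))" by (simp add: N_def mult_ac)
  finally show ?thesis .
 qed
 have "((%w. (?J w - ?J z) / (w - z) - ?D) \<longlongrightarrow> 0) (at z)"
 proof (rule Lim_null_comparison)
  show "eventually (%w. norm ((?J w - ?J z) / (w - z) - ?D) <= norm (w - z) * (N * (2 / y ^ 3))) (at z)"
   unfolding eventually_at using est y by (intro exI[of _ "y/2"]) (auto simp: dist_norm)
  have "((%w. norm (w - z) * (N * (2 / y ^ 3))) \<longlongrightarrow> norm (z - z) * (N * (2 / y ^ 3))) (at z)"
   by (intro tendsto_intros)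
  then show "((%w. norm (w - z) * (N * (2 / y ^ 3))) \<longlongrightarrow> 0) (at z)" by simp
 qed
 then have "(?J has_field_derivative ?D) (at z)"
  unfolding has_field_derivative_iff by (rule LIM_zero_cancel)
 then show ?thesis unfolding cauchyF_def by (rule DERIV_cmult)
qed

lemma cauchyF_holomorphic:
 assumes f: "integrable lborel f" and S: "\<And>z. z \<in> S ==> Im z \<noteq> 0"
 shows "cauchyF f holomorphic_on S"
 unfolding holomorphic_on_def field_differentiable_def
 using cauchyF_deriv[OF f S] has_field_derivative_at_within by blast

lemma cauchyF_decay:
 assumes f: "integrable lborel f" and supp: "\<And>s. a < \<bar>s\<bar> ==> f s = 0" and a: "0 <= a" and y: "0 < y" "y <= \<bar>Im z\<bar>"
 shows "norm (cauchyF f z) <= ((\<integral>s. norm (f s) \<partial>lborel) * ((1 + a) / y + 1)) / (1 + norm z)"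
proof -
 define K where "K = (1 + a) / y + 1"
 have K: "0 < K" using a y by (simp add: K_def add_pos_nonneg)
 have nn: "0 <= (\<integral>s. norm (f s) \<partial>lborel)" by simp
 have "norm (cauchyF f z) <= (\<integral>s. norm (f s) \<partial>lborel) / (pi * ((1 + norm z) / K))"
 proof (rule cauchyF_bound[OF f])
  show "0 < (1 + norm z) / K" using K by (simp add: add_pos_nonneg)
  fix s assume "f s \<noteq> 0"
  then have s: "\<bar>s\<bar> <= a" using supp[of s] by fastforce
  have n: "norm z <= norm (cr s - z) + a"
   using norm_triangle_ineq4[of "cr s" "cr s - z"] s by simp
  have "1 + a <= (1 + a) / y * norm (cr s - z)"
   using y norm_of_real_minus_ge[of z s] a mult_left_mono[of y "norm (cr s - z)" "(1 + a)/y"] by simp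
  with n have "1 + norm z <= K * norm (cr s - z)" unfolding K_def by (simp add: algebra_simps)
  then show "(1 + norm z) / K <= norm (cr s - z)" using K by (simp add: field_simps)
 qed
 also have "\<dots> = ((\<integral>s. norm (f s) \<partial>lborel) * K / (1 + norm z)) / pi" by (simp add: field_simps)
 also have "\<dots> <= ((\<integral>s. norm (f s) \<partial>lborel) * K / (1 + norm z)) / 1"
  using nn K pi_ge_two by (intro divide_left_mono) (auto intro!: divide_nonneg_pos mult_nonneg_nonneg add_pos_nonneg)
 finally show ?thesis by (simp add: K_def)
qed

text \<open>Let \<open>\<theta>\<close> be the argument of \<open>w\<close>, between
  \<open>- pi/2\<close> and \<open>pi/2\<close>. Near the end points \<open>cos \<theta>\<close>
  degenerates, but there \<open>cos (p * \<theta>)\<close> is close to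
  \<open>cos (p * pi / 2)\<close>, and the term with \<open>B\<close> alone exceeds 1. Elsewhere
  \<open>cos \<theta>\<close> is bounded below, and a large \<open>A\<close> also absorbs a negative
  second term.\<close>

lemma riesz_inequality:
 fixes p :: real
 assumes p: "0 < p" and c: "cos (p * pi / 2) \<noteq> 0"
 obtains A B where "0 <= A" "\<And>w. 0 < Re w ==> norm w powr p <= A * Re w powr p + B * Re (w powr (of_real p))"
proof -
 \<comment> \<open>Normalises the value at \<open>\<theta> = pi/2\<close> to 2, whatever the sign of
   the cosine, and so leaves a neighbourhood with values above 1.\<close>
 define B where "B = 2 / cos (p * pi / 2)"
 have "((%\<theta>. B * cos (p * \<theta>)) \<longlongrightarrow> B * cos (p * (pi/2))) (at (pi/2))" by (intro tendsto_intros)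
 moreover have "B * cos (p * (pi/2)) = 2" using c by (simp add: B_def)
 ultimately have "eventually (%\<theta>. 1 < B * cos (p * \<theta>)) (at (pi/2))" by (intro order_tendstoD(1)[where y=2]) auto
 then obtain d0 where d0: "0 < d0" "\<And>\<theta>. \<theta> \<noteq> pi/2 ==> \<bar>\<theta> - pi/2\<bar> < d0 ==> 1 < B * cos (p * \<theta>)"
  unfolding eventually_at by (auto simp: dist_real_def)
 define d where "d = min (d0/2) (pi/4)"
 have d: "0 < d" "d < d0" using d0 pi_gt_zero unfolding d_def by (auto simp: min_less_iff_disj)
 have "d <= pi/4" by (simp add: d_def)
 then have d3: "d < pi/2" using pi_gt_zero by linarith
 note d = d d3
 define \<kappa> where "\<kappa> = cos (pi/2 - d)"
 have \<kappa>: "0 < \<kappa>" unfolding \<kappa>_def using d by (intro cos_gt_zero) auto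
 define A where "A = (1 + \<bar>B\<bar>) / \<kappa> powr p"
 have A: "0 <= A" by (simp add: A_def)
 show ?thesis
 proof (rule that[OF A])
  fix w :: complex assume w: "0 < Re w"
  then have w0: "w \<noteq> 0" by auto
  define \<theta> where "\<theta> = Im (Ln w)"
  have th: "\<bar>\<theta>\<bar> < pi/2" unfolding \<theta>_def using Re_Ln_pos_lt_imp[OF w] by simp
  define r where "r = norm w"
  have r: "0 < r" using w0 by (simp add: r_def)
  have rew: "Re w = r * cos \<theta>"
  proof -
   have "Re w = Re (exp (Ln w))" using w0 by simp
   also have "\<dots> = exp (Re (Ln w)) * cos (Im (Ln w))" by (rule Re_exp)
   finally show ?thesis using w0 by (simp add: r_def \<theta>_def)
  qed
  have rep: "Re (w powr (of_real p)) = r powr p * cos (p * \<theta>)"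
   using w0 by (simp add: powr_def Re_exp r_def \<theta>_def)
  have "1 <= A * cos \<theta> powr p + B * cos (p * \<theta>)"
  proof (cases "\<bar>\<theta>\<bar> <= pi/2 - d")
   case True
   have "\<kappa> <= cos \<bar>\<theta>\<bar>" unfolding \<kappa>_def using True d by (intro cos_monotone_0_pi_le) auto
   then have "\<kappa> powr p <= cos \<theta> powr p" using \<kappa> p by (intro powr_mono2) auto
   then have "1 + \<bar>B\<bar> <= A * cos \<theta> powr p"
    using \<kappa> mult_left_mono[of "\<kappa> powr p" "cos \<theta> powr p" A] A by (simp add: A_def)
   moreover have "\<bar>B * cos (p * \<theta>)\<bar> <= \<bar>B\<bar> * 1" unfolding abs_mult by (intro mult_left_mono) auto
   ultimately show ?thesis by linarith
  next
   case False
   then have "1 < B * cos (p * \<bar>\<theta>\<bar>)" using th d by (intro d0) auto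
   moreover have "cos (p * \<bar>\<theta>\<bar>) = cos (p * \<theta>)" by (cases "0 <= \<theta>") auto
   ultimately show ?thesis using A by (smt (verit) mult_nonneg_nonneg powr_ge_zero)
  qed
  then have "r powr p * 1 <= r powr p * (A * cos \<theta> powr p + B * cos (p * \<theta>))" by (intro mult_left_mono) auto
  also have "\<dots> = A * Re w powr p + B * Re (w powr (of_real p))"
   unfolding rew rep using r th by (subst powr_mult) (auto simp: algebra_simps cos_ge_zero)
  finally show "norm w powr p <= A * Re w powr p + B * Re (w powr (of_real p))" by (simp add: r_def)
 qed
qed

text \<open>The tangent line of a convex function at 1, extracted from Young's inequality.\<close>

lemma powr_tangent:
 fixes u p :: real
 assumes "1 < p" "0 <= u"
 shows "1 + p * (u - 1) <= u powr p"
proof (cases "u = 0")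
 case False
 have "(u powr p) powr (1/p) * 1 powr (1 - 1/p) <= 1/p * u powr p + (1 - 1/p) * 1"
  using assms False by (intro Youngs_inequality_0) auto
 then have "u <= u powr p / p + (1 - 1/p)" using assms False by (simp add: powr_powr)
 then have "u * p <= (u powr p / p + (1 - 1/p)) * p" using assms by (intro mult_right_mono) auto
 also have "\<dots> = u powr p + p - 1" using assms by (simp add: field_simps)
 finally show ?thesis by (simp add: algebra_simps)
qed (use assms in auto)

text \<open>Jensen's inequality for the probability density given by the Poisson kernel over
  \<open>pi\<close>: the tangent line at the mean is integrated, and its linear part drops out.
  Positivity of the mean allows the tangent at 1 to be rescaled to it.\<close>

lemma poisson_powr_le:
 fixes f :: "real => real"
 assumes f: "integrable lborel f" "\<And>s. 0 <= f s" and p: "1 < p"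
  and fp: "integrable lborel (%s. f s powr p)" and y: "0 < y"
  and c: "0 < (1/pi) * (\<integral>s. y / ((s - x)\<^sup>2 + y\<^sup>2) * f s \<partial>lborel)"
 shows "((1/pi) * (\<integral>s. y / ((s - x)\<^sup>2 + y\<^sup>2) * f s \<partial>lborel)) powr p <= (1/pi) * (\<integral>s. y / ((s - x)\<^sup>2 + y\<^sup>2) * f s powr p \<partial>lborel)"
proof -
 define k where "k = (%s. y / ((s - x)\<^sup>2 + y\<^sup>2))"
 define c where "c = (1/pi) * (\<integral>s. k s * f s \<partial>lborel)"
 have c0: "0 < c" using c by (simp add: c_def k_def)
 have [measurable]: "k \<in> BM" unfolding k_def by measurable
 have kb: "0 <= k s" "k s <= 1 / y" for s
 proof -
  show "0 <= k s" using y by (simp add: k_def)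
  have "k s <= y / y\<^sup>2" unfolding k_def using y by (intro divide_left_mono) (auto simp: add_nonneg_pos)
  then show "k s <= 1 / y" using y by (simp add: power2_eq_square)
 qed
 have ik: "integrable lborel (%s. k s * g s)" if g: "integrable lborel g" for g :: "real => real"
 proof (rule Bochner_Integration.integrable_bound[OF integrable_mult_right[OF g, of "1/y"]])
  have [measurable]: "g \<in> BM" using borel_measurable_integrable[OF g] by simp
  show "(%s. k s * g s) \<in> borel_measurable lborel" by measurable
  show "AE s in lborel. norm (k s * g s) <= norm (1 / y * g s)"
  proof (rule AE_I2)
   fix s
   have "k s * \<bar>g s\<bar> <= 1 / y * \<bar>g s\<bar>" using kb[of s] by (intro mult_right_mono) auto
   then show "norm (k s * g s) <= norm (1 / y * g s)" using kb[of s] y by (simp add: abs_mult)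
  qed
 qed
 have k: "integrable lborel k" "integral\<^sup>L lborel k = pi"
  using integral_poisson[OF y, of x] unfolding k_def by auto
 have pt: "c powr p * k s + p * c powr (p - 1) * (k s * f s - c * k s) <= k s * f s powr p" for s
 proof -
  have "1 + p * (f s / c - 1) <= (f s / c) powr p" using powr_tangent[OF p] f c0 by simp
  then have "c powr p * (1 + p * (f s / c - 1)) <= c powr p * (f s / c) powr p" by (intro mult_left_mono) auto
  also have "\<dots> = f s powr p" using f c0 by (subst powr_mult[symmetric]) auto
  also have "c powr p * (1 + p * (f s / c - 1)) = c powr p + p * c powr (p - 1) * (f s - c)"
   using c0 by (simp add: powr_diff field_simps)
  finally have "k s * (c powr p + p * c powr (p - 1) * (f s - c)) <= k s * f s powr p"
   using kb[of s] by (intro mult_left_mono) auto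
  then show ?thesis by (simp add: algebra_simps)
 qed
 have "pi * c powr p = (\<integral>s. c powr p * k s + p * c powr (p - 1) * (k s * f s - c * k s) \<partial>lborel)"
  using k ik[OF f(1)] by (simp add: c_def)
 also have "\<dots> <= (\<integral>s. k s * f s powr p \<partial>lborel)"
  using k ik[OF f(1)] ik[OF fp] pt by (intro integral_mono) auto
 finally show ?thesis unfolding c_def k_def by (simp add: field_simps)
qed

lemma cauchyF_real_Re:
 fixes f :: "real => real"
 assumes f: "integrable lborel f" and y: "0 < y"
 shows "Re (cauchyF (%s. of_real (f s)) (Complex x y)) = (1/pi) * (\<integral>s. y / ((s - x)\<^sup>2 + y\<^sup>2) * f s \<partial>lborel)"
proof -
 have fi: "integrable lborel (%s. cr (f s))" using f by auto
 have i: "integrable lborel (%s. cr (f s) / (cr s - Complex x y))"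
  using y by (intro cauchy_kernel_integrable fi) auto
 have "Im (cr (f s) / (cr s - Complex x y)) = y / ((s - x)\<^sup>2 + y\<^sup>2) * f s" for s
  by (simp add: Im_divide)
 then have "Im (\<integral>s. cr (f s) / (cr s - Complex x y) \<partial>lborel) = (\<integral>s. y / ((s - x)\<^sup>2 + y\<^sup>2) * f s \<partial>lborel)"
  using integral_Im[OF i] by simp
 then show ?thesis unfolding cauchyF_def by (simp add: Re_divide power2_eq_square)
qed

lemma powr_le_imp_integrable:
 fixes f :: "real => complex"
 assumes f[measurable]: "f \<in> BM" and supp: "\<And>s. a < \<bar>s\<bar> ==> f s = 0"
  and p: "1 < p" and fp: "(\<integral>\<^sup>+s. ennreal (norm (f s) powr p) \<partial>lborel) < \<infinity>"
 shows "integrable lborel f"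
proof (rule integrableI_bounded)
 have "(\<integral>\<^sup>+s. ennreal (norm (f s)) \<partial>lborel) <= (\<integral>\<^sup>+s. indicator {-a..a} s + ennreal (norm (f s) powr p) \<partial>lborel)"
 proof (intro nn_integral_mono)
  fix s
  show "ennreal (norm (f s)) <= indicator {-a..a} s + ennreal (norm (f s) powr p)"
  proof (cases "a < \<bar>s\<bar>")
   case False
   have "norm (f s) <= 1 + norm (f s) powr p"
   proof (cases "norm (f s) <= 1")
    case False
    then have "norm (f s) powr 1 <= norm (f s) powr p" using p by (intro powr_mono) auto
    then show ?thesis using False by simp
   qed (smt (verit) powr_ge_zero)
   then have "ennreal (norm (f s)) <= ennreal 1 + ennreal (norm (f s) powr p)"
    by (subst ennreal_plus[symmetric]) (auto intro!: ennreal_leI simp del: ennreal_plus)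
   moreover have "s \<in> {-a..a}" using False by auto
   ultimately show ?thesis by simp
  qed (use supp in auto)
 qed
 also have "\<dots> < \<infinity>" using fp emeasure_bounded_finite[of "{-a..a}"]
  by (subst nn_integral_add) (auto simp: less_top[symmetric] ennreal_add_eq_top)
 finally show "(\<integral>\<^sup>+s. ennreal (norm (f s)) \<partial>lborel) < \<infinity>" .
qed simp

text \<open>For nonnegative \<open>f\<close> that is not a.e. zero the Cauchy integral has positive
  real part in the upper half plane, so its \<open>p\<close>-th power is holomorphic there. That
  power decays like \<open>(1 + norm z) powr (- p)\<close>, hence the integral of its real part
  along the line is zero. Integrating the pointwise inequality leaves only the Poisson term, which
  Jensen and Fubini control.\<close>

lemma riesz_nonneg:
 fixes f :: "real => real" and A B p y a :: real
 assumes AB: "0 <= A" "\<And>w. 0 < Re w ==> norm w powr p <= A * Re w powr p + B * Re (w powr (of_real p))"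
  and p: "1 < p" and f[measurable]: "f \<in> BM" and nn: "\<And>s. 0 <= f s"
  and supp: "\<And>s. a < \<bar>s\<bar> ==> f s = 0" and a: "0 <= a"
  and fp: "(\<integral>\<^sup>+s. ennreal (f s powr p) \<partial>lborel) < \<infinity>" and y: "0 < y"
 shows "(\<integral>\<^sup>+x. ennreal (norm (cauchyF (%s. of_real (f s)) (Complex x y)) powr p) \<partial>lborel)
   <= ennreal A * (\<integral>\<^sup>+s. ennreal (f s powr p) \<partial>lborel)"
proof -
 let ?f = "%s. cr (f s)"
 let ?F = "cauchyF ?f"
 have fpn: "(\<integral>\<^sup>+s. ennreal (norm (?f s) powr p) \<partial>lborel) < \<infinity>" using fp nn by simp
 have fi: "integrable lborel ?f"
  by (rule powr_le_imp_integrable[of ?f a p]) (use supp p fpn in auto)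
 then have fr: "integrable lborel f" by (simp add: complex_of_real_integrable_eq)
 have fpi: "integrable lborel (%s. f s powr p)" using fp by (intro integrableI_bounded) auto
 show ?thesis
 proof (cases "AE s in lborel. f s = 0")
  case True
  have "?F z = 0" for z
  proof -
   have "(\<integral>s. ?f s / (cr s - z) \<partial>lborel) = (\<integral>s. 0 \<partial>(lborel::real measure))"
    by (rule integral_cong_AE) (use True in auto)
   then show ?thesis by (simp add: cauchyF_def)
  qed
  then show ?thesis using p by simp
 next
  case False
  define P where "P = (%y x. (1/pi) * (\<integral>s. y / ((s - x)\<^sup>2 + y\<^sup>2) * f s \<partial>lborel))"
  have ReF: "Re (?F (Complex x y)) = P y x" if "0 < y" for x y
   unfolding P_def by (rule cauchyF_real_Re[OF fr that])
  have kfi: "integrable lborel (%s. y / ((s - x)\<^sup>2 + y\<^sup>2) * f s)" if y: "0 < y" for x y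
  proof -
   have "integrable lborel (%s. (y / ((s - x)\<^sup>2 + y\<^sup>2)) *\<^sub>R ?f s)"
    by (rule winteg_poisson_integrable[OF integrable_imp_winteg[OF fi] y])
   moreover have "(%s. (y / ((s - x)\<^sup>2 + y\<^sup>2)) *\<^sub>R ?f s) = (%s. cr (y / ((s - x)\<^sup>2 + y\<^sup>2) * f s))"
    by (simp add: fun_eq_iff scaleR_conv_of_real)
   ultimately show ?thesis by (simp only: complex_of_real_integrable_eq)
  qed
  have Ppos: "0 < P y x" if y: "0 < y" for x y
  proof -
   have k: "0 < y / ((s - x)\<^sup>2 + y\<^sup>2)" for s using y by (simp add: add_nonneg_pos)
   have nn': "0 <= y / ((s - x)\<^sup>2 + y\<^sup>2) * f s" for s using k[of s] nn[of s] by (intro mult_nonneg_nonneg) auto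
   have "(\<integral>s. y / ((s - x)\<^sup>2 + y\<^sup>2) * f s \<partial>lborel) \<noteq> 0"
   proof
    assume "(\<integral>s. y / ((s - x)\<^sup>2 + y\<^sup>2) * f s \<partial>lborel) = 0"
    then have "AE s in lborel. y / ((s - x)\<^sup>2 + y\<^sup>2) * f s = 0"
     using integral_nonneg_eq_0_iff_AE[OF kfi[OF y]] nn' by auto
    then have "AE s in lborel. f s = 0"
    proof (rule AE_mp, intro AE_I2 impI)
     fix s assume "y / ((s - x)\<^sup>2 + y\<^sup>2) * f s = 0"
     then show "f s = 0" using k[of s] by (metis mult_eq_0_iff less_irrefl)
    qed
    then show False using False by simp
   qed
   moreover have "0 <= (\<integral>s. y / ((s - x)\<^sup>2 + y\<^sup>2) * f s \<partial>lborel)" using nn' by (intro integral_nonneg_AE) auto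
   ultimately show ?thesis unfolding P_def by simp
  qed
  \<comment> \<open>The shift turns the line at height \<open>y\<close> into the real line and
    creates the strip of holomorphy below it that the contour argument requires.\<close>
  define \<Psi> where "\<Psi> = (%z. ?F (z + \<i> * of_real y) powr (of_real p))"
  have shift: "?F (z + \<i> * of_real y) = ?F (Complex (Re z) (Im z + y))" for z
   by (rule arg_cong[where f="?F"]) (simp add: complex_eq_iff)
  have hol: "\<Psi> holomorphic_on {z. - y < Im z}"
   unfolding \<Psi>_def
  proof (intro holomorphic_on_powr)
   have "(?F \<circ> (%z. z + \<i> * of_real y)) holomorphic_on {z. - y < Im z}"
    by (intro holomorphic_on_compose_gen[where t="{z. 0 < Im z}"] holomorphic_intros cauchyF_holomorphic fi) auto
   then show "(%z. ?F (z + \<i> * of_real y)) holomorphic_on {z. - y < Im z}" by (simp add: o_def)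
   fix z assume "z \<in> {z. - y < Im z}"
   then have "0 < Re (?F (z + \<i> * of_real y))" unfolding shift by (subst ReF) (auto intro!: Ppos)
   then show "?F (z + \<i> * of_real y) \<notin> \<real>\<^sub>\<le>\<^sub>0" by (auto simp: complex_nonpos_Reals_iff)
  qed auto
  define N where "N = (\<integral>s. norm (?f s) \<partial>lborel) * ((1 + a) / y + 1)"
  have N: "0 <= N" using a y by (simp add: N_def)
  have bd: "norm (\<Psi> z) <= (N * (1 + y)) powr p * (1 + norm z) powr (- p)" if z: "0 <= Im z" for z
  proof -
   let ?w = "z + \<i> * of_real y"
   have "norm (?F ?w) <= N / (1 + norm ?w)"
    unfolding N_def using cauchyF_decay[of ?f a y ?w] fi supp a y z by auto
   also have "\<dots> <= N * (1 + y) / (1 + norm z)"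
   proof -
    have "norm z <= norm ?w + y" using norm_triangle_ineq4[of ?w "\<i> * of_real y"] y by (simp add: norm_mult)
    moreover have "(1 + y) * (1 + norm ?w) = 1 + norm ?w + y + y * norm ?w" by (simp add: algebra_simps)
    moreover have "0 <= y * norm ?w" using y by simp
    ultimately have "1 + norm z <= (1 + y) * (1 + norm ?w)" by linarith
    then have "N * (1 + norm z) <= N * ((1 + y) * (1 + norm ?w))" using N by (intro mult_left_mono)
    then show ?thesis by (simp add: divide_simps add_pos_nonneg add_nonneg_eq_0_iff mult_ac)
   qed
   finally have le: "norm (?F ?w) <= N * (1 + y) / (1 + norm z)" .
   have "norm (\<Psi> z) = norm (?F ?w) powr p" unfolding \<Psi>_def by (simp add: norm_powr_real_powr')
   also have "\<dots> <= (N * (1 + y) / (1 + norm z)) powr p" using le p by (intro powr_mono2) auto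
   also have "\<dots> = (N * (1 + y)) powr p * (1 + norm z) powr (- p)"
    using N y by (subst powr_divide) (auto simp: powr_minus divide_inverse)
   finally show ?thesis .
  qed
  note zero = halfplane_integral_zero[OF hol y p bd]
  have Fx: "\<Psi> (cr x) = ?F (Complex x y) powr (of_real p)" for x
   unfolding \<Psi>_def shift by simp
  have zi: "integrable lborel (%x. Re (?F (Complex x y) powr (of_real p)))"
   using zero(1) unfolding Fx by (rule integrable_Re)
  have z0: "(\<integral>x. Re (?F (Complex x y) powr (of_real p)) \<partial>lborel) = 0"
   using integral_Re[OF zero(1)] zero(2) unfolding Fx by simp
  have normi: "integrable lborel (%x. norm (?F (Complex x y)) powr p)"
   using integrable_norm[OF zero(1)] unfolding Fx by (simp add: norm_powr_real_powr')
  have Pm[measurable]: "P y \<in> BM"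
   unfolding P_def by measurable
  have P_le: "P y x <= norm (?F (Complex x y))" for x using ReF[OF y, of x] complex_Re_le_cmod[of "?F (Complex x y)"] by simp
  have Pi: "integrable lborel (%x. P y x powr p)"
  proof (rule Bochner_Integration.integrable_bound[OF normi])
   show "AE x in lborel. norm (P y x powr p) <= norm (norm (?F (Complex x y)) powr p)"
   proof (rule AE_I2)
    fix x
    have "P y x powr p <= norm (?F (Complex x y)) powr p"
     using P_le[of x] Ppos[OF y, of x] p by (intro powr_mono2) auto
    then show "norm (P y x powr p) <= norm (norm (?F (Complex x y)) powr p)" by simp
   qed
  qed measurable
  have "(\<integral>x. norm (?F (Complex x y)) powr p \<partial>lborel) <= (\<integral>x. A * P y x powr p + B * Re (?F (Complex x y) powr (of_real p)) \<partial>lborel)"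
  proof (intro integral_mono normi Bochner_Integration.integrable_add integrable_mult_right Pi zi)
   fix x
   show "norm (?F (Complex x y)) powr p <= A * P y x powr p + B * Re (?F (Complex x y) powr (of_real p))"
    using AB(2)[of "?F (Complex x y)"] Ppos[OF y, of x] unfolding ReF[OF y] by simp
  qed
  also have "\<dots> = A * (\<integral>x. P y x powr p \<partial>lborel)"
   using Pi zi z0 by simp
  finally have main: "(\<integral>x. norm (?F (Complex x y)) powr p \<partial>lborel) <= A * (\<integral>x. P y x powr p \<partial>lborel)" .
  have jensen: "(\<integral>\<^sup>+x. ennreal (P y x powr p) \<partial>lborel) <= (\<integral>\<^sup>+s. ennreal (f s powr p) \<partial>lborel)"
  proof -
   have "(\<integral>\<^sup>+x. ennreal (P y x powr p) \<partial>lborel) <= (\<integral>\<^sup>+x. \<integral>\<^sup>+s. ennreal ((1/pi) * (y / ((s - x)\<^sup>2 + y\<^sup>2) * f s powr p)) \<partial>lborel \<partial>lborel)"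
   proof (intro nn_integral_mono)
    fix x
    have i: "integrable lborel (%s. y / ((s - x)\<^sup>2 + y\<^sup>2) * f s powr p)"
    proof -
     have "integrable lborel (%s. (y / ((s - x)\<^sup>2 + y\<^sup>2)) *\<^sub>R cr (f s powr p))"
      using fpi by (intro winteg_poisson_integrable[OF integrable_imp_winteg y]) auto
     moreover have "(%s. (y / ((s - x)\<^sup>2 + y\<^sup>2)) *\<^sub>R cr (f s powr p)) = (%s. cr (y / ((s - x)\<^sup>2 + y\<^sup>2) * f s powr p))"
      by (simp add: fun_eq_iff scaleR_conv_of_real)
     ultimately show ?thesis by (simp only: complex_of_real_integrable_eq)
    qed
    have "P y x powr p <= (1/pi) * (\<integral>s. y / ((s - x)\<^sup>2 + y\<^sup>2) * f s powr p \<partial>lborel)"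
     using poisson_powr_le[OF fr nn p fpi y] Ppos[OF y, of x] unfolding P_def by blast
    also have "\<dots> = (\<integral>s. (1/pi) * (y / ((s - x)\<^sup>2 + y\<^sup>2) * f s powr p) \<partial>lborel)"
     by (rule integral_mult_right_zero[symmetric])
    finally have "ennreal (P y x powr p) <= ennreal (\<integral>s. (1/pi) * (y / ((s - x)\<^sup>2 + y\<^sup>2) * f s powr p) \<partial>lborel)"
     by (rule ennreal_leI)
    also have "\<dots> = (\<integral>\<^sup>+s. ennreal ((1/pi) * (y / ((s - x)\<^sup>2 + y\<^sup>2) * f s powr p)) \<partial>lborel)"
     using i y by (intro nn_integral_eq_integral[symmetric] integrable_mult_right AE_I2) auto
    finally show "ennreal (P y x powr p) <= (\<integral>\<^sup>+s. ennreal ((1/pi) * (y / ((s - x)\<^sup>2 + y\<^sup>2) * f s powr p)) \<partial>lborel)" .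
   qed
   also have "\<dots> = (\<integral>\<^sup>+s. \<integral>\<^sup>+x. ennreal ((1/pi) * (y / ((s - x)\<^sup>2 + y\<^sup>2) * f s powr p)) \<partial>lborel \<partial>lborel)"
    by (rule lborel_pair.Fubini') measurable
   also have "\<dots> = (\<integral>\<^sup>+s. ennreal (f s powr p) \<partial>lborel)"
   proof (intro nn_integral_cong)
    fix s
    have "(\<integral>\<^sup>+x. ennreal ((1/pi) * (y / ((s - x)\<^sup>2 + y\<^sup>2) * f s powr p)) \<partial>lborel) = (\<integral>\<^sup>+x. ennreal ((1/pi) * f s powr p) * ennreal (y / ((x - s)\<^sup>2 + y\<^sup>2)) \<partial>lborel)"
     using y by (intro nn_integral_cong) (simp add: ennreal_mult[symmetric] power2_commute mult_ac)
    also have "\<dots> = ennreal ((1/pi) * f s powr p) * ennreal pi"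
     by (subst nn_integral_cmult) (auto simp: nn_integral_poisson[OF y])
    also have "\<dots> = ennreal (f s powr p)" by (simp add: ennreal_mult[symmetric])
    finally show "(\<integral>\<^sup>+x. ennreal ((1/pi) * (y / ((s - x)\<^sup>2 + y\<^sup>2) * f s powr p)) \<partial>lborel) = ennreal (f s powr p)" .
   qed
   finally show ?thesis .
  qed
  have "(\<integral>\<^sup>+x. ennreal (norm (?F (Complex x y)) powr p) \<partial>lborel) = ennreal (\<integral>x. norm (?F (Complex x y)) powr p \<partial>lborel)"
   by (intro nn_integral_eq_integral normi) auto
  also have "\<dots> <= ennreal (A * (\<integral>x. P y x powr p \<partial>lborel))" by (intro ennreal_leI main)
  also have "\<dots> = ennreal A * (\<integral>\<^sup>+x. ennreal (P y x powr p) \<partial>lborel)"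
   using AB(1) by (subst nn_integral_eq_integral[OF Pi]) (auto simp: ennreal_mult)
  also have "\<dots> <= ennreal A * (\<integral>\<^sup>+s. ennreal (f s powr p) \<partial>lborel)" using jensen by (intro mult_left_mono) auto
  finally show ?thesis .
 qed
qed

lemma cauchyF_measurable:
 assumes f: "integrable lborel f" and y: "0 < y"
 shows "(%x. cauchyF f (Complex x y)) \<in> BM"
proof (rule borel_measurable_continuous_onI)
 have "continuous_on {z. 0 < Im z} (cauchyF f)"
  by (intro holomorphic_on_imp_continuous_on cauchyF_holomorphic f) auto
 then show "continuous_on UNIV (%x. cauchyF f (Complex x y))"
  by (rule continuous_on_compose2) (use y in \<open>auto intro!: continuous_intros simp: Complex_eq\<close>)
qed

lemma powr_sum4_le:
 fixes a b c d p :: real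
 assumes "0 <= a" "0 <= b" "0 <= c" "0 <= d" "0 < p"
 shows "(a + b + c + d) powr p <= 4 powr p * (a powr p + b powr p + c powr p + d powr p)"
proof -
 define m where "m = max (max a b) (max c d)"
 have m: "m \<in> {a, b, c, d}" "a + b + c + d <= 4 * m" "0 <= m"
  unfolding m_def using assms by (auto simp: max_def)
 have "(a + b + c + d) powr p <= (4 * m) powr p" using m assms by (intro powr_mono2) auto
 also have "\<dots> = 4 powr p * m powr p" using m by (subst powr_mult) auto
 also have "m powr p <= a powr p + b powr p + c powr p + d powr p"
  using m(1) powr_ge_zero[of a p] powr_ge_zero[of b p] powr_ge_zero[of c p] powr_ge_zero[of d p] by auto
 finally show ?thesis by simp
qed

text \<open>Splitting into the positive and negative parts of real and imaginary part costs
  \<open>4 powr p\<close> for the sum of four terms and four copies of the bound. The constant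
  depends neither on the support radius \<open>a\<close> nor on the height \<open>y\<close>; this
  uniformity drives the boundary limits.\<close>

theorem riesz:
 fixes p :: real
 assumes p: "1 < p" and c: "cos (p * pi / 2) \<noteq> 0"
 shows "\<exists>C\<ge>0. \<forall>f a y. f \<in> BM --> (\<forall>s. a < \<bar>s\<bar> --> f s = 0) --> 0 <= a -->
    (\<integral>\<^sup>+s. ennreal (norm (f s) powr p) \<partial>lborel) < \<infinity> --> 0 < y -->
   (\<integral>\<^sup>+x. ennreal (norm (cauchyF f (Complex x y)) powr p) \<partial>lborel)
   <= ennreal C * (\<integral>\<^sup>+s. ennreal (norm (f s) powr p) \<partial>lborel)"
proof -
 obtain A B where AB: "0 <= A" "\<And>w. 0 < Re w ==> norm w powr p <= A * Re w powr p + B * Re (w powr (of_real p))"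
  using riesz_inequality[of p] p c by auto
 show ?thesis
 proof (intro exI[of _ "4 powr p * (4 * A)"] conjI allI impI)
  fix f :: "real => complex" and a y :: real
  assume f[measurable]: "f \<in> BM" and "\<forall>s. a < \<bar>s\<bar> --> f s = 0" and a: "0 <= a"
   and fp: "(\<integral>\<^sup>+s. ennreal (norm (f s) powr p) \<partial>lborel) < \<infinity>" and y: "0 < y"
  then have supp: "\<And>s. a < \<bar>s\<bar> ==> f s = 0" by blast
  let ?S = "\<integral>\<^sup>+s. ennreal (norm (f s) powr p) \<partial>lborel"
  define g where "g = (%i s. if i = (0::nat) then max 0 (Re (f s)) else if i = 1 then max 0 (- Re (f s))
    else if i = 2 then max 0 (Im (f s)) else max 0 (- Im (f s)))"
  have gm[measurable]: "g i \<in> BM" for i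
   by (cases "i = 0"; cases "i = 1"; cases "i = 2") (simp_all add: g_def)
  have g0: "0 <= g i s" and gle: "g i s <= norm (f s)" for i s
   using abs_Re_le_cmod[of "f s"] abs_Im_le_cmod[of "f s"] by (auto simp: g_def)
  have gs: "a < \<bar>s\<bar> ==> g i s = 0" for i s using supp[of s] by (simp add: g_def)
  have gp: "(\<integral>\<^sup>+s. ennreal (g i s powr p) \<partial>lborel) <= ?S" for i
   using g0 gle p by (intro nn_integral_mono ennreal_leI powr_mono2) auto
  have gpf: "(\<integral>\<^sup>+s. ennreal (g i s powr p) \<partial>lborel) < \<infinity>" for i
   using gp fp by (rule le_less_trans)
  let ?G = "%i. cauchyF (%s. of_real (g i s))"
  have fi: "integrable lborel f" by (rule powr_le_imp_integrable[OF f supp p fp])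
  have gi: "integrable lborel (%s. cr (g i s))" for i
  proof (rule Bochner_Integration.integrable_bound[OF fi])
   show "AE s in lborel. norm (cr (g i s)) <= norm (f s)" using g0 gle by auto
  qed measurable
  have ker: "integrable lborel (%s. cr (g i s) / (cr s - z))" if "Im z \<noteq> 0" for i z
   by (rule cauchy_kernel_integrable[OF gi that])
  have dec: "cauchyF f z = ?G 0 z - ?G 1 z + \<i> * (?G 2 z - ?G 3 z)" if z: "Im z \<noteq> 0" for z
  proof -
   have "f s / (cr s - z) = cr (g 0 s) / (cr s - z) - cr (g 1 s) / (cr s - z)
     + \<i> * (cr (g 2 s) / (cr s - z) - cr (g 3 s) / (cr s - z))" for s
   proof -
    have "f s = cr (g 0 s) - cr (g 1 s) + \<i> * (cr (g 2 s) - cr (g 3 s))"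
     by (simp add: complex_eq_iff g_def max_def)
    then show ?thesis by (metis add_divide_distrib diff_divide_distrib times_divide_eq_right)
   qed
   then have "(\<integral>s. f s / (cr s - z) \<partial>lborel) = (\<integral>s. cr (g 0 s) / (cr s - z) - cr (g 1 s) / (cr s - z)
     + \<i> * (cr (g 2 s) / (cr s - z) - cr (g 3 s) / (cr s - z)) \<partial>lborel)"
    by presburger
   also have "\<dots> = (\<integral>s. cr (g 0 s) / (cr s - z) \<partial>lborel) - (\<integral>s. cr (g 1 s) / (cr s - z) \<partial>lborel)
     + \<i> * ((\<integral>s. cr (g 2 s) / (cr s - z) \<partial>lborel) - (\<integral>s. cr (g 3 s) / (cr s - z) \<partial>lborel))"
    using ker[OF z] by (simp only: Bochner_Integration.integral_add Bochner_Integration.integral_diff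
      Bochner_Integration.integrable_diff integrable_mult_right integral_mult_right_zero)
   finally show ?thesis unfolding cauchyF_def by (simp only: ring_distribs mult.left_commute)
  qed
  have [measurable]: "(%x. ?G i (Complex x y)) \<in> BM" for i
   by (rule cauchyF_measurable[OF gi y])
  let ?n = "%i x. norm (?G i (Complex x y)) powr p"
  have "(\<integral>\<^sup>+x. ennreal (norm (cauchyF f (Complex x y)) powr p) \<partial>lborel) <=
    (\<integral>\<^sup>+x. ennreal (4 powr p) * (ennreal (?n 0 x) + ennreal (?n 1 x) + ennreal (?n 2 x) + ennreal (?n 3 x)) \<partial>lborel)"
  proof (intro nn_integral_mono)
   fix x
   let ?z = "Complex x y"
   have "norm (cauchyF f ?z) <= norm (?G 0 ?z) + norm (?G 1 ?z) + norm (?G 2 ?z) + norm (?G 3 ?z)"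
   proof -
    have "norm (cauchyF f ?z) <= norm (?G 0 ?z - ?G 1 ?z) + norm (\<i> * (?G 2 ?z - ?G 3 ?z))"
     using y by (subst dec) (auto intro: norm_triangle_ineq)
    also have "norm (\<i> * (?G 2 ?z - ?G 3 ?z)) = norm (?G 2 ?z - ?G 3 ?z)" by (simp add: norm_mult)
    finally show ?thesis using norm_triangle_ineq4[of "?G 0 ?z" "?G 1 ?z"] norm_triangle_ineq4[of "?G 2 ?z" "?G 3 ?z"] by linarith
   qed
   then have "norm (cauchyF f ?z) powr p <= (norm (?G 0 ?z) + norm (?G 1 ?z) + norm (?G 2 ?z) + norm (?G 3 ?z)) powr p"
    using p by (intro powr_mono2) auto
   also have "\<dots> <= 4 powr p * (?n 0 x + ?n 1 x + ?n 2 x + ?n 3 x)" using p by (intro powr_sum4_le) auto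
   finally have "ennreal (norm (cauchyF f ?z) powr p) <= ennreal (4 powr p * (?n 0 x + ?n 1 x + ?n 2 x + ?n 3 x))"
    by (rule ennreal_leI)
   then show "ennreal (norm (cauchyF f ?z) powr p) <= ennreal (4 powr p) * (ennreal (?n 0 x) + ennreal (?n 1 x) + ennreal (?n 2 x) + ennreal (?n 3 x))"
    by (simp add: ennreal_mult)
  qed
  also have "\<dots> = ennreal (4 powr p) * ((\<integral>\<^sup>+x. ennreal (?n 0 x) \<partial>lborel) + (\<integral>\<^sup>+x. ennreal (?n 1 x) \<partial>lborel) + (\<integral>\<^sup>+x. ennreal (?n 2 x) \<partial>lborel) + (\<integral>\<^sup>+x. ennreal (?n 3 x) \<partial>lborel))"
   by (simp add: nn_integral_cmult nn_integral_add)
  also have "\<dots> <= ennreal (4 powr p) * (ennreal A * ?S + ennreal A * ?S + ennreal A * ?S + ennreal A * ?S)"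
  proof -
   have "(\<integral>\<^sup>+x. ennreal (?n i x) \<partial>lborel) <= ennreal A * ?S" for i
   proof -
    have "(\<integral>\<^sup>+x. ennreal (?n i x) \<partial>lborel) <= ennreal A * (\<integral>\<^sup>+s. ennreal (g i s powr p) \<partial>lborel)"
     by (rule riesz_nonneg[OF AB p gm g0 gs a gpf y])
    also have "\<dots> <= ennreal A * ?S" using gp by (intro mult_left_mono) auto
    finally show ?thesis .
   qed
   then show ?thesis by (intro mult_left_mono add_mono) auto
  qed
  also have "\<dots> = ennreal (4 powr p * (4 * A)) * ?S"
  proof -
   have "ennreal A * ?S + ennreal A * ?S + ennreal A * ?S + ennreal A * ?S = (ennreal A + ennreal A + ennreal A + ennreal A) * ?S"
    by (simp add: distrib_right)
   also have "ennreal A + ennreal A + ennreal A + ennreal A = ennreal (4 * A)"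
    using AB(1) by (simp add: ennreal_plus[symmetric] del: ennreal_plus)
   finally show ?thesis using AB(1) by (simp add: ennreal_mult mult.assoc)
  qed
  finally show "(\<integral>\<^sup>+x. ennreal (norm (cauchyF f (Complex x y)) powr p) \<partial>lborel) <= ennreal (4 powr p * (4 * A)) * ?S" .
 qed (use AB in auto)
qed

section \<open>Weighted L^1 convergence and Lipschitz approximation\<close>

lemma L1_complete:
 fixes H :: "nat => 'a => complex"
 assumes H[measurable]: "\<And>n. H n \<in> borel_measurable M"
  and C: "\<And>e. 0 < e ==> \<exists>N. \<forall>m\<ge>N. \<forall>n\<ge>N. (\<integral>\<^sup>+x. ennreal (norm (H m x - H n x)) \<partial>M) <= ennreal e"
 obtains h where "h \<in> borel_measurable M" "(%n. \<integral>\<^sup>+x. ennreal (norm (H n x - h x)) \<partial>M) \<longlonglongrightarrow> 0"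
proof -
 let ?d = "%m n. \<integral>\<^sup>+x. ennreal (norm (H m x - H n x)) \<partial>M"
 obtain N where N: "\<And>k m n. N k <= m ==> N k <= n ==> ?d m n <= ennreal ((1/2)^k)" for k :: nat
  using C[of "(1/2)^k" for k] by (metis zero_less_divide_1_iff zero_less_numeral zero_less_power)
 \<comment> \<open>A subsequence with summable consecutive distances converges a.e.; Fatou's lemma
   then transfers the Cauchy estimate of the full sequence to the limit \<open>h\<close>.\<close>
 define r where "r = rec_nat (N 0) (%k m. max (Suc m) (N (Suc k)))"
 have r: "r 0 = N 0" "\<And>k. r (Suc k) = max (Suc (r k)) (N (Suc k))" by (simp_all add: r_def)
 have rN: "N k <= r k" for k by (cases k) (simp_all add: r)
 have rS: "r k < r (Suc k)" for k by (simp add: r less_max_iff_disj)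
 then have rmono: "strict_mono r" by (rule strict_monoI_Suc)
 have "(\<integral>\<^sup>+x. (\<Sum>k. ennreal (norm (H (r (Suc k)) x - H (r k) x))) \<partial>M) = (\<Sum>k. ?d (r (Suc k)) (r k))"
  by (rule nn_integral_suminf) measurable
 also have "\<dots> <= (\<Sum>k. ennreal ((1/2)^k))"
 proof (intro suminf_le allI)
  fix k
  have "N k <= r (Suc k)" using rN[of k] rS[of k] by simp
  then show "?d (r (Suc k)) (r k) <= ennreal ((1/2)^k)" using rN[of k] by (rule N)
 qed auto
 also have "\<dots> = ennreal (\<Sum>k. (1/2)^k)" by (rule suminf_ennreal2) (auto intro: summable_geometric)
 also have "\<dots> < \<infinity>" by simp
 finally have "AE x in M. (\<Sum>k. ennreal (norm (H (r (Suc k)) x - H (r k) x))) \<noteq> \<infinity>"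
  by (intro nn_integral_PInf_AE) auto
 then have conv: "AE x in M. convergent (%k. H (r k) x)"
 proof (rule AE_mp, intro AE_I2 impI)
  fix x assume "(\<Sum>k. ennreal (norm (H (r (Suc k)) x - H (r k) x))) \<noteq> \<infinity>"
  then have "summable (%k. norm (H (r (Suc k)) x - H (r k) x))"
   by (intro summable_suminf_not_top) auto
  then have "summable (%k. H (r (Suc k)) x - H (r k) x)" by (rule summable_norm_cancel)
  then have "convergent (%n. \<Sum>k<n. H (r (Suc k)) x - H (r k) x)" by (simp add: summable_iff_convergent)
  moreover have "(\<Sum>k<n. H (r (Suc k)) x - H (r k) x) = H (r n) x - H (r 0) x" for n
   by (rule sum_lessThan_telescope)
  ultimately have "convergent (%n. H (r n) x - H (r 0) x)" by simp
  from convergent_add[OF this convergent_const[of "H (r 0) x"]] show "convergent (%k. H (r k) x)" by simp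
 qed
 define h where "h = (%x. lim (%k. H (r k) x))"
 have hm[measurable]: "h \<in> borel_measurable M" unfolding h_def by (rule borel_measurable_lim_metric) measurable
 have lim: "AE x in M. (%k. H (r k) x) \<longlonglongrightarrow> h x"
  using conv by (auto simp: h_def convergent_LIMSEQ_iff)
 have le: "(\<integral>\<^sup>+x. ennreal (norm (H n x - h x)) \<partial>M) <= ennreal ((1/2)^k)" if n: "N k <= n" for k n
 proof -
  have "(\<integral>\<^sup>+x. ennreal (norm (H n x - h x)) \<partial>M) = (\<integral>\<^sup>+x. liminf (%j. ennreal (norm (H n x - H (r j) x))) \<partial>M)"
  proof (rule nn_integral_cong_AE, rule AE_mp[OF lim], intro AE_I2 impI)
   fix x assume "(%k. H (r k) x) \<longlonglongrightarrow> h x"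
   then have "(%j. ennreal (norm (H n x - H (r j) x))) \<longlonglongrightarrow> ennreal (norm (H n x - h x))"
    by (intro tendsto_intros)
   then show "ennreal (norm (H n x - h x)) = liminf (%j. ennreal (norm (H n x - H (r j) x)))"
    by (rule lim_imp_Liminf[OF sequentially_bot, symmetric])
  qed
  also have "\<dots> <= liminf (%j. ?d n (r j))" by (rule nn_integral_liminf) measurable
  also have "\<dots> <= liminf (%j. ennreal ((1/2)^k))"
  proof (rule Liminf_mono, rule eventually_mono[OF eventually_ge_at_top[of "N k"]])
   fix j assume "N k <= j"
   then have "N k <= r j" using seq_suble[OF rmono, of j] by simp
   then show "?d n (r j) <= ennreal ((1/2)^k)" using n by (intro N)
  qed
  also have "\<dots> = ennreal ((1/2)^k)" by (simp add: Liminf_const)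
  finally show ?thesis .
 qed
 have "(%n. \<integral>\<^sup>+x. ennreal (norm (H n x - h x)) \<partial>M) \<longlonglongrightarrow> 0"
 proof (rule order_tendstoI)
  fix a :: ennreal assume "0 < a"
  then obtain e where e: "0 < e" "e < a" using dense by blast
  then have "e < top" by (metis less_le_trans top_greatest)
  then obtain \<epsilon> where \<epsilon>: "e = ennreal \<epsilon>" "0 < \<epsilon>" using e by (cases e) auto
  obtain k where k: "(1/2::real)^k < \<epsilon>" using real_arch_pow_inv[of \<epsilon> "1/2"] \<epsilon> by auto
  show "eventually (%n. (\<integral>\<^sup>+x. ennreal (norm (H n x - h x)) \<partial>M) < a) sequentially"
   using eventually_ge_at_top[of "N k"]
  proof eventually_elim
   case (elim n)
   then have "(\<integral>\<^sup>+x. ennreal (norm (H n x - h x)) \<partial>M) <= ennreal ((1/2)^k)" by (rule le)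
   also have "\<dots> <= e" using k \<epsilon> by (auto intro!: ennreal_leI)
   finally show ?case using e by simp
  qed
 qed auto
 then show ?thesis using that hm by blast
qed

text \<open>A finite measure of total mass \<open>pi\<close> with the null sets of
  \<open>lborel\<close>. Convergence in its L^1 passes to the limit in Poisson integrals, and
  constants serve as dominating functions.\<close>

definition wlb :: "real measure" where
 "wlb = density lborel (%x. ennreal (1 / (1 + x\<^sup>2)))"

lemma sets_wlb[measurable_cong, simp]: "sets wlb = sets borel" by (simp add: wlb_def)

lemma space_wlb[simp]: "space wlb = UNIV" by (simp add: wlb_def)

lemma nn_integral_wlb:
 fixes h :: "real => complex"
 assumes [measurable]: "h \<in> BM"
 shows "(\<integral>\<^sup>+x. ennreal (norm (h x)) \<partial>wlb) = (\<integral>\<^sup>+x. ennreal (norm (h x) / (1 + x\<^sup>2)) \<partial>lborel)"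
 unfolding wlb_def by (subst nn_integral_density) (auto simp: ennreal_mult[symmetric] intro!: nn_integral_cong)

lemma emeasure_wlb: "emeasure wlb UNIV = ennreal pi"
 using nn_integral_poisson[of 1 0] unfolding wlb_def by (subst emeasure_density) (auto simp: add.commute)

lemma AE_wlb: "(AE x in wlb. P x) \<longleftrightarrow> (AE x in lborel. P x)"
proof -
 have "0 < 1 / (1 + x\<^sup>2)" for x :: real by (simp add: add_pos_nonneg)
 then show ?thesis unfolding wlb_def by (subst AE_density) auto
qed

lemma winteg_iff_wlb:
 assumes "f \<in> BM"
 shows "winteg f \<longleftrightarrow> (\<integral>\<^sup>+x. ennreal (norm (f x)) \<partial>wlb) < \<infinity>"
 using winteg_iff[OF assms] nn_integral_wlb[OF assms] by simp

text \<open>Where \<open>norm (h x) \<le> \<eta>\<close> the finite mass gives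
  \<open>pi * \<eta>\<close>; elsewhere \<open>norm (h x)\<close> is at most
  \<open>\<eta> powr (1 - p)\<close> times its \<open>p\<close>-th power. A small unweighted L^p
  integral thus yields a small weighted L^1 norm.\<close>

lemma wlb_le_powr:
 fixes h :: "real => complex"
 assumes [measurable]: "h \<in> BM" and \<eta>: "0 < \<eta>" and p: "1 < p"
 shows "(\<integral>\<^sup>+x. ennreal (norm (h x)) \<partial>wlb) <= ennreal (pi * \<eta>) + ennreal (\<eta> powr (1 - p)) * (\<integral>\<^sup>+x. ennreal (norm (h x) powr p) \<partial>lborel)"
proof -
 have "(\<integral>\<^sup>+x. ennreal (norm (h x) / (1 + x\<^sup>2)) \<partial>lborel) <=
   (\<integral>\<^sup>+x. ennreal \<eta> * ennreal (1 / ((x - 0)\<^sup>2 + 1\<^sup>2)) + ennreal (\<eta> powr (1 - p)) * ennreal (norm (h x) powr p) \<partial>lborel)"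
 proof (intro nn_integral_mono)
  fix x :: real
  have pos: "1 + x\<^sup>2 > 0" "1 <= 1 + x\<^sup>2" by (auto simp: add_pos_nonneg)
  have "norm (h x) / (1 + x\<^sup>2) <= \<eta> * (1 / (1 + x\<^sup>2)) + \<eta> powr (1 - p) * norm (h x) powr p"
  proof (cases "norm (h x) <= \<eta>")
   case True
   then have "norm (h x) / (1 + x\<^sup>2) <= \<eta> / (1 + x\<^sup>2)" using pos by (intro divide_right_mono) auto
   then show ?thesis by (simp add: add_increasing2)
  next
   case False
   then have n: "0 < norm (h x)" using \<eta> by linarith
   have "norm (h x) / (1 + x\<^sup>2) <= norm (h x) / 1" using pos by (intro divide_left_mono) (auto simp: add_pos_nonneg)
   also have "\<dots> = norm (h x) powr (1 - p) * norm (h x) powr p" using n by (simp add: powr_add[symmetric])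
   also have "\<dots> <= \<eta> powr (1 - p) * norm (h x) powr p"
    using False \<eta> p by (intro mult_right_mono powr_mono2') auto
   finally have "norm (h x) / (1 + x\<^sup>2) <= \<eta> powr (1 - p) * norm (h x) powr p" .
   moreover have "0 <= \<eta> * (1 / (1 + x\<^sup>2))" using \<eta> pos by (intro mult_nonneg_nonneg) auto
   ultimately show ?thesis by linarith
  qed
  then have "ennreal (norm (h x) / (1 + x\<^sup>2)) <= ennreal (\<eta> * (1 / (1 + x\<^sup>2)) + \<eta> powr (1 - p) * norm (h x) powr p)"
   by (rule ennreal_leI)
  also have "\<dots> = ennreal \<eta> * ennreal (1 / ((x - 0)\<^sup>2 + 1\<^sup>2)) + ennreal (\<eta> powr (1 - p)) * ennreal (norm (h x) powr p)"
   using \<eta> pos by (subst ennreal_plus) (auto simp: ennreal_mult[symmetric] add.commute)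
  finally show "ennreal (norm (h x) / (1 + x\<^sup>2)) <= \<dots>" .
 qed
 also have "\<dots> = ennreal (pi * \<eta>) + ennreal (\<eta> powr (1 - p)) * (\<integral>\<^sup>+x. ennreal (norm (h x) powr p) \<partial>lborel)"
 proof (subst nn_integral_add)
  have "(\<integral>\<^sup>+x. ennreal \<eta> * ennreal (1 / ((x - 0)\<^sup>2 + 1\<^sup>2)) \<partial>lborel) = ennreal \<eta> * ennreal pi"
   using nn_integral_poisson[of 1 0] by (subst nn_integral_cmult) auto
  moreover have "(\<integral>\<^sup>+x. ennreal (\<eta> powr (1 - p)) * ennreal (norm (h x) powr p) \<partial>lborel) = ennreal (\<eta> powr (1 - p)) * (\<integral>\<^sup>+x. ennreal (norm (h x) powr p) \<partial>lborel)"
   by (subst nn_integral_cmult) auto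
  ultimately show "(\<integral>\<^sup>+x. ennreal \<eta> * ennreal (1 / ((x - 0)\<^sup>2 + 1\<^sup>2)) \<partial>lborel) + (\<integral>\<^sup>+x. ennreal (\<eta> powr (1 - p)) * ennreal (norm (h x) powr p) \<partial>lborel)
    = ennreal (pi * \<eta>) + ennreal (\<eta> powr (1 - p)) * (\<integral>\<^sup>+x. ennreal (norm (h x) powr p) \<partial>lborel)"
   using \<eta> by (simp only: ennreal_mult' mult.commute) (simp add: ennreal_mult mult.commute)
 qed auto
 finally show ?thesis by (simp add: nn_integral_wlb)
qed

lemma powr_sum2_le:
 fixes a b p :: real
 assumes "0 <= a" "0 <= b" "0 < p"
 shows "(a + b) powr p <= 2 powr p * (a powr p + b powr p)"
proof -
 define m where "m = max a b"
 have m: "m \<in> {a, b}" "a + b <= 2 * m" "0 <= m"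
  unfolding m_def using assms by (auto simp: max_def)
 have "(a + b) powr p <= (2 * m) powr p" using m assms by (intro powr_mono2) auto
 also have "\<dots> = 2 powr p * m powr p" using m by (subst powr_mult) auto
 also have "m powr p <= a powr p + b powr p"
  using m(1) powr_ge_zero[of a p] powr_ge_zero[of b p] by auto
 finally show ?thesis by simp
qed

text \<open>Steklov averages, the difference quotients of the indefinite integral \<open>U\<close>
  of \<open>u\<close>. As \<open>u\<close> is bounded, \<open>U\<close> is Lipschitz and so are the
  averages. They converge at the Lebesgue points of \<open>u\<close>, and a common bound on a fixed
  interval gives convergence of the integrals of the \<open>p\<close>-th powers.\<close>

lemma steklov_approx:
 fixes u :: "real => complex"
 assumes u[measurable]: "u \<in> BM" and supp: "\<And>s. 1 < \<bar>s\<bar> ==> u s = 0"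
  and M: "\<And>s. norm (u s) <= M" and p: "0 < p" and \<epsilon>: "0 < \<epsilon>"
 shows "\<exists>g L. (\<forall>s t. norm (g s - g t) <= L * \<bar>s - t\<bar>) \<and> (\<forall>s. 2 < \<bar>s\<bar> --> g s = 0) \<and>
   (\<integral>\<^sup>+s. ennreal (norm (u s - g s) powr p) \<partial>lborel) <= ennreal \<epsilon>"
proof -
 have M0: "0 <= M" using order_trans[OF norm_ge_zero M[of 0]] .
 have ui: "integrable lborel u"
 proof (rule Bochner_Integration.integrable_bound[of _ "%s. M * indicator {-1..1} s"])
  show "integrable lborel (%s. M * indicator {-1..1::real} s)" using emeasure_bounded_finite[of "{-1..1::real}"] by (intro integrable_mult_right) (auto simp: less_top[symmetric])
  show "AE s in lborel. norm (u s) <= norm (M * indicator {-1..1} s)"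
  proof (rule AE_I2)
   fix s show "norm (u s) <= norm (M * indicator {-1..1} s)"
    using M[of s] M0 supp[of s] by (cases "1 < \<bar>s\<bar>") (auto simp: indicator_def)
  qed
 qed measurable
 define U where "U = (%x. \<integral>s. indicator {..x} s *\<^sub>R u s \<partial>lborel)"
 have indi: "integrable lborel (%s. indicator A s *\<^sub>R u s)" if [measurable]: "A \<in> sets borel" for A
  by (rule integrable_mult_indicator) (use ui in auto)
 have Udiff: "U y - U x = (\<integral>s. indicator {x<..y} s *\<^sub>R u s \<partial>lborel)" if "x <= y" for x y
 proof -
  have "U y - U x = (\<integral>s. indicator {..y} s *\<^sub>R u s - indicator {..x} s *\<^sub>R u s \<partial>lborel)"
   unfolding U_def by (intro Bochner_Integration.integral_diff[symmetric] indi) auto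
  also have "\<dots> = (\<integral>s. indicator {x<..y} s *\<^sub>R u s \<partial>lborel)"
   using that by (intro Bochner_Integration.integral_cong) (auto simp: indicator_def)
  finally show ?thesis .
 qed
 have U1: "norm (U y - U x) <= M * (y - x)" if "x <= y" for x y
 proof -
  have "norm (U y - U x) <= (\<integral>s. M * indicator {x<..y} s \<partial>lborel)"
   unfolding Udiff[OF that]
  proof (rule norm_integral_le[OF indi])
   show "integrable lborel (%s. M * indicator {x<..y} s)"
    using emeasure_bounded_finite[of "{x<..y}"] by (intro integrable_mult_right) (auto simp: less_top[symmetric])
  qed (use M in \<open>auto simp: indicator_def\<close>)
  also have "\<dots> = M * (y - x)" using that by simp
  finally show ?thesis .
 qed
 have Ulip: "norm (U y - U x) <= M * \<bar>y - x\<bar>" for x y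
  using U1[of x y] U1[of y x] by (cases "x <= y") (auto simp: norm_minus_commute)
 \<comment> \<open>Averaging over length at most 1 moves the support from [-1,1] into [-2,2] at
   worst.\<close>
 define d where "d = (%k. 1 / (real k + 1))"
 have d: "0 < d k" "d k <= 1" for k by (auto simp: d_def)
 define g where "g = (%k x. (1 / d k) *\<^sub>R (U (x + d k) - U x))"
 have glip: "norm (g k s - g k t) <= (2 * M / d k) * \<bar>s - t\<bar>" for k s t
 proof -
  have "g k s - g k t = (1 / d k) *\<^sub>R ((U (s + d k) - U (t + d k)) - (U s - U t))"
   unfolding g_def by (simp add: algebra_simps)
  then have "norm (g k s - g k t) = (1 / d k) * norm ((U (s + d k) - U (t + d k)) - (U s - U t))"
   using d(1)[of k] by simp
  also have "norm ((U (s + d k) - U (t + d k)) - (U s - U t)) <= norm (U (s + d k) - U (t + d k)) + norm (U s - U t)"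
   by (rule norm_triangle_ineq4)
  also have "\<dots> <= M * \<bar>s - t\<bar> + M * \<bar>s - t\<bar>"
   using Ulip[of "s + d k" "t + d k"] Ulip[of s t] by simp
  finally show ?thesis using d(1)[of k] by (simp add: field_simps mult_left_mono)
 qed
 have gM: "norm (g k s) <= M" for k s
 proof -
  have "norm (g k s) = (1 / d k) * norm (U (s + d k) - U s)" unfolding g_def using d(1)[of k] by simp
  also have "\<dots> <= (1 / d k) * (M * d k)" using Ulip[of "s + d k" s] d(1)[of k] by (intro mult_left_mono) auto
  finally show ?thesis using d(1)[of k] by simp
 qed
 have gsupp: "g k s = 0" if "2 < \<bar>s\<bar>" for k s
 proof -
  have "U (s + d k) - U s = (\<integral>t. 0 \<partial>(lborel::real measure))"
   unfolding Udiff[OF less_imp_le[of s "s + d k"], simplified, OF d(1)]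
  proof (rule Bochner_Integration.integral_cong[OF refl])
   fix t show "indicator {s<..s + d k} t *\<^sub>R u t = 0"
    using supp[of t] that d[of k] by (cases "s < t \<and> t <= s + d k") (auto simp: indicator_def)
  qed
  then show ?thesis by (simp add: g_def)
 qed
 have gm[measurable]: "g k \<in> BM" for k
 proof (rule borel_measurable_continuous_onI, rule lipschitz_on_continuous_on)
  show "(2 * M / d k)-lipschitz_on UNIV (g k)"
   using glip M0 d(1)[of k] by (auto intro!: lipschitz_onI simp: dist_norm)
 qed
 have conv: "(%k. g k x) \<longlonglongrightarrow> u x" if lp: "leb_pt u x" for x
 proof (rule LIMSEQ_I)
  fix r :: real assume r: "0 < r"
  then obtain \<delta> where \<delta>: "0 < \<delta>" "\<And>t. 0 < t ==> t < \<delta> ==>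
    (\<integral>\<^sup>+s\<in>{x-t..x+t}. ennreal (norm (u s - u x)) \<partial>lborel) <= ennreal (r/2 * t)"
   using lp unfolding leb_pt_def by (meson half_gt_zero)
  obtain K :: nat where K: "1 / (real K + 1) < \<delta>" using reals_Archimedean[OF \<delta>(1)] by (auto simp: inverse_eq_divide add.commute)
  have "norm (g k x - u x) < r" if k: "K <= k" for k
  proof -
   have "d k <= 1 / (real K + 1)" unfolding d_def using k by (intro frac_le) auto
   then have dk: "d k < \<delta>" using K by linarith
   let ?I = "indicator {x<..x + d k} :: real => real"
   have ii: "integrable lborel (%s. ?I s *\<^sub>R u x)"
    using emeasure_bounded_finite[of "{x<..x + d k}"] by (intro integrable_scaleR_left) (auto simp: less_top[symmetric])
   have "d k *\<^sub>R u x = (\<integral>s. ?I s *\<^sub>R u x \<partial>lborel)" using d(1)[of k] by simp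
   then have eq: "(U (x + d k) - U x) - d k *\<^sub>R u x = (\<integral>s. ?I s *\<^sub>R (u s - u x) \<partial>lborel)"
    using Udiff[of x "x + d k"] d(1)[of k] indi[of "{x<..x + d k}"] ii
    by (simp add: scaleR_diff_right)
   have "ennreal (norm ((U (x + d k) - U x) - d k *\<^sub>R u x)) <= (\<integral>\<^sup>+s. ennreal (norm (?I s *\<^sub>R (u s - u x))) \<partial>lborel)"
    unfolding eq using indi[of "{x<..x + d k}"] ii by (intro integral_norm_bound_ennreal) (auto simp: scaleR_diff_right)
   also have "\<dots> <= (\<integral>\<^sup>+s\<in>{x-d k..x+d k}. ennreal (norm (u s - u x)) \<partial>lborel)"
    using d(1)[of k] by (intro nn_integral_mono) (auto simp: indicator_def)
   also have "\<dots> <= ennreal (r/2 * d k)" by (intro \<delta> d dk)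
   finally have "norm ((U (x + d k) - U x) - d k *\<^sub>R u x) <= r/2 * d k" using r d(1)[of k] by simp
   moreover have "g k x - u x = (1 / d k) *\<^sub>R ((U (x + d k) - U x) - d k *\<^sub>R u x)"
    using d(1)[of k] by (simp add: g_def scaleR_diff_right)
   ultimately have "norm (g k x - u x) <= (1 / d k) * (r/2 * d k)"
    using d(1)[of k] by (simp only: norm_scaleR) (intro mult_mono, auto)
   then show ?thesis using d(1)[of k] r by simp
  qed
  then show "\<exists>K. \<forall>k\<ge>K. norm (g k x - u x) < r" by blast
 qed
 have "(%k. \<integral>\<^sup>+s. ennreal (norm (u s - g k s) powr p) \<partial>lborel) \<longlonglongrightarrow> (\<integral>\<^sup>+s. 0 \<partial>(lborel :: real measure))"
 proof (rule nn_integral_dominated_convergence)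
  show "AE s in lborel. (%k. ennreal (norm (u s - g k s) powr p)) \<longlonglongrightarrow> 0"
  proof (rule AE_mp[OF winteg_AE_leb_pt[OF integrable_imp_winteg[OF ui]]], intro AE_I2 impI)
   fix x assume "leb_pt u x"
   then have "(%k. norm (u x - g k x)) \<longlonglongrightarrow> norm (u x - u x)" by (intro tendsto_intros conv)
   then have "(%k. norm (u x - g k x) powr p) \<longlonglongrightarrow> 0 powr p"
    using p by (intro tendsto_powr2) auto
   then show "(%k. ennreal (norm (u x - g k x) powr p)) \<longlonglongrightarrow> 0"
    by (metis ennreal_0 powr_0 tendsto_ennrealI)
  qed
  show "AE s in lborel. ennreal (norm (u s - g k s) powr p) <= ennreal ((2 * M) powr p) * indicator {-2..2} s" for k
  proof (rule AE_I2)
   fix s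
   show "ennreal (norm (u s - g k s) powr p) <= ennreal ((2 * M) powr p) * indicator {-2..2} s"
   proof (cases "2 < \<bar>s\<bar>")
    case True then show ?thesis using supp[of s] gsupp[of s k] by simp
   next
    case False
    have "norm (u s - g k s) <= 2 * M" using norm_triangle_ineq4[of "u s" "g k s"] M[of s] gM[of k s] by linarith
    then have "norm (u s - g k s) powr p <= (2 * M) powr p" using p by (intro powr_mono2) auto
    moreover have "s \<in> {-2..2}" using False by auto
    ultimately show ?thesis by (simp add: ennreal_leI)
   qed
  qed
  show "(\<integral>\<^sup>+s. ennreal ((2 * M) powr p) * indicator {-2..2::real} s \<partial>lborel) < \<infinity>"
   using emeasure_bounded_finite[of "{-2..2::real}"] by (subst nn_integral_cmult_indicator) (auto simp: ennreal_mult_less_top)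
 qed auto
 then have "(%k. \<integral>\<^sup>+s. ennreal (norm (u s - g k s) powr p) \<partial>lborel) \<longlonglongrightarrow> 0" by simp
 then have "eventually (%k. (\<integral>\<^sup>+s. ennreal (norm (u s - g k s) powr p) \<partial>lborel) < ennreal \<epsilon>) sequentially"
  using \<epsilon> by (intro order_tendstoD) auto
 then obtain k where "(\<integral>\<^sup>+s. ennreal (norm (u s - g k s) powr p) \<partial>lborel) < ennreal \<epsilon>"
  unfolding eventually_sequentially by blast
 then show ?thesis using glip gsupp by (intro exI[of _ "g k"] exI[of _ "2 * M / d k"]) auto
qed

text \<open>Setting \<open>f\<close> to zero where its modulus exceeds \<open>n\<close> reduces the
  claim to bounded functions.\<close>

lemma lipschitz_approx:
 fixes f :: "real => complex"
 assumes f[measurable]: "f \<in> BM" and supp: "\<And>s. 1 < \<bar>s\<bar> ==> f s = 0"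
  and p: "0 < p" and fp: "(\<integral>\<^sup>+s. ennreal (norm (f s) powr p) \<partial>lborel) < \<infinity>" and \<epsilon>: "0 < \<epsilon>"
 shows "\<exists>g L. (\<forall>s t. norm (g s - g t) <= L * \<bar>s - t\<bar>) \<and> (\<forall>s. 2 < \<bar>s\<bar> --> g s = 0) \<and>
   (\<integral>\<^sup>+s. ennreal (norm (f s - g s) powr p) \<partial>lborel) <= ennreal \<epsilon>"
proof -
 define u where "u = (%n s. if norm (f s) <= real n then f s else 0)"
 have um[measurable]: "u n \<in> BM" for n unfolding u_def by measurable
 define e where "e = \<epsilon> / (2 * 2 powr p)"
 have e: "0 < e" using \<epsilon> by (simp add: e_def)
 have "(%n. \<integral>\<^sup>+s. ennreal (norm (f s - u n s) powr p) \<partial>lborel) \<longlonglongrightarrow> (\<integral>\<^sup>+s. 0 \<partial>(lborel :: real measure))"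
 proof (rule nn_integral_dominated_convergence[OF _ _ _ _ fp])
  show "AE s in lborel. (%n. ennreal (norm (f s - u n s) powr p)) \<longlonglongrightarrow> 0"
  proof (rule AE_I2)
   fix s
   obtain N :: nat where N: "norm (f s) <= real N" using real_arch_simple by blast
   have "eventually (%n. ennreal (norm (f s - u n s) powr p) = 0) sequentially"
    using eventually_ge_at_top[of N] by eventually_elim (use N in \<open>auto simp: u_def\<close>)
   then show "(%n. ennreal (norm (f s - u n s) powr p)) \<longlonglongrightarrow> 0" by (rule tendsto_eventually)
  qed
 qed (auto simp: u_def)
 then have "eventually (%n. (\<integral>\<^sup>+s. ennreal (norm (f s - u n s) powr p) \<partial>lborel) < ennreal e) sequentially"
  using e by (intro order_tendstoD) auto
 then obtain n where n: "(\<integral>\<^sup>+s. ennreal (norm (f s - u n s) powr p) \<partial>lborel) < ennreal e"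
  unfolding eventually_sequentially by blast
 obtain g L where g: "\<forall>s t. norm (g s - g t) <= L * \<bar>s - t\<bar>" "\<forall>s. 2 < \<bar>s\<bar> --> g s = 0"
   "(\<integral>\<^sup>+s. ennreal (norm (u n s - g s) powr p) \<partial>lborel) <= ennreal e"
 proof -
  have 1: "u n s = 0" if "1 < \<bar>s\<bar>" for s using supp[OF that] by (simp add: u_def)
  have 2: "norm (u n s) <= real n" for s by (simp add: u_def)
  show ?thesis using steklov_approx[OF um[of n] 1 2 p e] that by blast
 qed
 have L: "0 <= L" using order_trans[OF norm_ge_zero g(1)[rule_format, of 0 1]] by simp
 have gm[measurable]: "g \<in> BM"
  by (rule borel_measurable_continuous_onI, rule lipschitz_on_continuous_on[of L])
    (use g(1) L in \<open>auto intro!: lipschitz_onI simp: dist_norm\<close>)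
 have "(\<integral>\<^sup>+s. ennreal (norm (f s - g s) powr p) \<partial>lborel) <=
   (\<integral>\<^sup>+s. ennreal (2 powr p) * (ennreal (norm (f s - u n s) powr p) + ennreal (norm (u n s - g s) powr p)) \<partial>lborel)"
 proof (intro nn_integral_mono)
  fix s
  have "norm (f s - g s) powr p <= (norm (f s - u n s) + norm (u n s - g s)) powr p"
   using p norm_triangle_ineq[of "f s - u n s" "u n s - g s"] by (intro powr_mono2) auto
  also have "\<dots> <= 2 powr p * (norm (f s - u n s) powr p + norm (u n s - g s) powr p)" using p by (intro powr_sum2_le) auto
  finally show "ennreal (norm (f s - g s) powr p) <= ennreal (2 powr p) * (ennreal (norm (f s - u n s) powr p) + ennreal (norm (u n s - g s) powr p))"
   by (simp add: ennreal_mult[symmetric] ennreal_plus[symmetric] ennreal_leI del: ennreal_plus)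
 qed
 also have "\<dots> = ennreal (2 powr p) * ((\<integral>\<^sup>+s. ennreal (norm (f s - u n s) powr p) \<partial>lborel) + (\<integral>\<^sup>+s. ennreal (norm (u n s - g s) powr p) \<partial>lborel))"
  by (simp add: nn_integral_cmult nn_integral_add)
 also have "\<dots> <= ennreal (2 powr p) * (ennreal e + ennreal e)"
  using n g(3) by (intro mult_left_mono add_mono) auto
 also have "\<dots> = ennreal \<epsilon>"
  using e by (simp add: ennreal_mult[symmetric] ennreal_plus[symmetric] e_def del: ennreal_plus)
 finally show ?thesis using g by blast
qed

text \<open>Limits in the mean are taken along this one sequence of heights, so that dominated
  convergence and a.e. arguments stay sequential.\<close>

definition hgt :: "nat => real" where "hgt n = 1 / real (Suc n)"

lemma hgt_pos[simp]: "0 < hgt n" by (simp add: hgt_def)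

lemma hgt_lim: "filterlim hgt (at_right 0) sequentially"
 unfolding filterlim_at hgt_def using LIMSEQ_inverse_real_of_nat by (auto simp: inverse_eq_divide)

lemma hgt_neq[simp]: "hgt n \<noteq> 0" using hgt_pos[of n] by linarith

section \<open>Boundary values of Cauchy integrals\<close>

lemma integrable_indicator_Icc: "integrable lborel (indicator {a..b::real} :: real => real)"
 by (cases "a <= b") (auto simp: integrable_indicator_iff)

text \<open>On an interval centred at \<open>x\<close> the real part of the Cauchy kernel is odd
  under \<open>s \<mapsto> 2 * x - s\<close> and cancels; the imaginary part is the Poisson
  kernel.\<close>

lemma cauchyF_interval:
 assumes y: "0 < y" and R: "0 <= R"
 shows "cauchyF (%s. cr (indicator {x-R..x+R} s)) (Complex x y) = poisson y (%s. cr (indicator {x-R..x+R} s)) x"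
proof -
 let ?E = "%s. cr (indicator {x-R..x+R} s)"
 let ?e = "%s. ?E s / (cr s - Complex x y)"
 have Ei: "integrable lborel ?E"
  using emeasure_bounded_finite[of "{x-R..x+R}"] by (auto simp: less_top[symmetric])
 have ei: "integrable lborel ?e" by (rule cauchy_kernel_integrable[OF Ei]) (use y in auto)
 have refl: "?e (2 * x + (-1) * s) = - cnj (?e s)" for s
 proof -
  have "indicator {x-R..x+R} (2 * x + (-1) * s) = (indicator {x-R..x+R} s :: real)"
   by (auto simp: indicator_def)
  moreover have "cr (2 * x + (-1) * s) - Complex x y = - cnj (cr s - Complex x y)"
   by (simp add: complex_eq_iff)
  ultimately show ?thesis by (simp only: complex_cnj_divide complex_cnj_complex_of_real divide_minus_right)
 qed
 have "integral\<^sup>L lborel ?e = - cnj (integral\<^sup>L lborel ?e)"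
  using lborel_integral_real_affine[of "-1" ?e "2 * x"] unfolding refl by (simp del: complex_cnj_divide)
 then have "Re (integral\<^sup>L lborel ?e) = Re (- cnj (integral\<^sup>L lborel ?e))" by (rule arg_cong)
 also have "\<dots> = - Re (integral\<^sup>L lborel ?e)" by simp
 finally have Re0: "Re (integral\<^sup>L lborel ?e) = 0" by linarith
 have "Im (?e s) = y / ((s - x)\<^sup>2 + y\<^sup>2) * indicator {x-R..x+R} s" for s
  by (simp add: Im_divide)
 then have Im: "Im (integral\<^sup>L lborel ?e) = (\<integral>s. y / ((s - x)\<^sup>2 + y\<^sup>2) * indicator {x-R..x+R} s \<partial>lborel)"
  and Imi: "integrable lborel (%s. y / ((s - x)\<^sup>2 + y\<^sup>2) * indicator {x-R..x+R} s)"
  using integral_Im[OF ei] integrable_Im[OF ei] by simp_all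
 have "(\<integral>s. (y / ((s - x)\<^sup>2 + y\<^sup>2)) *\<^sub>R ?E s \<partial>lborel) = (\<integral>s. cr (y / ((s - x)\<^sup>2 + y\<^sup>2) * indicator {x-R..x+R} s) \<partial>lborel)"
  by (intro Bochner_Integration.integral_cong) (auto simp: scaleR_conv_of_real)
 also have "\<dots> = cr (Im (integral\<^sup>L lborel ?e))" unfolding Im using Imi by (rule integral_of_real)
 finally have a: "(\<integral>s. (y / ((s - x)\<^sup>2 + y\<^sup>2)) *\<^sub>R ?E s \<partial>lborel) = cr (Im (integral\<^sup>L lborel ?e))" .
 have "integral\<^sup>L lborel ?e = \<i> * cr (Im (integral\<^sup>L lborel ?e))"
  using Re0 by (simp add: complex_eq_iff)
 then have "(1 / (cr pi * \<i>)) * integral\<^sup>L lborel ?e = (1 / (cr pi * \<i>)) * (\<i> * cr (Im (integral\<^sup>L lborel ?e)))"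
  by (rule arg_cong)
 also have "\<dots> = (1/pi) *\<^sub>R cr (Im (integral\<^sup>L lborel ?e))"
  by (simp add: scaleR_conv_of_real field_simps)
 finally show ?thesis unfolding cauchyF_def poisson_def a .
qed

lemma norm_poisson_le:
 assumes f: "f \<in> BM" "\<And>s. norm (f s) <= M" and y: "0 < y"
 shows "norm (poisson y f x) <= M"
proof -
 note [measurable] = f(1)
 have M: "0 <= M" using order_trans[OF norm_ge_zero f(2)[of 0]] .
 have k: "0 <= y / ((s - x)\<^sup>2 + y\<^sup>2)" for s using y by (simp add: add_nonneg_pos)
 have b: "norm ((y / ((s - x)\<^sup>2 + y\<^sup>2)) *\<^sub>R f s) <= y / ((s - x)\<^sup>2 + y\<^sup>2) * M" for s
  using f(2)[of s] k[of s] by (simp only: norm_scaleR real_norm_def abs_of_nonneg) (intro mult_left_mono, auto)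
 have i: "integrable lborel (%s. y / ((s - x)\<^sup>2 + y\<^sup>2) * M)"
  using integral_poisson(1)[OF y, of x] by (rule integrable_mult_left)
 have i2: "integrable lborel (%s. (y / ((s - x)\<^sup>2 + y\<^sup>2)) *\<^sub>R f s)"
 proof (rule Bochner_Integration.integrable_bound[OF i])
  show "AE s in lborel. norm ((y / ((s - x)\<^sup>2 + y\<^sup>2)) *\<^sub>R f s) <= norm (y / ((s - x)\<^sup>2 + y\<^sup>2) * M)"
   by (rule AE_I2, rule order_trans[OF b]) (simp only: real_norm_def abs_ge_self)
 qed measurable
 have "norm (\<integral>s. (y / ((s - x)\<^sup>2 + y\<^sup>2)) *\<^sub>R f s \<partial>lborel) <= (\<integral>s. y / ((s - x)\<^sup>2 + y\<^sup>2) * M \<partial>lborel)"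
  by (rule norm_integral_le[OF i2 i b])
 also have "\<dots> = pi * M" using integral_poisson(2)[OF y, of x] by (simp only: integral_mult_left_zero)
 finally show ?thesis unfolding poisson_def by (simp add: field_simps)
qed

text \<open>Subtracting \<open>g x\<close> on an interval centred at \<open>x\<close> makes the
  Cauchy quotient bounded by the Lipschitz constant, uniformly in the height. What remains is
  \<open>g x\<close> times the Cauchy integral of a symmetric interval, which is a Poisson integral
  and so is bounded and convergent.\<close>

lemma lipschitz_boundary:
 assumes L: "\<And>s t. norm (g s - g t) <= L * \<bar>s - t\<bar>" and supp: "\<And>s. 2 < \<bar>s\<bar> ==> g s = 0"
 shows "integrable lborel g" "\<exists>K. \<forall>y>0. \<forall>x. norm (cauchyF g (Complex x y)) <= K"
  "convergent (%n. cauchyF g (Complex x (hgt n)))"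
proof -
 have L0: "0 <= L" using order_trans[OF norm_ge_zero L[of 0 1]] by simp
 have gm[measurable]: "g \<in> BM"
  by (rule borel_measurable_continuous_onI, rule lipschitz_on_continuous_on[of L])
    (use L L0 in \<open>auto intro!: lipschitz_onI simp: dist_norm\<close>)
 have gb: "norm (g s) <= L * \<bar>s - 3\<bar>" for s using L[of s 3] supp[of 3] by simp
 show gi: "integrable lborel g"
 proof (rule Bochner_Integration.integrable_bound[of _ "%s. (L * 5) * indicator {-2..2} s"])
  show "integrable lborel (%s. (L * 5) * indicator {-2..2::real} s)"
   using emeasure_bounded_finite[of "{-2..2::real}"] by (intro integrable_mult_right) (auto simp: less_top[symmetric])
  show "AE s in lborel. norm (g s) <= norm ((L * 5) * indicator {-2..2} s)"
  proof (rule AE_I2)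
   fix s
   show "norm (g s) <= norm ((L * 5) * indicator {-2..2} s)"
   proof (cases "2 < \<bar>s\<bar>")
    case False
    then have "L * \<bar>s - 3\<bar> <= L * 5" using L0 by (intro mult_left_mono) auto
    moreover have "s \<in> {-2..2}" using False by auto
    ultimately show ?thesis using gb[of s] L0 by simp
   qed (use supp in auto)
  qed
 qed measurable
 define E where "E = (%(R::real) x s. cr (indicator {x-R..x+R} s))"
 have Em[measurable]: "E R x \<in> BM" for R x unfolding E_def by measurable
 have Ei: "integrable lborel (E R x)" for R x unfolding E_def
  using emeasure_bounded_finite[of "{x-R..x+R}"] by (auto simp: less_top[symmetric])
 have En: "norm (E R x s) <= 1" for R x s by (auto simp: E_def indicator_def)
 define A where "A = (%R x y s. indicator {x-R..x+R} s *\<^sub>R ((g s - g x) / (cr s - Complex x y)))"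
 have Am[measurable]: "A R x y \<in> BM" for R x y unfolding A_def by measurable
 have Ab: "norm (A R x y s) <= L * indicator {x-R..x+R} s" for R x y s
 proof -
  have 1: "\<bar>s - x\<bar> <= norm (cr s - Complex x y)"
   using abs_Re_le_cmod[of "cr s - Complex x y"] by simp
  have "norm (g s - g x) / norm (cr s - Complex x y) <= L"
  proof (cases "norm (cr s - Complex x y) = 0")
   case False
   have "norm (g s - g x) <= L * norm (cr s - Complex x y)"
    using L[of s x] mult_left_mono[OF 1 L0] by linarith
   then show ?thesis using False by (simp add: pos_divide_le_eq)
  qed (use L0 in auto)
  then show ?thesis unfolding A_def by (auto simp: indicator_def norm_divide)
 qed
 have Li: "integrable lborel (%s::real. L * indicator {x-R..x+R} s)" for R x
  by (intro integrable_mult_right integrable_indicator_Icc)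
 have Ai: "integrable lborel (A R x y)" for R x y
  by (rule Bochner_Integration.integrable_bound[OF Li[of x R]]) (auto intro!: AE_I2 order_trans[OF Ab])
 \<comment> \<open>With radius \<open>\<bar>x\<bar> + 3\<close> the interval contains the support
   [-2,2] of \<open>g\<close>, so nothing is lost outside it.\<close>
 have form: "cauchyF g (Complex x y) = (1 / (cr pi * \<i>)) * integral\<^sup>L lborel (A R x y) + g x * poisson y (E R x) x"
  if y: "0 < y" and R: "\<bar>x\<bar> + 3 = R" for x y R
 proof -
  have R0: "0 <= R" using R by simp
  have "g s / (cr s - Complex x y) = A R x y s + g x * (E R x s / (cr s - Complex x y))" for s
  proof (cases "s \<in> {x-R..x+R}")
   case True then show ?thesis by (simp add: A_def E_def diff_divide_distrib)
  next
   case False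
   then have "2 < \<bar>s\<bar>" using R by (auto simp: abs_if split: if_splits)
   then show ?thesis using False supp[of s] by (simp add: A_def E_def)
  qed
  moreover have "integrable lborel (%s. E R x s / (cr s - Complex x y))"
   by (rule cauchy_kernel_integrable[OF Ei]) (use y in auto)
  ultimately have "(\<integral>s. g s / (cr s - Complex x y) \<partial>lborel) = integral\<^sup>L lborel (A R x y) + g x * (\<integral>s. E R x s / (cr s - Complex x y) \<partial>lborel)"
   using Ai[of R x y] by (simp only: Bochner_Integration.integral_add integrable_mult_right integral_mult_right_zero)
  then show ?thesis using cauchyF_interval[OF y R0, of x] unfolding cauchyF_def E_def
   by (simp only: distrib_left mult.left_commute)
 qed
 show "\<exists>K. \<forall>y>0. \<forall>x. norm (cauchyF g (Complex x y)) <= K"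
 \<comment> \<open>For \<open>\<bar>x\<bar> \<le> 4\<close> the radius is at most 7: the quotient
   contributes at most \<open>L\<close> times the length 14, and
   \<open>norm (g x) \<le> L * \<bar>x - 3\<bar> \<le> L * 7\<close>, as \<open>g\<close> vanishes
   at 3. For larger \<open>\<bar>x\<bar>\<close> the distance to the support is at least 2, and the
   integral of \<open>norm (g s)\<close> suffices.\<close>
 proof (intro exI[of _ "L * 21 + (\<integral>s. norm (g s) \<partial>lborel)"] allI impI)
  fix y x :: real assume y: "0 < y"
  have N: "0 <= (\<integral>s. norm (g s) \<partial>lborel)" by simp
  show "norm (cauchyF g (Complex x y)) <= L * 21 + (\<integral>s. norm (g s) \<partial>lborel)"
  proof (cases "\<bar>x\<bar> <= 4")
   case True
   define R where "R = \<bar>x\<bar> + 3"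
   have R: "0 <= R" "R <= 7" using True by (auto simp: R_def)
   have "norm (integral\<^sup>L lborel (A R x y)) <= (\<integral>s. L * indicator {x-R..x+R} s \<partial>lborel)"
    by (rule norm_integral_le[OF Ai Li Ab])
   also have "\<dots> = L * (2 * R)" using R by simp
   also have "\<dots> <= L * 14" using R L0 by (intro mult_left_mono) auto
   finally have 1: "norm (integral\<^sup>L lborel (A R x y)) <= L * 14" .
   have "norm ((1 / (cr pi * \<i>)) * integral\<^sup>L lborel (A R x y)) = norm (integral\<^sup>L lborel (A R x y)) / pi"
    by (simp add: norm_mult norm_divide)
   also have "\<dots> <= (L * 14) / 1" using 1 L0 pi_ge_two by (intro frac_le) auto
   finally have 1: "norm ((1 / (cr pi * \<i>)) * integral\<^sup>L lborel (A R x y)) <= L * 14" by simp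
   have "norm (g x * poisson y (E R x) x) <= (L * 7) * 1"
    unfolding norm_mult
   proof (intro mult_mono norm_poisson_le Em En y)
    have "L * \<bar>x - 3\<bar> <= L * 7" using True L0 by (intro mult_left_mono) auto
    then show "norm (g x) <= L * 7" using gb[of x] by linarith
   qed (use L0 in auto)
   with 1 show ?thesis unfolding form[OF y R_def[symmetric]]
    using norm_triangle_ineq[of "(1 / (cr pi * \<i>)) * integral\<^sup>L lborel (A R x y)" "g x * poisson y (E R x) x"] N
    by linarith
  next
   case False
   have "norm (cauchyF g (Complex x y)) <= (\<integral>s. norm (g s) \<partial>lborel) / (pi * 2)"
   proof (rule cauchyF_bound[OF gi])
    fix s assume "g s \<noteq> 0"
    then have "\<bar>s\<bar> <= 2" using supp[of s] by fastforce
    then show "2 <= norm (cr s - Complex x y)"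
     using abs_Re_le_cmod[of "cr s - Complex x y"] False by simp
   qed auto
   also have "\<dots> <= (\<integral>s. norm (g s) \<partial>lborel) / 1" using N pi_ge_two by (intro divide_left_mono) auto
   finally show ?thesis using L0 by simp
  qed
 qed
 show "convergent (%n. cauchyF g (Complex x (hgt n)))"
 proof -
  define R where "R = \<bar>x\<bar> + 3"
  have R: "0 < R" by (simp add: R_def)
  have lp: "leb_pt (E R x) x" unfolding leb_pt_def
  proof (intro allI impI exI[of _ R] conjI R)
   fix \<eta> r :: real assume "0 < \<eta>" and r: "0 < r \<and> r < R"
   have "(\<integral>\<^sup>+t\<in>{x-r..x+r}. ennreal (norm (E R x t - E R x x)) \<partial>lborel) = (\<integral>\<^sup>+t. 0 \<partial>(lborel :: real measure))"
    using r by (intro nn_integral_cong) (auto simp: E_def indicator_def)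
   then show "(\<integral>\<^sup>+t\<in>{x-r..x+r}. ennreal (norm (E R x t - E R x x)) \<partial>lborel) <= ennreal (\<eta> * r)" by simp
  qed
  have P: "(%n. poisson (hgt n) (E R x) x) \<longlonglongrightarrow> E R x x"
   using filterlim_compose[OF poisson_tendsto[OF integrable_imp_winteg[OF Ei] lp] hgt_lim] .
  have I: "(%n. integral\<^sup>L lborel (A R x (hgt n))) \<longlonglongrightarrow> (\<integral>s. indicator {x-R..x+R} s *\<^sub>R ((g s - g x) / (cr s - cr x)) \<partial>lborel)"
  proof (rule integral_dominated_convergence[OF _ _ Li])
   show "AE s in lborel. (%n. A R x (hgt n) s) \<longlonglongrightarrow> indicator {x-R..x+R} s *\<^sub>R ((g s - g x) / (cr s - cr x))"
   proof (rule AE_mp[OF AE_lborel_singleton[of x]], intro AE_I2 impI)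
    fix s assume s: "s \<noteq> x"
    have "(%n. cr x + \<i> * cr (hgt n)) \<longlonglongrightarrow> cr x + \<i> * cr 0"
     using filterlim_mono[OF hgt_lim at_within_le_nhds order_refl] by (intro tendsto_intros)
    then have c: "(%n. Complex x (hgt n)) \<longlonglongrightarrow> cr x" by (simp add: Complex_eq)
    show "(%n. A R x (hgt n) s) \<longlonglongrightarrow> indicator {x-R..x+R} s *\<^sub>R ((g s - g x) / (cr s - cr x))"
     unfolding A_def using s by (intro tendsto_intros c) auto
   qed
   show "AE s in lborel. norm (A R x (hgt n) s) <= L * indicator {x-R..x+R} s" for n using Ab by auto
  qed auto
  have "(%n. cauchyF g (Complex x (hgt n))) \<longlonglongrightarrow> (1 / (cr pi * \<i>)) * (\<integral>s. indicator {x-R..x+R} s *\<^sub>R ((g s - g x) / (cr s - cr x)) \<partial>lborel) + g x * E R x x"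
   unfolding form[OF hgt_pos R_def[symmetric]] by (intro tendsto_intros P I)
  then show ?thesis by (rule convergentI)
 qed
qed

lemma poisson_diff_le:
 assumes u: "winteg u" and v: "winteg v" and s: "0 < s"
 shows "ennreal (norm (poisson s u x - poisson s v x)) <= ennreal ((s + (1 + 2 * x\<^sup>2) / s) * 2) * (\<integral>\<^sup>+t. ennreal (norm (u t - v t)) \<partial>wlb)"
proof -
 note [measurable] = wintegD(1)[OF u] wintegD(1)[OF v]
 let ?k = "%t. s / ((t - x)\<^sup>2 + s\<^sup>2)" and ?C = "(s + (1 + 2 * x\<^sup>2) / s) * 2"
 have C: "0 <= ?C" using s by (auto intro!: add_nonneg_nonneg)
 have i: "integrable lborel (%t. ?k t *\<^sub>R u t)" "integrable lborel (%t. ?k t *\<^sub>R v t)"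
  using winteg_poisson_integrable u v s by auto
 have eq: "pi *\<^sub>R (poisson s u x - poisson s v x) = (\<integral>t. ?k t *\<^sub>R (u t - v t) \<partial>lborel)"
  using i by (simp add: poisson_def scaleR_diff_right)
 have "norm (poisson s u x - poisson s v x) <= norm (pi *\<^sub>R (poisson s u x - poisson s v x))"
  using pi_ge_two by (simp add: mult_le_cancel_right1)
 then have "ennreal (norm (poisson s u x - poisson s v x)) <= ennreal (norm (pi *\<^sub>R (poisson s u x - poisson s v x)))"
  by (rule ennreal_leI)
 also have "\<dots> <= (\<integral>\<^sup>+t. ennreal (norm (?k t *\<^sub>R (u t - v t))) \<partial>lborel)"
  unfolding eq using i by (intro integral_norm_bound_ennreal) (auto simp: scaleR_diff_right)
 also have "\<dots> <= (\<integral>\<^sup>+t. ennreal ?C * ennreal (norm (u t - v t) / (1 + t\<^sup>2)) \<partial>lborel)"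
 proof (intro nn_integral_mono)
  fix t
  have "?k t * norm (u t - v t) <= ?C * (1 / (1 + t\<^sup>2)) * norm (u t - v t)"
   using poisson_kernel_le[OF s] by (intro mult_right_mono) auto
  also have "\<dots> = ?C * (norm (u t - v t) / (1 + t\<^sup>2))" by simp
  finally have "ennreal (?k t * norm (u t - v t)) <= ennreal (?C * (norm (u t - v t) / (1 + t\<^sup>2)))" by (rule ennreal_leI)
  also have "\<dots> = ennreal ?C * ennreal (norm (u t - v t) / (1 + t\<^sup>2))" by (rule ennreal_mult'[OF C])
  finally show "ennreal (norm (?k t *\<^sub>R (u t - v t))) <= \<dots>" using s by simp
 qed
 also have "\<dots> = ennreal ?C * (\<integral>\<^sup>+t. ennreal (norm (u t - v t)) \<partial>wlb)"
  by (subst nn_integral_cmult) (auto simp: nn_integral_wlb)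
 finally show ?thesis .
qed

lemma nn_norm_triangle:
 fixes a b c :: "'a => complex"
 assumes [measurable]: "a \<in> borel_measurable M" "b \<in> borel_measurable M" "c \<in> borel_measurable M"
 shows "(\<integral>\<^sup>+x. ennreal (norm (a x - c x)) \<partial>M) <= (\<integral>\<^sup>+x. ennreal (norm (a x - b x)) \<partial>M) + (\<integral>\<^sup>+x. ennreal (norm (b x - c x)) \<partial>M)"
proof -
 have "(\<integral>\<^sup>+x. ennreal (norm (a x - c x)) \<partial>M) <= (\<integral>\<^sup>+x. ennreal (norm (a x - b x)) + ennreal (norm (b x - c x)) \<partial>M)"
 proof (intro nn_integral_mono)
  fix x
  have "norm (a x - c x) <= norm (a x - b x) + norm (b x - c x)" using norm_triangle_ineq[of "a x - b x" "b x - c x"] by simp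
  then show "ennreal (norm (a x - c x)) <= ennreal (norm (a x - b x)) + ennreal (norm (b x - c x))"
   by (subst ennreal_plus[symmetric]) (auto intro!: ennreal_leI simp del: ennreal_plus)
 qed
 then show ?thesis by (simp add: nn_integral_add)
qed

text \<open>The Cauchy integrals at heights \<open>hgt n\<close> form a Cauchy sequence in L^1 of
  \<open>wlb\<close>: the Riesz bound makes the contribution of \<open>f - g\<close>, with
  \<open>g\<close> Lipschitz, small at all heights at once, and for \<open>g\<close> bounded
  convergence applies. The limit \<open>h\<close> represents the Cauchy integral as a Poisson
  integral, which converges at every Lebesgue point of \<open>h\<close>, and not only along the
  sequence.\<close>

theorem cauchyF_boundary:
 fixes f :: "real => complex"
 assumes f[measurable]: "f \<in> BM" and supp: "\<And>s. 1 < \<bar>s\<bar> ==> f s = 0"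
  and p: "1 < p" "cos (p * pi / 2) \<noteq> 0" and fp: "(\<integral>\<^sup>+s. ennreal (norm (f s) powr p) \<partial>lborel) < \<infinity>"
 obtains h where "h \<in> BM" "winteg h"
  "(%n. \<integral>\<^sup>+x. ennreal (norm (cauchyF f (Complex x (hgt n)) - h x)) \<partial>wlb) \<longlonglongrightarrow> 0"
  "AE x in lborel. ((%y. cauchyF f (Complex x y)) \<longlongrightarrow> h x) (at_right 0)"
proof -
 have fi: "integrable lborel f" by (rule powr_le_imp_integrable[OF f supp p(1) fp])
 obtain C where C: "0 <= C" "\<forall>f a y. f \<in> BM --> (\<forall>s. a < \<bar>s\<bar> --> f s = 0) --> 0 <= a -->
    (\<integral>\<^sup>+s. ennreal (norm (f s) powr p) \<partial>lborel) < \<infinity> --> 0 < y -->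
   (\<integral>\<^sup>+x. ennreal (norm (cauchyF f (Complex x y)) powr p) \<partial>lborel)
   <= ennreal C * (\<integral>\<^sup>+s. ennreal (norm (f s) powr p) \<partial>lborel)"
  using riesz[OF p] by blast
 define H where "H = (%n x. cauchyF f (Complex x (hgt n)))"
 have Hm[measurable]: "H n \<in> BM" for n unfolding H_def by (intro cauchyF_measurable fi) simp
 have cauchy: "\<exists>N. \<forall>m\<ge>N. \<forall>n\<ge>N. (\<integral>\<^sup>+x. ennreal (norm (H m x - H n x)) \<partial>wlb) <= ennreal e" if e: "0 < e" for e
 proof -
  define \<eta> where "\<eta> = e / (8 * pi)"
  have \<eta>: "0 < \<eta>" using e by (simp add: \<eta>_def)
  \<comment> \<open>\<open>pi * \<eta>\<close> is \<open>e / 8\<close>, and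
    \<open>\<epsilon>\<close> makes the L^p term of \<open>wlb_le_powr\<close> at most another
    \<open>e / 8\<close>; using \<open>C + 1\<close> avoids division by zero.\<close>
  define \<epsilon> where "\<epsilon> = e / (8 * (C + 1) * \<eta> powr (1 - p))"
  have \<epsilon>: "0 < \<epsilon>" using e C(1) \<eta> by (simp add: \<epsilon>_def)
  obtain g L where g: "\<And>s t. norm (g s - g t) <= L * \<bar>s - t\<bar>" "\<And>s. 2 < \<bar>s\<bar> ==> g s = 0"
   "(\<integral>\<^sup>+s. ennreal (norm (f s - g s) powr p) \<partial>lborel) <= ennreal \<epsilon>"
   using lipschitz_approx[OF f supp _ fp \<epsilon>] p by auto
  note lb = lipschitz_boundary[OF g(1,2)]
  have gm[measurable]: "g \<in> BM" using borel_measurable_integrable[OF lb(1)] by simp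
  define G where "G = (%n x. cauchyF g (Complex x (hgt n)))"
  have Gm[measurable]: "G n \<in> BM" for n unfolding G_def by (rule cauchyF_measurable[OF lb(1) hgt_pos])
  have diff: "(\<integral>\<^sup>+x. ennreal (norm (H n x - G n x)) \<partial>wlb) <= ennreal (e/4)" for n
  proof -
   let ?w = "%s. f s - g s"
   have HG: "H n x - G n x = cauchyF ?w (Complex x (hgt n))" for x
   proof -
    have k: "integrable lborel (%s. f s / (cr s - Complex x (hgt n)))" "integrable lborel (%s. g s / (cr s - Complex x (hgt n)))"
     by (intro cauchy_kernel_integrable fi lb(1); simp)+
    then show ?thesis unfolding H_def G_def cauchyF_def by (simp add: diff_divide_distrib right_diff_distrib)
   qed
   have "(\<integral>\<^sup>+x. ennreal (norm (cauchyF ?w (Complex x (hgt n))) powr p) \<partial>lborel) <= ennreal C * (\<integral>\<^sup>+s. ennreal (norm (?w s) powr p) \<partial>lborel)"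
    using g(3) by (intro C(2)[rule_format, of ?w 2] hgt_pos) (auto simp: supp g(2) intro: le_less_trans)
   also have "\<dots> <= ennreal C * ennreal \<epsilon>" using g(3) by (intro mult_left_mono) auto
   finally have 1: "(\<integral>\<^sup>+x. ennreal (norm (H n x - G n x) powr p) \<partial>lborel) <= ennreal (C * \<epsilon>)"
    unfolding HG using C(1) \<epsilon> by (simp add: ennreal_mult)
   have "(\<integral>\<^sup>+x. ennreal (norm (H n x - G n x)) \<partial>wlb) <= ennreal (pi * \<eta>) + ennreal (\<eta> powr (1 - p)) * (\<integral>\<^sup>+x. ennreal (norm (H n x - G n x) powr p) \<partial>lborel)"
    using \<eta> p(1) by (intro wlb_le_powr) auto
   also have "\<dots> <= ennreal (pi * \<eta>) + ennreal (\<eta> powr (1 - p)) * ennreal (C * \<epsilon>)"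
    using 1 by (intro add_left_mono mult_left_mono) auto
   also have "\<dots> = ennreal (pi * \<eta> + \<eta> powr (1 - p) * (C * \<epsilon>))"
    using \<eta> C(1) \<epsilon> by (subst ennreal_plus) (auto simp: ennreal_mult[symmetric])
   also have "\<dots> <= ennreal (e/4)"
   proof (rule ennreal_leI)
    have 2: "pi * \<eta> = e / 8" by (simp add: \<eta>_def)
    have "\<eta> powr (1 - p) * (C * \<epsilon>) = (C / (C + 1)) * (e / 8)" using \<eta> C(1) by (simp add: \<epsilon>_def)
    also have "\<dots> <= 1 * (e / 8)" using C(1) e by (intro mult_right_mono) auto
    finally show "pi * \<eta> + \<eta> powr (1 - p) * (C * \<epsilon>) <= e/4" using 2 by linarith
   qed
   finally show ?thesis .
  qed
  obtain K where K: "\<And>y x. 0 < y ==> norm (cauchyF g (Complex x y)) <= K" using lb(2) by blast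
  define l where "l = (%x. lim (%n. G n x))"
  have lm[measurable]: "l \<in> BM" unfolding l_def by (rule borel_measurable_lim_metric) measurable
  have ll: "(%n. G n x) \<longlonglongrightarrow> l x" for x using lb(3)[of x] unfolding l_def G_def by (simp add: convergent_LIMSEQ_iff)
  have lK: "norm (l x) <= K" for x
   by (rule Lim_bounded[OF tendsto_norm[OF ll], of 0]) (use K in \<open>auto simp: G_def\<close>)
  have "(%n. \<integral>\<^sup>+x. ennreal (norm (G n x - l x)) \<partial>wlb) \<longlonglongrightarrow> (\<integral>\<^sup>+x. 0 \<partial>wlb)"
  proof (rule nn_integral_dominated_convergence[where w="%_. ennreal (2 * K)"])
   show "AE x in wlb. ennreal (norm (G n x - l x)) <= ennreal (2 * K)" for n
   proof (intro AE_I2 ennreal_leI)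
    fix x show "norm (G n x - l x) <= 2 * K"
     using norm_triangle_ineq4[of "G n x" "l x"] lK[of x] K[of "hgt n" x] unfolding G_def by simp
   qed
   show "(\<integral>\<^sup>+x. ennreal (2 * K) \<partial>wlb) < \<infinity>" by (simp add: emeasure_wlb ennreal_mult_less_top)
   show "AE x in wlb. (%n. ennreal (norm (G n x - l x))) \<longlonglongrightarrow> 0"
   proof (rule AE_I2)
    fix x
    have "(%n. ennreal (norm (G n x - l x))) \<longlonglongrightarrow> ennreal (norm (l x - l x))" by (intro tendsto_intros ll)
    then show "(%n. ennreal (norm (G n x - l x))) \<longlonglongrightarrow> 0" by simp
   qed
  qed auto
  then have "eventually (%n. (\<integral>\<^sup>+x. ennreal (norm (G n x - l x)) \<partial>wlb) < ennreal (e/4)) sequentially"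
   using e by (intro order_tendstoD) auto
  then obtain N where N: "\<And>n. N <= n ==> (\<integral>\<^sup>+x. ennreal (norm (G n x - l x)) \<partial>wlb) < ennreal (e/4)"
   unfolding eventually_sequentially by blast
  have half: "(\<integral>\<^sup>+x. ennreal (norm (H n x - l x)) \<partial>wlb) <= ennreal (e/2)" if "N <= n" for n
  proof -
   have "(\<integral>\<^sup>+x. ennreal (norm (H n x - l x)) \<partial>wlb) <= (\<integral>\<^sup>+x. ennreal (norm (H n x - G n x)) \<partial>wlb) + (\<integral>\<^sup>+x. ennreal (norm (G n x - l x)) \<partial>wlb)"
    by (rule nn_norm_triangle) measurable
   also have "\<dots> <= ennreal (e/4) + ennreal (e/4)" using diff[of n] N[OF that] by (intro add_mono) auto
   also have "\<dots> = ennreal (e/2)" using e by (simp add: ennreal_plus[symmetric] del: ennreal_plus)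
   finally show ?thesis .
  qed
  show ?thesis
  proof (intro exI[of _ N] allI impI)
   fix m n assume mn: "N <= m" "N <= n"
   have "(\<integral>\<^sup>+x. ennreal (norm (H m x - H n x)) \<partial>wlb) <= (\<integral>\<^sup>+x. ennreal (norm (H m x - l x)) \<partial>wlb) + (\<integral>\<^sup>+x. ennreal (norm (l x - H n x)) \<partial>wlb)"
    by (rule nn_norm_triangle) measurable
   also have "\<dots> <= ennreal (e/2) + ennreal (e/2)"
    using half[OF mn(1)] half[OF mn(2)] by (intro add_mono) (auto simp: norm_minus_commute)
   also have "\<dots> = ennreal e" using e by (simp add: ennreal_plus[symmetric] del: ennreal_plus)
   finally show "(\<integral>\<^sup>+x. ennreal (norm (H m x - H n x)) \<partial>wlb) <= ennreal e" .
  qed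
 qed
 obtain h where hm: "h \<in> borel_measurable wlb" and hl: "(%n. \<integral>\<^sup>+x. ennreal (norm (H n x - h x)) \<partial>wlb) \<longlonglongrightarrow> 0"
  by (rule L1_complete[of H wlb]) (use cauchy in auto)
 have hm'[measurable]: "h \<in> BM" using hm by simp
 have Hb: "norm (cauchyF f z) <= (\<integral>s. norm (f s) \<partial>lborel) / (pi * y)" if "0 < y" "y <= Im z" for y z
 proof (rule cauchyF_bound[OF fi that(1)])
  fix s show "y <= norm (cr s - z)" using norm_of_real_minus_ge[of z s] that by linarith
 qed
 have Hw: "winteg (H n)" for n
 proof -
  have "(\<integral>\<^sup>+x. ennreal (norm (H n x)) \<partial>wlb) <= (\<integral>\<^sup>+x. ennreal ((\<integral>s. norm (f s) \<partial>lborel) / (pi * hgt n)) \<partial>wlb)"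
   unfolding H_def by (intro nn_integral_mono ennreal_leI Hb) auto
  also have "\<dots> < \<infinity>" by (simp add: emeasure_wlb ennreal_mult_less_top)
  finally show ?thesis using winteg_iff_wlb[OF Hm[of n]] by blast
 qed
 have hw: "winteg h"
 proof -
  have "eventually (%n. (\<integral>\<^sup>+x. ennreal (norm (H n x - h x)) \<partial>wlb) < 1) sequentially"
   using hl by (intro order_tendstoD) auto
  then obtain n where n: "(\<integral>\<^sup>+x. ennreal (norm (H n x - h x)) \<partial>wlb) < 1" unfolding eventually_sequentially by blast
  have "(\<integral>\<^sup>+x. ennreal (norm (h x - 0)) \<partial>wlb) <= (\<integral>\<^sup>+x. ennreal (norm (h x - H n x)) \<partial>wlb) + (\<integral>\<^sup>+x. ennreal (norm (H n x - 0)) \<partial>wlb)"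
   by (rule nn_norm_triangle) measurable
  also have "\<dots> < \<infinity>" using n Hw[of n] winteg_iff_wlb[OF Hm[of n]]
   by (auto simp: norm_minus_commute less_top[symmetric] ennreal_add_eq_top)
  finally show ?thesis using winteg_iff_wlb[OF hm'] by simp
 qed
 \<comment> \<open>Poisson's formula holds above height \<open>hgt n\<close> because the Cauchy
   integral is bounded there. Letting \<open>n\<close> grow uses continuity on the left and weighted
   L^1 convergence on the right.\<close>
 have rep: "cauchyF f (Complex x s) = poisson s h x" if s: "0 < s" for x s
 proof -
  have P: "cauchyF f (Complex x (s + hgt n)) = poisson s (H n) x" for n
  proof -
   define \<Psi> where "\<Psi> = (%z. cauchyF f (z + \<i> * of_real (hgt n)))"
   have e: "\<Psi> z = cauchyF f (Complex (Re z) (Im z + hgt n))" for z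
    unfolding \<Psi>_def by (rule arg_cong[where f="cauchyF f"]) (simp add: complex_eq_iff)
   have "(cauchyF f \<circ> (%z. z + \<i> * of_real (hgt n))) holomorphic_on {z. - hgt n < Im z}"
    by (intro holomorphic_on_compose_gen[where t="{z. 0 < Im z}"] holomorphic_intros cauchyF_holomorphic fi) auto
   then have hol: "\<Psi> holomorphic_on {z. - hgt n < Im z}" by (simp add: \<Psi>_def o_def)
   have "\<Psi> (Complex x s) = poisson s (%u. \<Psi> (cr u)) x"
   proof (rule halfplane_poisson[OF hol hgt_pos _ s])
    fix z assume "0 <= Im z"
    then show "norm (\<Psi> z) <= (\<integral>s. norm (f s) \<partial>lborel) / (pi * hgt n)" unfolding e by (intro Hb) auto
   qed
   then show ?thesis unfolding e H_def by simp
  qed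
  have "(%n. cauchyF f (Complex x (s + hgt n))) \<longlonglongrightarrow> cauchyF f (Complex x s)"
  proof -
   have "isCont (cauchyF f) (Complex x s)"
    by (rule DERIV_isCont[OF cauchyF_deriv[OF fi]]) (use s in simp)
   moreover have "(%n. Complex x (s + hgt n)) \<longlonglongrightarrow> Complex x s"
   proof -
    have "(%n. cr x + \<i> * cr (s + hgt n)) \<longlonglongrightarrow> cr x + \<i> * cr (s + 0)"
     using filterlim_mono[OF hgt_lim at_within_le_nhds order_refl] by (intro tendsto_intros)
    then show ?thesis by (simp add: Complex_eq)
   qed
   ultimately show ?thesis by (rule isCont_tendsto_compose)
  qed
  moreover have "(%n. poisson s (H n) x) \<longlonglongrightarrow> poisson s h x"
  proof -
   let ?C = "ennreal ((s + (1 + 2 * x\<^sup>2) / s) * 2)"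
   have "(%n. ?C * (\<integral>\<^sup>+x. ennreal (norm (H n x - h x)) \<partial>wlb)) \<longlonglongrightarrow> ?C * 0"
    by (intro ennreal_tendsto_cmult hl) auto
   then have "(%n. ?C * (\<integral>\<^sup>+x. ennreal (norm (H n x - h x)) \<partial>wlb)) \<longlonglongrightarrow> 0" by simp
   moreover have "\<forall>\<^sub>F n in sequentially. ennreal (norm (poisson s (H n) x - poisson s h x)) <= ?C * (\<integral>\<^sup>+x. ennreal (norm (H n x - h x)) \<partial>wlb)"
    using poisson_diff_le[OF Hw hw s, of _ x] by (intro always_eventually allI)
   ultimately have "(%n. norm (poisson s (H n) x - poisson s h x)) \<longlonglongrightarrow> 0"
    using tendsto_sandwich[of "%_. 0" "%n. ennreal (norm (poisson s (H n) x - poisson s h x))" sequentially _ 0] 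
    by (simp add: tendsto_ennreal_iff[of _ _ 0, simplified])
   then show ?thesis by (rule LIM_zero_cancel[OF tendsto_norm_zero_cancel])
  qed
  ultimately show ?thesis unfolding P using LIMSEQ_unique by blast
 qed
 have "AE x in lborel. ((%y. cauchyF f (Complex x y)) \<longlongrightarrow> h x) (at_right 0)"
 proof (rule AE_mp[OF winteg_AE_leb_pt[OF hw]], intro AE_I2 impI)
  fix x assume lp: "leb_pt h x"
  show "((%y. cauchyF f (Complex x y)) \<longlongrightarrow> h x) (at_right 0)"
  proof (rule Lim_transform_eventually[OF poisson_tendsto[OF hw lp]])
   show "\<forall>\<^sub>F y in at_right 0. poisson y h x = cauchyF f (Complex x y)"
    using rep by (auto simp: eventually_at_right_field intro!: exI[of _ 1])
  qed
 qed
 then show ?thesis using that hm' hw hl unfolding H_def by blast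
qed

definition ptrunc :: "real => (real => complex) => real => complex" where
 "ptrunc e f x = (1 / (cr pi * \<i>)) *
   (\<integral>s. indicator {s. e < \<bar>s - x\<bar>} s *\<^sub>R (f s / cr (s - x)) \<partial>lborel)"

lemma borel_measurable_cnj[measurable]: "cnj \<in> BM"
 by (intro borel_measurable_continuous_onI continuous_intros)

lemma cauchyF_cnj:
 assumes f: "integrable lborel f"
 shows "cauchyF f (cnj z) = - cnj (cauchyF (%s. cnj (f s)) z)"
proof -
 have "cnj (\<integral>s. cnj (f s) / (cr s - z) \<partial>lborel) = (\<integral>s. cnj (cnj (f s) / (cr s - z)) \<partial>lborel)"
  by (rule Bochner_Integration.integral_cnj[symmetric])
 then show ?thesis unfolding cauchyF_def by simp
qed

text \<open>The jump relation before the limit: the kernels at two points symmetric to the real line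
  differ by \<open>2 * \<i>\<close> times the Poisson kernel.\<close>

lemma cauchyF_lower:
 assumes f: "integrable lborel f" and y: "0 < y"
 shows "cauchyF f (Complex x (- y)) = cauchyF f (Complex x y) - 2 * poisson y f x"
proof -
 let ?A = "%s. f s / (cr s - Complex x y)"
 let ?B = "%s. f s / (cr s - Complex x (- y))"
 let ?P = "%s. (y / ((s - x)\<^sup>2 + y\<^sup>2)) *\<^sub>R f s"
 have i: "integrable lborel ?A" "integrable lborel ?B" "integrable lborel ?P"
  using y by (auto intro!: cauchy_kernel_integrable f winteg_poisson_integrable integrable_imp_winteg)
 have "?B s = ?A s - (2 * \<i>) * ?P s" for s
 proof -
  have nz: "cr s - Complex x y \<noteq> 0" "cr s - Complex x (- y) \<noteq> 0" using y by (auto simp: complex_eq_iff)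
  have p: "(s - x)\<^sup>2 + y\<^sup>2 > 0" using y by (simp add: add_nonneg_pos)
  have "1 / (cr s - Complex x y) = Complex ((s - x) / ((s - x)\<^sup>2 + y\<^sup>2)) (y / ((s - x)\<^sup>2 + y\<^sup>2))"
   "1 / (cr s - Complex x (-y)) = Complex ((s - x) / ((s - x)\<^sup>2 + y\<^sup>2)) (- y / ((s - x)\<^sup>2 + y\<^sup>2))"
   by (simp_all add: complex_eq_iff Re_divide Im_divide)
  then have "1 / (cr s - Complex x (-y)) = 1 / (cr s - Complex x y) - (2 * \<i>) * cr (y / ((s - x)\<^sup>2 + y\<^sup>2))"
   by (simp add: complex_eq_iff)
  then have "f s * (1 / (cr s - Complex x (-y))) = f s * (1 / (cr s - Complex x y)) - (2 * \<i>) * (cr (y / ((s - x)\<^sup>2 + y\<^sup>2)) * f s)"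
   by (simp only: right_diff_distrib mult_ac)
  then show ?thesis by (simp only: scaleR_conv_of_real times_divide_eq_right mult_1_right)
 qed
 then have "integral\<^sup>L lborel ?B = integral\<^sup>L lborel ?A - (2 * \<i>) * integral\<^sup>L lborel ?P"
  using i by (simp only: Bochner_Integration.integral_diff integrable_mult_right integral_mult_right_zero)
 moreover have "(1 / (cr pi * \<i>)) * (a - (2 * \<i>) * p) = (1 / (cr pi * \<i>)) * a - 2 * ((1 / pi) *\<^sub>R p)" for a p
  by (simp add: scaleR_conv_of_real field_simps)
 ultimately show ?thesis unfolding cauchyF_def poisson_def by presburger
qed

text \<open>With \<open>u\<close> the upper boundary value put \<open>h = u - f\<close>: at Lebesgue
  points the truncated integral differs from Cauchy minus Poisson integral by a quantity tending to
  0. Mean convergence from below comes from the upper result for the conjugate of \<open>f\<close>,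
  since conjugation exchanges the half planes.\<close>

theorem hilbert_boundary:
 fixes f :: "real => complex"
 assumes f[measurable]: "f \<in> BM" and supp: "\<And>s. 1 < \<bar>s\<bar> ==> f s = 0"
  and p: "1 < p" "cos (p * pi / 2) \<noteq> 0" and fp: "(\<integral>\<^sup>+s. ennreal (norm (f s) powr p) \<partial>lborel) < \<infinity>"
 obtains h where "h \<in> BM" "winteg h"
  "AE x in lborel. ((%e. ptrunc e f x) \<longlongrightarrow> h x) (at_right 0)"
  "AE x in lborel. ((%y. cauchyF f (Complex x y)) \<longlongrightarrow> h x + f x) (at_right 0)"
  "(%n. \<integral>\<^sup>+x. ennreal (norm (cauchyF f (Complex x (hgt n)) - (h x + f x))) \<partial>wlb) \<longlonglongrightarrow> 0"
  "(%n. \<integral>\<^sup>+x. ennreal (norm (cauchyF f (Complex x (- hgt n)) - (h x - f x))) \<partial>wlb) \<longlonglongrightarrow> 0"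
proof -
 have fi: "integrable lborel f" by (rule powr_le_imp_integrable[OF f supp p(1) fp])
 have wf: "winteg f" by (rule integrable_imp_winteg[OF fi])
 obtain u where u[measurable]: "u \<in> BM" and uw: "winteg u"
  and u1: "(%n. \<integral>\<^sup>+x. ennreal (norm (cauchyF f (Complex x (hgt n)) - u x)) \<partial>wlb) \<longlonglongrightarrow> 0"
  and u2: "AE x in lborel. ((%y. cauchyF f (Complex x y)) \<longlongrightarrow> u x) (at_right 0)"
  by (rule cauchyF_boundary[OF f supp p fp])
 have cp: "(\<integral>\<^sup>+s. ennreal (norm (cnj (f s)) powr p) \<partial>lborel) < \<infinity>" using fp by simp
 obtain v where v[measurable]: "v \<in> BM"
  and v1: "(%n. \<integral>\<^sup>+x. ennreal (norm (cauchyF (%s. cnj (f s)) (Complex x (hgt n)) - v x)) \<partial>wlb) \<longlonglongrightarrow> 0"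
  and v2: "AE x in lborel. ((%y. cauchyF (%s. cnj (f s)) (Complex x y)) \<longlongrightarrow> v x) (at_right 0)"
  by (rule cauchyF_boundary[of "%s. cnj (f s)" p]) (use supp p cp in auto)
 define h where "h = (%x. u x - f x)"
 have hm[measurable]: "h \<in> BM" unfolding h_def by measurable
 have hw: "winteg h" using uw wf unfolding winteg_def h_def by (simp add: scaleR_diff_right)
 have lp: "AE x in lborel. leb_pt f x" by (rule winteg_AE_leb_pt[OF wf])
 have "AE x in lborel. ((%e. ptrunc e f x) \<longlongrightarrow> h x) (at_right 0)"
  using lp u2
 proof eventually_elim
  case (elim x)
  have "((%e. (ptrunc e f x - (cauchyF f (Complex x e) - poisson e f x)) + (cauchyF f (Complex x e) - poisson e f x)) \<longlongrightarrow> 0 + (u x - f x)) (at_right 0)"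
   unfolding ptrunc_def
   by (intro tendsto_add truncation_tendsto fi elim tendsto_diff poisson_tendsto wf)
  then show ?case by (simp add: h_def)
 qed
 moreover have "AE x in lborel. ((%y. cauchyF f (Complex x y)) \<longlongrightarrow> h x + f x) (at_right 0)"
  using u2 by (simp add: h_def)
 moreover have "(%n. \<integral>\<^sup>+x. ennreal (norm (cauchyF f (Complex x (hgt n)) - (h x + f x))) \<partial>wlb) \<longlonglongrightarrow> 0"
  using u1 by (simp add: h_def)
 moreover have "(%n. \<integral>\<^sup>+x. ennreal (norm (cauchyF f (Complex x (- hgt n)) - (h x - f x))) \<partial>wlb) \<longlonglongrightarrow> 0"
 proof -
  have low: "cauchyF f (Complex x (- y)) = - cnj (cauchyF (%s. cnj (f s)) (Complex x y))" for x y
   using cauchyF_cnj[OF fi, of "Complex x y"] by (simp add: complex_cnj)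
  \<comment> \<open>Both sides are limits of the lower Cauchy integral, once by conjugation and once
    by subtracting twice the Poisson integral of \<open>f\<close>.\<close>
  have eq: "AE x in lborel. - cnj (v x) = h x - f x"
   using lp u2 v2
  proof eventually_elim
   case (elim x)
   have a: "((%y. cauchyF f (Complex x y) - 2 * poisson y f x) \<longlongrightarrow> u x - 2 * f x) (at_right 0)"
    by (intro tendsto_intros poisson_tendsto wf elim)
   have b: "((%y. - cnj (cauchyF (%s. cnj (f s)) (Complex x y))) \<longlongrightarrow> - cnj (v x)) (at_right 0)"
    by (intro tendsto_intros elim)
   have "\<forall>\<^sub>F y in at_right 0. - cnj (cauchyF (%s. cnj (f s)) (Complex x y)) = cauchyF f (Complex x y) - 2 * poisson y f x"
    using cauchyF_lower[OF fi] unfolding low by (auto simp: eventually_at_right_field intro!: exI[of _ 1])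
   from Lim_transform_eventually[OF b this] a have "- cnj (v x) = u x - 2 * f x"
    by (intro tendsto_unique[of "at_right (0::real)"]) auto
   then show ?case by (simp add: h_def)
  qed
  have "(\<integral>\<^sup>+x. ennreal (norm (cauchyF f (Complex x (- hgt n)) - (h x - f x))) \<partial>wlb) =
    (\<integral>\<^sup>+x. ennreal (norm (cauchyF (%s. cnj (f s)) (Complex x (hgt n)) - v x)) \<partial>wlb)" for n
  proof (rule nn_integral_cong_AE)
   show "AE x in wlb. ennreal (norm (cauchyF f (Complex x (- hgt n)) - (h x - f x))) =
     ennreal (norm (cauchyF (%s. cnj (f s)) (Complex x (hgt n)) - v x))"
    unfolding AE_wlb using eq
   proof eventually_elim
    case (elim x)
    have "cauchyF f (Complex x (- hgt n)) - (h x - f x) = - cnj (cauchyF (%s. cnj (f s)) (Complex x (hgt n)) - v x)"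
     unfolding low elim[symmetric] by simp
    then show ?case by (metis complex_mod_cnj norm_minus_cancel)
   qed
  qed
  then show ?thesis using v1 by simp
 qed
 ultimately show ?thesis using that hm hw by blast
qed

text \<open>Fatou's lemma carries the height-independent Riesz bound to the boundary value
  \<open>h + f\<close>, and the triangle inequality removes \<open>f\<close>. The function
  \<open>h\<close> is only required to be an a.e. limit of truncations, so the bound also applies to
  a difference of such limits.\<close>

theorem hilbert_norm_bound:
 fixes q :: real
 assumes q: "1 < q" "cos (q * pi / 2) \<noteq> 0"
 shows "\<exists>C\<ge>0. \<forall>f h. f \<in> BM --> h \<in> BM --> (\<forall>s. 1 < \<bar>s\<bar> --> f s = 0) -->
   (\<integral>\<^sup>+s. ennreal (norm (f s) powr q) \<partial>lborel) < \<infinity> -->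
   (AE x in lborel. ((%e. ptrunc e f x) \<longlongrightarrow> h x) (at_right 0)) -->
   (\<integral>\<^sup>+x. ennreal (norm (h x) powr q) \<partial>lborel) <= ennreal C * (\<integral>\<^sup>+s. ennreal (norm (f s) powr q) \<partial>lborel)"
proof -
 obtain C where C: "0 <= C" "\<forall>f a y. f \<in> BM --> (\<forall>s. a < \<bar>s\<bar> --> f s = 0) --> 0 <= a -->
    (\<integral>\<^sup>+s. ennreal (norm (f s) powr q) \<partial>lborel) < \<infinity> --> 0 < y -->
   (\<integral>\<^sup>+x. ennreal (norm (cauchyF f (Complex x y)) powr q) \<partial>lborel)
   <= ennreal C * (\<integral>\<^sup>+s. ennreal (norm (f s) powr q) \<partial>lborel)"
  using riesz[OF q] by blast
 show ?thesis
 proof (intro exI[of _ "2 powr q * (C + 1)"] conjI allI impI)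
  fix f h :: "real => complex"
  assume f[measurable]: "f \<in> BM" and h[measurable]: "h \<in> BM"
   and supp: "\<forall>s. 1 < \<bar>s\<bar> --> f s = 0" and fq: "(\<integral>\<^sup>+s. ennreal (norm (f s) powr q) \<partial>lborel) < \<infinity>"
   and lim: "AE x in lborel. ((%e. ptrunc e f x) \<longlongrightarrow> h x) (at_right 0)"
  let ?S = "\<integral>\<^sup>+s. ennreal (norm (f s) powr q) \<partial>lborel"
  have fi: "integrable lborel f" by (rule powr_le_imp_integrable[OF f _ q(1) fq, of 1]) (use supp in auto)
  have wf: "winteg f" by (rule integrable_imp_winteg[OF fi])
  have [measurable]: "(%x. cauchyF f (Complex x (hgt n))) \<in> BM" for n
   by (rule cauchyF_measurable[OF fi hgt_pos])
  have lim2: "AE x in lborel. (%n. cauchyF f (Complex x (hgt n))) \<longlonglongrightarrow> h x + f x"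
   using lim winteg_AE_leb_pt[OF wf]
  proof eventually_elim
   case (elim x)
   have "((%e. ptrunc e f x - (ptrunc e f x - (cauchyF f (Complex x e) - poisson e f x)) + poisson e f x) \<longlongrightarrow> h x - 0 + f x) (at_right 0)"
    by (intro tendsto_add tendsto_diff elim poisson_tendsto wf truncation_tendsto[OF fi, folded ptrunc_def])
   then have "((%e. cauchyF f (Complex x e)) \<longlongrightarrow> h x + f x) (at_right 0)" by simp
   then show ?case by (rule filterlim_compose[OF _ hgt_lim])
  qed
  have "(\<integral>\<^sup>+x. ennreal (norm (h x + f x) powr q) \<partial>lborel) = (\<integral>\<^sup>+x. liminf (%n. ennreal (norm (cauchyF f (Complex x (hgt n))) powr q)) \<partial>lborel)"
  proof (rule nn_integral_cong_AE, use lim2 in eventually_elim)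
   case (elim x)
   have "(%n. ennreal (norm (cauchyF f (Complex x (hgt n))) powr q)) \<longlonglongrightarrow> ennreal (norm (h x + f x) powr q)"
    by (intro tendsto_ennrealI tendsto_powr2 tendsto_norm elim tendsto_const) (use q in auto)
   then show ?case by (rule lim_imp_Liminf[OF sequentially_bot, symmetric])
  qed
  also have "\<dots> <= liminf (%n. \<integral>\<^sup>+x. ennreal (norm (cauchyF f (Complex x (hgt n))) powr q) \<partial>lborel)"
   by (rule nn_integral_liminf) measurable
  also have "\<dots> <= liminf (%n::nat. ennreal C * ?S)"
  proof (intro Liminf_mono always_eventually allI)
   fix n
   show "(\<integral>\<^sup>+x. ennreal (norm (cauchyF f (Complex x (hgt n))) powr q) \<partial>lborel) <= ennreal C * ?S"
    by (rule C(2)[rule_format, of f 1]) (use f supp fq hgt_pos in auto)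
  qed
  also have "\<dots> = ennreal C * ?S" by (simp add: Liminf_const)
  finally have b: "(\<integral>\<^sup>+x. ennreal (norm (h x + f x) powr q) \<partial>lborel) <= ennreal C * ?S" .
  have "(\<integral>\<^sup>+x. ennreal (norm (h x) powr q) \<partial>lborel) <=
    (\<integral>\<^sup>+x. ennreal (2 powr q) * (ennreal (norm (h x + f x) powr q) + ennreal (norm (f x) powr q)) \<partial>lborel)"
  proof (intro nn_integral_mono)
   fix x
   have "norm (h x) powr q <= (norm (h x + f x) + norm (f x)) powr q"
    using q norm_triangle_ineq4[of "h x + f x" "f x"] by (intro powr_mono2) auto
   also have "\<dots> <= 2 powr q * (norm (h x + f x) powr q + norm (f x) powr q)" using q by (intro powr_sum2_le) auto
   finally show "ennreal (norm (h x) powr q) <= ennreal (2 powr q) * (ennreal (norm (h x + f x) powr q) + ennreal (norm (f x) powr q))"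
    by (simp add: ennreal_mult[symmetric] ennreal_plus[symmetric] ennreal_leI del: ennreal_plus)
  qed
  also have "\<dots> = ennreal (2 powr q) * ((\<integral>\<^sup>+x. ennreal (norm (h x + f x) powr q) \<partial>lborel) + ?S)"
   by (simp add: nn_integral_cmult nn_integral_add)
  also have "\<dots> <= ennreal (2 powr q) * (ennreal C * ?S + 1 * ?S)"
   using b by (intro mult_left_mono add_mono) auto
  also have "\<dots> = ennreal (2 powr q * (C + 1)) * ?S"
   using C(1) by (simp add: ennreal_mult distrib_right mult.assoc)
  finally show "(\<integral>\<^sup>+x. ennreal (norm (h x) powr q) \<partial>lborel) <= ennreal (2 powr q * (C + 1)) * ?S" .
 qed (use C in auto)
qed

section \<open>Passage between the interval and the real line\<close>

lemma AE_M11: "(AE x in M11. P x) \<longleftrightarrow> (AE x in lborel. x \<in> {-1<..<1} --> P x)"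
 by (subst AE_restrict_space_iff) (auto simp: AE_completion_iff)

text \<open>Elements of \<open>L0\<close> are merely Lebesgue measurable and arbitrary outside the
  interval; the estimates above work with Borel functions on the line that vanish there.\<close>

lemma borel_representative:
 assumes "f \<in> L0"
 obtains f' where "f' \<in> BM" "\<And>s. s \<notin> {-1<..<1} ==> f' s = 0"
  "AE x in lborel. x \<in> {-1<..<1} --> f x = f' x"
proof -
 let ?g = "%x. if x \<in> {-1<..<1} then f x else 0"
 have gm: "?g \<in> borel_measurable lebesgue" using assms by (intro borel_measurable_if_I) auto
 have "(%x. Re (?g x)) \<in> borel_measurable lebesgue" "(%x. Im (?g x)) \<in> borel_measurable lebesgue"
  using gm by measurable
 then obtain r i where r: "r \<in> borel_measurable lborel" "AE x in lborel. Re (?g x) = r x"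
  and i: "i \<in> borel_measurable lborel" "AE x in lborel. Im (?g x) = i x"
  using completion_ex_borel_measurable_real[of "%x. Re (?g x)" lborel] completion_ex_borel_measurable_real[of "%x. Im (?g x)" lborel] by auto
 note [measurable] = r(1) i(1)
 define f' where "f' = (%x. if x \<in> {-1<..<1} then Complex (r x) (i x) else 0)"
 show ?thesis
 proof (rule that[of f'])
  show "f' \<in> BM" unfolding f'_def Complex_eq using r(1) i(1) by measurable
  show "AE x in lborel. x \<in> {-1<..<1} --> f x = f' x"
   using r(2) i(2) by eventually_elim (auto simp: f'_def complex_eq_iff)
 qed (auto simp: f'_def)
qed

text \<open>Changing the representative leaves every truncated integral unchanged, so the two
  \<open>Lim\<close> terms coincide at each point of the interval, including points where no limit
  exists.\<close>

lemma finite_Hilbert_ptrunc: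
 assumes f: "f \<in> L0" and f'[measurable]: "f' \<in> BM" and supp: "\<And>s. s \<notin> {-1<..<1} ==> f' s = 0"
  and eq: "AE x in lborel. x \<in> {-1<..<1} --> f x = f' x" and i: "integrable lborel f'"
  and t: "t \<in> {-1<..<1}"
 shows "finite_Hilbert f t = Lim (at_right 0) (%e. ptrunc e f' t)"
proof -
 have key: "1 / (cr pi * \<i>) *
    (set_lebesgue_integral lebesgue {-1<..<t - e} (%x. f x / cr (x - t)) +
    set_lebesgue_integral lebesgue {t + e<..<1} (%x. f x / cr (x - t))) = ptrunc e f' t" if e: "0 < e" for e
 proof -
  have swap: "set_lebesgue_integral lebesgue A (%x. f x / cr (x - t)) = (\<integral>s. indicator A s *\<^sub>R (f' s / cr (s - t)) \<partial>lborel)"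
   if A[measurable]: "A \<in> sets borel" and sub: "A \<subseteq> {-1<..<1}" for A
  proof -
   have "set_lebesgue_integral lebesgue A (%x. f x / cr (x - t)) = (\<integral>s. indicator A s *\<^sub>R (f s / cr (s - t)) \<partial>lebesgue)"
    by (simp add: set_lebesgue_integral_def)
   also have "\<dots> = (\<integral>s. indicator A s *\<^sub>R (f' s / cr (s - t)) \<partial>lebesgue)"
   proof (rule integral_cong_AE)
    have "(%x. if x \<in> {-1<..<1} then f x else 0) \<in> borel_measurable lebesgue"
     using f by (intro borel_measurable_if_I) auto
    moreover have "A \<in> sets lebesgue" using A by auto
    ultimately have "(%s. indicator A s *\<^sub>R ((if s \<in> {-1<..<1} then f s else 0) / cr (s - t))) \<in> borel_measurable lebesgue"
     by (intro borel_measurable_scaleR borel_measurable_divide borel_measurable_indicator borel_measurable_of_real) (auto intro!: measurable_completion)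
    moreover have "(%s. indicator A s *\<^sub>R ((if s \<in> {-1<..<1} then f s else 0) / cr (s - t))) = (%s. indicator A s *\<^sub>R (f s / cr (s - t)))"
     using sub by (auto simp: fun_eq_iff indicator_def)
    ultimately show "(%s. indicator A s *\<^sub>R (f s / cr (s - t))) \<in> borel_measurable lebesgue" by simp
    show "(%s. indicator A s *\<^sub>R (f' s / cr (s - t))) \<in> borel_measurable lebesgue"
     by (rule measurable_completion) measurable
    show "AE s in lebesgue. indicator A s *\<^sub>R (f s / cr (s - t)) = indicator A s *\<^sub>R (f' s / cr (s - t))"
     unfolding AE_completion_iff using eq by eventually_elim (use sub in \<open>auto simp: indicator_def\<close>)
   qed
   also have "\<dots> = (\<integral>s. indicator A s *\<^sub>R (f' s / cr (s - t)) \<partial>lborel)"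
    by (rule integral_completion) measurable
   finally show ?thesis .
  qed
  have ii: "integrable lborel (%s. indicator A s *\<^sub>R (f' s / cr (s - t)))"
   if A[measurable]: "A \<in> sets borel" and sub: "A \<subseteq> {s. e <= \<bar>s - t\<bar>}" for A
  proof (rule Bochner_Integration.integrable_bound[OF integrable_scaleR_right[OF i, of "1/e"]])
   show "AE s in lborel. norm (indicator A s *\<^sub>R (f' s / cr (s - t))) <= norm ((1/e) *\<^sub>R f' s)"
   proof (rule AE_I2)
    fix s
    have "norm (f' s) / \<bar>s - t\<bar> <= norm (f' s) / e" if "s \<in> A"
     using sub that e by (intro divide_left_mono) (auto intro!: mult_pos_pos)
    then show "norm (indicator A s *\<^sub>R (f' s / cr (s - t))) <= norm ((1/e) *\<^sub>R f' s)"
     using e by (auto simp: norm_divide indicator_def simp del: of_real_diff)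
   qed
  qed measurable
  have "(\<integral>s. indicator {-1<..<t-e} s *\<^sub>R (f' s / cr (s - t)) \<partial>lborel) + (\<integral>s. indicator {t+e<..<1} s *\<^sub>R (f' s / cr (s - t)) \<partial>lborel)
   = (\<integral>s. indicator {-1<..<t-e} s *\<^sub>R (f' s / cr (s - t)) + indicator {t+e<..<1} s *\<^sub>R (f' s / cr (s - t)) \<partial>lborel)"
   using e by (intro Bochner_Integration.integral_add[symmetric] ii) (auto simp: abs_if)
  also have "\<dots> = (\<integral>s. indicator {s. e < \<bar>s - t\<bar>} s *\<^sub>R (f' s / cr (s - t)) \<partial>lborel)"
  proof (rule Bochner_Integration.integral_cong[OF refl])
   fix s
   show "indicator {-1<..<t-e} s *\<^sub>R (f' s / cr (s - t)) + indicator {t+e<..<1} s *\<^sub>R (f' s / cr (s - t))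
     = indicator {s. e < \<bar>s - t\<bar>} s *\<^sub>R (f' s / cr (s - t))"
    using supp[of s] e by (cases "s \<in> {-1<..<1}") (auto simp: indicator_def abs_if)
  qed
  finally show ?thesis unfolding ptrunc_def using t e by (subst (1 2) swap) auto
 qed
 have "finite_Hilbert f t = (THE l. ((%e. ptrunc e f' t) \<longlongrightarrow> l) (at_right 0))"
 proof -
  have "(((%e. 1 / (cr pi * \<i>) *
    (set_lebesgue_integral lebesgue {-1<..<t - e} (%x. f x / cr (x - t)) +
    set_lebesgue_integral lebesgue {t + e<..<1} (%x. f x / cr (x - t)))) \<longlongrightarrow> l) (at_right 0))
   \<longleftrightarrow> ((%e. ptrunc e f' t) \<longlongrightarrow> l) (at_right 0)" for l
   by (rule tendsto_cong) (use key in \<open>auto simp: eventually_at_right_field intro!: exI[of _ 1]\<close>)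
  then show ?thesis unfolding finite_Hilbert_def Topological_Spaces.Lim_def by simp
 qed
 then show ?thesis by (simp add: Topological_Spaces.Lim_def)
qed

section \<open>Rearrangements and Boyd indices\<close>

definition dstr :: "(real => complex) => real => real" where
 "dstr f r = measure M11 {x \<in> {-1<..<1}. r < norm (f x)}"

lemma space_M11[simp]: "space M11 = {-1<..<1}" by simp

lemma finite_measure_M11: "finite_measure M11"
 by (rule finite_measureI) (simp add: emeasure_restrict_space)

interpretation M11: finite_measure M11 by (rule finite_measure_M11)

lemma level_set_M11[measurable]: "f \<in> L0 ==> {x \<in> {-1<..<1}. r < norm (f x)} \<in> sets M11"
proof -
 assume f: "f \<in> L0"
 then have [measurable]: "f \<in> borel_measurable M11" .
 have "{x \<in> space M11. r < norm (f x)} \<in> sets M11" by measurable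
 then show ?thesis by simp
qed

lemma measure_M11_Icc_le: "measure M11 A <= 2"
proof -
 have "measure M11 A <= measure M11 (space M11)" by (rule M11.bounded_measure)
 also have "\<dots> = 2" by (simp add: measure_restrict_space)
 finally show ?thesis .
qed

lemma dstr_bounds: "0 <= dstr f r" "dstr f r <= 2"
 unfolding dstr_def by (auto intro: measure_M11_Icc_le)

lemma emeasure_level: "emeasure M11 {x \<in> {-1<..<1}. r < norm (f x)} = ennreal (dstr f r)"
 unfolding dstr_def by (rule M11.emeasure_eq_measure)

lemma dstr_antimono:
 assumes "f \<in> L0" "r <= r'" shows "dstr f r' <= dstr f r"
 unfolding dstr_def using assms(2) by (intro M11.finite_measure_mono level_set_M11[OF assms(1)]) auto

lemma dstr_mono_AE:
 assumes f: "f \<in> L0" "g \<in> L0" and le: "AE x in M11. norm (g x) <= norm (f x)"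
 shows "dstr g r <= dstr f r"
proof -
 have "AE x in M11. x \<in> {x \<in> {-1<..<1}. r < norm (g x)} --> x \<in> {x \<in> {-1<..<1}. r < norm (f x)}"
  using le by eventually_elim auto
 then show ?thesis unfolding dstr_def by (rule M11.finite_measure_mono_AE[OF _ level_set_M11[OF f(1)]])
qed

lemma dstr_scale:
 assumes c: "0 < c" shows "dstr (%x. of_real c * f x) r = dstr f (r / c)"
proof -
 have "{x \<in> {-1<..<1}. r < norm (of_real c * f x)} = {x \<in> {-1<..<1}. r / c < norm (f x)}"
  using c by (auto simp: norm_mult pos_divide_less_eq mult.commute)
 then show ?thesis by (simp add: dstr_def)
qed

lemma dstr_tendsto_0:
 assumes f: "f \<in> L0" shows "(%n. dstr f (real n)) \<longlonglongrightarrow> 0"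
proof -
 have "(%n. measure M11 {x \<in> {-1<..<1}. real n < norm (f x)}) \<longlonglongrightarrow> measure M11 (\<Inter>n. {x \<in> {-1<..<1}. real n < norm (f x)})"
 proof (rule M11.finite_Lim_measure_decseq)
  show "range (%n. {x \<in> {-1<..<1}. real n < norm (f x)}) \<subseteq> sets M11" using level_set_M11[OF f] by blast
 qed (auto simp: decseq_def)
 moreover have "(\<Inter>n. {x \<in> {-1<..<1}. real n < norm (f x)}) = {}"
 proof (rule equals0I)
  fix x assume "x \<in> (\<Inter>n. {x \<in> {-1<..<1}. real n < norm (f x)})"
  then have "real n < norm (f x)" for n by auto
  then show False using real_arch_simple[of "norm (f x)"] by (metis not_less)
 qed
 ultimately show ?thesis by (simp add: dstr_def)
qed

lemma dstr_right_cont: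
 assumes f: "f \<in> L0" and le: "\<And>n. dstr f (r + 1 / (real n + 1)) <= t" shows "dstr f r <= t"
proof -
 have "(%n. measure M11 {x \<in> {-1<..<1}. r + 1 / (real n + 1) < norm (f x)}) \<longlonglongrightarrow> measure M11 (\<Union>n. {x \<in> {-1<..<1}. r + 1 / (real n + 1) < norm (f x)})"
 proof (rule M11.finite_Lim_measure_incseq)
  show "range (%n. {x \<in> {-1<..<1}. r + 1 / (real n + 1) < norm (f x)}) \<subseteq> sets M11" using level_set_M11[OF f] by blast
  show "incseq (%n. {x \<in> {-1<..<1}. r + 1 / (real n + 1) < norm (f x)})"
  proof (rule incseq_SucI, clarify)
   fix n x assume "r + 1 / (real n + 1) < norm (f x)"
   moreover have "1 / (real (Suc n) + 1) <= 1 / (real n + 1)" by (intro frac_le) auto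
   ultimately show "r + 1 / (real (Suc n) + 1) < norm (f x)" by linarith
  qed
 qed
 moreover have "(\<Union>n. {x \<in> {-1<..<1}. r + 1 / (real n + 1) < norm (f x)}) = {x \<in> {-1<..<1}. r < norm (f x)}"
 proof safe
  fix x n assume "r + 1 / (real n + 1) < norm (f x)"
  moreover have "0 < 1 / (real n + 1)" by simp
  ultimately show "r < norm (f x)" by linarith
 next
  fix x assume x: "x \<in> {-1<..<1::real}" "r < norm (f x)"
  then obtain n where "inverse (real (Suc n)) < norm (f x) - r" using reals_Archimedean[of "norm (f x) - r"] by auto
  then have "r + 1 / (real n + 1) < norm (f x)" by (simp add: inverse_eq_divide add.commute)
  then show "x \<in> (\<Union>n. {x \<in> {-1<..<1}. r + 1 / (real n + 1) < norm (f x)})" using x by auto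
 qed
 ultimately have "(%n. dstr f (r + 1 / (real n + 1))) \<longlonglongrightarrow> dstr f r" unfolding dstr_def by simp
 then show ?thesis by (rule LIMSEQ_le_const2) (use le in auto)
qed

text \<open>Real-valued counterpart of \<open>rearr\<close>, used for \<open>t > 0\<close> only: at
  0 the set of levels is empty for unbounded \<open>f\<close>, where \<open>rearr\<close> is
  infinite.\<close>

definition fstar :: "(real => complex) => real => real" where
 "fstar f t = Inf {s. 0 <= s \<and> dstr f s <= t}"

text \<open>Rearrangement and distribution function are generalised inverses of each other. The
  direction from left to right rests on right continuity of \<open>dstr\<close>, which makes the
  infimum attained.\<close>

lemma fstar_le_iff:
 assumes f: "f \<in> L0" and t: "0 < t" and r: "0 <= r"
 shows "fstar f t <= r \<longleftrightarrow> dstr f r <= t"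
proof
 let ?A = "{s. 0 <= s \<and> dstr f s <= t}"
 have bdd: "bdd_below ?A" by (rule bdd_belowI[of _ 0]) auto
 show "fstar f t <= r" if "dstr f r <= t"
  unfolding fstar_def using that r by (intro cInf_lower bdd) auto
 assume le: "fstar f t <= r"
 have "eventually (%n. dstr f (real n) < t) sequentially"
  using dstr_tendsto_0[OF f] t by (rule order_tendstoD)
 then obtain n where "dstr f (real n) < t" unfolding eventually_sequentially by blast
 then have ne: "?A \<noteq> {}" by (auto intro!: exI[of _ "real n"])
 show "dstr f r <= t"
 proof (rule dstr_right_cont[OF f])
  fix n
  have "Inf ?A < r + 1 / (real n + 1)" using le unfolding fstar_def by (smt (verit) divide_pos_pos of_nat_0_le_iff)
  then obtain s where s: "s \<in> ?A" "s < r + 1 / (real n + 1)" using cInf_lessD[OF ne] by blast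
  have "dstr f (r + 1 / (real n + 1)) <= dstr f s" using s by (intro dstr_antimono f) auto
  then show "dstr f (r + 1 / (real n + 1)) <= t" using s by auto
 qed
qed

lemma fstar_nonneg:
 assumes f: "f \<in> L0" and t: "0 < t" shows "0 <= fstar f t"
proof -
 have "eventually (%n. dstr f (real n) < t) sequentially"
  using dstr_tendsto_0[OF f] t by (rule order_tendstoD)
 then obtain n where "dstr f (real n) < t" unfolding eventually_sequentially by blast
 then show ?thesis unfolding fstar_def by (intro cInf_greatest) (auto intro!: exI[of _ "real n"])
qed

lemma dstr_fstar:
 assumes f: "f \<in> L0" and t: "0 < t" shows "dstr f (fstar f t) <= t"
 using fstar_le_iff[OF f t fstar_nonneg[OF f t]] by simp

lemma fstar_antimono:
 assumes f: "f \<in> L0" and t: "0 < t" "t <= t'" shows "fstar f t' <= fstar f t"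
 using fstar_le_iff[OF f, of t' "fstar f t"] fstar_nonneg[OF f t(1)] dstr_fstar[OF f t(1)] t by auto

text \<open>The symmetric rearrangement stretched by the factor \<open>2/c\<close> and cut off at \<open>\<bar>s\<bar> = d\<close>;
  the values at \<open>0\<close>, where the rearrangement may be infinite, are set to \<open>0\<close>.\<close>

definition csym :: "real => real => (real => complex) => real => complex" where
 "csym c d f s = (if s = 0 \<or> d < \<bar>s\<bar> then 0 else cr (fstar f (c * \<bar>s\<bar>)))"

lemma norm_csym:
 assumes "f \<in> L0" "0 < c"
 shows "norm (csym c d f s) = (if s = 0 \<or> d < \<bar>s\<bar> then 0 else fstar f (c * \<bar>s\<bar>))"
 using fstar_nonneg[OF assms(1), of "c * \<bar>s\<bar>"] assms by (auto simp: csym_def)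

lemma csym_level:
 assumes f: "f \<in> L0" and c: "0 < c" and r: "0 <= r"
 shows "r < norm (csym c d f s) \<longleftrightarrow> s \<noteq> 0 \<and> \<bar>s\<bar> <= d \<and> c * \<bar>s\<bar> < dstr f r"
proof (cases "s = 0")
 case False
 then have "0 < c * \<bar>s\<bar>" using c by simp
 from fstar_le_iff[OF f this r] show ?thesis
  unfolding norm_csym[OF f c] using False r by (smt (verit))
qed (use norm_csym[OF f c] r in auto)

lemma csym_measurable:
 assumes f: "f \<in> L0" and c: "0 < c" shows "csym c d f \<in> BM"
proof -
 have 1: "(%s. norm (csym c d f s)) \<in> BM"
 proof (rule borel_measurable_iff_greater[THEN iffD2], intro allI)
  fix a :: real
  show "{w \<in> space borel. a < norm (csym c d f w)} \<in> sets borel"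
  proof (cases "0 <= a")
   case True
   have "{w. w \<noteq> 0 \<and> \<bar>w\<bar> <= d \<and> c * \<bar>w\<bar> < dstr f a} \<in> sets borel" by measurable
   then show ?thesis using csym_level[OF f c True] by simp
  next
   case False
   then have "{w \<in> space borel. a < norm (csym c d f w)} = UNIV" by (auto intro: less_le_trans[of a 0])
   then show ?thesis by simp
  qed
 qed
 have "csym c d f s = cr (norm (csym c d f s))" for s
  unfolding norm_csym[OF f c] by (auto simp: csym_def)
 then have "(%s. cr (norm (csym c d f s))) = csym c d f" by presburger
 moreover have "(%s. cr (norm (csym c d f s))) \<in> BM" using 1 by measurable
 ultimately show ?thesis by simp
qed

lemma borel_L0: "f \<in> BM ==> f \<in> L0"
 by (rule measurable_restrict_space1, rule measurable_completion) simp

lemma csym_L0: "f \<in> L0 ==> 0 < c ==> csym c d f \<in> L0"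
 by (rule borel_L0[OF csym_measurable])

lemma measure_M11_borel:
 assumes "A \<in> sets borel" shows "measure M11 ({-1<..<1} \<inter> A) = measure lborel ({-1<..<1} \<inter> A)"
 using assms by (subst measure_restrict_space) auto

lemma measure_M11_abs_less:
 assumes a: "0 <= a" "a <= 1"
 shows "measure M11 {s \<in> {-1<..<1}. s \<noteq> 0 \<and> \<bar>s\<bar> < a} = 2 * a"
proof -
 have "{s \<in> {-1<..<1}. s \<noteq> 0 \<and> \<bar>s\<bar> < a} = {-1<..<1} \<inter> ({-a<..<0} \<union> {0<..<a})" using a by auto
 then have "measure M11 {s \<in> {-1<..<1}. s \<noteq> 0 \<and> \<bar>s\<bar> < a} = measure lborel ({-1<..<1} \<inter> ({-a<..<0} \<union> {0<..<a}))"
  using measure_M11_borel[of "{-a<..<0} \<union> {0<..<a}"] by simp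
 also have "{-1<..<1} \<inter> ({-a<..<0} \<union> {0<..<a}) = {-a<..<0} \<union> {0<..<a}" using a by auto
 also have "measure lborel ({-a<..<0} \<union> {0<..<a}) = measure lborel {-a<..<0} + measure lborel {0<..<a}"
  using a by (intro measure_Union) auto
 finally show ?thesis using a by simp
qed

lemma measure_M11_pos_less:
 assumes a: "0 <= a" "a <= 1"
 shows "measure M11 {s \<in> {-1<..<1}. 0 < s \<and> s < a} = a" "measure M11 {s \<in> {-1<..<1}. s < 0 \<and> - s < a} = a"
proof -
 have "{s \<in> {-1<..<1}. 0 < s \<and> s < a} = {-1<..<1} \<inter> {0<..<a}" "{s \<in> {-1<..<1}. s < 0 \<and> - s < a} = {-1<..<1} \<inter> {-a<..<0}"
  using a by auto
 moreover have "{-1<..<1} \<inter> {0<..<a} = {0<..<a}" "{-1<..<1} \<inter> {-a<..<0} = {-a<..<0}" using a by auto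
 ultimately show "measure M11 {s \<in> {-1<..<1}. 0 < s \<and> s < a} = a" "measure M11 {s \<in> {-1<..<1}. s < 0 \<and> - s < a} = a"
  using measure_M11_borel[of "{0<..<a}"] measure_M11_borel[of "{-a<..<0}"] a by simp_all
qed

text \<open>The cap 2 is the measure of the interval. For \<open>c = 2\<close> the function is
  equimeasurable with \<open>f\<close>; smaller \<open>c\<close> multiplies the distribution
  function until the interval is full.\<close>

lemma dstr_csym:
 assumes f: "f \<in> L0" and c: "0 < c" and r: "0 <= r"
 shows "dstr (csym c 1 f) r = min 2 (2 * dstr f r / c)"
proof -
 define a where "a = min 1 (dstr f r / c)"
 have a: "0 <= a" "a <= 1" using dstr_bounds(1)[of f r] c by (auto simp: a_def)
 have "{x \<in> {-1<..<1}. r < norm (csym c 1 f x)} = {s \<in> {-1<..<1}. s \<noteq> 0 \<and> \<bar>s\<bar> < a}"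
  unfolding csym_level[OF f c r] a_def using c by (auto simp: field_simps abs_if)
 then have "dstr (csym c 1 f) r = 2 * a" unfolding dstr_def using measure_M11_abs_less[OF a] by simp
 then show ?thesis by (auto simp: a_def min_def)
qed

section \<open>Consequences of rearrangement invariance\<close>

context ri_space
begin

lemma XL0: "f \<in> X ==> f \<in> L0" using subset_L0 by blast

text \<open>\<open>rearr\<close> is an infimum over the levels \<open>s \<ge> 0\<close> at which the
  distribution function is at most \<open>t\<close>; a smaller distribution function enlarges this
  set.\<close>

lemma dstr_mem:
 assumes g: "g \<in> L0" and f: "f \<in> X" and le: "\<And>r. 0 <= r ==> dstr g r <= dstr f r"
 shows "g \<in> X" "N g <= N f"
proof -
 have "rearr g t <= rearr f t" for t
  unfolding rearr_def space_M11 emeasure_level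
 proof (rule INF_superset_mono)
  show "{s. 0 <= s \<and> ennreal (dstr f s) <= ennreal t} \<subseteq> {s. 0 <= s \<and> ennreal (dstr g s) <= ennreal t}"
   using le by (auto intro: order_trans ennreal_leI)
 qed simp
 then show "g \<in> X" "N g <= N f" using rearr_mem[OF g f] rearr_norm[OF g f] by auto
qed

lemma lattice_mem:
 assumes g: "g \<in> L0" and f: "f \<in> X" and le: "AE x in M11. norm (g x) <= norm (f x)"
 shows "g \<in> X" "N g <= N f"
 using dstr_mem[OF g f dstr_mono_AE[OF XL0[OF f] g le]] by auto

lemma N_AE_eq:
 assumes f: "f \<in> X" and g: "g \<in> L0" and eq: "ae_eq f g"
 shows "N g = N f"
proof -
 have gX: "g \<in> X" using ae_closed f g eq by blast
 have "N g <= N f" by (rule lattice_mem(2)[OF g f]) (use eq in \<open>auto simp: ae_eq_def\<close>)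
 moreover have "N f <= N g" by (rule lattice_mem(2)[OF XL0[OF f] gX]) (use eq in \<open>auto simp: ae_eq_def\<close>)
 ultimately show ?thesis by simp
qed

lemma csym2:
 assumes f: "f \<in> X" shows "csym 2 1 f \<in> X" "N (csym 2 1 f) <= N f"
 using dstr_mem[OF csym_L0[OF XL0[OF f]] f, of 2 1] dstr_csym[OF XL0[OF f], of 2] by auto

text \<open>\<open>csym 1 1 f\<close> has twice the distribution function of \<open>f\<close>,
  capped at 2, and is the sum of its restrictions to the two half intervals. Each restriction has a
  distribution function at most that of \<open>f\<close>, so the triangle inequality gives the
  factor 2.\<close>

lemma doubling:
 assumes f: "f \<in> X" and g: "g \<in> L0" and le: "\<And>r. 0 <= r ==> dstr g r <= 2 * dstr f r"
 shows "g \<in> X" "N g <= 2 * N f"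
proof -
 note f0 = XL0[OF f]
 define u where "u = (%s. if 0 < s then csym 1 1 f s else 0)"
 define v where "v = (%s. if s < 0 then csym 1 1 f s else 0)"
 have [measurable]: "csym 1 1 f \<in> BM" by (rule csym_measurable[OF f0]) simp
 have u0: "u \<in> L0" unfolding u_def by (rule borel_L0) measurable
 have v0: "v \<in> L0" unfolding v_def by (rule borel_L0) measurable
 have du: "dstr u r <= dstr f r" and dv: "dstr v r <= dstr f r" if r: "0 <= r" for r
 proof -
  define a where "a = min 1 (dstr f r)"
  have a: "0 <= a" "a <= 1" using dstr_bounds(1)[of f r] by (auto simp: a_def)
  have "{x \<in> {-1<..<1}. r < norm (u x)} = {s \<in> {-1<..<1}. 0 < s \<and> s < a}"
  proof -
   have "r < norm (u x) \<longleftrightarrow> 0 < x \<and> x < a" if "x \<in> {-1<..<1}" for x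
   proof (cases "0 < x")
    case True
    then show ?thesis using csym_level[OF f0 zero_less_one r, of 1 x] that by (simp add: u_def a_def)
   qed (use r in \<open>simp add: u_def\<close>)
   then show ?thesis by (intro Collect_cong conj_cong refl)
  qed
  then have "dstr u r = a" unfolding dstr_def using measure_M11_pos_less(1)[OF a] by simp
  then show "dstr u r <= dstr f r" by (simp add: a_def)
  have "{x \<in> {-1<..<1}. r < norm (v x)} = {s \<in> {-1<..<1}. s < 0 \<and> - s < a}"
  proof -
   have "r < norm (v x) \<longleftrightarrow> x < 0 \<and> - x < a" if "x \<in> {-1<..<1}" for x
   proof (cases "x < 0")
    case True
    then show ?thesis using csym_level[OF f0 zero_less_one r, of 1 x] that by (simp add: v_def a_def)
   qed (use r in \<open>simp add: v_def\<close>)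
   then show ?thesis by (intro Collect_cong conj_cong refl)
  qed
  then have "dstr v r = a" unfolding dstr_def using measure_M11_pos_less(2)[OF a] by simp
  then show "dstr v r <= dstr f r" by (simp add: a_def)
 qed
 have u: "u \<in> X" "N u <= N f" using dstr_mem[OF u0 f du] by blast+
 have v: "v \<in> X" "N v <= N f" using dstr_mem[OF v0 f dv] by blast+
 have uv: "(%x. u x + v x) = csym 1 1 f" by (auto simp: u_def v_def csym_def fun_eq_iff)
 have s: "csym 1 1 f \<in> X" using add_mem[OF u(1) v(1)] uv by simp
 have sN: "N (csym 1 1 f) <= 2 * N f" using norm_triangle[OF u(1) v(1)] u v unfolding uv by simp
 have "dstr g r <= dstr (csym 1 1 f) r" if "0 <= r" for r
  using le[OF that] dstr_bounds(2)[of g r] dstr_csym[OF f0 _ that, of 1] by simp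
 then show "g \<in> X" "N g <= 2 * N f" using dstr_mem[OF g s] sN by auto
qed

text \<open>The induction passes through \<open>csym (2 / 2^k) 1 f\<close>, whose distribution
  function is exactly \<open>2^k\<close> times that of \<open>f\<close>, capped at the full
  measure.\<close>

lemma power_doubling:
 assumes f: "f \<in> X" and g: "g \<in> L0" and le: "\<And>r. 0 <= r ==> dstr g r <= 2^k * dstr f r"
 shows "g \<in> X" "N g <= 2^k * N f"
proof -
 have "\<forall>g. g \<in> L0 --> (\<forall>r\<ge>0. dstr g r <= 2^k * dstr f r) --> g \<in> X \<and> N g <= 2^k * N f"
 proof (induction k)
  case 0
  then show ?case using dstr_mem[OF _ f] by auto
 next
  case (Suc k)
  show ?case
  proof (intro allI impI)
   fix g assume g: "g \<in> L0" and le: "\<forall>r\<ge>0. dstr g r <= 2^Suc k * dstr f r"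
   let ?h = "csym (2 / 2^k) 1 f"
   have dh: "dstr ?h r = min 2 (2^k * dstr f r)" if "0 <= r" for r
    using dstr_csym[OF XL0[OF f] _ that, of "2 / 2^k"] by (simp add: mult.commute)
   have h: "?h \<in> X" "N ?h <= 2^k * N f"
    using Suc.IH csym_L0[OF XL0[OF f], of "2 / 2^k" 1] dh by auto
   have "dstr g r <= 2 * dstr ?h r" if "0 <= r" for r
    using le that dh[OF that] dstr_bounds(2)[of g r] by auto
   then have "g \<in> X" "N g <= 2 * N ?h" using doubling[OF h(1) g] by auto
   then show "g \<in> X \<and> N g <= 2^Suc k * N f" using h(2) by auto
  qed
 qed
 then show "g \<in> X" "N g <= 2^k * N f" using g le by auto
qed

text \<open>A nonzero \<open>f\<close> exceeds some \<open>r > 0\<close> on a set of positive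
  measure. Scaled by \<open>1 / r\<close> it exceeds every level below 1 there, and enough doublings
  of the distribution function fill the interval.\<close>

lemma one_mem: "(%x. 1) \<in> X" "0 < N (%x. 1)"
proof -
 obtain f where f: "f \<in> X" "\<not> ae_eq f (%x. 0)" using nonzero by blast
 note f0 = XL0[OF f(1)]
 have "dstr f 0 \<noteq> 0"
 proof
  assume "dstr f 0 = 0"
  then have "emeasure M11 {x \<in> {-1<..<1}. 0 < norm (f x)} = 0" using emeasure_level[of 0 f] by simp
  then have "AE x in M11. \<not> 0 < norm (f x)"
   by (intro AE_iff_measurable[THEN iffD2, OF level_set_M11[OF f0, of 0]]) (simp_all del: zero_less_norm_iff)
  then show False using f(2) unfolding ae_eq_def by auto
 qed
 then have pos: "0 < dstr f 0" using dstr_bounds(1)[of f 0] by simp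
 have "\<exists>n. 0 < dstr f (1 / (real n + 1))"
 proof (rule ccontr)
  assume "\<not> ?thesis"
  then have "dstr f (0 + 1 / (real n + 1)) <= 0" for n by (simp add: not_less)
  then have "dstr f 0 <= 0" by (rule dstr_right_cont[OF f0])
  then show False using pos by simp
 qed
 then obtain n where n: "0 < dstr f (1 / (real n + 1))" by blast
 define r where "r = 1 / (real n + 1)"
 have r: "0 < r" "0 < dstr f r" using n by (auto simp: r_def)
 obtain k where k: "2 / dstr f r < 2^k" using real_arch_pow[of 2 "2 / dstr f r"] by auto
 have g: "(%x. cr (1/r) * f x) \<in> X" by (rule scale_mem[OF f(1)])
 have one0: "(%x. 1) \<in> L0" by simp
 have "dstr (%x. 1) \<rho> <= 2^k * dstr (%x. cr (1/r) * f x) \<rho>" if \<rho>: "0 <= \<rho>" for \<rho>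
 proof (cases "\<rho> < 1")
  case True
  have "dstr f r <= dstr f (\<rho> / (1/r))" using True r by (intro dstr_antimono f0) (auto simp: mult_le_cancel_right1)
  then have "2^k * dstr f r <= 2^k * dstr (%x. cr (1/r) * f x) \<rho>"
   using r by (subst dstr_scale) (auto intro!: mult_left_mono)
  moreover have "2 <= 2^k * dstr f r" using k r by (simp add: field_simps)
  ultimately show ?thesis using dstr_bounds(2)[of "%x. 1" \<rho>] by linarith
 next
  case False
  then have "dstr (%x. 1) \<rho> = 0" by (simp add: dstr_def)
  then show ?thesis using dstr_bounds(1) by simp
 qed
 then show one: "(%x. 1) \<in> X" using power_doubling(1)[OF g one0] by blast
 have "\<not> ae_eq (%x. 1) (%x. 0)"
 proof
  assume "ae_eq (%x. 1) (%x. 0)"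
  then have "AE x in M11. False" by (simp add: ae_eq_def)
  then have "emeasure M11 (space M11) = 0" by (subst (asm) AE_iff_measurable[OF sets.top]) auto
  then show False by (simp add: emeasure_restrict_space)
 qed
 then show "0 < N (%x. 1)" using norm_zero_iff[OF one] norm_nonneg[OF one] by linarith
qed

end

section \<open>Dilations and the Boyd indices\<close>

lemma lebesgue_measurable_mult: "(%x::real. c * x) \<in> lebesgue \<rightarrow>\<^sub>M lebesgue"
proof -
 have "(*\<^sub>R) c = (%x::real. c * x)" by (simp add: fun_eq_iff)
 then show ?thesis using lebesgue_measurable_scaling[of c, where 'a=real] by metis
qed

lemma emeasure_lebesgue_scale:
 assumes t: "0 < t" and A: "A \<in> sets lebesgue"
 shows "emeasure lebesgue {s::real. (1/t) * s \<in> A} = ennreal t * emeasure lebesgue A"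
proof -
 note m = lebesgue_measurable_mult[of "1/t"]
 have "emeasure lebesgue A = emeasure (density (distr lebesgue lebesgue (%x. (1/t) * x)) (%x. ennreal \<bar>1/t\<bar>)) A"
  using lebesgue_real_scale[of "1/t"] t by simp
 also have "\<dots> = ennreal (1/t) * emeasure (distr lebesgue lebesgue (%x. (1/t) * x)) A"
  using A t by (subst emeasure_density) (auto simp: nn_integral_cmult_indicator)
 also have "emeasure (distr lebesgue lebesgue (%x. (1/t) * x)) A = emeasure lebesgue {s. (1/t) * s \<in> A}"
  using A by (subst emeasure_distr[OF m]) (auto simp: vimage_def)
 finally have "ennreal t * emeasure lebesgue A = ennreal t * (ennreal (1/t) * emeasure lebesgue {s. (1/t) * s \<in> A})" by simp
 also have "\<dots> = emeasure lebesgue {s. (1/t) * s \<in> A}"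
  using t by (simp add: mult.assoc[symmetric] ennreal_mult[symmetric])
 finally show ?thesis by simp
qed

lemma dilation_dstr:
 assumes f: "f \<in> L0" and t: "0 < t"
 shows "dilation (1/t) f \<in> L0" "0 <= r ==> dstr (dilation (1/t) f) r <= t * dstr f r"
proof -
 define g where "g = (%x. if x \<in> {-1<..<1} then f x else 0)"
 have gm: "g \<in> borel_measurable lebesgue" unfolding g_def using f by (intro borel_measurable_if_I) auto
 note m = lebesgue_measurable_mult[of "1/t"]
 have gc: "(%s. g ((1/t) * s)) \<in> borel_measurable lebesgue" by (rule measurable_compose[OF m gm])
 \<comment> \<open>The closed interval in \<open>dilation\<close> lets \<open>f 1\<close> and
   \<open>f (-1)\<close> enter, which \<open>L0\<close> leaves arbitrary; they occur only at the two
   points \<open>t\<close> and \<open>- t\<close>.\<close>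
 have eq: "dilation (1/t) f s = (if s \<in> {t} then f 1 else if s \<in> {-t} then f (-1) else g ((1/t) * s))" for s
  using t by (auto simp: dilation_def g_def divide_simps)
 have "dilation (1/t) f \<in> borel_measurable lebesgue"
  unfolding eq[abs_def] by (intro measurable_If_set gc) auto
 then show dL: "dilation (1/t) f \<in> L0" by (rule measurable_restrict_space1)
 assume r: "0 <= r"
 let ?A = "{x \<in> {-1<..<1}. r < norm (f x)}"
 have A: "?A \<in> sets lebesgue"
  using level_set_M11[OF f, of r] by (simp add: sets_restrict_space_iff)
 have meq: "emeasure M11 B = emeasure lebesgue B" if "B \<subseteq> {-1<..<1}" for B
  using that by (subst emeasure_restrict_space) auto
 let ?B = "{s::real. (1/t) * s \<in> ?A}"
 have Bs: "?B \<in> sets lebesgue" using measurable_sets[OF m A] by (simp add: vimage_def)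
 have null: "{t, -t} \<in> null_sets lebesgue"
  by (rule null_sets_completionI, rule finite_imp_null_set_lborel) simp
 have "ennreal (dstr (dilation (1/t) f) r) = emeasure lebesgue {s \<in> {-1<..<1}. r < norm (dilation (1/t) f s)}"
  unfolding emeasure_level[symmetric] by (rule meq) auto
 also have "\<dots> <= emeasure lebesgue (?B \<union> {t, -t})"
 proof (rule emeasure_mono)
  show "{s \<in> {-1<..<1}. r < norm (dilation (1/t) f s)} \<subseteq> ?B \<union> {t, -t}"
   using r unfolding eq by (auto simp: g_def split: if_splits)
 qed (rule sets.Un[OF Bs null_setsD2[OF null]])
 also have "\<dots> = emeasure lebesgue ?B"
  by (rule emeasure_Un_null_set[OF Bs null])
 also have "\<dots> = ennreal t * emeasure lebesgue ?A"
  by (rule emeasure_lebesgue_scale[OF t A])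
 also have "emeasure lebesgue ?A = ennreal (dstr f r)"
  by (rule trans[OF meq[symmetric] emeasure_level]) auto
 also have "ennreal t * \<dots> = ennreal (t * dstr f r)"
  using t by (intro ennreal_mult[symmetric] dstr_bounds) simp
 finally show "dstr (dilation (1/t) f) r <= t * dstr f r"
  using t dstr_bounds(1)[of f r] by simp
qed

context ri_space
begin

lemma dilation_bounded:
 assumes t: "0 < t"
 shows "\<exists>K\<ge>0. \<forall>f\<in>X. dilation (1/t) f \<in> X \<and> N (dilation (1/t) f) <= K * N f"
proof -
 obtain k where k: "t < 2^k" using real_arch_pow[of 2 t] by auto
 show ?thesis
 proof (intro exI[of _ "2^k"] conjI ballI)
  fix f assume f: "f \<in> X"
  have le: "dstr (dilation (1/t) f) r <= 2^k * dstr f r" if "0 <= r" for r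
   using dilation_dstr(2)[OF XL0[OF f] t that] mult_right_mono[of t "2^k" "dstr f r"] k dstr_bounds(1)[of f r] by linarith
  show "dilation (1/t) f \<in> X" "N (dilation (1/t) f) <= 2^k * N f"
   using power_doubling[OF f dilation_dstr(1)[OF XL0[OF f] t] le] by auto
 qed auto
qed

lemma dilation_mem: "0 < t ==> f \<in> X ==> dilation (1/t) f \<in> X"
 using dilation_bounded by blast

text \<open>\<open>opnorm\<close> is a supremum of reals and is informative only if the values are
  bounded, which \<open>dilation_bounded\<close> supplies. The estimate for general \<open>f\<close>
  follows by homogeneity.\<close>

lemma opnorm_dilation:
 assumes t: "0 < t"
 shows "0 <= opnorm X N (dilation (1/t))" "\<And>f. f \<in> X ==> N (dilation (1/t) f) <= opnorm X N (dilation (1/t)) * N f"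
proof -
 let ?T = "dilation (1/t)" and ?B = "{f \<in> X. N f <= 1}"
 obtain K where K: "0 <= K" "\<And>f. f \<in> X ==> ?T f \<in> X" "\<And>f. f \<in> X ==> N (?T f) <= K * N f"
  using dilation_bounded[OF t] by blast
 have bdd: "bdd_above ((%f. N (?T f)) ` ?B)"
 proof (rule bdd_aboveI2)
  fix f assume "f \<in> ?B"
  then show "N (?T f) <= K" using K(3)[of f] mult_left_mono[of "N f" 1 K] K(1) by auto
 qed
 have up: "N (?T f) <= opnorm X N ?T" if "f \<in> X" "N f <= 1" for f
  unfolding opnorm_def using that by (intro cSUP_upper bdd) auto
 have N0: "N (%x. 0) = 0" using norm_zero_iff[OF zero_mem] by (simp add: ae_eq_def)
 have "0 <= N (?T (%x. 0))" by (intro norm_nonneg K(2) zero_mem)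
 then show op0: "0 <= opnorm X N ?T" using up[OF zero_mem] N0 by linarith
 fix f assume f: "f \<in> X"
 show "N (?T f) <= opnorm X N ?T * N f"
 proof (cases "N f = 0")
  case True then show ?thesis using K(3)[OF f] by simp
 next
  case False
  then have n: "0 < N f" using norm_nonneg[OF f] by simp
  let ?c = "cr (1 / N f)"
  let ?g = "%x. ?c * f x"
  have g: "?g \<in> X" by (rule scale_mem[OF f])
  have "N ?g = 1" using norm_scale[OF f, of ?c] n by (simp add: norm_divide)
  then have "N (?T ?g) <= opnorm X N ?T" using up[OF g] by simp
  moreover have "?T ?g = (%x. ?c * ?T f x)" by (auto simp: dilation_def fun_eq_iff)
  ultimately have "(1 / N f) * N (?T f) <= opnorm X N ?T"
   using norm_scale[OF K(2)[OF f], of ?c] n by (simp add: norm_divide)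
  then show ?thesis using n by (simp add: field_simps)
 qed
qed

lemma upper_Boyd_decay:
 assumes "upper_Boyd X N < 1"
 obtains t \<beta> where "1 < t" "0 < \<beta>" "\<beta> < 1" "\<And>f. f \<in> X ==> N (dilation (1/t) f) <= t powr \<beta> * N f"
proof -
 obtain t where t: "t \<in> {1<..}" "ereal (ln (opnorm X N (dilation (1/t))) / ln t) < 1"
  using assms unfolding upper_Boyd_def INF_less_iff by blast
 let ?o = "opnorm X N (dilation (1/t))"
 have t1: "1 < t" using t by simp
 have lt: "0 < ln t" using t1 by simp
 have q: "ln ?o / ln t < 1" using t(2) by simp
 \<comment> \<open>The maximum with 1/2 makes \<open>\<beta>\<close> positive; for
   \<open>t > 1\<close> increasing the exponent only weakens the bound.\<close>
 define \<beta> where "\<beta> = max (1/2) (ln ?o / ln t)"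
 have b: "0 < \<beta>" "\<beta> < 1" using q by (auto simp: \<beta>_def)
 have o0: "0 <= ?o" by (rule opnorm_dilation(1)) (use t1 in simp)
 have "?o <= t powr \<beta>"
 proof (cases "?o = 0")
  case False
  then have "0 < ?o" using o0 by simp
  moreover have "ln ?o <= \<beta> * ln t"
  proof -
   have "ln ?o / ln t <= \<beta>" by (simp add: \<beta>_def)
   then show ?thesis using lt by (simp add: pos_divide_le_eq)
  qed
  ultimately show ?thesis using t1 by (simp add: powr_def ln_ge_iff[symmetric]) (metis exp_le_cancel_iff exp_ln)
 qed simp
 then have "N (dilation (1/t) f) <= t powr \<beta> * N f" if "f \<in> X" for f
  using opnorm_dilation(2)[of t f] that t1 mult_right_mono[of ?o "t powr \<beta>" "N f"] norm_nonneg[OF that] by simp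
 then show ?thesis using that t1 b by blast
qed

lemma lower_Boyd_decay:
 assumes "0 < lower_Boyd X N"
 obtains t \<alpha> where "0 < t" "t < 1" "0 < \<alpha>" "\<And>f. f \<in> X ==> N (dilation (1/t) f) <= t powr \<alpha> * N f"
proof -
 obtain t where t: "t \<in> {0<..<1}" "0 < ereal (ln (opnorm X N (dilation (1/t))) / ln t)"
  using assms unfolding lower_Boyd_def less_SUP_iff by blast
 let ?o = "opnorm X N (dilation (1/t))"
 have t1: "0 < t" "t < 1" using t by auto
 have lt: "ln t < 0" using t1 by simp
 define \<alpha> where "\<alpha> = ln ?o / ln t"
 have a: "0 < \<alpha>" using t(2) by (simp add: \<alpha>_def)
 have o0: "0 <= ?o" by (rule opnorm_dilation(1)) (use t1 in simp)
 \<comment> \<open>With \<open>ln 0 = 0\<close> a vanishing norm would give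
   \<open>\<alpha> = 0\<close>.\<close>
 have "?o \<noteq> 0" using a by (auto simp: \<alpha>_def)
 then have op: "0 < ?o" using o0 by simp
 have "t powr \<alpha> = exp (\<alpha> * ln t)" using t1 by (simp add: powr_def)
 also have "\<dots> = ?o" using lt op by (simp add: \<alpha>_def)
 finally have "N (dilation (1/t) f) <= t powr \<alpha> * N f" if "f \<in> X" for f
  using opnorm_dilation(2)[of t f] that t1 by simp
 then show ?thesis using that t1 a by blast
qed

text \<open>Each dilation by the single \<open>t > 1\<close> divides the factor in
  \<open>csym\<close> by \<open>t\<close>, at the price \<open>t powr \<beta>\<close>. For general
  \<open>c\<close> the least power of \<open>t\<close> that reaches \<open>2 / c\<close> is used;
  overshooting by at most a factor \<open>t\<close> goes into the constant.\<close>

lemma csym_expand_bound: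
 assumes "upper_Boyd X N < 1"
 obtains C \<beta> where "0 <= C" "0 < \<beta>" "\<beta> < 1"
  "\<And>f c. f \<in> X ==> 0 < c ==> c <= 1 ==> csym c 1 f \<in> X \<and> N (csym c 1 f) <= C * c powr (- \<beta>) * N f"
proof -
 obtain t \<beta> where t: "1 < t" and b: "0 < \<beta>" "\<beta> < 1" and dec: "\<And>f. f \<in> X ==> N (dilation (1/t) f) <= t powr \<beta> * N f"
  using upper_Boyd_decay[OF assms] by blast
 have iter: "csym (2 / t^k) 1 f \<in> X \<and> N (csym (2 / t^k) 1 f) <= (t powr \<beta>)^k * N f" if f: "f \<in> X" for f k
 proof (induction k)
  case 0 then show ?case using csym2[OF f] by simp
 next
  case (Suc k)
  let ?g = "csym (2 / t^k) 1 f" and ?h = "csym (2 / t^Suc k) 1 f"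
  have tk: "0 < t^k" "0 < t" using t by auto
  have eq: "dilation (1/t) ?g s = ?h s" if s: "s \<in> {-1<..<1}" for s
  proof -
   have "\<bar>s\<bar> <= t" using s t by auto
   then have "-1 <= s * (1/t) \<and> s * (1/t) <= 1" "\<not> 1 < \<bar>s * (1/t)\<bar>" using tk by (auto simp: divide_simps abs_if split: if_splits)
   moreover have "2 / t^k * \<bar>s * (1/t)\<bar> = 2 / t^Suc k * \<bar>s\<bar>" using tk by (simp add: abs_mult)
   ultimately show ?thesis using s tk unfolding dilation_def csym_def by (auto simp: mult.commute)
  qed
  have d: "dilation (1/t) ?g \<in> X" by (rule dilation_mem) (use Suc tk in auto)
  have h0: "?h \<in> L0" using tk by (intro csym_L0 XL0 f) auto
  have h: "?h \<in> X" "N ?h <= N (dilation (1/t) ?g)"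
   by (rule lattice_mem[OF h0 d]; auto intro!: AE_I2 simp: eq)+
  have "N (dilation (1/t) ?g) <= t powr \<beta> * N ?g" by (rule dec) (use Suc in auto)
  also have "\<dots> <= t powr \<beta> * ((t powr \<beta>)^k * N f)" using Suc by (intro mult_left_mono) auto
  finally show ?case using h by (simp add: mult.assoc)
 qed
 show ?thesis
 proof (rule that[of "(2 * t) powr \<beta>" \<beta>])
  fix f c assume f: "f \<in> X" and c: "0 < c" "c <= (1::real)"
  define k where "k = (LEAST k. 2 / c <= t^k)"
  obtain k' where "2 / c < t^k'" using real_arch_pow[OF t] by blast
  then have "2 / c <= t^k'" by simp
  then have k: "2 / c <= t^k" unfolding k_def by (rule LeastI)
  have "k \<noteq> 0" using k c by (intro notI) (simp add: divide_simps)
  then have "t^(k-1) < 2 / c" using not_less_Least[of "k-1" "%k. 2 / c <= t^k"] unfolding k_def[symmetric] by simp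
  then have "t * t^(k-1) <= t * (2 / c)" using t by (intro mult_left_mono) auto
  then have tk: "t^k <= 2 * t / c" using \<open>k \<noteq> 0\<close> by (simp add: power_eq_if[of t k] mult.commute)
  have tp: "0 < t^k" using t by simp
  let ?g = "csym (2 / t^k) 1 f"
  have g: "?g \<in> X" "N ?g <= (t powr \<beta>)^k * N f" using iter[OF f] by auto
  have le: "2 / t^k <= c" using k c tp by (simp add: divide_simps mult.commute)
  have pt: "norm (csym c 1 f s) <= norm (?g s)" for s
  proof -
   have "fstar f (c * \<bar>s\<bar>) <= fstar f (2 / t^k * \<bar>s\<bar>)" if "s \<noteq> 0"
    using le that tp by (intro fstar_antimono XL0 f mult_right_mono) auto
   then show ?thesis using c tp by (auto simp: norm_csym[OF XL0[OF f]])
  qed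
  have h: "csym c 1 f \<in> X" "N (csym c 1 f) <= N ?g"
   by (rule lattice_mem[OF csym_L0[OF XL0[OF f] c(1)] g(1)]; auto intro!: AE_I2 simp: pt)+
  have "(t powr \<beta>)^k = (t^k) powr \<beta>" using t by (simp add: powr_power powr_realpow[symmetric] powr_powr mult.commute)
  also have "\<dots> <= (2 * t / c) powr \<beta>" using tk tp b by (intro powr_mono2) auto
  also have "\<dots> = (2 * t) powr \<beta> * c powr (- \<beta>)" using t c by (subst powr_divide) (auto simp: powr_minus divide_inverse)
  finally have "(t powr \<beta>)^k * N f <= (2 * t) powr \<beta> * c powr (- \<beta>) * N f"
   using norm_nonneg[OF f] by (intro mult_right_mono) auto
  then show "csym c 1 f \<in> X \<and> N (csym c 1 f) <= (2 * t) powr \<beta> * c powr (- \<beta>) * N f" using h g by auto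
 qed (use b in auto)
qed

text \<open>Dilation by the single \<open>t < 1\<close> compresses the symmetric rearrangement into
  \<open>\<bar>s\<bar> \<le> t^k\<close> and gains \<open>t powr \<alpha>\<close> each time. The
  statement is specialised to powers of 2, the scales that are summed later.\<close>

lemma csym_shrink_bound:
 assumes "0 < lower_Boyd X N"
 obtains C \<alpha> where "0 <= C" "0 < \<alpha>"
  "\<And>f i. f \<in> X ==> 1 <= i ==> csym (2^i) ((1/2)^i) f \<in> X \<and> N (csym (2^i) ((1/2)^i) f) <= C * 2 powr (- \<alpha> * real i) * N f"
proof -
 obtain t \<alpha> where t: "0 < t" "t < 1" and a: "0 < \<alpha>" and dec: "\<And>f. f \<in> X ==> N (dilation (1/t) f) <= t powr \<alpha> * N f"
  using lower_Boyd_decay[OF assms] by blast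
 have iter: "csym (2 / t^k) (t^k) f \<in> X \<and> N (csym (2 / t^k) (t^k) f) <= (t powr \<alpha>)^k * N f" if f: "f \<in> X" for f k
 proof (induction k)
  case 0 then show ?case using csym2[OF f] by simp
 next
  case (Suc k)
  let ?g = "csym (2 / t^k) (t^k) f" and ?h = "csym (2 / t^Suc k) (t^Suc k) f"
  have tk: "0 < t^k" "t^k <= 1" using t by (auto intro: power_le_one)
  have le: "norm (?h s) <= norm (dilation (1/t) ?g s)" for s
  proof (cases "s = 0 \<or> t^Suc k < \<bar>s\<bar>")
   case True then show ?thesis by (simp add: csym_def)
  next
   case False
   then have "\<bar>s\<bar> <= t * t^k" by simp
   then have s: "\<bar>s * (1/t)\<bar> <= t^k" using t by (simp add: abs_mult divide_simps mult.commute)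
   then have "-1 <= s * (1/t) \<and> s * (1/t) <= 1" using tk by linarith
   moreover have "2 / t^k * \<bar>s * (1/t)\<bar> = 2 / t^Suc k * \<bar>s\<bar>" using t by (simp add: abs_mult)
   ultimately show ?thesis using s False t unfolding dilation_def csym_def by (auto simp: mult.commute)
  qed
  have d: "dilation (1/t) ?g \<in> X" by (rule dilation_mem) (use Suc t in auto)
  have h0: "?h \<in> L0" using t by (intro csym_L0 XL0 f) auto
  have h: "?h \<in> X" "N ?h <= N (dilation (1/t) ?g)"
   by (rule lattice_mem[OF h0 d]; rule AE_I2; rule le)+
  have "N (dilation (1/t) ?g) <= t powr \<alpha> * N ?g" by (rule dec) (use Suc in auto)
  also have "\<dots> <= t powr \<alpha> * ((t powr \<alpha>)^k * N f)" using Suc by (intro mult_left_mono) auto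
  finally show ?case using h by (simp add: mult.assoc)
 qed
 show ?thesis
 proof (rule that[of "(2 / t) powr \<alpha>" \<alpha>])
  fix f and i :: nat assume f: "f \<in> X" and i: "1 <= i"
  \<comment> \<open>If \<open>t^k\<close> were equal to \<open>\<tau>\<close>, both the factor
    \<open>2 / t^k\<close> would be \<open>2^i\<close> and half the cut-off would be
    \<open>(1/2)^i\<close>. The \<open>k\<close> chosen satisfies
    \<open>t^Suc k < \<tau> \<le> t^k\<close>.\<close>
  define \<tau> :: real where "\<tau> = 2 * (1/2)^i"
  have \<tau>: "0 < \<tau>" "\<tau> <= 1" using i by (auto simp: \<tau>_def power_eq_if[of _ i] power_le_one)
  define m where "m = (LEAST m. t^m < \<tau>)"
  obtain m' where "t^m' < \<tau>" using real_arch_pow_inv[OF \<tau>(1) t(2)] by blast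
  then have m: "t^m < \<tau>" unfolding m_def by (rule LeastI)
  have "m \<noteq> 0" using m \<tau> by (intro notI) simp
  define k where "k = m - 1"
  have mk: "m = Suc k" using \<open>m \<noteq> 0\<close> by (simp add: k_def)
  have k: "\<tau> <= t^k" using not_less_Least[of k "%m. t^m < \<tau>"] mk unfolding m_def[symmetric] by simp
  have tk: "t^k <= \<tau> / t" using m mk t by (simp add: pos_le_divide_eq mult.commute)
  have tp: "0 < t^k" using t by simp
  let ?g = "csym (2 / t^k) (t^k) f" and ?h = "csym (2^i) ((1/2)^i) f"
  have g: "?g \<in> X" "N ?g <= (t powr \<alpha>)^k * N f" using iter[OF f] by auto
  have ti: "\<tau> * 2^i = 2" by (simp add: \<tau>_def power_mult_distrib[symmetric] mult.assoc)
  have le: "2 / t^k <= 2^i"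
  proof -
   have "2 <= t^k * 2^i" using mult_right_mono[OF k, of "2^i"] ti by simp
   then show ?thesis using tp by (simp add: pos_divide_le_eq mult.commute)
  qed
  have le2: "(1/2)^i <= t^k" using k by (simp add: \<tau>_def) (use zero_le_power[of "1/2::real" i] in linarith)
  have pt: "norm (?h s) <= norm (?g s)" for s
  proof -
   have "fstar f (2^i * \<bar>s\<bar>) <= fstar f (2 / t^k * \<bar>s\<bar>)" if "s \<noteq> 0"
    using le that tp by (intro fstar_antimono XL0 f mult_right_mono) auto
   then show ?thesis using le2 tp norm_ge_zero[of "?g s"] by (auto simp: norm_csym[OF XL0[OF f]])
  qed
  have h: "?h \<in> X" "N ?h <= N ?g"
   by (rule lattice_mem[OF csym_L0[OF XL0[OF f]] g(1)]; auto intro!: AE_I2 simp: pt)+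
  have "(t powr \<alpha>)^k = (t^k) powr \<alpha>" using t by (simp add: powr_power powr_realpow[symmetric] powr_powr mult.commute)
  also have "\<dots> <= (\<tau> / t) powr \<alpha>" using tk tp a by (intro powr_mono2) auto
  also have "\<tau> / t = (2 / t) * 2 powr (- real i)" by (simp add: \<tau>_def powr_minus powr_realpow power_one_over inverse_eq_divide)
  also have "((2 / t) * 2 powr (- real i)) powr \<alpha> = (2 / t) powr \<alpha> * 2 powr (- \<alpha> * real i)"
   using t by (subst powr_mult) (auto simp: powr_powr mult.commute)
  finally have "(t powr \<alpha>)^k * N f <= (2 / t) powr \<alpha> * 2 powr (- \<alpha> * real i) * N f"
   using norm_nonneg[OF f] by (intro mult_right_mono) auto
  then show "?h \<in> X \<and> N ?h <= (2 / t) powr \<alpha> * 2 powr (- \<alpha> * real i) * N f" using h g by auto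
 qed (use a in auto)
qed

end

section \<open>Layer-cake sums over dyadic levels\<close>

definition lvl :: "(real => complex) => nat => real" where
 "lvl f j = fstar f (2 * (1/2)^j)"

lemma lvl_nonneg: "f \<in> L0 ==> 0 <= lvl f j"
 unfolding lvl_def by (rule fstar_nonneg) auto

lemma dstr_lvl: "f \<in> L0 ==> dstr f (lvl f j) <= 2 * (1/2)^j"
 unfolding lvl_def by (rule dstr_fstar) auto

lemma emeasure_lvl: "f \<in> L0 ==> emeasure M11 {x \<in> {-1<..<1}. lvl f j < norm (f x)} <= ennreal (2 * (1/2)^j)"
 unfolding emeasure_level using dstr_lvl by (intro ennreal_leI) auto

lemma AE_le_lvl:
 assumes f: "f \<in> L0" shows "AE x in M11. \<exists>j. norm (f x) <= lvl f j"
proof -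
 let ?S = "\<Inter>j. {x \<in> {-1<..<1}. lvl f j < norm (f x)}"
 have S: "?S \<in> sets M11" using level_set_M11[OF f] by (intro sets.countable_INT) auto
 have "measure M11 ?S <= 2 * (1/2)^j" for j
 proof -
  have "measure M11 ?S <= measure M11 {x \<in> {-1<..<1}. lvl f j < norm (f x)}"
   by (intro M11.finite_measure_mono level_set_M11[OF f]) blast
  then show ?thesis using dstr_lvl[OF f, of j] by (simp add: dstr_def)
 qed
 moreover have "(%j. 2 * (1/2)^j) \<longlonglongrightarrow> (2 * 0 :: real)" by (intro tendsto_intros LIMSEQ_power_zero) auto
 ultimately have "measure M11 ?S <= 0" by (intro LIMSEQ_le_const[of "%j. 2 * (1/2)^j"]) auto
 then have "?S \<in> null_sets M11" using S by (auto simp: null_sets_def M11.emeasure_eq_measure intro: antisym)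
 then have "AE x in M11. x \<notin> ?S" by (rule AE_not_in)
 then show ?thesis
 proof (rule AE_mp, intro AE_I2 impI)
  fix x assume "x \<in> space M11" "x \<notin> ?S"
  then obtain j where "\<not> lvl f j < norm (f x)" by auto
  then show "\<exists>j. norm (f x) <= lvl f j" by (auto simp: not_less)
 qed
qed

text \<open>Layer cake over the increasing heights \<open>lvl f j\<close>: between the levels
  \<open>j\<close> and \<open>j + 1\<close> the modulus is at most \<open>lvl f (Suc j)\<close>, and
  this happens only where \<open>f\<close> exceeds level \<open>j\<close>, a set of measure at most
  \<open>2 * (1/2)^j\<close>.\<close>

lemma nn_integral_above_lvl:
 assumes f: "f \<in> L0" and p: "0 < p"
 shows "(\<integral>\<^sup>+x. (if lvl f n < norm (f x) then ennreal (norm (f x) powr p) else 0) \<partial>M11)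
   <= (\<Sum>j. if n <= j then ennreal (lvl f (Suc j) powr p * (2 * (1/2)^j)) else 0)"
proof -
 note [measurable] = f
 let ?A = "%j. {x \<in> {-1<..<1}. lvl f j < norm (f x)}"
 note As[measurable] = level_set_M11[OF f]
 have "(\<integral>\<^sup>+x. (if lvl f n < norm (f x) then ennreal (norm (f x) powr p) else 0) \<partial>M11)
  <= (\<integral>\<^sup>+x. (\<Sum>j. (if n <= j then ennreal (lvl f (Suc j) powr p) else 0) * indicator (?A j) x) \<partial>M11)"
 proof (rule nn_integral_mono_AE, rule AE_mp[OF AE_le_lvl[OF f]], intro AE_I2 impI)
  fix x assume x: "x \<in> space M11" and "\<exists>j. norm (f x) <= lvl f j"
  then obtain J' where J': "norm (f x) <= lvl f J'" by blast
  let ?t = "%j. (if n <= j then ennreal (lvl f (Suc j) powr p) else 0) * indicator (?A j) x"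
  show "(if lvl f n < norm (f x) then ennreal (norm (f x) powr p) else 0) <= (\<Sum>j. ?t j)"
  proof (cases "lvl f n < norm (f x)")
   case True
   \<comment> \<open>The first level from \<open>n\<close> on that dominates \<open>f x\<close>. Its
     predecessor is still exceeded, so a single summand already majorises the left side.\<close>
   define J where "J = (LEAST J. n <= J \<and> norm (f x) <= lvl f J)"
   have mono: "lvl f i <= lvl f k" if "i <= k" for i k
    unfolding lvl_def using that by (intro fstar_antimono f) (auto intro: power_decreasing)
   have ex: "n <= max n J' \<and> norm (f x) <= lvl f (max n J')" using J' mono[of J' "max n J'"] by auto
   have J: "n <= J" "norm (f x) <= lvl f J" using LeastI[of "%J. n <= J \<and> norm (f x) <= lvl f J", OF ex] unfolding J_def by auto
   have "J \<noteq> n" using True J by auto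
   then have Jn: "n <= J - 1" "Suc (J - 1) = J" using J by auto
   have "\<not> (n <= J - 1 \<and> norm (f x) <= lvl f (J - 1))" unfolding J_def by (rule not_less_Least) (use Jn J_def in linarith)
   then have "lvl f (J - 1) < norm (f x)" using Jn by auto
   then have "x \<in> ?A (J - 1)" using x by simp
   then have "?t (J - 1) = ennreal (lvl f J powr p)" using Jn by (simp only: indicator_simps mult_1_right if_True)
   moreover have "ennreal (norm (f x) powr p) <= ennreal (lvl f J powr p)" using J p by (auto intro!: ennreal_leI powr_mono2)
   moreover have "sum ?t {J - 1} <= (\<Sum>j. ?t j)" by (rule sum_le_suminf) auto
   moreover have "sum ?t {J - 1} = ?t (J - 1)" by (simp only: sum.insert[OF finite.emptyI, of "J - 1"] sum.empty empty_iff not_False_eq_True add_0_right)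
   ultimately have "ennreal (norm (f x) powr p) <= (\<Sum>j. ?t j)" by order
   then show ?thesis using True by simp
  qed simp
 qed
 also have "\<dots> = (\<Sum>j. (if n <= j then ennreal (lvl f (Suc j) powr p) else 0) * emeasure M11 (?A j))"
  by (subst nn_integral_suminf) (auto simp: nn_integral_cmult_indicator As simp del: greaterThanLessThan_iff)
 also have "\<dots> <= (\<Sum>j. if n <= j then ennreal (lvl f (Suc j) powr p * (2 * (1/2)^j)) else 0)"
 proof (intro suminf_le allI)
  fix j
  have "ennreal (lvl f (Suc j) powr p) * emeasure M11 (?A j) <= ennreal (lvl f (Suc j) powr p) * ennreal (2 * (1/2)^j)"
   by (intro mult_left_mono emeasure_lvl f) auto
  then show "(if n <= j then ennreal (lvl f (Suc j) powr p) else 0) * emeasure M11 (?A j) <= (if n <= j then ennreal (lvl f (Suc j) powr p * (2 * (1/2)^j)) else 0)"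
   by (simp add: ennreal_mult)
 qed auto
 finally show ?thesis .
qed

text \<open>The complementary part of the layer cake. Points below the lowest level have no
  predecessor level and are paid for with the full measure 2.\<close>

lemma nn_integral_below_lvl:
 assumes f: "f \<in> L0" and p: "0 < p"
 shows "(\<integral>\<^sup>+x. (if lvl f n < norm (f x) then 0 else ennreal (norm (f x) powr p)) \<partial>M11)
   <= ennreal (2 * lvl f 0 powr p) + (\<Sum>j<n. ennreal (lvl f (Suc j) powr p * (2 * (1/2)^j)))"
proof -
 note [measurable] = f
 let ?A = "%j. {x \<in> {-1<..<1}. lvl f j < norm (f x)}"
 note As[measurable] = level_set_M11[OF f]
 have "(\<integral>\<^sup>+x. (if lvl f n < norm (f x) then 0 else ennreal (norm (f x) powr p)) \<partial>M11)
  <= (\<integral>\<^sup>+x. ennreal (lvl f 0 powr p) + (\<Sum>j<n. ennreal (lvl f (Suc j) powr p) * indicator (?A j) x) \<partial>M11)"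
 proof (intro nn_integral_mono)
  fix x assume x: "x \<in> space M11"
  let ?t = "%j. ennreal (lvl f (Suc j) powr p) * indicator (?A j) x"
  show "(if lvl f n < norm (f x) then 0 else ennreal (norm (f x) powr p)) <= ennreal (lvl f 0 powr p) + (\<Sum>j<n. ?t j)"
  proof (cases "lvl f n < norm (f x)")
   case False
   define J where "J = (LEAST J. norm (f x) <= lvl f J)"
   have J: "norm (f x) <= lvl f J" unfolding J_def by (rule LeastI[of _ n]) (use False in simp)
   have Jn: "J <= n" unfolding J_def by (rule Least_le) (use False in simp)
   show ?thesis
   proof (cases "J = 0")
    case True
    then have "ennreal (norm (f x) powr p) <= ennreal (lvl f 0 powr p)" using J p by (auto intro!: ennreal_leI powr_mono2)
    then show ?thesis using False by (simp add: add_increasing2)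
   next
    case J0: False
    then have "\<not> norm (f x) <= lvl f (J - 1)" unfolding J_def by (intro not_less_Least) (use J0 J_def in linarith)
    then have "x \<in> ?A (J - 1)" using x by simp
    moreover have "Suc (J - 1) = J" using J0 by simp
    ultimately have "?t (J - 1) = ennreal (lvl f J powr p)" by (simp only: indicator_simps mult_1_right)
    moreover have "ennreal (norm (f x) powr p) <= ennreal (lvl f J powr p)" using J p by (auto intro!: ennreal_leI powr_mono2)
    moreover have "?t (J - 1) <= (\<Sum>j<n. ?t j)" using J0 Jn by (intro member_le_sum) auto
    ultimately have "ennreal (norm (f x) powr p) <= (\<Sum>j<n. ?t j)" by order
    then show ?thesis using False by (simp add: add_increasing)
   qed
  qed simp
 qed
 also have "\<dots> = ennreal (lvl f 0 powr p) * emeasure M11 (space M11) + (\<Sum>j<n. ennreal (lvl f (Suc j) powr p) * emeasure M11 (?A j))"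
 proof -
  have m: "(%x. ennreal c * indicator (?A j) x) \<in> borel_measurable M11" for c j
   by (rule borel_measurable_times_ennreal[OF borel_measurable_const borel_measurable_indicator[OF As]])
  have m2: "(%x. \<Sum>j<n. ennreal (lvl f (Suc j) powr p) * indicator (?A j) x) \<in> borel_measurable M11"
   by (rule borel_measurable_sum) (rule m)
  have "(\<integral>\<^sup>+x. (\<Sum>j<n. ennreal (lvl f (Suc j) powr p) * indicator (?A j) x) \<partial>M11) = (\<Sum>j<n. ennreal (lvl f (Suc j) powr p) * emeasure M11 (?A j))"
   by (subst nn_integral_sum[OF m]) (simp only: nn_integral_cmult_indicator[OF As])
  then show ?thesis by (subst nn_integral_add[OF borel_measurable_const m2]) (simp only: nn_integral_const)
 qed
 also have "\<dots> <= ennreal (2 * lvl f 0 powr p) + (\<Sum>j<n. ennreal (lvl f (Suc j) powr p * (2 * (1/2)^j)))"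
 proof (intro add_mono sum_mono)
  show "ennreal (lvl f 0 powr p) * emeasure M11 (space M11) <= ennreal (2 * lvl f 0 powr p)"
   by (simp add: emeasure_restrict_space ennreal_mult mult.commute)
  fix j
  have "ennreal (lvl f (Suc j) powr p) * emeasure M11 (?A j) <= ennreal (lvl f (Suc j) powr p) * ennreal (2 * (1/2)^j)"
   by (intro mult_left_mono emeasure_lvl f) auto
  then show "ennreal (lvl f (Suc j) powr p) * emeasure M11 (?A j) <= ennreal (lvl f (Suc j) powr p * (2 * (1/2)^j))"
   by (simp add: ennreal_mult)
 qed
 finally show ?thesis .
qed

lemma geometric_partial_le:
 fixes \<rho> :: real assumes "0 <= \<rho>" "\<rho> < 1"
 shows "(\<Sum>i<k. \<rho>^i) <= 1 / (1 - \<rho>)"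
proof -
 have "(\<Sum>i<k. \<rho>^i) = (1 - \<rho>^k) / (1 - \<rho>)"
  using assms by (subst sum_gp_strict) auto
 also have "\<dots> <= 1 / (1 - \<rho>)" using assms by (intro divide_right_mono) auto
 finally show ?thesis .
qed

lemma AE_abs_less_one: "AE s in M11. 0 <= \<bar>s::real\<bar> \<and> \<bar>s\<bar> < 1"
 by (rule AE_I2) auto

context ri_space
begin

lemma sum_mem:
 assumes "\<And>i. i < k ==> G i \<in> X"
 shows "(%s. \<Sum>i<k. G i s) \<in> X \<and> N (%s. \<Sum>i<k. G i s) <= (\<Sum>i<(k::nat). N (G i))"
 using assms
proof (induction k)
 case 0
 have "N (%x. 0) = 0" using norm_zero_iff[OF zero_mem] by (simp add: ae_eq_def)
 then show ?case using zero_mem by simp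
next
 case (Suc k)
 then have IH: "(%s. \<Sum>i<k. G i s) \<in> X" "N (%s. \<Sum>i<k. G i s) <= (\<Sum>i<k. N (G i))" and G: "G k \<in> X" by auto
 show ?case using add_mem[OF IH(1) G] norm_triangle[OF IH(1) G] IH(2) by simp
qed

text \<open>For \<open>0 < \<bar>s\<bar> < 1\<close> monotonicity gives
  \<open>fstar f c \<le> fstar f (c * \<bar>s\<bar>)\<close>, so the constant function is dominated
  a.e. by \<open>csym c 1 f\<close>. Comparing norms turns a bound in \<open>X\<close> into a
  pointwise one.\<close>

lemma fstar_bound:
 assumes f: "f \<in> X" and c: "0 < c" and mem: "csym c 1 f \<in> X"
 shows "fstar f c <= N (csym c 1 f) / N (%x. 1)"
proof -
 let ?g = "%x. cr (fstar f c) * 1"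
 have f0: "0 <= fstar f c" by (rule fstar_nonneg[OF XL0[OF f] c])
 have "AE s in M11. s \<noteq> 0"
  unfolding AE_M11 using AE_lborel_singleton[of "0::real"] by eventually_elim simp
 then have "AE s in M11. norm (?g s) <= norm (csym c 1 f s)"
  using AE_abs_less_one
 proof eventually_elim
  case (elim s)
  have "fstar f c <= fstar f (c * \<bar>s\<bar>)"
   using c elim by (intro fstar_antimono XL0 f) (auto simp: mult_le_cancel_left2)
  then show ?case using elim f0 by (simp add: norm_csym[OF XL0[OF f] c])
 qed
 then have "N ?g <= N (csym c 1 f)" by (intro lattice_mem(2)[OF _ mem]) auto
 then have "fstar f c * N (%x. 1) <= N (csym c 1 f)"
  using norm_scale[OF one_mem(1), of "cr (fstar f c)"] f0 by simp
 then show ?thesis using one_mem(2) by (simp add: pos_le_divide_eq)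
qed

text \<open>\<open>D s\<close> is 1 plus two weighted sums of dyadic dilates of the rearrangement, a
  discrete form of Calderon's operator: contractions of \<open>\<bar>s\<bar>\<close> with weights
  \<open>2 powr (- a * i)\<close>, expansions, cut off at \<open>(1/2)^i\<close>, with weights
  \<open>2 powr (b * i)\<close>. As \<open>a\<close> lies above \<open>\<beta>\<close> and
  \<open>b\<close> below \<open>\<alpha>\<close>, the norms of the terms decay geometrically, and
  the Fatou property puts the sum into \<open>X\<close>. Each inequality keeps a single
  term.\<close>

theorem boyd_majorant:
 assumes "upper_Boyd X N < 1" "0 < lower_Boyd X N"
 obtains \<alpha> \<beta> where "0 < \<alpha>" "0 < \<beta>" "\<beta> < 1"
  "\<And>f p. f \<in> X ==> 0 < p ==> \<beta> * p < 1 ==> (\<integral>\<^sup>+x. ennreal (norm (f x) powr p) \<partial>M11) < \<infinity>"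
  "\<And>f a b. f \<in> X ==> \<beta> < a ==> 0 < b ==> b < \<alpha> ==>
    \<exists>D. (%s. cr (D s)) \<in> X \<and> (\<forall>s. 1 <= D s) \<and>
     (\<forall>s i. 0 < \<bar>s\<bar> \<and> \<bar>s\<bar> < 1 --> fstar f ((1/2)^i * \<bar>s\<bar>) <= 2 powr (a * real i) * D s) \<and>
     (\<forall>s i. 0 < \<bar>s\<bar> \<and> \<bar>s\<bar> < 1 \<and> 1 <= i \<and> \<bar>s\<bar> <= (1/2)^i --> fstar f (2^i * \<bar>s\<bar>) <= 2 powr (- b * real i) * D s)"
proof -
 obtain C1 \<beta> where C1: "0 <= C1" and b: "0 < \<beta>" "\<beta> < 1"
  and up: "\<And>f c. f \<in> X ==> 0 < c ==> c <= 1 ==> csym c 1 f \<in> X \<and> N (csym c 1 f) <= C1 * c powr (- \<beta>) * N f"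
  using csym_expand_bound[OF assms(1)] by blast
 obtain C2 \<alpha> where C2: "0 <= C2" and a: "0 < \<alpha>"
  and lo: "\<And>f i. f \<in> X ==> 1 <= i ==> csym (2^i) ((1/2)^i) f \<in> X \<and> N (csym (2^i) ((1/2)^i) f) <= C2 * 2 powr (- \<alpha> * real i) * N f"
  using csym_shrink_bound[OF assms(2)] by blast
 \<comment> \<open>A weak-type embedding: rearrangements of elements of \<open>X\<close> are at most
   a multiple of \<open>c powr (- \<beta>)\<close>. It gives both the integrability for
   \<open>\<beta> * p < 1\<close> and the pointwise convergence of the sum over
   contractions.\<close>
 have weak: "fstar f c <= (C1 * N f / N (%x. 1)) * c powr (- \<beta>)" if f: "f \<in> X" and c: "0 < c" "c <= 1" for f c
 proof -
  have "fstar f c <= N (csym c 1 f) / N (%x. 1)" using up[OF f c] by (intro fstar_bound f c) auto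
  also have "\<dots> <= (C1 * c powr (- \<beta>) * N f) / N (%x. 1)" using up[OF f c] one_mem(2) by (intro divide_right_mono) auto
  finally show ?thesis by (simp add: mult_ac)
 qed
 show ?thesis
 proof (rule that[OF a b])
  fix f p assume f: "f \<in> X" and p: "0 < p" "\<beta> * p < (1::real)"
  note f0 = XL0[OF f]
  define W where "W = C1 * N f / N (%x. 1)"
  have W: "0 <= W" using C1 norm_nonneg[OF f] one_mem(2) by (simp add: W_def)
  define \<rho> where "\<rho> = 2 powr (\<beta> * p - 1)"
  have \<rho>: "0 <= \<rho>" "\<rho> < 1" using p powr_less_mono[of "\<beta> * p - 1" 0 2] by (auto simp: \<rho>_def)
  have trm: "lvl f (Suc j) powr p * (2 * (1/2)^j) <= 2 * W powr p * \<rho>^j" for j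
  proof -
   have c: "(0::real) < (1/2)^j" "(1/2::real)^j <= 1" by (auto intro: power_le_one)
   have hp: "(1/2::real)^j = 2 powr (- real j)" by (simp add: powr_minus powr_realpow power_one_over inverse_eq_divide)
   have "lvl f (Suc j) = fstar f ((1/2)^j)" by (simp add: lvl_def)
   also have "\<dots> <= W * ((1/2)^j) powr (- \<beta>)" unfolding W_def by (rule weak[OF f c])
   also have "((1/2)^j) powr (- \<beta>) = 2 powr (\<beta> * real j)" unfolding hp by (simp add: powr_powr mult.commute)
   finally have "lvl f (Suc j) powr p <= (W * 2 powr (\<beta> * real j)) powr p" using p lvl_nonneg[OF f0] by (intro powr_mono2) auto
   also have "\<dots> = W powr p * 2 powr (\<beta> * real j * p)" using W by (subst powr_mult) (auto simp: powr_powr)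
   finally have "lvl f (Suc j) powr p * (2 * (1/2)^j) <= W powr p * 2 powr (\<beta> * real j * p) * (2 * (1/2)^j)"
    by (intro mult_right_mono) auto
   also have "\<dots> = 2 * W powr p * (2 powr (\<beta> * real j * p) * 2 powr (- real j))" unfolding hp by simp
   also have "2 powr (\<beta> * real j * p) * 2 powr (- real j) = \<rho>^j"
    unfolding \<rho>_def powr_add[symmetric] by (simp add: powr_power algebra_simps)
   finally show ?thesis .
  qed
  have "(\<integral>\<^sup>+x. ennreal (norm (f x) powr p) \<partial>M11) =
    (\<integral>\<^sup>+x. (if lvl f 0 < norm (f x) then ennreal (norm (f x) powr p) else 0) + (if lvl f 0 < norm (f x) then 0 else ennreal (norm (f x) powr p)) \<partial>M11)"
   by (intro nn_integral_cong) auto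
  also have "\<dots> = (\<integral>\<^sup>+x. (if lvl f 0 < norm (f x) then ennreal (norm (f x) powr p) else 0) \<partial>M11) + (\<integral>\<^sup>+x. (if lvl f 0 < norm (f x) then 0 else ennreal (norm (f x) powr p)) \<partial>M11)"
  proof (rule nn_integral_add)
   note [measurable] = f0
   show "(%x. if lvl f 0 < norm (f x) then ennreal (norm (f x) powr p) else 0) \<in> borel_measurable M11"
    "(%x. if lvl f 0 < norm (f x) then 0 else ennreal (norm (f x) powr p)) \<in> borel_measurable M11" by measurable
  qed
  also have "\<dots> <= (\<Sum>j. if 0 <= j then ennreal (lvl f (Suc j) powr p * (2 * (1/2)^j)) else 0) + (ennreal (2 * lvl f 0 powr p) + (\<Sum>j<0. ennreal (lvl f (Suc j) powr p * (2 * (1/2)^j))))"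
   by (intro add_mono nn_integral_above_lvl nn_integral_below_lvl f0 p)
  also have "\<dots> = (\<Sum>j. ennreal (lvl f (Suc j) powr p * (2 * (1/2)^j))) + ennreal (2 * lvl f 0 powr p)" by simp
  also have "\<dots> <= (\<Sum>j. ennreal (2 * W powr p * \<rho>^j)) + ennreal (2 * lvl f 0 powr p)"
   using trm by (intro add_right_mono suminf_le allI ennreal_leI) auto
  also have "(\<Sum>j. ennreal (2 * W powr p * \<rho>^j)) = ennreal (\<Sum>j. 2 * W powr p * \<rho>^j)"
   using \<rho> by (intro suminf_ennreal2) (auto intro!: summable_mult summable_geometric)
  also have "ennreal (\<Sum>j. 2 * W powr p * \<rho>^j) + ennreal (2 * lvl f 0 powr p) < \<infinity>" by simp
  finally show "(\<integral>\<^sup>+x. ennreal (norm (f x) powr p) \<partial>M11) < \<infinity>" .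
 next
  fix f a' b' assume f: "f \<in> X" and a': "\<beta> < a'" and b': "0 < b'" "b' < \<alpha>"
  note f0 = XL0[OF f]
  have nf: "0 <= N f" by (rule norm_nonneg[OF f])
  define \<rho>1 where "\<rho>1 = 2 powr (\<beta> - a')"
  define \<rho>2 where "\<rho>2 = 2 powr (b' - \<alpha>)"
  have \<rho>1: "0 <= \<rho>1" "\<rho>1 < 1" using a' powr_less_mono[of "\<beta> - a'" 0 2] by (auto simp: \<rho>1_def)
  have \<rho>2: "0 <= \<rho>2" "\<rho>2 < 1" using b' powr_less_mono[of "b' - \<alpha>" 0 2] by (auto simp: \<rho>2_def)
  have hp: "(1/2::real)^j = 2 powr (- real j)" for j by (simp add: powr_minus powr_realpow power_one_over inverse_eq_divide)
  have c: "(0::real) < (1/2)^j" "(1/2::real)^j <= 1" for j by (auto intro: power_le_one)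
  define G1 where "G1 = (%i s. cr (2 powr (- a' * real i)) * csym ((1/2)^i) 1 f s)"
  \<comment> \<open>Index 0 is switched off: the shrinking bound starts at \<open>i = 1\<close>, and
    scale 0 already occurs in \<open>G1\<close>.\<close>
  define G2 where "G2 = (%i s. cr (if i = 0 then 0 else 2 powr (b' * real i)) * csym (2^i) ((1/2)^i) f s)"
  have G1: "G1 i \<in> X" "N (G1 i) <= C1 * N f * \<rho>1^i" for i
  proof -
   note u = up[OF f c, of i]
   show "G1 i \<in> X" unfolding G1_def using u by (intro scale_mem) auto
   have "N (G1 i) = 2 powr (- a' * real i) * N (csym ((1/2)^i) 1 f)"
    unfolding G1_def using u by (subst norm_scale) auto
   also have "\<dots> <= 2 powr (- a' * real i) * (C1 * ((1/2)^i) powr (- \<beta>) * N f)" using u by (intro mult_left_mono) auto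
   also have "\<dots> = C1 * N f * (2 powr (- a' * real i) * 2 powr (\<beta> * real i))"
    unfolding hp by (simp add: powr_powr mult_ac)
   also have "2 powr (- a' * real i) * 2 powr (\<beta> * real i) = \<rho>1^i"
    unfolding \<rho>1_def powr_add[symmetric] by (simp add: powr_power algebra_simps)
   finally show "N (G1 i) <= C1 * N f * \<rho>1^i" .
  qed
  have G2: "G2 i \<in> X \<and> N (G2 i) <= C2 * N f * \<rho>2^i" for i
  proof (cases "i = 0")
   case True
   have "N (%x. 0) = 0" using norm_zero_iff[OF zero_mem] by (simp add: ae_eq_def)
   then show ?thesis using True C2 nf zero_mem by (simp add: G2_def)
  next
   case False
   then have u: "csym (2^i) ((1/2)^i) f \<in> X" "N (csym (2^i) ((1/2)^i) f) <= C2 * 2 powr (- \<alpha> * real i) * N f"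
    using lo[OF f, of i] by auto
   have "N (G2 i) = 2 powr (b' * real i) * N (csym (2^i) ((1/2)^i) f)"
    unfolding G2_def using u False by (subst norm_scale) auto
   also have "\<dots> <= 2 powr (b' * real i) * (C2 * 2 powr (- \<alpha> * real i) * N f)" using u by (intro mult_left_mono) auto
   also have "\<dots> = C2 * N f * (2 powr (b' * real i) * 2 powr (- \<alpha> * real i))" by (simp add: mult_ac)
   also have "2 powr (b' * real i) * 2 powr (- \<alpha> * real i) = \<rho>2^i"
    unfolding \<rho>2_def powr_add[symmetric] by (simp add: powr_power algebra_simps)
   finally show ?thesis using u unfolding G2_def by (intro conjI scale_mem) auto
  qed
  define G where "G = (%i s. G1 i s + G2 i s)"
  have G: "G i \<in> X" "N (G i) <= C1 * N f * \<rho>1^i + C2 * N f * \<rho>2^i" for i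
   unfolding G_def using add_mem[OF G1(1)[of i] conjunct1[OF G2[of i]]] norm_triangle[OF G1(1)[of i] conjunct1[OF G2[of i]]] G1(2)[of i] G2[of i] by auto
  define F where "F = (%k s. 1 + (\<Sum>i<k. G i s))"
  have F: "F k \<in> X" "N (F k) <= N (%x. 1) + (C1 * N f / (1 - \<rho>1) + C2 * N f / (1 - \<rho>2))" for k
  proof -
   have s: "(%s. \<Sum>i<k. G i s) \<in> X" "N (%s. \<Sum>i<k. G i s) <= (\<Sum>i<k. N (G i))" using sum_mem[of k G] G(1) by auto
   show "F k \<in> X" unfolding F_def by (rule add_mem[OF one_mem(1) s(1)])
   have "(\<Sum>i<k. N (G i)) <= (\<Sum>i<k. C1 * N f * \<rho>1^i + C2 * N f * \<rho>2^i)" by (intro sum_mono G)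
   also have "\<dots> = C1 * N f * (\<Sum>i<k. \<rho>1^i) + C2 * N f * (\<Sum>i<k. \<rho>2^i)" by (simp add: sum.distrib sum_distrib_left)
   also have "\<dots> <= C1 * N f * (1 / (1 - \<rho>1)) + C2 * N f * (1 / (1 - \<rho>2))"
    using C1 C2 nf \<rho>1 \<rho>2 by (intro add_mono mult_left_mono geometric_partial_le) auto
   finally show "N (F k) <= N (%x. 1) + (C1 * N f / (1 - \<rho>1) + C2 * N f / (1 - \<rho>2))"
    using norm_triangle[OF one_mem(1) s(1)] s(2) unfolding F_def by simp
  qed
  define g where "g = (%i s. 2 powr (- a' * real i) * norm (csym ((1/2)^i) 1 f s) + (if i = 0 then 0 else 2 powr (b' * real i)) * norm (csym (2^i) ((1/2)^i) f s))"
  have rc: "csym c d f s = cr (norm (csym c d f s))" if "0 < c" for c d s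
   using norm_csym[OF f0 that, of d s] by (auto simp: csym_def)
  have Gg: "G i s = cr (g i s)" for i s
   unfolding G_def G1_def G2_def g_def using rc[of "(1/2)^i" 1 s] rc[of "2^i" "(1/2)^i" s] by simp
  have g0: "0 <= g i s" for i s unfolding g_def by (intro add_nonneg_nonneg mult_nonneg_nonneg) auto
  define W where "W = C1 * N f / N (%x. 1)"
  have W: "0 <= W" using C1 nf one_mem(2) by (simp add: W_def)
  \<comment> \<open>The Fatou property speaks about a limit function, so pointwise convergence comes
    before any norm estimate. The first part converges by \<open>weak\<close>; of the second only
    finitely many cut-off terms are nonzero at a given \<open>s \<noteq> 0\<close>.\<close>
  have summ: "summable (%i. g i s)" for s
  proof (cases "s = 0 \<or> 1 < \<bar>s\<bar>")
   case True
   have "(1/2::real)^i <= 1" for i by (rule c)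
   then have "csym (2^i) ((1/2)^i) f s = 0" for i using True by (auto simp: csym_def intro: less_le_trans) (meson le_less_trans)
   then show ?thesis using True by (simp add: g_def csym_def)
  next
   case False
   have 1: "summable (%i. 2 powr (- a' * real i) * norm (csym ((1/2)^i) 1 f s))"
   proof (rule summable_comparison_test')
    show "summable (%i. (W * \<bar>s\<bar> powr (- \<beta>)) * \<rho>1^i)" using \<rho>1 by (intro summable_mult summable_geometric) auto
    fix i
    have cs: "0 < (1/2)^i * \<bar>s\<bar>" "(1/2)^i * \<bar>s\<bar> <= 1"
     using False c[of i] mult_mono[of "(1/2)^i" 1 "\<bar>s\<bar>" 1] by auto
    have "norm (csym ((1/2)^i) 1 f s) = fstar f ((1/2)^i * \<bar>s\<bar>)" using False norm_csym[OF f0 c(1)[of i], of 1 s] by simp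
    also have "\<dots> <= W * ((1/2)^i * \<bar>s\<bar>) powr (- \<beta>)" unfolding W_def by (rule weak[OF f cs])
    also have "((1/2)^i * \<bar>s\<bar>) powr (- \<beta>) = 2 powr (\<beta> * real i) * \<bar>s\<bar> powr (- \<beta>)"
     unfolding hp by (subst powr_mult) (auto simp: powr_powr mult.commute)
    finally have "2 powr (- a' * real i) * norm (csym ((1/2)^i) 1 f s) <= 2 powr (- a' * real i) * (W * (2 powr (\<beta> * real i) * \<bar>s\<bar> powr (- \<beta>)))"
     by (intro mult_left_mono) auto
    also have "\<dots> = (W * \<bar>s\<bar> powr (- \<beta>)) * (2 powr (- a' * real i) * 2 powr (\<beta> * real i))" by (simp add: mult_ac)
    also have "2 powr (- a' * real i) * 2 powr (\<beta> * real i) = \<rho>1^i"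
     unfolding \<rho>1_def powr_add[symmetric] by (simp add: powr_power algebra_simps)
    finally show "norm (2 powr (- a' * real i) * norm (csym ((1/2)^i) 1 f s)) <= (W * \<bar>s\<bar> powr (- \<beta>)) * \<rho>1^i" by simp
   qed
   have 2: "summable (%i. (if i = 0 then 0 else 2 powr (b' * real i)) * norm (csym (2^i) ((1/2)^i) f s))"
   proof -
    obtain m where m: "(1/2::real)^m < \<bar>s\<bar>" using real_arch_pow_inv[of "\<bar>s\<bar>" "1/2"] False by auto
    show ?thesis
    proof (rule summable_finite[of "{..<m}"])
     fix i assume "i \<notin> {..<m}"
     then have "(1/2::real)^i <= (1/2)^m" by (intro power_decreasing) auto
     then have "(1/2)^i < \<bar>s\<bar>" using m by linarith
     then have "csym (2^i) ((1/2)^i) f s = 0" by (simp add: csym_def)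
     then show "(if i = 0 then 0 else 2 powr (b' * real i)) * norm (csym (2^i) ((1/2)^i) f s) = 0" by simp
    qed simp
   qed
   show ?thesis unfolding g_def by (rule summable_add[OF 1 2])
  qed
  define D where "D = (%s. 1 + (\<Sum>i. g i s))"
  have Fr: "F k s = cr (1 + (\<Sum>i<k. g i s))" for k s unfolding F_def Gg by simp
  have lim: "(%k. F k s) \<longlonglongrightarrow> cr (D s)" for s
   unfolding Fr D_def by (intro tendsto_of_real tendsto_add tendsto_const summable_LIMSEQ summ)
  have D0: "(%s. cr (D s)) \<in> L0"
   by (rule borel_measurable_LIMSEQ_metric[of F]) (use XL0[OF F(1)] lim in auto)
  have DX: "(%s. cr (D s)) \<in> X"
  proof -
   have "AE x in M11. (\<forall>n. Im (F n x) = 0 \<and> 0 <= Re (F n x)) \<and> incseq (%n. Re (F n x)) \<and> (%n. F n x) \<longlonglongrightarrow> cr (D x)"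
   proof (intro AE_I2 conjI allI lim)
    fix x n
    show "Im (F n x) = 0" unfolding Fr by simp
    show "0 <= Re (F n x)" unfolding Fr using g0 by (simp add: sum_nonneg add_nonneg_nonneg)
    show "incseq (%n. Re (F n x))" unfolding Fr by (rule incseq_SucI) (simp add: g0)
   qed
   moreover have "bdd_above (range (%n. N (F n)))" using F(2) by (intro bdd_aboveI2) auto
   ultimately show ?thesis using Fatou[of F "%s. cr (D s)", OF F(1) D0] by blast
  qed
  have gD: "g i s <= D s" for i s
  proof -
   have "sum (%i. g i s) {i} <= (\<Sum>i. g i s)" by (rule sum_le_suminf[OF summ]) (use g0 in auto)
   then show ?thesis by (simp add: D_def)
  qed
  show "\<exists>D. (%s. cr (D s)) \<in> X \<and> (\<forall>s. 1 <= D s) \<and>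
     (\<forall>s i. 0 < \<bar>s\<bar> \<and> \<bar>s\<bar> < 1 --> fstar f ((1/2)^i * \<bar>s\<bar>) <= 2 powr (a' * real i) * D s) \<and>
     (\<forall>s i. 0 < \<bar>s\<bar> \<and> \<bar>s\<bar> < 1 \<and> 1 <= i \<and> \<bar>s\<bar> <= (1/2)^i --> fstar f (2^i * \<bar>s\<bar>) <= 2 powr (- b' * real i) * D s)"
  proof (intro exI[of _ D] conjI DX allI impI)
   fix s show "1 <= D s" unfolding D_def using suminf_nonneg[OF summ g0] by simp
  next
   fix s :: real and i assume s: "0 < \<bar>s\<bar> \<and> \<bar>s\<bar> < 1"
   have "2 powr (- a' * real i) * norm (csym ((1/2)^i) 1 f s) <= g i s" unfolding g_def by simp
   also note gD
   also have "norm (csym ((1/2)^i) 1 f s) = fstar f ((1/2)^i * \<bar>s\<bar>)" using s norm_csym[OF f0 c(1)[of i], of 1 s] by auto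
   finally have "2 powr (a' * real i) * (2 powr (- a' * real i) * fstar f ((1/2)^i * \<bar>s\<bar>)) <= 2 powr (a' * real i) * D s"
    by (intro mult_left_mono) auto
   then show "fstar f ((1/2)^i * \<bar>s\<bar>) <= 2 powr (a' * real i) * D s" by (simp add: mult.assoc[symmetric] powr_add[symmetric])
  next
   fix s :: real and i :: nat assume s: "0 < \<bar>s\<bar> \<and> \<bar>s\<bar> < 1 \<and> 1 <= i \<and> \<bar>s\<bar> <= (1/2)^i"
   have "2 powr (b' * real i) * norm (csym (2^i) ((1/2)^i) f s) <= g i s" unfolding g_def using s by auto
   also note gD
   also have "norm (csym (2^i) ((1/2)^i) f s) = fstar f (2^i * \<bar>s\<bar>)" using s norm_csym[OF f0, of "2^i" "(1/2)^i" s] by auto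
   finally have "2 powr (- b' * real i) * (2 powr (b' * real i) * fstar f (2^i * \<bar>s\<bar>)) <= 2 powr (- b' * real i) * D s"
    by (intro mult_left_mono) auto
   then show "fstar f (2^i * \<bar>s\<bar>) <= 2 powr (- b' * real i) * D s" by (simp add: mult.assoc[symmetric] powr_add[symmetric])
  qed
 qed
qed

end

section \<open>Interpolation between two exponents\<close>

lemma ptrunc_integrable:
 assumes i: "integrable lborel f" and e: "0 < e"
 shows "integrable lborel (%s. indicator {s. e < \<bar>s - x\<bar>} s *\<^sub>R (f s / cr (s - x)))"
proof (rule Bochner_Integration.integrable_bound[OF integrable_scaleR_right[OF i, of "1/e"]])
 have [measurable]: "f \<in> BM" using borel_measurable_integrable[OF i] by simp
 show "(%s. indicator {s. e < \<bar>s - x\<bar>} s *\<^sub>R (f s / cr (s - x))) \<in> borel_measurable lborel" by measurable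
 show "AE s in lborel. norm (indicator {s. e < \<bar>s - x\<bar>} s *\<^sub>R (f s / cr (s - x))) <= norm ((1/e) *\<^sub>R f s)"
 proof (rule AE_I2)
  fix s
  have "norm (f s) / \<bar>s - x\<bar> <= norm (f s) / e" if "e < \<bar>s - x\<bar>"
   using that e by (intro divide_left_mono) auto
  then show "norm (indicator {s. e < \<bar>s - x\<bar>} s *\<^sub>R (f s / cr (s - x))) <= norm ((1/e) *\<^sub>R f s)"
   using e by (auto simp: norm_divide indicator_def simp del: of_real_diff)
 qed
qed

lemma ptrunc_add:
 assumes f: "integrable lborel f" and g: "integrable lborel g" and e: "0 < e"
 shows "ptrunc e (%s. f s + g s) x = ptrunc e f x + ptrunc e g x"
proof -
 have "indicator {s. e < \<bar>s - x\<bar>} s *\<^sub>R ((f s + g s) / cr (s - x)) =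
   indicator {s. e < \<bar>s - x\<bar>} s *\<^sub>R (f s / cr (s - x)) + indicator {s. e < \<bar>s - x\<bar>} s *\<^sub>R (g s / cr (s - x))" for s
  by (simp add: add_divide_distrib scaleR_add_right)
 then show ?thesis unfolding ptrunc_def
  using ptrunc_integrable[OF f e, of x] ptrunc_integrable[OF g e, of x]
  by (simp only: Bochner_Integration.integral_add distrib_left)
qed

lemma nn_integral_markov_powr:
 fixes h :: "real => complex"
 assumes [measurable]: "h \<in> BM" and p: "0 < p" and r: "0 < r"
  and le: "(\<integral>\<^sup>+x. ennreal (norm (h x) powr p) \<partial>lborel) <= ennreal (c * r powr p)" and c: "0 <= c"
 shows "emeasure lborel {x. r < norm (h x)} <= ennreal c"
proof -
 have rp: "0 < r powr p" using r by simp
 have "ennreal (r powr p) * emeasure lborel {x. r < norm (h x)} = (\<integral>\<^sup>+x. ennreal (r powr p) * indicator {x. r < norm (h x)} x \<partial>lborel)"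
  by (subst nn_integral_cmult_indicator) auto
 also have "\<dots> <= (\<integral>\<^sup>+x. ennreal (norm (h x) powr p) \<partial>lborel)"
  using r p by (intro nn_integral_mono) (auto simp: indicator_def intro!: ennreal_leI powr_mono2)
 also note le
 finally have "ennreal (r powr p) * emeasure lborel {x. r < norm (h x)} <= ennreal (c * r powr p)" .
 then have "ennreal (1 / r powr p) * (ennreal (r powr p) * emeasure lborel {x. r < norm (h x)}) <= ennreal (1 / r powr p) * ennreal (c * r powr p)"
  by (rule mult_left_mono) simp
 moreover have "ennreal (1 / r powr p) * ennreal (r powr p) = 1" using rp by (simp add: ennreal_mult[symmetric])
 moreover have "ennreal (1 / r powr p) * ennreal (c * r powr p) = ennreal c" using rp c by (simp add: ennreal_mult[symmetric])
 ultimately show ?thesis by (simp add: mult.assoc[symmetric])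
qed

lemma nn_integral_M11_lborel:
 assumes f: "f \<in> L0" and eq: "AE x in lborel. x \<in> {-1<..<1} --> f x = f' x" and supp: "\<And>s. s \<notin> {-1<..<1} ==> f' s = 0"
  and \<phi>0: "\<phi> 0 = (0::ennreal)"
 shows "(\<integral>\<^sup>+x. \<phi> (f x) \<partial>M11) = (\<integral>\<^sup>+x. \<phi> (f' x) \<partial>lborel)"
proof -
 have "(\<integral>\<^sup>+x. \<phi> (f x) \<partial>M11) = (\<integral>\<^sup>+x. \<phi> (f x) * indicator {-1<..<1} x \<partial>lebesgue)"
  by (subst nn_integral_restrict_space) auto
 also have "\<dots> = (\<integral>\<^sup>+x. \<phi> (f x) * indicator {-1<..<1} x \<partial>lborel)" by (rule nn_integral_completion)
 also have "\<dots> = (\<integral>\<^sup>+x. \<phi> (f' x) \<partial>lborel)"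
 proof (rule nn_integral_cong_AE, use eq in eventually_elim)
  case (elim x) then show ?case using supp[of x] \<phi>0 by (cases "x \<in> {-1<..<1}") auto
 qed
 finally show ?thesis .
qed

lemma dstr_le_emeasure:
 assumes h: "h \<in> BM" and le: "emeasure lborel {x. r < norm (h x)} <= ennreal c" and c: "0 <= c"
 shows "dstr h r <= c"
proof -
 note [measurable] = h
 have "ennreal (dstr h r) = emeasure lebesgue {x \<in> {-1<..<1}. r < norm (h x)}"
  unfolding emeasure_level[symmetric] by (subst emeasure_restrict_space) auto
 also have "\<dots> = emeasure lborel {x \<in> {-1<..<1}. r < norm (h x)}"
 proof -
  have S: "{x \<in> {-1<..<1}. r < norm (h x)} \<in> sets borel" by measurable
  have "emeasure lebesgue {x \<in> {-1<..<1}. r < norm (h x)} = (\<integral>\<^sup>+x. indicator {x \<in> {-1<..<1}. r < norm (h x)} x \<partial>lebesgue)"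
   using S by (intro nn_integral_indicator[symmetric] sets_completionI_sets) simp
  also have "\<dots> = (\<integral>\<^sup>+x. indicator {x \<in> {-1<..<1}. r < norm (h x)} x \<partial>lborel)" by (rule nn_integral_completion)
  also have "\<dots> = emeasure lborel {x \<in> {-1<..<1}. r < norm (h x)}" using S by (intro nn_integral_indicator) simp
  finally show ?thesis .
 qed
 also have "\<dots> <= emeasure lborel {x. r < norm (h x)}" by (intro emeasure_mono) auto
 also note le
 finally show ?thesis using c by simp
qed

context ri_space
begin

text \<open>Interpolation of Marcinkiewicz type, scale by scale. For \<open>\<bar>s\<bar>\<close> of
  size \<open>(1/2)^n\<close> the function is split at height \<open>lvl f n\<close>: the high part
  obeys the L^p bound, the low part the L^q bound, and \<open>D s\<close> controls both integrals.
  Markov's inequality shows that \<open>h\<close> exceeds a fixed multiple of \<open>D s\<close> on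
  a set of measure at most \<open>2 * \<bar>s\<bar>\<close>, so that multiple of \<open>D\<close>
  dominates \<open>h\<close> in distribution.\<close>

theorem hilbert_on_X:
 assumes ub: "upper_Boyd X N < 1" and lb: "0 < lower_Boyd X N" and f: "f \<in> X"
 obtains f' h p where "f' \<in> BM" "\<And>s. s \<notin> {-1<..<1} ==> f' s = 0"
  "AE x in lborel. x \<in> {-1<..<1} --> f x = f' x" "integrable lborel f'"
  "1 < p" "cos (p * pi / 2) \<noteq> 0" "(\<integral>\<^sup>+s. ennreal (norm (f' s) powr p) \<partial>lborel) < \<infinity>"
  "h \<in> BM" "AE x in lborel. ((%e. ptrunc e f' x) \<longlongrightarrow> h x) (at_right 0)"
  "AE x in M11. finite_Hilbert f x = h x" "h \<in> X"
proof -
 obtain \<alpha> \<beta> where \<alpha>: "0 < \<alpha>" and \<beta>: "0 < \<beta>" "\<beta> < 1"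
  and Lp: "\<And>f p. f \<in> X ==> 0 < p ==> \<beta> * p < 1 ==> (\<integral>\<^sup>+x. ennreal (norm (f x) powr p) \<partial>M11) < \<infinity>"
  and maj: "\<And>f a b. f \<in> X ==> \<beta> < a ==> 0 < b ==> b < \<alpha> ==>
    \<exists>D. (%s. cr (D s)) \<in> X \<and> (\<forall>s. 1 <= D s) \<and>
     (\<forall>s i. 0 < \<bar>s\<bar> \<and> \<bar>s\<bar> < 1 --> fstar f ((1/2)^i * \<bar>s\<bar>) <= 2 powr (a * real i) * D s) \<and>
     (\<forall>s i. 0 < \<bar>s\<bar> \<and> \<bar>s\<bar> < 1 \<and> 1 <= i \<and> \<bar>s\<bar> <= (1/2)^i --> fstar f (2^i * \<bar>s\<bar>) <= 2 powr (- b * real i) * D s)"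
  using boyd_majorant[OF ub lb] by blast
 note f0 = XL0[OF f]
 \<comment> \<open>The midpoint of 1 and \<open>1 / \<beta>\<close>, capped at 3/2:
   \<open>\<beta> * p < 1\<close> puts \<open>f\<close> into L^p, and \<open>1 < p < 2\<close> makes
   \<open>cos (p * pi / 2)\<close> negative.\<close>
 define p where "p = min (3/2) ((1 + 1/\<beta>) / 2)"
 have "(1 + 1/\<beta>) / 2 < 1/\<beta>" "1 < (1 + 1/\<beta>) / 2" using \<beta> by (auto simp: field_simps)
 moreover have "p <= (1 + 1/\<beta>) / 2" "p <= 3/2" unfolding p_def by (rule min.cobounded2, rule min.cobounded1)
 moreover have "p = 3/2 \<or> p = (1 + 1/\<beta>) / 2" unfolding p_def min_def by presburger
 ultimately have p: "1 < p" "p < 2" "p < 1/\<beta>" by linarith+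
 have p\<beta>: "\<beta> * p < 1" using p(3) \<beta> by (simp add: field_simps)
 have "cos (p * pi / 2) < cos (pi / 2)" using p by (intro cos_monotone_0_pi) auto
 then have pc: "cos (p * pi / 2) \<noteq> 0" by simp
 \<comment> \<open>The midpoint of \<open>\<beta>\<close> and \<open>1 / p\<close>: above
   \<open>\<beta>\<close> for the majorant, below \<open>1 / p\<close> so that the high-part series
   has ratio \<open>\<rho>1 < 1\<close>.\<close>
 define a where "a = (\<beta> + 1/p) / 2"
 have a: "\<beta> < a" "a * p < 1" using p p\<beta> \<beta> by (auto simp: a_def field_simps)
 define b where "b = \<alpha> / 2"
 have b: "0 < b" "b < \<alpha>" using \<alpha> by (auto simp: b_def)
 obtain m :: nat where m: "1 / b < real m" using reals_Archimedean2 by blast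
 \<comment> \<open>An even integer, where the cosine is 1 or -1, large enough for
   \<open>b * q > 1\<close>; the low-part series then has ratio \<open>\<rho>2 < 1\<close>.\<close>
 define q where "q = 2 * real (m + 1)"
 have q1: "1 < q" by (simp add: q_def)
 have bq: "1 < b * q"
 proof -
  have "1 < b * real m" using m b by (simp add: field_simps)
  also have "\<dots> <= b * q" using b by (intro mult_left_mono) (auto simp: q_def)
  finally show ?thesis .
 qed
 have "q * pi / 2 = real (m + 1) * pi" by (simp add: q_def field_simps)
 then have "cos (q * pi / 2) = cos (real (m + 1) * pi)" by (rule arg_cong)
 also have "\<dots> \<noteq> 0" unfolding cos_npi by simp
 finally have qc: "cos (q * pi / 2) \<noteq> 0" .
 obtain f' where f'[measurable]: "f' \<in> BM" and supp: "\<And>s. s \<notin> {-1<..<1} ==> f' s = 0"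
  and eq: "AE x in lborel. x \<in> {-1<..<1} --> f x = f' x" using borel_representative[OF f0] by blast
 have supp1: "f' s = 0" if "1 < \<bar>s\<bar>" for s by (rule supp) (use that in auto)
 have f'p: "(\<integral>\<^sup>+s. ennreal (norm (f' s) powr p) \<partial>lborel) < \<infinity>"
  using Lp[OF f _ p\<beta>] p nn_integral_M11_lborel[OF f0 eq supp, of "%z. ennreal (norm z powr p)"] by simp
 have f'i: "integrable lborel f'" by (rule powr_le_imp_integrable[OF f' supp1 p(1) f'p])
 obtain h where h[measurable]: "h \<in> BM"
  and hlim: "AE x in lborel. ((%e. ptrunc e f' x) \<longlongrightarrow> h x) (at_right 0)"
  by (rule hilbert_boundary[OF f' supp1 p(1) pc f'p])
 have heq: "AE x in M11. finite_Hilbert f x = h x"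
  unfolding AE_M11 using hlim
 proof eventually_elim
  case (elim x)
  then show ?case using finite_Hilbert_ptrunc[OF f0 f' supp eq f'i] by (auto intro: tendsto_Lim)
 qed
 have h0: "h \<in> L0" by (rule borel_L0[OF h])
 obtain D where DX: "(%s. cr (D s)) \<in> X" and D1: "\<And>s. 1 <= D s"
  and Da: "\<And>s i. 0 < \<bar>s\<bar> ==> \<bar>s\<bar> < 1 ==> fstar f ((1/2)^i * \<bar>s\<bar>) <= 2 powr (a * real i) * D s"
  and Db: "\<And>s i. 0 < \<bar>s\<bar> ==> \<bar>s\<bar> < 1 ==> 1 <= i ==> \<bar>s\<bar> <= (1/2)^i ==> fstar f (2^i * \<bar>s\<bar>) <= 2 powr (- b * real i) * D s"
  using maj[OF f a(1) b] by blast
 obtain Cp where Cp: "0 <= Cp" "\<forall>f h. f \<in> BM --> h \<in> BM --> (\<forall>s. 1 < \<bar>s\<bar> --> f s = 0) -->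
   (\<integral>\<^sup>+s. ennreal (norm (f s) powr p) \<partial>lborel) < \<infinity> -->
   (AE x in lborel. ((%e. ptrunc e f x) \<longlongrightarrow> h x) (at_right 0)) -->
   (\<integral>\<^sup>+x. ennreal (norm (h x) powr p) \<partial>lborel) <= ennreal Cp * (\<integral>\<^sup>+s. ennreal (norm (f s) powr p) \<partial>lborel)"
  using hilbert_norm_bound[OF p(1) pc] by blast
 obtain Cq where Cq: "0 <= Cq" "\<forall>f h. f \<in> BM --> h \<in> BM --> (\<forall>s. 1 < \<bar>s\<bar> --> f s = 0) -->
   (\<integral>\<^sup>+s. ennreal (norm (f s) powr q) \<partial>lborel) < \<infinity> -->
   (AE x in lborel. ((%e. ptrunc e f x) \<longlongrightarrow> h x) (at_right 0)) -->
   (\<integral>\<^sup>+x. ennreal (norm (h x) powr q) \<partial>lborel) <= ennreal Cq * (\<integral>\<^sup>+s. ennreal (norm (f s) powr q) \<partial>lborel)"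
  using hilbert_norm_bound[OF q1 qc] by blast
 define \<rho>1 where "\<rho>1 = 2 powr (a * p - 1)"
 define \<rho>2 where "\<rho>2 = 2 powr (1 - b * q)"
 have \<rho>1: "0 <= \<rho>1" "\<rho>1 < 1" using a powr_less_mono[of "a * p - 1" 0 2] by (auto simp: \<rho>1_def)
 have \<rho>2: "0 <= \<rho>2" "\<rho>2 < 1" using bq powr_less_mono[of "1 - b * q" 0 2] by (auto simp: \<rho>2_def)
 define \<kappa>1 where "\<kappa>1 = 1 / (1 - \<rho>1)"
 define \<kappa>2 where "\<kappa>2 = 1 / (1 - \<rho>2)"
 have \<kappa>: "0 <= \<kappa>1" "0 <= \<kappa>2" using \<rho>1 \<rho>2 by (auto simp: \<kappa>1_def \<kappa>2_def)
 \<comment> \<open>The factors 4 make each of the two Markov bounds at most half of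
   \<open>(1/2)^n\<close>; the summand 1 gives \<open>\<Lambda> \<ge> 1\<close>, hence
   \<open>\<Lambda> \<le> \<Lambda> powr t\<close> for \<open>t \<ge> 1\<close>.\<close>
 define \<Lambda> where "\<Lambda> = 1 + 4 * Cp * \<kappa>1 + 4 * Cq * (1 + \<kappa>2)"
 have \<Lambda>: "1 <= \<Lambda>" "4 * Cp * \<kappa>1 <= \<Lambda>" "4 * Cq * (1 + \<kappa>2) <= \<Lambda>"
  using Cp(1) Cq(1) \<kappa> by (auto simp: \<Lambda>_def add_nonneg_nonneg)
 have hp: "(1/2::real)^j = 2 powr (- real j)" for j by (simp add: powr_minus powr_realpow power_one_over inverse_eq_divide)
 have key: "dstr h (2 * \<Lambda> * D s) <= 2 * \<bar>s\<bar>" if s: "0 < \<bar>s\<bar>" "\<bar>s\<bar> < 1" for s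
 proof -
  \<comment> \<open>Locates the dyadic scale of \<open>s\<close>: with \<open>n = k - 1\<close> one
    has \<open>(1/2)^n / 2 \<le> \<bar>s\<bar> < (1/2)^n\<close>.\<close>
  define k where "k = (LEAST k. (1/2)^k <= \<bar>s\<bar>)"
  obtain k' where "(1/2)^k' < \<bar>s\<bar>" using real_arch_pow_inv[of "\<bar>s\<bar>" "1/2"] s by auto
  then have "(1/2)^k' <= \<bar>s\<bar>" by simp
  then have k: "(1/2)^k <= \<bar>s\<bar>" unfolding k_def by (rule LeastI)
  have "k \<noteq> 0" using k s by (intro notI) simp
  define n where "n = k - 1"
  have kn: "k = Suc n" using \<open>k \<noteq> 0\<close> by (simp add: n_def)
  have sn: "\<bar>s\<bar> < (1/2)^n" using not_less_Least[of n "%k. (1/2)^k <= \<bar>s\<bar>"] kn unfolding k_def[symmetric] by simp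
  have ns: "(1/2)^n <= 2 * \<bar>s\<bar>" using k kn by simp
  define d where "d = D s"
  have d: "1 <= d" by (simp add: d_def D1)
  \<comment> \<open>\<open>lvl f (Suc j)\<close> is \<open>fstar f ((1/2)^j)\<close>, and
    \<open>(1/2)^j\<close> is at least \<open>(1/2)^(j - n) * \<bar>s\<bar>\<close>; monotonicity of
    the rearrangement and the estimate \<open>Da\<close> apply. For \<open>j < n\<close> the same
    works with expansions and \<open>Db\<close>.\<close>
  have up: "lvl f (Suc j) <= 2 powr (a * real (j - n)) * d" if "n <= j" for j
  proof -
   have "(1/2)^(j - n) * \<bar>s\<bar> <= (1/2)^(j - n) * (1/2)^n" using sn by (intro mult_left_mono) auto
   also have "\<dots> = (1/2)^j" using that by (simp add: power_add[symmetric])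
   finally have "fstar f ((1/2)^j) <= fstar f ((1/2)^(j - n) * \<bar>s\<bar>)" using s by (intro fstar_antimono f0) auto
   also have "\<dots> <= 2 powr (a * real (j - n)) * d" unfolding d_def by (rule Da[OF s])
   finally show ?thesis by (simp add: lvl_def)
  qed
  have dn: "lvl f (Suc j) <= 2 powr (- b * real (n - j)) * d" if "j < n" for j
  proof -
   have e: "(1/2::real)^n * 2^(n - j) = (1/2)^j"
   proof -
    have "(1/2::real)^n = (1/2)^j * (1/2)^(n - j)" using that by (simp add: power_add[symmetric])
    then show ?thesis by (simp add: mult.assoc power_mult_distrib[symmetric])
   qed
   have "\<bar>s\<bar> * 2^(n - j) <= (1/2)^n * 2^(n - j)" using sn by (intro mult_right_mono) auto
   then have "fstar f ((1/2)^j) <= fstar f (2^(n - j) * \<bar>s\<bar>)" unfolding e using s by (intro fstar_antimono f0) (auto simp: mult.commute)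
   also have "\<dots> <= 2 powr (- b * real (n - j)) * d" unfolding d_def
   proof (rule Db[OF s])
    have "(1/2::real)^n <= (1/2)^(n - j)" by (intro power_decreasing) auto
    then show "\<bar>s\<bar> <= (1/2)^(n - j)" using sn by linarith
   qed (use that in auto)
   finally show ?thesis by (simp add: lvl_def)
  qed
  have l0: "lvl f 0 <= 2 powr (- b * real n) * d"
  proof (cases "n = 0")
   case True
   have "lvl f 0 <= fstar f ((1/2)^0 * \<bar>s\<bar>)" unfolding lvl_def using s by (intro fstar_antimono f0) auto
   also have "\<dots> <= 2 powr (a * real 0) * d" unfolding d_def by (rule Da[OF s])
   finally show ?thesis using True by simp
  next
   case False
   have "lvl f 0 <= lvl f (Suc 0)" unfolding lvl_def by (intro fstar_antimono f0) auto
   also have "\<dots> <= 2 powr (- b * real (n - 0)) * d" using False by (intro dn) auto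
   finally show ?thesis by simp
  qed
  define u where "u = (%x. if lvl f n < norm (f' x) then f' x else 0)"
  define v where "v = (%x. if lvl f n < norm (f' x) then 0 else f' x)"
  have um[measurable]: "u \<in> BM" and vm[measurable]: "v \<in> BM"
   unfolding u_def v_def by measurable
  have us: "1 < \<bar>x\<bar> ==> u x = 0" and vs: "1 < \<bar>x\<bar> ==> v x = 0" for x using supp1[of x] by (auto simp: u_def v_def)
  have up_p: "(\<integral>\<^sup>+x. ennreal (norm (u x) powr p) \<partial>lborel) <= ennreal (2 * \<kappa>1 * (1/2)^n * d powr p)"
  proof -
   have "(\<integral>\<^sup>+x. ennreal (norm (u x) powr p) \<partial>lborel) = (\<integral>\<^sup>+x. (if lvl f n < norm (f' x) then ennreal (norm (f' x) powr p) else 0) \<partial>lborel)"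
    by (intro nn_integral_cong) (auto simp: u_def)
   also have "\<dots> = (\<integral>\<^sup>+x. (if lvl f n < norm (f x) then ennreal (norm (f x) powr p) else 0) \<partial>M11)"
    by (rule nn_integral_M11_lborel[OF f0 eq supp, of "%z. if lvl f n < norm z then ennreal (norm z powr p) else 0", symmetric]) auto
   also have "\<dots> <= (\<Sum>j. if n <= j then ennreal (lvl f (Suc j) powr p * (2 * (1/2)^j)) else 0)"
    using p by (intro nn_integral_above_lvl f0) auto
   also have "\<dots> = (\<Sum>i. if n <= i + n then ennreal (lvl f (Suc (i + n)) powr p * (2 * (1/2)^(i + n))) else 0)
     + (\<Sum>j<n. if n <= j then ennreal (lvl f (Suc j) powr p * (2 * (1/2)^j)) else 0)"
    by (rule suminf_offset[where f="%j. if n <= j then ennreal (lvl f (Suc j) powr p * (2 * (1/2)^j)) else 0"]) (rule summableI)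
   also have "(\<Sum>j<n. if n <= j then ennreal (lvl f (Suc j) powr p * (2 * (1/2)^j)) else 0) = 0"
    by (intro sum.neutral) auto
   also have "(\<Sum>i. if n <= i + n then ennreal (lvl f (Suc (i + n)) powr p * (2 * (1/2)^(i + n))) else 0) + 0
     = (\<Sum>i. ennreal (lvl f (Suc (i + n)) powr p * (2 * (1/2)^(i + n))))" by simp
   also have "\<dots> <= (\<Sum>i. ennreal (2 * (1/2)^n * d powr p * \<rho>1^i))"
   proof (intro suminf_le allI ennreal_leI)
    fix i
    have "lvl f (Suc (i + n)) powr p <= (2 powr (a * real i) * d) powr p"
     using up[of "i + n"] p lvl_nonneg[OF f0] by (intro powr_mono2) auto
    also have "\<dots> = 2 powr (a * real i * p) * d powr p" using d by (subst powr_mult) (auto simp: powr_powr)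
    finally have "lvl f (Suc (i + n)) powr p * (2 * (1/2)^(i + n)) <= 2 powr (a * real i * p) * d powr p * (2 * (1/2)^(i + n))"
     by (intro mult_right_mono) auto
    also have "\<dots> = 2 * (1/2)^n * d powr p * (2 powr (a * real i * p) * (1/2)^i)" by (simp add: power_add mult_ac)
    also have "2 powr (a * real i * p) * (1/2)^i = \<rho>1^i"
     unfolding hp \<rho>1_def powr_add[symmetric] by (simp add: powr_power algebra_simps)
    finally show "lvl f (Suc (i + n)) powr p * (2 * (1/2)^(i + n)) <= 2 * (1/2)^n * d powr p * \<rho>1^i" .
   qed auto
   also have "\<dots> = ennreal (2 * (1/2)^n * d powr p * \<kappa>1)"
   proof -
    have "(%i. 2 * (1/2)^n * d powr p * \<rho>1^i) sums (2 * (1/2)^n * d powr p * \<kappa>1)"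
     unfolding \<kappa>1_def using \<rho>1 by (intro sums_mult geometric_sums) auto
    then show ?thesis using \<rho>1 by (intro suminf_ennreal_eq) auto
   qed
   finally show ?thesis by (simp add: mult_ac)
  qed
  have vp_q: "(\<integral>\<^sup>+x. ennreal (norm (v x) powr q) \<partial>lborel) <= ennreal (2 * (1 + \<kappa>2) * (1/2)^n * d powr q)"
  proof -
   have "(\<integral>\<^sup>+x. ennreal (norm (v x) powr q) \<partial>lborel) = (\<integral>\<^sup>+x. (if lvl f n < norm (f' x) then 0 else ennreal (norm (f' x) powr q)) \<partial>lborel)"
    by (intro nn_integral_cong) (auto simp: v_def)
   also have "\<dots> = (\<integral>\<^sup>+x. (if lvl f n < norm (f x) then 0 else ennreal (norm (f x) powr q)) \<partial>M11)"
    by (rule nn_integral_M11_lborel[OF f0 eq supp, of "%z. if lvl f n < norm z then 0 else ennreal (norm z powr q)", symmetric]) auto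
   also have "\<dots> <= ennreal (2 * lvl f 0 powr q) + (\<Sum>j<n. ennreal (lvl f (Suc j) powr q * (2 * (1/2)^j)))"
    using q1 by (intro nn_integral_below_lvl f0) auto
   also have "\<dots> = ennreal (2 * lvl f 0 powr q + (\<Sum>j<n. lvl f (Suc j) powr q * (2 * (1/2)^j)))"
    by (subst ennreal_plus) (auto simp: sum_ennreal intro!: sum_nonneg)
   also have "\<dots> <= ennreal (2 * (1 + \<kappa>2) * (1/2)^n * d powr q)"
   proof (rule ennreal_leI)
    have bn: "2 powr (- b * real i * q) = (1/2)^i * \<rho>2^i" for i
     unfolding hp \<rho>2_def by (simp add: powr_power powr_add[symmetric] algebra_simps)
    have "lvl f 0 powr q <= (2 powr (- b * real n) * d) powr q"
     using l0 q1 lvl_nonneg[OF f0] by (intro powr_mono2) auto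
    also have "\<dots> = 2 powr (- b * real n * q) * d powr q" using d by (subst powr_mult) (auto simp: powr_powr)
    also have "\<dots> <= (1/2)^n * d powr q"
     unfolding bn using \<rho>2 by (intro mult_right_mono) (auto intro!: mult_left_le power_le_one)
    finally have 1: "2 * lvl f 0 powr q <= 2 * ((1/2)^n * d powr q)" by simp
    have "(\<Sum>j<n. lvl f (Suc j) powr q * (2 * (1/2)^j)) <= (\<Sum>j<n. 2 * (1/2)^n * d powr q * \<rho>2^(n - j))"
    proof (intro sum_mono)
     fix j assume j: "j \<in> {..<n}"
     have "lvl f (Suc j) powr q <= (2 powr (- b * real (n - j)) * d) powr q"
      using dn[of j] j q1 lvl_nonneg[OF f0] by (intro powr_mono2) auto
     also have "\<dots> = 2 powr (- b * real (n - j) * q) * d powr q" using d by (subst powr_mult) (auto simp: powr_powr)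
     finally have "lvl f (Suc j) powr q * (2 * (1/2)^j) <= ((1/2)^(n - j) * \<rho>2^(n - j)) * d powr q * (2 * (1/2)^j)"
      unfolding bn by (intro mult_right_mono) auto
     also have "\<dots> = 2 * ((1/2)^(n - j) * (1/2)^j) * d powr q * \<rho>2^(n - j)" by (simp add: mult_ac)
     also have "(1/2::real)^(n - j) * (1/2)^j = (1/2)^n" using j by (simp add: power_add[symmetric])
     finally show "lvl f (Suc j) powr q * (2 * (1/2)^j) <= 2 * (1/2)^n * d powr q * \<rho>2^(n - j)" .
    qed
    also have "\<dots> = 2 * (1/2)^n * d powr q * (\<Sum>j<n. \<rho>2^(n - j))" by (simp add: sum_distrib_left)
    also have "(\<Sum>j<n. \<rho>2^(n - j)) = (\<Sum>j<n. \<rho>2^(Suc j))"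
     by (rule sum.reindex_bij_witness[of _ "%j. n - Suc j" "%j. n - Suc j"]) (auto simp del: power_Suc simp: Suc_diff_Suc)
    also have "\<dots> <= (\<Sum>j<n. \<rho>2^j)" using \<rho>2 by (intro sum_mono power_decreasing) auto
    also have "\<dots> <= \<kappa>2" unfolding \<kappa>2_def by (rule geometric_partial_le[OF \<rho>2])
    finally have 2: "(\<Sum>j<n. lvl f (Suc j) powr q * (2 * (1/2)^j)) <= 2 * (1/2)^n * d powr q * \<kappa>2"
     by (simp add: mult_left_mono)
    show "2 * lvl f 0 powr q + (\<Sum>j<n. lvl f (Suc j) powr q * (2 * (1/2)^j)) <= 2 * (1 + \<kappa>2) * (1/2)^n * d powr q"
     using 1 2 by (simp add: algebra_simps)
   qed
   finally show ?thesis .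
  qed
  have up_fin: "(\<integral>\<^sup>+x. ennreal (norm (u x) powr p) \<partial>lborel) < \<infinity>" using up_p by (rule le_less_trans) simp
  have vq_fin: "(\<integral>\<^sup>+x. ennreal (norm (v x) powr q) \<partial>lborel) < \<infinity>" using vp_q by (rule le_less_trans) simp
  have ui: "integrable lborel u" by (rule powr_le_imp_integrable[OF um us p(1) up_fin])
  have vi: "integrable lborel v" by (rule powr_le_imp_integrable[OF vm vs q1 vq_fin])
  obtain hv where hv[measurable]: "hv \<in> BM"
   and hvl: "AE x in lborel. ((%e. ptrunc e v x) \<longlongrightarrow> hv x) (at_right 0)"
   by (rule hilbert_boundary[OF vm vs q1 qc vq_fin])
  \<comment> \<open>As a difference it satisfies \<open>hu + hv = h\<close> everywhere; that it is
    the limit of the truncations of \<open>u\<close> follows from additivity.\<close>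
  define hu where "hu = (%x. h x - hv x)"
  have hu[measurable]: "hu \<in> BM" unfolding hu_def by measurable
  have hul: "AE x in lborel. ((%e. ptrunc e u x) \<longlongrightarrow> hu x) (at_right 0)"
   using hlim hvl
  proof eventually_elim
   case (elim x)
   have "((%e. ptrunc e f' x - ptrunc e v x) \<longlongrightarrow> hu x) (at_right 0)" unfolding hu_def by (intro tendsto_diff elim)
   moreover have "\<forall>\<^sub>F e in at_right 0. ptrunc e f' x - ptrunc e v x = ptrunc e u x"
   proof -
    have "ptrunc e f' x - ptrunc e v x = ptrunc e u x" if "0 < e" for e
    proof -
     have "(%x. u x + v x) = f'" by (auto simp: u_def v_def fun_eq_iff)
     then show ?thesis using ptrunc_add[OF ui vi that, of x] by simp
    qed
    then show ?thesis by (auto simp: eventually_at_right_field intro!: exI[of _ 1])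
   qed
   ultimately show ?case by (rule Lim_transform_eventually)
  qed
  have r: "0 < \<Lambda> * d" using \<Lambda>(1) d by simp
  have pw: "\<Lambda> * d powr t <= (\<Lambda> * d) powr t" if "1 <= t" for t
  proof -
   have "\<Lambda> powr 1 <= \<Lambda> powr t" using \<Lambda>(1) that by (intro powr_mono) auto
   then have "\<Lambda> * d powr t <= \<Lambda> powr t * d powr t" using \<Lambda>(1) by (intro mult_right_mono) auto
   then show ?thesis using \<Lambda>(1) d by (simp add: powr_mult)
  qed
  have Hu: "emeasure lborel {x. \<Lambda> * d < norm (hu x)} <= ennreal ((1/2)^n / 2)"
  proof (rule nn_integral_markov_powr[OF hu _ r])
   have "(\<integral>\<^sup>+x. ennreal (norm (hu x) powr p) \<partial>lborel) <= ennreal Cp * (\<integral>\<^sup>+x. ennreal (norm (u x) powr p) \<partial>lborel)"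
    by (rule Cp(2)[rule_format]) (use um hu us up_fin hul in auto)
   also have "\<dots> <= ennreal Cp * ennreal (2 * \<kappa>1 * (1/2)^n * d powr p)" using up_p by (intro mult_left_mono) auto
   also have "\<dots> = ennreal (Cp * (2 * \<kappa>1 * (1/2)^n * d powr p))" using Cp(1) by (simp add: ennreal_mult')
   also have "\<dots> <= ennreal ((1/2)^n / 2 * (\<Lambda> * d) powr p)"
   proof (rule ennreal_leI)
    have "4 * Cp * \<kappa>1 * d powr p <= \<Lambda> * d powr p" using \<Lambda> by (intro mult_right_mono) auto
    also have "\<dots> <= (\<Lambda> * d) powr p" using p by (intro pw) auto
    finally have "(1/2)^n / 2 * (4 * Cp * \<kappa>1 * d powr p) <= (1/2)^n / 2 * (\<Lambda> * d) powr p" by (intro mult_left_mono) auto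
    moreover have "(1/2)^n / 2 * (4 * Cp * \<kappa>1 * d powr p) = Cp * (2 * \<kappa>1 * (1/2)^n * d powr p)" by simp
    ultimately show "Cp * (2 * \<kappa>1 * (1/2)^n * d powr p) <= (1/2)^n / 2 * (\<Lambda> * d) powr p" by linarith
   qed
   finally show "(\<integral>\<^sup>+x. ennreal (norm (hu x) powr p) \<partial>lborel) <= ennreal ((1/2)^n / 2 * (\<Lambda> * d) powr p)" .
  qed (use p in auto)
  have Hv: "emeasure lborel {x. \<Lambda> * d < norm (hv x)} <= ennreal ((1/2)^n / 2)"
  proof (rule nn_integral_markov_powr[OF hv _ r])
   have "(\<integral>\<^sup>+x. ennreal (norm (hv x) powr q) \<partial>lborel) <= ennreal Cq * (\<integral>\<^sup>+x. ennreal (norm (v x) powr q) \<partial>lborel)"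
    by (rule Cq(2)[rule_format]) (use vm hv vs vq_fin hvl in auto)
   also have "\<dots> <= ennreal Cq * ennreal (2 * (1 + \<kappa>2) * (1/2)^n * d powr q)" using vp_q by (intro mult_left_mono) auto
   also have "\<dots> = ennreal (Cq * (2 * (1 + \<kappa>2) * (1/2)^n * d powr q))" using Cq(1) by (simp add: ennreal_mult')
   also have "\<dots> <= ennreal ((1/2)^n / 2 * (\<Lambda> * d) powr q)"
   proof (rule ennreal_leI)
    have "4 * Cq * (1 + \<kappa>2) * d powr q <= \<Lambda> * d powr q" using \<Lambda> by (intro mult_right_mono) auto
    also have "\<dots> <= (\<Lambda> * d) powr q" using q1 by (intro pw) auto
    finally have "(1/2)^n / 2 * (4 * Cq * (1 + \<kappa>2) * d powr q) <= (1/2)^n / 2 * (\<Lambda> * d) powr q" by (intro mult_left_mono) auto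
    moreover have "(1/2)^n / 2 * (4 * Cq * (1 + \<kappa>2) * d powr q) = Cq * (2 * (1 + \<kappa>2) * (1/2)^n * d powr q)"
    proof -
     have "c / 2 * (4 * Cq * k * y) = Cq * (2 * k * c * y)" for c k y :: real by simp
     then show ?thesis .
    qed
    ultimately show "Cq * (2 * (1 + \<kappa>2) * (1/2)^n * d powr q) <= (1/2)^n / 2 * (\<Lambda> * d) powr q" by linarith
   qed
   finally show "(\<integral>\<^sup>+x. ennreal (norm (hv x) powr q) \<partial>lborel) <= ennreal ((1/2)^n / 2 * (\<Lambda> * d) powr q)" .
  qed (use q1 in auto)
  have "emeasure lborel {x. 2 * \<Lambda> * d < norm (h x)} <= emeasure lborel ({x. \<Lambda> * d < norm (hu x)} \<union> {x. \<Lambda> * d < norm (hv x)})"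
  proof (rule emeasure_mono)
   show "{x. 2 * \<Lambda> * d < norm (h x)} \<subseteq> {x. \<Lambda> * d < norm (hu x)} \<union> {x. \<Lambda> * d < norm (hv x)}"
   proof
    fix x assume "x \<in> {x. 2 * \<Lambda> * d < norm (h x)}"
    moreover have "norm (h x) <= norm (hu x) + norm (hv x)" using norm_triangle_ineq[of "hu x" "hv x"] by (simp add: hu_def)
    ultimately show "x \<in> {x. \<Lambda> * d < norm (hu x)} \<union> {x. \<Lambda> * d < norm (hv x)}" by auto
   qed
  qed measurable
  also have "\<dots> <= emeasure lborel {x. \<Lambda> * d < norm (hu x)} + emeasure lborel {x. \<Lambda> * d < norm (hv x)}"
   by (rule emeasure_subadditive) measurable
  also have "\<dots> <= ennreal ((1/2)^n / 2) + ennreal ((1/2)^n / 2)" by (intro add_mono Hu Hv)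
  also have "\<dots> = ennreal ((1/2)^n)" by (subst ennreal_plus[symmetric]) auto
  finally have "dstr h (2 * \<Lambda> * d) <= (1/2)^n" by (rule dstr_le_emeasure[OF h]) simp
  then show ?thesis using ns by (simp add: d_def)
 qed
 define g where "g = (%s. cr (2 * \<Lambda>) * cr (D s))"
 have gX: "g \<in> X" unfolding g_def by (rule scale_mem[OF DX])
 \<comment> \<open>If \<open>2 * \<bar>s\<bar> < dstr h r\<close>, then \<open>key\<close> forces
   \<open>r < norm (g s)\<close>. The set of such nonzero \<open>s\<close> has measure exactly
   \<open>dstr h r\<close>.\<close>
 have "dstr h r <= dstr g r" for r
 proof -
  define m where "m = dstr h r"
  have m: "0 <= m / 2" "m / 2 <= 1" using dstr_bounds[of h r] by (auto simp: m_def)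
  have "m = measure M11 {s \<in> {-1<..<1}. s \<noteq> 0 \<and> \<bar>s\<bar> < m / 2}" using measure_M11_abs_less[OF m] by simp
  also have "\<dots> <= measure M11 {s \<in> {-1<..<1}. r < norm (g s)}"
  proof (rule M11.finite_measure_mono[OF _ level_set_M11[OF XL0[OF gX]]])
   show "{s \<in> {-1<..<1}. s \<noteq> 0 \<and> \<bar>s\<bar> < m / 2} \<subseteq> {s \<in> {-1<..<1}. r < norm (g s)}"
   proof
    fix s assume s: "s \<in> {s \<in> {-1<..<1}. s \<noteq> 0 \<and> \<bar>s\<bar> < m / 2}"
    then have s1: "0 < \<bar>s\<bar>" "\<bar>s\<bar> < 1" "2 * \<bar>s\<bar> < m" by auto
    have "r < 2 * \<Lambda> * D s"
    proof (rule ccontr)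
     assume "\<not> r < 2 * \<Lambda> * D s"
     then have "dstr h r <= dstr h (2 * \<Lambda> * D s)" by (intro dstr_antimono h0) simp
     also have "\<dots> <= 2 * \<bar>s\<bar>" by (rule key[OF s1(1,2)])
     finally show False using s1(3) by (simp add: m_def)
    qed
    also have "2 * \<Lambda> * D s = norm (g s)" using \<Lambda>(1) D1[of s] by (simp add: g_def norm_mult)
    finally show "s \<in> {s \<in> {-1<..<1}. r < norm (g s)}" using s by simp
   qed
  qed
  finally show ?thesis by (simp add: m_def dstr_def)
 qed
 then have "h \<in> X" using dstr_mem(1)[OF h0 gX] by blast
 then show ?thesis using that[OF f' supp eq f'i p(1) pc f'p h hlim heq] by blast
qed

end

section \<open>Symmetries of the spectra\<close>

lemma AE_lborel_reflect:
 assumes "AE x in lborel. P x" shows "AE x in lborel. P (- x :: real)"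
proof -
 obtain A where A: "{x \<in> space lborel. \<not> P x} \<subseteq> A" "A \<in> null_sets lborel"
  using assms by (auto simp: eventually_ae_filter)
 have "emeasure lborel (uminus -` A :: real set) = emeasure (distr lborel borel uminus) A"
  using A(2) by (subst emeasure_distr) (auto dest: null_setsD2)
 also have "\<dots> = 0" using A(2) lborel_distr_uminus by (simp add: null_sets_def)
 finally have "uminus -` A \<in> null_sets lborel"
  using A(2) measurable_sets[of uminus borel borel A] by (auto simp: null_sets_def)
 moreover have "{x \<in> space lborel. \<not> P (- x)} \<subseteq> uminus -` A" using A(1) by auto
 ultimately show ?thesis by (rule AE_I')
qed

text \<open>\<open>finite_Hilbert f\<close> is known only almost everywhere, with unspecified values
  elsewhere; completeness of Lebesgue measure still makes it measurable.\<close>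

lemma L0_AE_cong:
 assumes h: "h \<in> L0" and eq: "AE x in M11. g x = h x"
 shows "g \<in> L0"
proof -
 let ?S = "{-1<..<1::real}"
 have "AE x in lebesgue. x \<in> ?S --> g x = h x" using eq by (subst (asm) AE_restrict_space_iff) auto
 then obtain A where A: "{x \<in> space lebesgue. \<not> (x \<in> ?S --> g x = h x)} \<subseteq> A" "A \<in> null_sets lebesgue"
  by (auto simp: eventually_ae_filter)
 have "(%x. if x \<in> ?S then g x else 0) \<in> borel_measurable lebesgue"
 proof (rule borel_measurableI)
  fix U :: "complex set" assume U: "open U"
  let ?G = "%x. if x \<in> ?S then g x else 0" and ?H = "%x. if x \<in> ?S then h x else 0"
  have "?H \<in> borel_measurable lebesgue" using h by (intro borel_measurable_if_I) auto
  then have B: "?H -` U \<in> sets lebesgue" using U measurable_sets[of ?H lebesgue borel U] by simp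
  have "?G -` U \<inter> A \<subseteq> A" by blast
  then have "negligible (?G -` U \<inter> A)" using A(2) by (metis negligible_iff_null_sets negligible_subset)
  then have N: "?G -` U \<inter> A \<in> sets lebesgue" by (metis negligible_iff_null_sets null_setsD2)
  have "?G x = ?H x" if "x \<notin> A" for x using A(1) that by auto
  then have "?G -` U \<inter> space lebesgue = (?H -` U - A) \<union> (?G -` U \<inter> A)" by auto
  moreover have "(?H -` U - A) \<union> (?G -` U \<inter> A) \<in> sets lebesgue" using B N A(2) by (intro sets.Un sets.Diff) (auto dest: null_setsD2)
  ultimately show "?G -` U \<inter> space lebesgue \<in> sets lebesgue" by metis
 qed
 then show ?thesis by (subst (asm) borel_measurable_if) auto
qed

lemma ptrunc_scale: "ptrunc e (%s. c * f s) x = c * ptrunc e f x"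
proof -
 have "indicator {s. e < \<bar>s - x\<bar>} s *\<^sub>R (c * f s / cr (s - x)) = c * (indicator {s. e < \<bar>s - x\<bar>} s *\<^sub>R (f s / cr (s - x)))" for s
  by simp
 then show ?thesis unfolding ptrunc_def by (simp only: integral_mult_right_zero mult.left_commute)
qed

lemma ptrunc_cnj: "ptrunc e (%s. cnj (f s)) x = - cnj (ptrunc e f x)"
proof -
 have "indicator {s. e < \<bar>s - x\<bar>} s *\<^sub>R (cnj (f s) / cr (s - x)) = cnj (indicator {s. e < \<bar>s - x\<bar>} s *\<^sub>R (f s / cr (s - x)))" for s
  by simp
 then have "(\<integral>s. indicator {s. e < \<bar>s - x\<bar>} s *\<^sub>R (cnj (f s) / cr (s - x)) \<partial>lborel)
  = cnj (\<integral>s. indicator {s. e < \<bar>s - x\<bar>} s *\<^sub>R (f s / cr (s - x)) \<partial>lborel)"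
  by (simp only: Bochner_Integration.integral_cnj)
 then show ?thesis unfolding ptrunc_def by simp
qed

lemma ptrunc_reflect: "ptrunc e (%s. f (- s)) x = - ptrunc e f (- x)"
proof -
 let ?F = "%s. indicator {s. e < \<bar>s - x\<bar>} s *\<^sub>R (f (- s) / cr (s - x))"
 have "?F (0 + (-1) * s) = - (indicator {s. e < \<bar>s - (-x)\<bar>} s *\<^sub>R (f s / cr (s - (-x))))" for s
 proof -
  have a: "cr (- s - x) = - cr (s - (- x))" by simp
  have b: "f s / cr (- s - x) = - (f s / cr (s - (- x)))"
   unfolding a by (rule divide_minus_right)
  have c: "\<bar>- s - x\<bar> = \<bar>s - (- x)\<bar>" by simp
  have d: "indicator {s. e < \<bar>s - x\<bar>} (- s) = (indicator {s. e < \<bar>s - (- x)\<bar>} s :: real)"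
   unfolding indicator_def mem_Collect_eq c ..
  have "0 + (-1) * s = - s" by simp
  then show ?thesis by (simp only: d b minus_minus scaleR_minus_right)
 qed
 then have "integral\<^sup>L lborel ?F = - (\<integral>s. indicator {s. e < \<bar>s - (-x)\<bar>} s *\<^sub>R (f s / cr (s - (-x))) \<partial>lborel)"
  using lborel_integral_real_affine[of "-1" ?F 0] by (simp only: integral_minus) simp
 then show ?thesis unfolding ptrunc_def by simp
qed

lemma ae_eq_sym: "ae_eq f g ==> ae_eq g f"
 unfolding ae_eq_def by (erule AE_mp) (auto intro: AE_I2)

lemma ae_eq_trans:
 assumes "ae_eq f g" "ae_eq g h" shows "ae_eq f h"
 using assms unfolding ae_eq_def by eventually_elim simp

lemma reflect_L0:
 assumes f: "f \<in> L0"
 shows "(%x. f (- x)) \<in> L0" "dstr (%x. f (- x)) r = dstr f r"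
proof -
 let ?g = "%x. if x \<in> {-1<..<1} then f x else 0"
 note m = lebesgue_measurable_mult[of "-1"]
 have gm: "?g \<in> borel_measurable lebesgue" using f by (intro borel_measurable_if_I) auto
 have "(%x. ?g ((-1) * x)) \<in> borel_measurable lebesgue" by (rule measurable_compose[OF m gm])
 moreover have "(%x. ?g ((-1) * x)) = (%x. if x \<in> {-1<..<1} then f (- x) else 0)" by (auto simp: fun_eq_iff)
 ultimately have "(%x. if x \<in> {-1<..<1} then f (- x) else 0) \<in> borel_measurable lebesgue" by (simp only:)
 then show "(%x. f (- x)) \<in> L0" by (subst (asm) borel_measurable_if) auto
 let ?A = "{x \<in> {-1<..<1}. r < norm (f x)}"
 have A: "?A \<in> sets lebesgue" using level_set_M11[OF f, of r] by (simp add: sets_restrict_space_iff)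
 have meq: "emeasure M11 B = emeasure lebesgue B" if "B \<subseteq> {-1<..<1}" for B
  using that by (subst emeasure_restrict_space) auto
 have refl: "emeasure lebesgue B = emeasure lebesgue ((%x. (-1) * x) -` B \<inter> space lebesgue)"
  if B: "B \<in> sets lebesgue" for B :: "real set"
 proof -
  have "emeasure lebesgue B = emeasure (density (distr lebesgue lebesgue (%x. (-1) * x)) (%x. ennreal \<bar>-1\<bar>)) B"
   using lebesgue_real_scale[of "-1"] by simp
  also have "\<dots> = emeasure (distr lebesgue lebesgue (%x. (-1) * x)) B"
   using B by (subst emeasure_density) auto
  also have "\<dots> = emeasure lebesgue ((%x. (-1) * x) -` B \<inter> space lebesgue)"
   by (rule emeasure_distr[OF m B])
  finally show ?thesis .
 qed
 note refl[OF A]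
 also have "(%x. (-1) * x) -` ?A \<inter> space lebesgue = {x \<in> {-1<..<1}. r < norm (f (- x))}" by auto
 finally have "emeasure M11 ?A = emeasure M11 {x \<in> {-1<..<1}. r < norm (f (- x))}"
  by (subst (1 2) meq) blast+
 then have "ennreal (dstr f r) = ennreal (dstr (%x. f (- x)) r)" unfolding emeasure_level .
 then show "dstr (%x. f (- x)) r = dstr f r" using dstr_bounds(1) by simp
qed

context ri_space
begin

text \<open>Compatibility with \<open>ae_eq\<close> is not among the clauses of
  \<open>bounded_op\<close>. It follows from linearity and the norm bound, since
  \<open>f - g\<close> has norm zero.\<close>

lemma bounded_op_ae:
 assumes S: "bounded_op X N S" and f: "f \<in> X" and g: "g \<in> X" and eq: "ae_eq f g"
 shows "ae_eq (S f) (S g)"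
proof -
 let ?mg = "%x. (-1) * g x" and ?d = "%x. f x + (-1) * g x"
 obtain C where SX: "\<And>f. f \<in> X ==> S f \<in> X" and C: "\<And>f. f \<in> X ==> N (S f) <= C * N f"
  and add: "\<And>f g. f \<in> X ==> g \<in> X ==> ae_eq (S (%x. f x + g x)) (%x. S f x + S g x)"
  and scl: "\<And>c f. f \<in> X ==> ae_eq (S (%x. c * f x)) (%x. c * S f x)"
  using S unfolding bounded_op_def by blast
 have mg: "?mg \<in> X" by (rule scale_mem[OF g])
 have d: "?d \<in> X" by (rule add_mem[OF f mg])
 have "ae_eq ?d (%x. 0)" using eq unfolding ae_eq_def by eventually_elim simp
 then have "N ?d = 0" using norm_zero_iff[OF d] by simp
 then have "N (S ?d) = 0" using C[OF d] norm_nonneg[OF SX[OF d]] by simp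
 then have "ae_eq (S ?d) (%x. 0)" using norm_zero_iff[OF SX[OF d]] by simp
 then show ?thesis using add[OF f mg] scl[OF g, of "-1"] unfolding ae_eq_def by eventually_elim simp
qed

end

section \<open>The transform as an operator on the space and its symmetries\<close>

locale boyd_space = ri_space +
 assumes ub: "upper_Boyd X N < 1" and lb: "0 < lower_Boyd X N"
begin

abbreviation T where "T \<equiv> finite_Hilbert"

lemma hilbert_cong:
 assumes g: "g \<in> L0" and g': "g' \<in> BM" "\<And>s. s \<notin> {-1<..<1} ==> g' s = 0" "integrable lborel g'"
  and eq: "AE x in lborel. x \<in> {-1<..<1} --> g x = g' x"
  and lim: "AE x in lborel. ((%e. ptrunc e g' x) \<longlongrightarrow> k x) (at_right 0)"
 shows "AE x in M11. T g x = k x"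
 unfolding AE_M11 using lim
proof eventually_elim
 case (elim x)
 then show ?case using finite_Hilbert_ptrunc[OF g g'(1,2) eq g'(3)] by (auto intro: tendsto_Lim)
qed

lemma hilbert_rep:
 assumes f: "f \<in> X"
 shows "\<exists>f' h. f' \<in> BM \<and> (\<forall>s. s \<notin> {-1<..<1} --> f' s = 0) \<and>
  (AE x in lborel. x \<in> {-1<..<1} --> f x = f' x) \<and> integrable lborel f' \<and>
  (AE x in lborel. ((%e. ptrunc e f' x) \<longlongrightarrow> h x) (at_right 0)) \<and> (AE x in M11. T f x = h x)"
 by (rule hilbert_on_X[OF ub lb f]) blast

lemma hilbert_mem:
 assumes f: "f \<in> X" shows "T f \<in> X"
proof -
 obtain f' h p where h: "h \<in> X" "AE x in M11. T f x = h x" using hilbert_on_X[OF ub lb f] by blast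
 have "T f \<in> L0" by (rule L0_AE_cong[OF XL0[OF h(1)] h(2)])
 moreover have "ae_eq h (T f)" using h(2) unfolding ae_eq_def by eventually_elim simp
 ultimately show ?thesis using ae_closed[OF h(1)] by blast
qed

lemma hilbert_scale:
 assumes f: "f \<in> X" shows "ae_eq (T (%x. c * f x)) (%x. c * T f x)"
proof -
 obtain f' h where f': "f' \<in> BM" "\<And>s. s \<notin> {-1<..<1} ==> f' s = 0"
  "AE x in lborel. x \<in> {-1<..<1} --> f x = f' x" "integrable lborel f'"
  "AE x in lborel. ((%e. ptrunc e f' x) \<longlongrightarrow> h x) (at_right 0)" "AE x in M11. T f x = h x"
  using hilbert_rep[OF f] by blast
 have "AE x in M11. T (%x. c * f x) x = c * h x"
 proof (rule hilbert_cong[where g'="%x. c * f' x"])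
  show "(%x. c * f x) \<in> L0" by (rule XL0[OF scale_mem[OF f]])
  show "AE x in lborel. x \<in> {-1<..<1} --> c * f x = c * f' x" using f'(3) by eventually_elim auto
  show "AE x in lborel. ((%e. ptrunc e (%x. c * f' x) x) \<longlongrightarrow> c * h x) (at_right 0)"
   unfolding ptrunc_scale using f'(5) by eventually_elim (intro tendsto_intros)
 qed (use f' in auto)
 then show ?thesis using f'(6) unfolding ae_eq_def by eventually_elim simp
qed

lemma hilbert_cnj:
 assumes f: "f \<in> X" shows "(%x. cnj (f x)) \<in> X" "N (%x. cnj (f x)) = N f" "ae_eq (T (%x. cnj (f x))) (%x. - cnj (T f x))"
proof -
 obtain f' h where f': "f' \<in> BM" "\<And>s. s \<notin> {-1<..<1} ==> f' s = 0"
  "AE x in lborel. x \<in> {-1<..<1} --> f x = f' x" "integrable lborel f'"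
  "AE x in lborel. ((%e. ptrunc e f' x) \<longlongrightarrow> h x) (at_right 0)" "AE x in M11. T f x = h x"
  using hilbert_rep[OF f] by blast
 note f0[measurable] = XL0[OF f]
 have c0: "(%x. cnj (f x)) \<in> L0" by measurable
 show cX: "(%x. cnj (f x)) \<in> X" by (rule lattice_mem(1)[OF c0 f]) simp
 show "N (%x. cnj (f x)) = N f"
  by (rule antisym; rule lattice_mem(2)) (use f f0 c0 cX in auto)
 have "AE x in M11. T (%x. cnj (f x)) x = - cnj (h x)"
 proof (rule hilbert_cong[where g'="%x. cnj (f' x)"])
  show "AE x in lborel. x \<in> {-1<..<1} --> cnj (f x) = cnj (f' x)" using f'(3) by eventually_elim auto
  show "AE x in lborel. ((%e. ptrunc e (%x. cnj (f' x)) x) \<longlongrightarrow> - cnj (h x)) (at_right 0)"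
   unfolding ptrunc_cnj using f'(5) by eventually_elim (intro tendsto_intros)
  show "(%x. cnj (f' x)) \<in> BM" using f'(1) by measurable
 qed (use f' c0 in auto)
 then show "ae_eq (T (%x. cnj (f x))) (%x. - cnj (T f x))" using f'(6) unfolding ae_eq_def by eventually_elim simp
qed

lemma ae_eq_reflect:
 assumes "ae_eq f g" shows "ae_eq (%x. f (- x)) (%x. g (- x))"
 using AE_lborel_reflect[of "%x. x \<in> {-1<..<1} --> f x = g x"] assms unfolding ae_eq_def AE_M11
 by (auto elim!: AE_mp)

lemma hilbert_reflect:
 assumes f: "f \<in> X" shows "(%x. f (- x)) \<in> X" "N (%x. f (- x)) = N f" "ae_eq (T (%x. f (- x))) (%x. - T f (- x))"
proof -
 obtain f' h where f': "f' \<in> BM" "\<And>s. s \<notin> {-1<..<1} ==> f' s = 0"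
  "AE x in lborel. x \<in> {-1<..<1} --> f x = f' x" "integrable lborel f'"
  "AE x in lborel. ((%e. ptrunc e f' x) \<longlongrightarrow> h x) (at_right 0)" "AE x in M11. T f x = h x"
  using hilbert_rep[OF f] by blast
 note f0 = XL0[OF f]
 note r0 = reflect_L0[OF f0]
 show rX: "(%x. f (- x)) \<in> X" by (rule dstr_mem(1)[OF r0(1) f]) (simp add: r0(2))
 show "N (%x. f (- x)) = N f"
  by (rule antisym; rule dstr_mem(2)) (use f f0 r0 rX in auto)
 have "AE x in M11. T (%x. f (- x)) x = - h (- x)"
 proof (rule hilbert_cong[where g'="%x. f' (- x)"])
  show "AE x in lborel. x \<in> {-1<..<1} --> f (- x) = f' (- x)" using AE_lborel_reflect[OF f'(3)] by eventually_elim auto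
  show "AE x in lborel. ((%e. ptrunc e (%x. f' (- x)) x) \<longlongrightarrow> - h (- x)) (at_right 0)"
   unfolding ptrunc_reflect using AE_lborel_reflect[OF f'(5)] by eventually_elim (intro tendsto_intros)
  show "(%x. f' (- x)) \<in> BM" using f'(1) by measurable
  show "integrable lborel (%x. f' (- x))" using lborel_integrable_real_affine[OF f'(4), of "-1" 0] by simp
 qed (use f' r0 in auto)
 moreover have "ae_eq (%x. T f (- x)) (%x. h (- x))" by (rule ae_eq_reflect) (use f'(6) in \<open>simp add: ae_eq_def\<close>)
 ultimately show "ae_eq (T (%x. f (- x))) (%x. - T f (- x))" unfolding ae_eq_def by eventually_elim simp
qed

lemma shifted_mem: "f \<in> X ==> shifted z T f \<in> X"
 using add_mem[OF scale_mem[of f z] scale_mem[OF hilbert_mem, of f "-1"]] by (simp add: shifted_def)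

lemma shifted_uminus:
 assumes f: "f \<in> X" shows "ae_eq (shifted z T (%x. (-1) * f x)) (%x. (-1) * shifted z T f x)"
 using hilbert_scale[OF f, of "-1"] unfolding ae_eq_def shifted_def by eventually_elim simp

end

text \<open>Reflection and conjugation are both (real-)linear isometric involutions that anticommute with the
  transform; each of them maps the parts of the spectrum by \<open>z \<mapsto> - \<sigma> z\<close>.\<close>

locale hilbert_symmetry = boyd_space +
 fixes J :: "(real => complex) => real => complex" and \<sigma> :: "complex => complex"
 assumes Jmem: "f \<in> X ==> J f \<in> X" and JN: "f \<in> X ==> N (J f) = N f" and JJ: "J (J f) = f"
  and Jadd: "J (%x. f x + g x) = (%x. J f x + J g x)" and Jscale: "J (%x. c * f x) = (%x. \<sigma> c * J f x)"
  and Jae: "ae_eq f g ==> ae_eq (J f) (J g)" and JT: "f \<in> X ==> ae_eq (T (J f)) (%x. - J (T f) x)"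
  and \<sigma>\<sigma>: "\<sigma> (\<sigma> c) = c" and \<sigma>m: "\<sigma> (- c) = - \<sigma> c" and \<sigma>1: "\<sigma> 1 = 1"
begin

lemma Jminus: "J (%x. (-1) * f x) = (%x. (-1) * J f x)"
 using Jscale[of "-1" f] \<sigma>m[of 1] \<sigma>1 by simp

lemma Jdiff: "J (%x. f x - g x) = (%x. J f x - J g x)"
 using Jadd[of f "%x. (-1) * g x"] Jminus[of g] by simp

text \<open>From \<open>T J = - J T\<close> one gets
  \<open>(- \<sigma> z - T) J = - J (z - T)\<close>, up to \<open>ae_eq\<close>. The statements
  about spectrum, injectivity and dense range are read off from this intertwining relation.\<close>

lemma key:
 assumes f: "f \<in> X" shows "ae_eq (shifted (- \<sigma> z) T (J f)) (%x. (-1) * J (shifted z T f) x)"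
proof -
 have "J (shifted z T f) = (%x. \<sigma> z * J f x - J (T f) x)"
  unfolding shifted_def Jdiff Jscale ..
 then show ?thesis using JT[OF f] unfolding ae_eq_def shifted_def by (auto elim!: AE_mp)
qed

lemma spectrum_sym:
 assumes "z \<notin> spectrum X N T" shows "- \<sigma> z \<notin> spectrum X N T"
proof -
 obtain S where S: "bounded_op X N S"
  and inv: "\<And>f. f \<in> X ==> ae_eq (S (shifted z T f)) f" "\<And>f. f \<in> X ==> ae_eq (shifted z T (S f)) f"
  using assms unfolding spectrum_def by blast
 obtain C where SX: "\<And>f. f \<in> X ==> S f \<in> X" and C: "\<And>f. f \<in> X ==> N (S f) <= C * N f"
  and add: "\<And>f g. f \<in> X ==> g \<in> X ==> ae_eq (S (%x. f x + g x)) (%x. S f x + S g x)"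
  and scl: "\<And>c f. f \<in> X ==> ae_eq (S (%x. c * f x)) (%x. c * S f x)"
  using S unfolding bounded_op_def by blast
 \<comment> \<open>The inverse at \<open>- \<sigma> z\<close> is \<open>- J S J\<close>. Even if
   \<open>J\<close> is conjugate-linear, it occurs twice, so \<open>R\<close> is complex linear
   again.\<close>
 define R where "R = (%f. J (%x. (-1) * S (J f) x))"
 have RX: "R f \<in> X" if "f \<in> X" for f unfolding R_def by (intro Jmem scale_mem SX that)
 have "bounded_op X N R"
  unfolding bounded_op_def
 proof (intro conjI ballI allI exI[of _ C])
  fix f assume f: "f \<in> X"
  show "R f \<in> X" by (rule RX[OF f])
  have "N (R f) = N (S (J f))" unfolding R_def
   using JN[OF scale_mem[OF SX[OF Jmem[OF f]], of "-1"]] norm_scale[OF SX[OF Jmem[OF f]], of "-1"] by simp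
  then show "N (R f) <= C * N f" using C[OF Jmem[OF f]] JN[OF f] by simp
  fix c
  have "ae_eq (%x. (-1) * S (%x. \<sigma> c * J f x) x) (%x. \<sigma> c * ((-1) * S (J f) x))"
   using scl[OF Jmem[OF f], of "\<sigma> c"] unfolding ae_eq_def by eventually_elim simp
  from Jae[OF this] show "ae_eq (R (%x. c * f x)) (%x. c * R f x)"
   unfolding R_def Jscale[of c f] Jscale[of "\<sigma> c"] \<sigma>\<sigma> .
 next
  fix f g assume f: "f \<in> X" and g: "g \<in> X"
  have "ae_eq (%x. (-1) * S (%x. J f x + J g x) x) (%x. (-1) * S (J f) x + (-1) * S (J g) x)"
   using add[OF Jmem[OF f] Jmem[OF g]] unfolding ae_eq_def by eventually_elim simp
  from Jae[OF this] show "ae_eq (R (%x. f x + g x)) (%x. R f x + R g x)"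
   unfolding R_def Jadd .
 qed
 moreover have "ae_eq (R (shifted (- \<sigma> z) T f)) f" if f: "f \<in> X" for f
 proof -
  let ?f = "J f" and ?s = "shifted (- \<sigma> z) T f"
  have fX: "?f \<in> X" by (rule Jmem[OF f])
  have "ae_eq ?s (%x. (-1) * J (shifted z T ?f) x)" using key[OF fX, of z] by (simp only: JJ)
  from Jae[OF this] have "ae_eq (J ?s) (%x. (-1) * shifted z T ?f x)" unfolding Jminus JJ .
  from bounded_op_ae[OF S Jmem[OF shifted_mem[OF f]] scale_mem[OF shifted_mem[OF fX]] this]
  have "ae_eq (S (J ?s)) (S (%x. (-1) * shifted z T ?f x))" .
  then have "ae_eq (%x. (-1) * S (J ?s) x) ?f"
   using scl[OF shifted_mem[OF fX], of "-1" z] inv(1)[OF fX] unfolding ae_eq_def by eventually_elim simp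
  from Jae[OF this] show ?thesis unfolding R_def JJ .
 qed
 moreover have "ae_eq (shifted (- \<sigma> z) T (R f)) f" if f: "f \<in> X" for f
 proof -
  let ?g = "%x. (-1) * S (J f) x"
  have g: "?g \<in> X" by (intro scale_mem SX Jmem f)
  have "ae_eq (%x. (-1) * shifted z T ?g x) (J f)"
   using shifted_uminus[OF SX[OF Jmem[OF f]], of z] inv(2)[OF Jmem[OF f]] unfolding ae_eq_def by eventually_elim simp
  from Jae[OF this] have "ae_eq (%x. (-1) * J (shifted z T ?g) x) f" unfolding Jminus JJ .
  then show ?thesis using key[OF g, of z] unfolding R_def by (rule ae_eq_trans[rotated])
 qed
 ultimately show ?thesis unfolding spectrum_def by blast
qed

lemma point_sym:
 assumes "z \<in> point_spectrum X T" shows "- \<sigma> z \<in> point_spectrum X T"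
proof -
 obtain f where f: "f \<in> X" "\<not> ae_eq f (%x. 0)" "ae_eq (T f) (%x. z * f x)"
  using assms unfolding point_spectrum_def by blast
 have "J (%x. 0) = (%x. 0)" using Jadd[of "%x. 0" "%x. 0"] by (simp add: fun_eq_iff)
 then have "\<not> ae_eq (J f) (%x. 0)" using f(2) Jae[of "J f" "%x. 0"] JJ by auto
 moreover have "ae_eq (T (J f)) (%x. - \<sigma> z * J f x)"
  using JT[OF f(1)] Jae[OF f(3)] unfolding Jscale ae_eq_def by eventually_elim simp
 ultimately show ?thesis unfolding point_spectrum_def using Jmem[OF f(1)] by blast
qed

lemma inj_sym:
 assumes inj: "inj_op X (shifted z T)" shows "inj_op X (shifted (- \<sigma> z) T)"
 unfolding inj_op_def
proof (intro ballI impI)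
 fix f g assume f: "f \<in> X" and g: "g \<in> X" and eq: "ae_eq (shifted (- \<sigma> z) T f) (shifted (- \<sigma> z) T g)"
 have "ae_eq (%x. (-1) * J (shifted z T (J f)) x) (%x. (-1) * J (shifted z T (J g)) x)"
  using key[OF Jmem[OF f], of z] key[OF Jmem[OF g], of z] eq unfolding JJ by (metis ae_eq_sym ae_eq_trans)
 then have "ae_eq (J (shifted z T (J f))) (J (shifted z T (J g)))" unfolding ae_eq_def by eventually_elim simp
 from Jae[OF this] have "ae_eq (J f) (J g)" unfolding JJ using inj Jmem[OF f] Jmem[OF g] unfolding inj_op_def by blast
 from Jae[OF this] show "ae_eq f g" unfolding JJ .
qed

lemma dense_sym:
 assumes dense: "dense_range X N (shifted z T)" shows "dense_range X N (shifted (- \<sigma> z) T)"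
 unfolding dense_range_def
proof (intro ballI allI impI)
 fix g and e :: real assume g: "g \<in> X" and e: "0 < e"
 obtain f where f: "f \<in> X" "N (%x. J g x - shifted z T f x) < e"
  using dense Jmem[OF g] e unfolding dense_range_def by blast
 \<comment> \<open>The approximating element is \<open>J (- f)\<close>: the sign in the intertwining
   relation is absorbed into the argument.\<close>
 have mf: "(%x. (-1) * f x) \<in> X" by (rule scale_mem[OF f(1)])
 have dX: "(%x. J g x - shifted z T f x) \<in> X"
  using add_mem[OF Jmem[OF g] scale_mem[OF shifted_mem[OF f(1)], of "-1"]] by simp
 have "ae_eq (%x. (-1) * J (shifted z T (%x. (-1) * f x)) x) (J (shifted z T f))"
  using Jae[OF shifted_uminus[OF f(1), of z]] unfolding Jminus ae_eq_def by eventually_elim simp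
 with key[OF mf, of z] have "ae_eq (shifted (- \<sigma> z) T (J (%x. (-1) * f x))) (J (shifted z T f))" by (rule ae_eq_trans)
 then have eq: "ae_eq (J (%x. J g x - shifted z T f x)) (%x. g x - shifted (- \<sigma> z) T (J (%x. (-1) * f x)) x)"
  unfolding Jdiff JJ ae_eq_def by eventually_elim simp
 have L: "(%x. g x - shifted (- \<sigma> z) T (J (%x. (-1) * f x)) x) \<in> L0"
  using XL0[OF add_mem[OF g scale_mem[OF shifted_mem[OF Jmem[OF mf]], of "-1"]]] by simp
 have "N (%x. g x - shifted (- \<sigma> z) T (J (%x. (-1) * f x)) x) = N (%x. J g x - shifted z T f x)"
  using N_AE_eq[OF Jmem[OF dX] L eq] JN[OF dX] by simp
 then show "\<exists>f\<in>X. N (%x. g x - shifted (- \<sigma> z) T f x) < e" using f(2) Jmem[OF mf] by (intro bexI[of _ "J (%x. (-1) * f x)"]) auto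
qed

lemma \<sigma>_inv: "- \<sigma> (- \<sigma> z) = z" by (simp add: \<sigma>m \<sigma>\<sigma>)

text \<open>Since \<open>z \<mapsto> - \<sigma> z\<close> is an involution, the implication for
  dense range becomes an equivalence and the one for the complement of the spectrum turns around;
  this also handles the negated condition in the residual spectrum.\<close>

lemma all_sym:
 assumes "S \<in> {spectrum X N T, point_spectrum X T, continuous_spectrum X N T, residual_spectrum X N T}" and "z \<in> S"
 shows "- \<sigma> z \<in> S"
proof -
 have 1: "- \<sigma> z \<in> spectrum X N T" if "z \<in> spectrum X N T" for z
  using spectrum_sym[of "- \<sigma> z"] that \<sigma>_inv by metis
 have 2: "dense_range X N (shifted (- \<sigma> z) T) \<longleftrightarrow> dense_range X N (shifted z T)" for z
  using dense_sym[of z] dense_sym[of "- \<sigma> z"] \<sigma>_inv by metis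
 show ?thesis using assms 1 2 point_sym inj_sym unfolding continuous_spectrum_def residual_spectrum_def by auto
qed

end

context boyd_space
begin

text \<open>Reflection is complex linear and gives \<open>- z\<close>; conjugation acts on scalars
  as well and gives \<open>- cnj z\<close>. Their composition is the symmetry in the real
  axis.\<close>

theorem spectra_symmetric:
 assumes "S \<in> {spectrum X N T, point_spectrum X T, continuous_spectrum X N T, residual_spectrum X N T}"
 shows "axes_symmetric S \<and> uminus ` S = S"
proof -
 interpret R: hilbert_symmetry X N "%f x. f (- x)" "%c. c"
  by unfold_locales (auto intro: hilbert_reflect ae_eq_reflect)
 interpret C: hilbert_symmetry X N "%f x. cnj (f x)" cnj
 proof unfold_locales
  show "ae_eq (%x. cnj (f x)) (%x. cnj (g x))" if "ae_eq f g" for f g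
   using that unfolding ae_eq_def by eventually_elim simp
 qed (auto intro: hilbert_cnj)
 have r: "- z \<in> S" and c: "- cnj z \<in> S" if "z \<in> S" for z
  using R.all_sym[OF assms that] C.all_sym[OF assms that] by auto
 have "cnj z \<in> S" if "z \<in> S" for z using r[OF c[OF that]] by simp
 moreover have "z \<in> f ` S" if "f (f z) = z" "f z \<in> S" for f :: "complex => complex" and z using that by (metis imageI)
 ultimately show ?thesis unfolding axes_symmetric_def using r c by (auto intro!: set_eqI)
qed

end

section \<open>Boundary values and eigenfunctions\<close>

text \<open>Poisson's formula on lines above the axis passes to the limit by weighted L^1
  convergence. Hence a holomorphic function that is bounded on every half plane
  \<open>y \<le> Im z\<close> with \<open>y > 0\<close> is determined by its boundary
  function.\<close>

lemma poisson_limit_rep: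
 assumes hol: "\<Psi> holomorphic_on {z. 0 < Im z}"
  and bd: "\<And>y. 0 < y ==> \<exists>M. \<forall>z. y <= Im z --> norm (\<Psi> z) <= M"
  and g: "winteg g" and L1: "(%n. \<integral>\<^sup>+x. ennreal (norm (\<Psi> (Complex x (hgt n)) - g x)) \<partial>wlb) \<longlonglongrightarrow> 0"
  and s: "0 < s"
 shows "\<Psi> (Complex x s) = poisson s g x"
proof -
 define H where "H = (%n u. \<Psi> (Complex u (hgt n)))"
 have cont: "continuous_on {z. 0 < Im z} \<Psi>" by (rule holomorphic_on_imp_continuous_on[OF hol])
 have Hm[measurable]: "H n \<in> BM" for n
  unfolding H_def by (intro borel_measurable_continuous_onI continuous_on_compose2[OF cont])
   (auto intro!: continuous_intros simp: Complex_eq)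
 have Hw: "winteg (H n)" for n
 proof -
  obtain M where M: "\<And>z. hgt n <= Im z ==> norm (\<Psi> z) <= M" using bd[OF hgt_pos] by blast
  have "(\<integral>\<^sup>+x. ennreal (norm (H n x)) \<partial>wlb) <= (\<integral>\<^sup>+x. ennreal M \<partial>wlb)"
   unfolding H_def by (intro nn_integral_mono ennreal_leI M) auto
  also have "\<dots> < \<infinity>" by (simp add: emeasure_wlb ennreal_mult_less_top)
  finally show ?thesis using winteg_iff_wlb[OF Hm[of n]] by blast
 qed
 have P: "\<Psi> (Complex x (s + hgt n)) = poisson s (H n) x" for n
 proof -
  define \<Phi> where "\<Phi> = (%z. \<Psi> (z + \<i> * of_real (hgt n)))"
  have e: "\<Phi> z = \<Psi> (Complex (Re z) (Im z + hgt n))" for z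
   unfolding \<Phi>_def by (rule arg_cong[where f="\<Psi>"]) (simp add: complex_eq_iff)
  have "(\<Psi> \<circ> (%z. z + \<i> * of_real (hgt n))) holomorphic_on {z. - hgt n < Im z}"
   by (intro holomorphic_on_compose_gen[where t="{z. 0 < Im z}"] holomorphic_intros hol) auto
  then have hol': "\<Phi> holomorphic_on {z. - hgt n < Im z}" by (simp add: \<Phi>_def o_def)
  obtain M where M: "\<And>z. hgt n <= Im z ==> norm (\<Psi> z) <= M" using bd[OF hgt_pos] by blast
  have "\<Phi> (Complex x s) = poisson s (%u. \<Phi> (cr u)) x"
  proof (rule halfplane_poisson[OF hol' hgt_pos _ s])
   fix z assume "0 <= Im z"
   then show "norm (\<Phi> z) <= M" unfolding e by (intro M) auto
  qed
  then show ?thesis unfolding e H_def by simp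
 qed
 have "(%n. \<Psi> (Complex x (s + hgt n))) \<longlonglongrightarrow> \<Psi> (Complex x s)"
 proof -
  have "isCont \<Psi> (Complex x s)"
   using cont s by (simp add: continuous_on_eq_continuous_at open_halfspace_Im_gt)
  moreover have "(%n. Complex x (s + hgt n)) \<longlonglongrightarrow> Complex x s"
  proof -
   have "(%n. cr x + \<i> * cr (s + hgt n)) \<longlonglongrightarrow> cr x + \<i> * cr (s + 0)"
    using filterlim_mono[OF hgt_lim at_within_le_nhds order_refl] by (intro tendsto_intros)
   then show ?thesis by (simp add: Complex_eq)
  qed
  ultimately show ?thesis by (rule isCont_tendsto_compose)
 qed
 moreover have "(%n. poisson s (H n) x) \<longlonglongrightarrow> poisson s g x"
 proof -
  let ?C = "ennreal ((s + (1 + 2 * x\<^sup>2) / s) * 2)"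
  have "(%n. ?C * (\<integral>\<^sup>+x. ennreal (norm (H n x - g x)) \<partial>wlb)) \<longlonglongrightarrow> ?C * 0"
   unfolding H_def by (intro ennreal_tendsto_cmult L1) auto
  then have "(%n. ?C * (\<integral>\<^sup>+x. ennreal (norm (H n x - g x)) \<partial>wlb)) \<longlonglongrightarrow> 0" by simp
  moreover have "\<forall>\<^sub>F n in sequentially. ennreal (norm (poisson s (H n) x - poisson s g x)) <= ?C * (\<integral>\<^sup>+x. ennreal (norm (H n x - g x)) \<partial>wlb)"
   using poisson_diff_le[OF Hw g s, of _ x] by (intro always_eventually allI)
  ultimately have "(%n. norm (poisson s (H n) x - poisson s g x)) \<longlonglongrightarrow> 0"
   using tendsto_sandwich[of "%_. 0" "%n. ennreal (norm (poisson s (H n) x - poisson s g x))" sequentially _ 0]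
   by (simp add: tendsto_ennreal_iff[of _ _ 0, simplified])
  then show ?thesis by (rule LIM_zero_cancel[OF tendsto_norm_zero_cancel])
 qed
 ultimately show ?thesis unfolding P using LIMSEQ_unique by blast
qed

lemma poisson_cnj: "poisson s (%x. cnj (g x)) x = cnj (poisson s g x)"
proof -
 have "(\<integral>t. (s / ((t - x)\<^sup>2 + s\<^sup>2)) *\<^sub>R cnj (g t) \<partial>lborel) = (\<integral>t. cnj ((s / ((t - x)\<^sup>2 + s\<^sup>2)) *\<^sub>R g t) \<partial>lborel)" by simp
 also have "\<dots> = cnj (\<integral>t. (s / ((t - x)\<^sup>2 + s\<^sup>2)) *\<^sub>R g t \<partial>lborel)" by (rule Bochner_Integration.integral_cnj)
 finally show ?thesis unfolding poisson_def by simp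
qed

lemma holomorphic_cnj_reflect:
 assumes "G holomorphic_on {z. Im z \<noteq> 0}"
 shows "(%z. cnj (G (cnj z))) holomorphic_on {z. Im z \<noteq> 0}"
proof -
 have op: "open {z. Im z \<noteq> 0}"
 proof -
  have "{z. Im z \<noteq> 0} = {z. Im z < 0} \<union> {z. Im z > 0}" by auto
  then show ?thesis using open_halfspace_Im_lt[of 0] open_halfspace_Im_gt[of 0] by auto
 qed
 have im: "cnj ` {z. Im z \<noteq> 0} = {z. Im z \<noteq> 0}"
 proof (intro equalityI subsetI)
  fix z assume "z \<in> {z. Im z \<noteq> 0}"
  then show "z \<in> cnj ` {z. Im z \<noteq> 0}" by (intro image_eqI[where x="cnj z"]) auto
 qed auto
 have "(cnj \<circ> G \<circ> cnj) holomorphic_on {z. Im z \<noteq> 0}"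
  by (rule holomorphic_on_compose_cnj_cnj[OF _ op]) (simp add: im assms)
 then show ?thesis by (simp add: o_def)
qed

text \<open>Both half-plane values are the Poisson integral of the same boundary function, so \<open>G\<close> and its conjugate
  are holomorphic.\<close>

lemma two_sided_const:
 assumes hol: "G holomorphic_on {z. Im z \<noteq> 0}"
  and bd: "\<And>y. 0 < y ==> \<exists>M. \<forall>z. y <= \<bar>Im z\<bar> --> norm (G z) <= M"
  and g: "winteg g"
  and up: "(%n. \<integral>\<^sup>+x. ennreal (norm (G (Complex x (hgt n)) - g x)) \<partial>wlb) \<longlonglongrightarrow> 0"
  and dn: "(%n. \<integral>\<^sup>+x. ennreal (norm (G (Complex x (- hgt n)) - g x)) \<partial>wlb) \<longlonglongrightarrow> 0"
 shows "\<exists>c. (\<forall>z. 0 < Im z --> G z = c) \<and> (AE x in lborel. g x = c)"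
proof -
 let ?U = "{z. 0 < Im z}"
 have sub: "?U \<subseteq> {z. Im z \<noteq> 0}" by auto
 have holU: "G holomorphic_on ?U" by (rule holomorphic_on_subset[OF hol sub])
 \<comment> \<open>The values in the lower half plane, carried to the upper one by conjugation; the
   boundary function becomes the conjugate of \<open>g\<close>.\<close>
 define K where "K = (%z. cnj (G (cnj z)))"
 have holK: "K holomorphic_on ?U" unfolding K_def by (rule holomorphic_on_subset[OF holomorphic_cnj_reflect[OF hol] sub])
 have rep: "G (Complex x s) = poisson s g x" if "0 < s" for x s
 proof (rule poisson_limit_rep[OF holU _ g up that])
  fix y :: real assume "0 < y"
  then obtain M where "\<forall>z. y <= \<bar>Im z\<bar> --> norm (G z) <= M" using bd by blast
  then show "\<exists>M. \<forall>z. y <= Im z --> norm (G z) <= M" by force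
 qed
 have gc: "winteg (%x. cnj (g x))" using g unfolding winteg_def
  by (subst (asm) complex_integrable_cnj[symmetric]) simp
 have repK: "K (Complex x s) = poisson s (%x. cnj (g x)) x" if "0 < s" for x s
 proof (rule poisson_limit_rep[OF holK _ gc _ that])
  fix y :: real assume "0 < y"
  then obtain M where "\<forall>z. y <= \<bar>Im z\<bar> --> norm (G z) <= M" using bd by blast
  then show "\<exists>M. \<forall>z. y <= Im z --> norm (K z) <= M" unfolding K_def by (intro exI[of _ M]) auto
 next
  have "norm (K (Complex x (hgt n)) - cnj (g x)) = norm (G (Complex x (- hgt n)) - g x)" for x n
  proof -
   have "K (Complex x (hgt n)) - cnj (g x) = cnj (G (Complex x (- hgt n)) - g x)" unfolding K_def by (simp add: complex_cnj)
   then show ?thesis by (metis complex_mod_cnj)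
  qed
  then show "(%n. \<integral>\<^sup>+x. ennreal (norm (K (Complex x (hgt n)) - cnj (g x))) \<partial>wlb) \<longlonglongrightarrow> 0" using dn by simp
 qed
 have KG: "K z = cnj (G z)" if "0 < Im z" for z
  using rep[OF that, of "Re z"] repK[OF that, of "Re z"] by (simp add: poisson_cnj)
 have opU: "open ?U" by (rule open_halfspace_Im_gt)
 have der0: "(G has_field_derivative 0) (at z within ?U)" if z: "z \<in> ?U" for z
 proof -
  obtain a where a: "(G has_field_derivative a) (at z)" using holU opU z by (meson holomorphic_on_open)
  obtain b where b: "(K has_field_derivative b) (at z)" using holK opU z by (meson holomorphic_on_open)
  \<comment> \<open>Differentiating \<open>K = cnj G\<close> along the real line through
    \<open>z\<close> in direction \<open>v\<close> equates a complex linear with a conjugate-linear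
    map; the directions 1 and \<open>\<i>\<close> force both derivatives to vanish.\<close>
  have dirs: "b * v = cnj (a * v)" for v :: complex
  proof -
   let ?l = "%t::real. z + of_real t * v"
   have l: "(?l has_vector_derivative v) (at 0)" by (auto intro!: derivative_eq_intros simp: has_vector_derivative_def scaleR_conv_of_real)
   have "((G \<circ> ?l) has_vector_derivative v * a) (at 0)"
    by (rule field_vector_diff_chain_at[OF l]) (use a in simp)
   then have 1: "((%t. cnj ((G \<circ> ?l) t)) has_vector_derivative cnj (v * a)) (at 0)" by (rule has_vector_derivative_cnj)
   have 2: "((K \<circ> ?l) has_vector_derivative v * b) (at 0)"
    by (rule field_vector_diff_chain_at[OF l]) (use b in simp)
   have "\<forall>\<^sub>F t in nhds (0::real). 0 < Im (?l t)"
   proof -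
    have "((%t::real. Im z + t * Im v) \<longlongrightarrow> Im z + 0 * Im v) (nhds 0)" by (intro tendsto_intros filterlim_ident)
    from order_tendstoD(1)[OF this, of 0] show ?thesis using z by simp
   qed
   then have E: "\<forall>\<^sub>F t in nhds (0::real). (K \<circ> ?l) t = cnj ((G \<circ> ?l) t)" by eventually_elim (simp add: KG)
   have E0: "(K \<circ> ?l) 0 = cnj ((G \<circ> ?l) 0)" using E by (rule eventually_nhds_x_imp_x)
   have "((K \<circ> ?l) has_vector_derivative cnj (v * a)) (at 0) \<longleftrightarrow> ((%t. cnj ((G \<circ> ?l) t)) has_vector_derivative cnj (v * a)) (at 0)"
    by (rule has_vector_derivative_cong_ev) (use E E0 in simp_all)
   then have "((K \<circ> ?l) has_vector_derivative cnj (v * a)) (at 0)" using 1 by blast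
   from vector_derivative_unique_at[OF 2 this] show ?thesis by (simp add: mult.commute)
  qed
  have b1: "b = cnj a" using dirs[of 1] by simp
  have "b * \<i> = - (b * \<i>)" using dirs[of \<i>] unfolding b1 by simp
  then have "b = 0" by simp
  then have "a = 0" unfolding b1 by simp
  then show ?thesis using a has_field_derivative_at_within by blast
 qed
 have "\<exists>c. \<forall>z\<in>?U. G z = c"
  using has_field_derivative_zero_constant[OF convex_halfspace_Im_gt der0] by blast
 then obtain c where c: "\<And>z. z \<in> ?U ==> G z = c" by blast
 have "AE x in lborel. g x = c"
 proof (rule AE_mp[OF winteg_AE_leb_pt[OF g]], intro AE_I2 impI)
  fix x assume "leb_pt g x"
  then have "((%y. poisson y g x) \<longlongrightarrow> g x) (at_right 0)" by (rule poisson_tendsto[OF g])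
  moreover have "\<forall>\<^sub>F y in at_right 0. poisson y g x = c"
   using rep c by (auto simp: eventually_at_right_field intro!: exI[of _ 1])
  ultimately have "((%y. c) \<longlongrightarrow> g x) (at_right (0::real))" by (rule Lim_transform_eventually)
  then show "g x = c" using tendsto_unique[of "at_right (0::real)" "%y. c" "g x" c] by simp
 qed
 then show ?thesis using c by blast
qed

text \<open>The dominating functions \<open>C * (norm (F n x) + 1)\<close> vary with
  \<open>n\<close> but converge in the mean. Subtracting \<open>C * norm (F n x - f x)\<close>
  leaves \<open>d n\<close>, which has a fixed integrable bound; the subtracted part tends to zero
  by hypothesis.\<close>

lemma dominated_L1_convergence:
 fixes F :: "nat => real => complex"
 assumes [measurable]: "\<And>n. F n \<in> BM" "f \<in> BM" "\<And>n. G n \<in> BM" "g \<in> BM"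
  and f: "winteg f" and F: "(%n. \<integral>\<^sup>+x. ennreal (norm (F n x - f x)) \<partial>wlb) \<longlonglongrightarrow> 0"
  and lim: "AE x in lborel. (%n. G n x) \<longlonglongrightarrow> g x" and C: "0 <= C"
  and dom: "\<And>n. AE x in lborel. norm (G n x) <= C * (norm (F n x) + 1)" "AE x in lborel. norm (g x) <= C * (norm (f x) + 1)"
 shows "(%n. \<integral>\<^sup>+x. ennreal (norm (G n x - g x)) \<partial>wlb) \<longlonglongrightarrow> 0" "winteg g"
proof -
 define d where "d = (%n x. max 0 (norm (G n x - g x) - C * norm (F n x - f x)))"
 have [measurable]: "d n \<in> BM" for n unfolding d_def by measurable
 have fin: "(\<integral>\<^sup>+x. ennreal (2 * C * (norm (f x) + 1)) \<partial>wlb) < \<infinity>"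
 proof -
  have "(\<integral>\<^sup>+x. ennreal (2 * C * (norm (f x) + 1)) \<partial>wlb) = (\<integral>\<^sup>+x. ennreal (2 * C) * (ennreal (norm (f x)) + 1) \<partial>wlb)"
   using C by (intro nn_integral_cong) (simp add: ennreal_mult ennreal_plus)
  also have "\<dots> = ennreal (2 * C) * ((\<integral>\<^sup>+x. ennreal (norm (f x)) \<partial>wlb) + ennreal pi)"
   by (simp add: nn_integral_cmult nn_integral_add emeasure_wlb)
  also have "\<dots> < \<infinity>" using f winteg_iff_wlb[of f] by (auto simp: ennreal_mult_less_top)
  finally show ?thesis .
 qed
 have "(%n. \<integral>\<^sup>+x. ennreal (d n x) \<partial>wlb) \<longlonglongrightarrow> (\<integral>\<^sup>+x. 0 \<partial>wlb)"
 proof (rule nn_integral_dominated_convergence[OF _ _ _ _ fin])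
  show "AE x in wlb. ennreal (d n x) <= ennreal (2 * C * (norm (f x) + 1))" for n
   unfolding AE_wlb using dom(1)[of n] dom(2)
  proof eventually_elim
   case (elim x)
   have "norm (F n x) <= norm (F n x - f x) + norm (f x)" using norm_triangle_ineq[of "F n x - f x" "f x"] by simp
   then have "C * norm (F n x) <= C * norm (F n x - f x) + C * norm (f x)" using C by (metis distrib_left mult_left_mono)
   then have "norm (G n x - g x) - C * norm (F n x - f x) <= 2 * C * (norm (f x) + 1)"
    using norm_triangle_ineq4[of "G n x" "g x"] elim by (simp add: algebra_simps)
   moreover have "0 <= 2 * C * (norm (f x) + 1)" using C by simp
   ultimately show ?case unfolding d_def by (intro ennreal_leI) simp
  qed
  show "AE x in wlb. (%n. ennreal (d n x)) \<longlonglongrightarrow> 0"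
   unfolding AE_wlb using lim
  proof eventually_elim
   case (elim x)
   have 1: "(%n. norm (G n x - g x)) \<longlonglongrightarrow> 0" using elim by (metis LIM_zero tendsto_norm_zero)
   have "(%n. d n x) \<longlonglongrightarrow> 0"
    by (rule tendsto_sandwich[OF _ _ tendsto_const 1]) (use C in \<open>auto simp: d_def\<close>)
   then show ?case by (metis ennreal_0 tendsto_ennrealI)
  qed
 qed auto
 then have D: "(%n. \<integral>\<^sup>+x. ennreal (d n x) \<partial>wlb) \<longlonglongrightarrow> 0" by simp
 have le: "(\<integral>\<^sup>+x. ennreal (norm (G n x - g x)) \<partial>wlb) <= (\<integral>\<^sup>+x. ennreal (d n x) \<partial>wlb) + ennreal C * (\<integral>\<^sup>+x. ennreal (norm (F n x - f x)) \<partial>wlb)" for n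
 proof -
  have "(\<integral>\<^sup>+x. ennreal (norm (G n x - g x)) \<partial>wlb) <= (\<integral>\<^sup>+x. ennreal (d n x) + ennreal C * ennreal (norm (F n x - f x)) \<partial>wlb)"
  proof (intro nn_integral_mono)
   fix x
   have "norm (G n x - g x) <= d n x + C * norm (F n x - f x)" by (simp add: d_def)
   then have "ennreal (norm (G n x - g x)) <= ennreal (d n x + C * norm (F n x - f x))" by (rule ennreal_leI)
   also have "\<dots> = ennreal (d n x) + ennreal C * ennreal (norm (F n x - f x))"
    using C by (subst ennreal_plus) (auto simp: d_def ennreal_mult)
   finally show "ennreal (norm (G n x - g x)) <= \<dots>" .
  qed
  also have "\<dots> = (\<integral>\<^sup>+x. ennreal (d n x) \<partial>wlb) + ennreal C * (\<integral>\<^sup>+x. ennreal (norm (F n x - f x)) \<partial>wlb)"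
   by (simp add: nn_integral_add nn_integral_cmult)
  finally show ?thesis .
 qed
 have up0: "(%n. (\<integral>\<^sup>+x. ennreal (d n x) \<partial>wlb) + ennreal C * (\<integral>\<^sup>+x. ennreal (norm (F n x - f x)) \<partial>wlb)) \<longlonglongrightarrow> 0 + ennreal C * 0"
  by (intro tendsto_add D ennreal_tendsto_cmult F) auto
 show "(%n. \<integral>\<^sup>+x. ennreal (norm (G n x - g x)) \<partial>wlb) \<longlonglongrightarrow> 0"
  by (rule tendsto_sandwich[OF _ _ tendsto_const, where h="%n. (\<integral>\<^sup>+x. ennreal (d n x) \<partial>wlb) + ennreal C * (\<integral>\<^sup>+x. ennreal (norm (F n x - f x)) \<partial>wlb)"])
    (use le up0 in auto)
 have "(\<integral>\<^sup>+x. ennreal (norm (g x)) \<partial>wlb) <= (\<integral>\<^sup>+x. ennreal (2 * C * (norm (f x) + 1)) \<partial>wlb)"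
 proof (rule nn_integral_mono_AE)
  show "AE x in wlb. ennreal (norm (g x)) <= ennreal (2 * C * (norm (f x) + 1))"
   unfolding AE_wlb using dom(2)
  proof eventually_elim
   case (elim x)
   have "0 <= C * (norm (f x) + 1)" using C by simp
   then show ?case using elim by (intro ennreal_leI) linarith
  qed
 qed
 then show "winteg g" using fin winteg_iff_wlb[of g] by (auto intro: le_less_trans)
qed

text \<open>The quotient maps the upper half plane to itself and is negative real exactly on (-1,1).
  The principal logarithm therefore jumps there and is continuous across the rest of the real line,
  apart from the points 1 and -1.\<close>

definition Lg :: "complex => complex" where "Lg z = Ln ((z - 1) / (z + 1))"

lemma Im_quotient: "Im ((z - 1) / (z + 1)) = 2 * Im z / (norm (z + 1))\<^sup>2"
 by (simp add: Im_divide cmod_power2 algebra_simps)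

lemma Lg_holomorphic: "Lg holomorphic_on {z. Im z \<noteq> 0}"
proof -
 have "z + 1 \<noteq> 0" "(z - 1) / (z + 1) \<notin> \<real>\<^sub>\<le>\<^sub>0" if "Im z \<noteq> 0" for z
 proof -
  show nz: "z + 1 \<noteq> 0" using that by (auto simp: complex_eq_iff)
  then have "Im ((z - 1) / (z + 1)) \<noteq> 0" unfolding Im_quotient using that by simp
  then show "(z - 1) / (z + 1) \<notin> \<real>\<^sub>\<le>\<^sub>0" by (auto simp: complex_nonpos_Reals_iff)
 qed
 then show ?thesis unfolding Lg_def by (intro holomorphic_intros) auto
qed

lemma Lg_Im:
 shows "0 < Im z ==> 0 < Im (Lg z) \<and> Im (Lg z) < pi" "Im z \<noteq> 0 ==> \<bar>Im (Lg z)\<bar> <= pi"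
proof -
 show "0 < Im (Lg z) \<and> Im (Lg z) < pi" if "0 < Im z"
 proof -
  have "z + 1 \<noteq> 0" using that by (auto simp: complex_eq_iff)
  then have "0 < Im ((z - 1) / (z + 1))" unfolding Im_quotient using that by simp
  then show ?thesis unfolding Lg_def by (rule Im_Ln_pos_lt_imp)
 qed
 show "\<bar>Im (Lg z)\<bar> <= pi" if "Im z \<noteq> 0"
 proof -
  have "z - 1 \<noteq> 0" "z + 1 \<noteq> 0" using that by (auto simp: complex_eq_iff)
  then have "(z - 1) / (z + 1) \<noteq> 0" by simp
  from mpi_less_Im_Ln[OF this] Im_Ln_le_pi[OF this] show ?thesis unfolding Lg_def by linarith
 qed
qed

lemma norm_exp_Lg:
 assumes "Im z \<noteq> 0"
 shows "norm (exp (c * Lg z)) = (norm (z - 1) / norm (z + 1)) powr (Re c) * exp (- (Im c * Im (Lg z)))"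
proof -
 have "z - 1 \<noteq> 0" "z + 1 \<noteq> 0" using assms by (auto simp: complex_eq_iff)
 then have nz: "(z - 1) / (z + 1) \<noteq> 0" by simp
 then have n: "0 < norm (z - 1) / norm (z + 1)" by (metis norm_divide zero_less_norm_iff)
 have "Re (Lg z) = ln (norm (z - 1) / norm (z + 1))" unfolding Lg_def using nz by (simp add: norm_divide)
 then have "norm (exp (c * Lg z)) = exp (Re c * ln (norm (z - 1) / norm (z + 1)) - Im c * Im (Lg z))"
  unfolding norm_exp_eq_Re by simp
 also have "\<dots> = (norm (z - 1) / norm (z + 1)) powr (Re c) * exp (- (Im c * Im (Lg z)))"
  using n \<open>z - 1 \<noteq> 0\<close> \<open>z + 1 \<noteq> 0\<close> by (simp only: powr_def diff_conv_add_uminus exp_add) simp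
 finally show ?thesis .
qed

text \<open>Boundary values of \<open>Lg\<close> from the half planes \<open>\<sigma> Im z > 0\<close>.\<close>

definition Lgb :: "real => real => complex" where
 "Lgb \<sigma> x = (if \<bar>x\<bar> < 1 then of_real (ln ((1 - x) / (1 + x))) + \<i> * of_real (\<sigma> * pi) else of_real (ln ((x - 1) / (x + 1))))"

lemma Lg_tendsto:
 assumes x: "x \<noteq> 1" "x \<noteq> -1" and \<sigma>: "\<sigma> = 1 \<or> \<sigma> = -1"
 shows "(%n. Lg (Complex x (\<sigma> * hgt n))) \<longlonglongrightarrow> Lgb \<sigma> x"
proof -
 let ?z = "%n. Complex x (\<sigma> * hgt n)"
 have h0: "hgt \<longlonglongrightarrow> 0" using filterlim_mono[OF hgt_lim at_within_le_nhds order_refl] .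
 have "(%n. cr x + \<i> * cr (\<sigma> * hgt n)) \<longlonglongrightarrow> cr x + \<i> * cr (\<sigma> * 0)"
  by (intro tendsto_intros h0)
 then have zl: "?z \<longlonglongrightarrow> cr x" by (simp add: Complex_eq)
 have x1: "cr x + 1 \<noteq> 0" "cr x - 1 \<noteq> 0" using x by (auto simp: complex_eq_iff)
 have ql: "(%n. (?z n - 1) / (?z n + 1)) \<longlonglongrightarrow> (cr x - 1) / (cr x + 1)"
  by (intro tendsto_intros zl x1)
 have qr: "(cr x - 1) / (cr x + 1) = cr ((x - 1) / (x + 1))" by simp
 show ?thesis
 proof (cases "\<bar>x\<bar> < 1")
  case False
  then have pos: "0 < (x - 1) / (x + 1)" using x by (auto simp: abs_if zero_less_divide_iff split: if_splits)
  have "(%n. Ln ((?z n - 1) / (?z n + 1))) \<longlonglongrightarrow> Ln (cr ((x - 1) / (x + 1)))"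
   using ql unfolding qr by (rule tendsto_Ln) (use pos in \<open>auto simp: complex_nonpos_Reals_iff\<close>)
  then show ?thesis unfolding Lg_def Lgb_def Ln_of_real[OF pos] if_not_P[OF False] .
 next
  case True
  then have pos: "0 < (1 - x) / (1 + x)" by (auto simp: abs_if split: if_splits)
  \<comment> \<open>Inside (-1,1) the quotient tends to the cut of \<open>Ln\<close>. The negated
    quotient stays away from it, and the side of approach fixes the sign of
    \<open>pi\<close>.\<close>
  have eq: "Ln ((?z n - 1) / (?z n + 1)) = Ln (- ((?z n - 1) / (?z n + 1))) + \<i> * of_real (\<sigma> * pi)" for n
  proof -
   let ?q = "(?z n - 1) / (?z n + 1)"
   have zn: "?z n + 1 \<noteq> 0" using \<sigma> by (auto simp: complex_eq_iff)
   have Imq: "Im ?q = 2 * (\<sigma> * hgt n) / (norm (?z n + 1))\<^sup>2" unfolding Im_quotient by simp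
   have "?z n - 1 \<noteq> 0" using \<sigma> by (auto simp: complex_eq_iff)
   then have q0: "?q \<noteq> 0" using zn by simp
   have "0 < 2 * hgt n / (norm (?z n + 1))\<^sup>2" using zn by simp
   then have "\<sigma> = 1 \<and> 0 < Im ?q \<or> \<sigma> = -1 \<and> Im ?q < 0" using \<sigma> unfolding Imq by auto
   then show ?thesis using Ln_minus[OF q0] by auto
  qed
  have "(%n. Ln (- ((?z n - 1) / (?z n + 1)))) \<longlonglongrightarrow> Ln (- cr ((x - 1) / (x + 1)))"
   using tendsto_minus[OF ql] unfolding qr by (rule tendsto_Ln) (use pos in \<open>auto simp: complex_nonpos_Reals_iff divide_simps split: if_splits\<close>)
  moreover have "- cr ((x - 1) / (x + 1)) = cr ((1 - x) / (1 + x))"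
   by (metis add.commute minus_diff_eq minus_divide_left of_real_minus)
  ultimately have "(%n. Ln (- ((?z n - 1) / (?z n + 1)))) \<longlonglongrightarrow> cr (ln ((1 - x) / (1 + x)))"
   by (simp only: Ln_of_real[OF pos])
  then have "(%n. Ln (- ((?z n - 1) / (?z n + 1))) + \<i> * of_real (\<sigma> * pi)) \<longlonglongrightarrow> cr (ln ((1 - x) / (1 + x))) + \<i> * of_real (\<sigma> * pi)"
   by (intro tendsto_intros)
  then show ?thesis unfolding Lg_def Lgb_def eq using True by simp
 qed
qed

lemma Lgb_measurable[measurable]: "Lgb \<sigma> \<in> BM"
 unfolding Lgb_def by measurable

section \<open>Calculus of two-sided boundary values\<close>

lemma holomorphic_line_measurable:
 assumes "G holomorphic_on {z. Im z \<noteq> 0}" "y \<noteq> 0"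
 shows "(%x. G (Complex x y)) \<in> BM"
proof (rule borel_measurable_continuous_onI)
 have "continuous_on {z. Im z \<noteq> 0} G" by (rule holomorphic_on_imp_continuous_on[OF assms(1)])
 then show "continuous_on UNIV (%x. G (Complex x y))"
  by (rule continuous_on_compose2) (use assms(2) in \<open>auto intro!: continuous_intros simp: Complex_eq\<close>)
qed

text \<open>\<open>bdry G k\<close>: the boundary values of \<open>G\<close> on the real line from above and below are \<open>k 1\<close> and \<open>k (-1)\<close>.\<close>

definition bdry :: "(complex => complex) => (real => real => complex) => bool" where
 "bdry G k \<longleftrightarrow> G holomorphic_on {z. Im z \<noteq> 0} \<and>
   (\<forall>y>0. \<exists>M. \<forall>z. y <= \<bar>Im z\<bar> --> norm (G z) <= M) \<and>
   (\<forall>\<sigma>\<in>{1, -1}. k \<sigma> \<in> BM \<and> winteg (k \<sigma>) \<and>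
    (%n. \<integral>\<^sup>+x. ennreal (norm (G (Complex x (\<sigma> * hgt n)) - k \<sigma> x)) \<partial>wlb) \<longlonglongrightarrow> 0 \<and>
    (AE x in lborel. (%n. G (Complex x (\<sigma> * hgt n))) \<longlonglongrightarrow> k \<sigma> x))"

lemma bdryD:
 assumes "bdry G k"
 shows "G holomorphic_on {z. Im z \<noteq> 0}" "0 < y ==> \<exists>M. \<forall>z. y <= \<bar>Im z\<bar> --> norm (G z) <= M"
  "\<sigma> \<in> {1, -1} ==> k \<sigma> \<in> BM" "\<sigma> \<in> {1, -1} ==> winteg (k \<sigma>)"
  "\<sigma> \<in> {1, -1} ==> (%n. \<integral>\<^sup>+x. ennreal (norm (G (Complex x (\<sigma> * hgt n)) - k \<sigma> x)) \<partial>wlb) \<longlonglongrightarrow> 0"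
  "\<sigma> \<in> {1, -1} ==> AE x in lborel. (%n. G (Complex x (\<sigma> * hgt n))) \<longlonglongrightarrow> k \<sigma> x"
 using assms unfolding bdry_def by blast+

lemma bdry_line_measurable:
 assumes "bdry G k" "\<sigma> \<in> {1, -1}" shows "(%x. G (Complex x (\<sigma> * hgt n))) \<in> BM"
 by (rule holomorphic_line_measurable[OF bdryD(1)[OF assms(1)]]) (use assms(2) in auto)

lemma bdry_const:
 assumes b: "bdry G k" and eq: "AE x in lborel. k 1 x = k (-1) x"
 shows "\<exists>c. (\<forall>z. 0 < Im z --> G z = c) \<and> (AE x in lborel. k 1 x = c)"
proof (rule two_sided_const[OF bdryD(1,2)[OF b]])
 show "winteg (k 1)" using bdryD(4)[OF b] by simp
 show "(%n. \<integral>\<^sup>+x. ennreal (norm (G (Complex x (hgt n)) - k 1 x)) \<partial>wlb) \<longlonglongrightarrow> 0" using bdryD(5)[OF b, of 1] by simp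
 have "(\<integral>\<^sup>+x. ennreal (norm (G (Complex x (- hgt n)) - k 1 x)) \<partial>wlb) = (\<integral>\<^sup>+x. ennreal (norm (G (Complex x (- hgt n)) - k (-1) x)) \<partial>wlb)" for n
  by (rule nn_integral_cong_AE) (use eq in \<open>auto simp: AE_wlb elim: eventually_mono\<close>)
 then show "(%n. \<integral>\<^sup>+x. ennreal (norm (G (Complex x (- hgt n)) - k 1 x)) \<partial>wlb) \<longlonglongrightarrow> 0" using bdryD(5)[OF b, of "-1"] by simp
qed

text \<open>Without a jump the function is constant on the upper half plane, and decay along the
  imaginary axis alone identifies the constant.\<close>

lemma bdry_zero:
 assumes b: "bdry G k" and eq: "AE x in lborel. k 1 x = k (-1) x"
  and dec: "\<And>y. 0 < y ==> norm (G (Complex 0 y)) <= K / y"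
 shows "\<And>z. 0 < Im z ==> G z = 0" "AE x in lborel. k 1 x = 0"
proof -
 obtain c where c: "\<And>z. 0 < Im z ==> G z = c" "AE x in lborel. k 1 x = c" using bdry_const[OF b eq] by blast
 have "c = 0"
 proof (rule ccontr)
  assume "c \<noteq> 0"
  then have n: "0 < norm c" by simp
  have le: "norm c <= K / y" if "0 < y" for y using dec[OF that] c(1)[of "Complex 0 y"] that by simp
  have K: "0 < K" using le[of 1] n by linarith
  have "norm c <= K / (2 * K / norm c)" by (rule le) (use K n in simp)
  then show False using K n by simp
 qed
 then show "\<And>z. 0 < Im z ==> G z = 0" "AE x in lborel. k 1 x = 0" using c by auto
qed

lemma winteg_diff:
 assumes [measurable]: "f \<in> BM" "g \<in> BM" and f: "winteg f" and g: "winteg g"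
 shows "winteg (%x. f x - c * g x)"
proof -
 have "(\<integral>\<^sup>+x. ennreal (norm (f x - c * g x)) \<partial>wlb) <= (\<integral>\<^sup>+x. ennreal (norm (f x)) + ennreal (norm c) * ennreal (norm (g x)) \<partial>wlb)"
 proof (intro nn_integral_mono)
  fix x
  have "norm (f x - c * g x) <= norm (f x) + norm c * norm (g x)" using norm_triangle_ineq4[of "f x" "c * g x"] by (simp add: norm_mult)
  then show "ennreal (norm (f x - c * g x)) <= ennreal (norm (f x)) + ennreal (norm c) * ennreal (norm (g x))"
   by (metis ennreal_leI ennreal_mult ennreal_plus norm_ge_zero mult_nonneg_nonneg)
 qed
 also have "\<dots> = (\<integral>\<^sup>+x. ennreal (norm (f x)) \<partial>wlb) + ennreal (norm c) * (\<integral>\<^sup>+x. ennreal (norm (g x)) \<partial>wlb)"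
  by (simp add: nn_integral_add nn_integral_cmult)
 also have "\<dots> < \<infinity>" using f g winteg_iff_wlb[of f] winteg_iff_wlb[of g] by (auto simp: ennreal_mult_less_top)
 finally show ?thesis using winteg_iff_wlb[of "%x. f x - c * g x"] by simp
qed

lemma bdry_diff:
 assumes b: "bdry G k" and b': "bdry G' k'"
 shows "bdry (%z. G z - c * G' z) (%\<sigma> x. k \<sigma> x - c * k' \<sigma> x)"
 unfolding bdry_def
proof (intro conjI allI impI ballI)
 show "(%z. G z - c * G' z) holomorphic_on {z. Im z \<noteq> 0}" by (intro holomorphic_intros bdryD(1)[OF b] bdryD(1)[OF b'])
 fix y :: real assume y: "0 < y"
 obtain M where M: "\<And>z. y <= \<bar>Im z\<bar> ==> norm (G z) <= M" using bdryD(2)[OF b y] by blast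
 obtain M' where M': "\<And>z. y <= \<bar>Im z\<bar> ==> norm (G' z) <= M'" using bdryD(2)[OF b' y] by blast
 show "\<exists>M. \<forall>z. y <= \<bar>Im z\<bar> --> norm (G z - c * G' z) <= M"
 proof (intro exI[of _ "M + norm c * M'"] allI impI)
  fix z assume z: "y <= \<bar>Im z\<bar>"
  have "norm (G z - c * G' z) <= norm (G z) + norm c * norm (G' z)" using norm_triangle_ineq4[of "G z" "c * G' z"] by (simp add: norm_mult)
  also have "\<dots> <= M + norm c * M'" by (intro add_mono mult_left_mono M M' z) auto
  finally show "norm (G z - c * G' z) <= M + norm c * M'" .
 qed
next
 fix \<sigma> :: real assume s: "\<sigma> \<in> {1, -1}"
 note [measurable] = bdryD(3)[OF b s] bdryD(3)[OF b' s] bdry_line_measurable[OF b s] bdry_line_measurable[OF b' s]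
 show m: "(%x. k \<sigma> x - c * k' \<sigma> x) \<in> BM" by measurable
 show "winteg (%x. k \<sigma> x - c * k' \<sigma> x)" by (intro winteg_diff bdryD(3,4)[OF b s] bdryD(3,4)[OF b' s])
 show "AE x in lborel. (%n. G (Complex x (\<sigma> * hgt n)) - c * G' (Complex x (\<sigma> * hgt n))) \<longlonglongrightarrow> k \<sigma> x - c * k' \<sigma> x"
  using bdryD(6)[OF b s] bdryD(6)[OF b' s] by eventually_elim (intro tendsto_intros)
 let ?I = "%n. \<integral>\<^sup>+x. ennreal (norm (G (Complex x (\<sigma> * hgt n)) - k \<sigma> x)) \<partial>wlb"
 let ?J = "%n. \<integral>\<^sup>+x. ennreal (norm (G' (Complex x (\<sigma> * hgt n)) - k' \<sigma> x)) \<partial>wlb"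
 have le: "(\<integral>\<^sup>+x. ennreal (norm (G (Complex x (\<sigma> * hgt n)) - c * G' (Complex x (\<sigma> * hgt n)) - (k \<sigma> x - c * k' \<sigma> x))) \<partial>wlb) <= ?I n + ennreal (norm c) * ?J n" for n
 proof -
  have "(\<integral>\<^sup>+x. ennreal (norm (G (Complex x (\<sigma> * hgt n)) - c * G' (Complex x (\<sigma> * hgt n)) - (k \<sigma> x - c * k' \<sigma> x))) \<partial>wlb)
    <= (\<integral>\<^sup>+x. ennreal (norm (G (Complex x (\<sigma> * hgt n)) - k \<sigma> x)) + ennreal (norm c) * ennreal (norm (G' (Complex x (\<sigma> * hgt n)) - k' \<sigma> x)) \<partial>wlb)"
  proof (intro nn_integral_mono)
   fix x
   let ?A = "G (Complex x (\<sigma> * hgt n)) - k \<sigma> x" and ?B = "G' (Complex x (\<sigma> * hgt n)) - k' \<sigma> x"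
   have "norm (?A - c * ?B) <= norm ?A + norm c * norm ?B" using norm_triangle_ineq4[of ?A "c * ?B"] by (simp only: norm_mult)
   moreover have "?A - c * ?B = G (Complex x (\<sigma> * hgt n)) - c * G' (Complex x (\<sigma> * hgt n)) - (k \<sigma> x - c * k' \<sigma> x)" by (simp add: algebra_simps)
   ultimately show "ennreal (norm (G (Complex x (\<sigma> * hgt n)) - c * G' (Complex x (\<sigma> * hgt n)) - (k \<sigma> x - c * k' \<sigma> x)))
     <= ennreal (norm ?A) + ennreal (norm c) * ennreal (norm ?B)"
    by (metis ennreal_leI ennreal_mult ennreal_plus norm_ge_zero mult_nonneg_nonneg)
  qed
  also have "\<dots> = ?I n + ennreal (norm c) * ?J n" by (simp add: nn_integral_add nn_integral_cmult)
  finally show ?thesis .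
 qed
 have "(%n. ?I n + ennreal (norm c) * ?J n) \<longlonglongrightarrow> 0 + ennreal (norm c) * 0"
  by (intro tendsto_add ennreal_tendsto_cmult bdryD(5)[OF b s] bdryD(5)[OF b' s]) auto
 then have lim: "(%n. ?I n + ennreal (norm c) * ?J n) \<longlonglongrightarrow> 0" by simp
 show "(%n. \<integral>\<^sup>+x. ennreal (norm (G (Complex x (\<sigma> * hgt n)) - c * G' (Complex x (\<sigma> * hgt n)) - (k \<sigma> x - c * k' \<sigma> x))) \<partial>wlb) \<longlonglongrightarrow> 0"
  by (rule tendsto_sandwich[OF _ _ tendsto_const lim]) (use le in auto)
qed

text \<open>The multiplier \<open>M\<close> may be unbounded: only the product has to be dominated
  by \<open>C * (norm (F z) + 1)\<close>, so that decay of \<open>F\<close> at infinity can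
  compensate growth of \<open>M\<close>.\<close>

lemma bdry_mult:
 assumes b: "bdry F k" and M: "M holomorphic_on {z. Im z \<noteq> 0}"
  and m: "\<And>\<sigma>. \<sigma> \<in> {1, -1} ==> m \<sigma> \<in> BM"
  and lim: "\<And>\<sigma>. \<sigma> \<in> {1, -1} ==> AE x in lborel. (%n. M (Complex x (\<sigma> * hgt n))) \<longlonglongrightarrow> m \<sigma> x"
  and C: "0 <= C" and dom: "\<And>z. Im z \<noteq> 0 ==> norm (F z * M z) <= C * (norm (F z) + 1)"
 shows "bdry (%z. F z * M z) (%\<sigma> x. k \<sigma> x * m \<sigma> x)"
proof -
 have h: "(%z. F z * M z) holomorphic_on {z. Im z \<noteq> 0}" by (intro holomorphic_intros bdryD(1)[OF b] M)
 show ?thesis unfolding bdry_def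
 proof (intro conjI allI impI ballI h)
 fix y :: real assume y: "0 < y"
 obtain B where B: "\<And>z. y <= \<bar>Im z\<bar> ==> norm (F z) <= B" using bdryD(2)[OF b y] by blast
 show "\<exists>B. \<forall>z. y <= \<bar>Im z\<bar> --> norm (F z * M z) <= B"
 proof (intro exI[of _ "C * (B + 1)"] allI impI)
  fix z assume z: "y <= \<bar>Im z\<bar>"
  have "norm (F z * M z) <= C * (norm (F z) + 1)" by (rule dom) (use z y in auto)
  also have "\<dots> <= C * (B + 1)" by (intro mult_left_mono add_mono B z C) auto
  finally show "norm (F z * M z) <= C * (B + 1)" .
 qed
next
 fix \<sigma> :: real assume s: "\<sigma> \<in> {1, -1}"
 note [measurable] = bdryD(3)[OF b s] m[OF s]
 have sn: "\<sigma> * hgt n \<noteq> 0" for n using s by auto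
 have L: "AE x in lborel. (%n. F (Complex x (\<sigma> * hgt n)) * M (Complex x (\<sigma> * hgt n))) \<longlonglongrightarrow> k \<sigma> x * m \<sigma> x"
  using bdryD(6)[OF b s] lim[OF s] by eventually_elim (intro tendsto_intros)
 show "AE x in lborel. (%n. F (Complex x (\<sigma> * hgt n)) * M (Complex x (\<sigma> * hgt n))) \<longlonglongrightarrow> k \<sigma> x * m \<sigma> x" by (rule L)
 show "(%x. k \<sigma> x * m \<sigma> x) \<in> BM" by measurable
 have D: "AE x in lborel. norm (k \<sigma> x * m \<sigma> x) <= C * (norm (k \<sigma> x) + 1)"
  using L bdryD(6)[OF b s]
 proof eventually_elim
  case (elim x)
  have "(%n. norm (F (Complex x (\<sigma> * hgt n)) * M (Complex x (\<sigma> * hgt n)))) \<longlonglongrightarrow> norm (k \<sigma> x * m \<sigma> x)"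
   "(%n. C * (norm (F (Complex x (\<sigma> * hgt n))) + 1)) \<longlonglongrightarrow> C * (norm (k \<sigma> x) + 1)"
   by (intro tendsto_intros elim)+
  then show ?case by (rule LIMSEQ_le) (use dom sn in auto)
 qed
 note * = dominated_L1_convergence[where F="%n x. F (Complex x (\<sigma> * hgt n))" and G="%n x. F (Complex x (\<sigma> * hgt n)) * M (Complex x (\<sigma> * hgt n))",
   OF bdry_line_measurable[OF b s] bdryD(3)[OF b s] holomorphic_line_measurable[OF h sn] _ bdryD(4,5)[OF b s] L C _ D]
 show "(%n. \<integral>\<^sup>+x. ennreal (norm (F (Complex x (\<sigma> * hgt n)) * M (Complex x (\<sigma> * hgt n)) - k \<sigma> x * m \<sigma> x)) \<partial>wlb) \<longlonglongrightarrow> 0"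
  by (rule *(1)) (use dom sn in auto)
 show "winteg (%x. k \<sigma> x * m \<sigma> x)"
  by (rule *(2)) (use dom sn in auto)
 qed
qed

lemma AE_neq_pm1: "AE x in lborel. x \<noteq> 1 \<and> x \<noteq> (-1::real)"
 using AE_lborel_singleton[of 1] AE_lborel_singleton[of "-1"] by eventually_elim simp

section \<open>A model function with power singularities at both end points\<close>

lemma nn_integral_powr_01:
 assumes r: "0 < r" "r < 1"
 shows "(\<integral>\<^sup>+u. ennreal (indicator {0..1} u * u powr (-r)) \<partial>lborel) < \<infinity>"
proof -
 have "((%x. x powr (-r)) has_integral (1 powr (-r + 1) / (-r + 1))) {0..1::real}"
  by (rule has_integral_powr_from_0) (use r in auto)
 then have "((%x. if x \<in> {0..1} then x powr (-r) else 0) has_integral (1 powr (-r + 1) / (-r + 1))) UNIV"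
  by (subst has_integral_restrict_UNIV)
 moreover have "(%x. if x \<in> {0..1} then x powr (-r) else 0) = (%x. indicator {0..1} x * x powr (-r))"
  by (auto simp: indicator_def)
 ultimately have "((%x. indicator {0..1} x * x powr (-r)) has_integral (1 powr (-r + 1) / (-r + 1))) UNIV" by simp
 then have "(\<integral>\<^sup>+u. ennreal (indicator {0..1} u * u powr (-r)) \<partial>lborel) = ennreal (1 powr (-r + 1) / (-r + 1))"
  by (intro nn_integral_has_integral_lborel) auto
 then show ?thesis by simp
qed

lemma nn_integral_powr_wlb:
 assumes r: "0 < r" "r < 1"
 shows "(\<integral>\<^sup>+x. ennreal (\<bar>x - c\<bar> powr (-r)) \<partial>wlb) < \<infinity>"
proof -
 let ?f = "%u::real. ennreal (indicator {0..1} u * u powr (-r))"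
 have ae: "\<bar>x - c\<bar> powr (-r) / (1 + x\<^sup>2) <= indicator {0..1} (x - c) * (x - c) powr (-r) + indicator {0..1} (c - x) * (c - x) powr (-r) + 1 / (1 + x\<^sup>2)" for x
 proof (cases "\<bar>x - c\<bar> <= 1")
  case True
  have "\<bar>x - c\<bar> powr (-r) / (1 + x\<^sup>2) <= \<bar>x - c\<bar> powr (-r) / 1" by (intro divide_left_mono) (auto simp: add_pos_nonneg)
  also have "\<dots> <= indicator {0..1} (x - c) * (x - c) powr (-r) + indicator {0..1} (c - x) * (c - x) powr (-r)"
   using True by (cases "c <= x") (auto simp: abs_if indicator_def)
  finally show ?thesis by (simp add: add_increasing2)
 next
  case False
  then have "\<bar>x - c\<bar> powr (-r) <= 1" using powr_mono2'[of "-r" 1 "\<bar>x - c\<bar>"] r by simp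
  then have "\<bar>x - c\<bar> powr (-r) / (1 + x\<^sup>2) <= 1 / (1 + x\<^sup>2)" by (intro divide_right_mono) auto
  moreover have "0 <= indicator {0..1} (x - c) * (x - c) powr (-r) + indicator {0..1} (c - x) * (c - x) powr (-r)" by simp
  ultimately show ?thesis by linarith
 qed
 have "(\<integral>\<^sup>+x. ennreal (\<bar>x - c\<bar> powr (-r)) \<partial>wlb) = (\<integral>\<^sup>+x. ennreal (\<bar>x - c\<bar> powr (-r) / (1 + x\<^sup>2)) \<partial>lborel)"
  using nn_integral_wlb[of "%x. of_real (\<bar>x - c\<bar> powr (-r))"] by simp
 also have "\<dots> <= (\<integral>\<^sup>+x. ?f (x - c) + ?f (c - x) + ennreal (1 / (1 + x\<^sup>2)) \<partial>lborel)"
 proof (intro nn_integral_mono)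
  fix x :: real
  have p: "0 <= 1 / (1 + x\<^sup>2)" by simp
  from ennreal_leI[OF ae[of x]] show "ennreal (\<bar>x - c\<bar> powr (-r) / (1 + x\<^sup>2)) <= ?f (x - c) + ?f (c - x) + ennreal (1 / (1 + x\<^sup>2))"
   using p by (simp only: ennreal_plus indicator_pos_le powr_ge_zero mult_nonneg_nonneg add_nonneg_nonneg)
 qed
 also have "\<dots> = (\<integral>\<^sup>+x. ?f (x - c) \<partial>lborel) + (\<integral>\<^sup>+x. ?f (c - x) \<partial>lborel) + (\<integral>\<^sup>+x. ennreal (1 / (1 + x\<^sup>2)) \<partial>lborel)"
  by (simp add: nn_integral_add)
 also have "(\<integral>\<^sup>+x. ?f (x - c) \<partial>lborel) = (\<integral>\<^sup>+x. ?f x \<partial>lborel)"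
  using nn_integral_real_affine[of ?f 1 "-c"] by (simp add: algebra_simps)
 also have "(\<integral>\<^sup>+x. ?f (c - x) \<partial>lborel) = (\<integral>\<^sup>+x. ?f x \<partial>lborel)"
  using nn_integral_real_affine[of ?f "-1" c] by (simp add: algebra_simps)
 also have "(\<integral>\<^sup>+x. ennreal (1 / (1 + x\<^sup>2)) \<partial>lborel) = ennreal pi"
  using nn_integral_poisson[of 1 0] by (simp add: add.commute)
 also have "(\<integral>\<^sup>+x. ?f x \<partial>lborel) + (\<integral>\<^sup>+x. ?f x \<partial>lborel) + ennreal pi < \<infinity>" using nn_integral_powr_01[OF r] by simp
 finally show ?thesis .
qed

text \<open>The function is \<open>z - 1\<close> to the power \<open>- a\<close> times
  \<open>z + 1\<close> to the power \<open>a - 1\<close>. The imaginary part of \<open>a\<close>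
  contributes only a bounded factor, because the imaginary part of \<open>Lg\<close> is
  bounded.\<close>

lemma norm_Vfun:
 assumes z: "Im z \<noteq> 0"
 shows "norm (exp (- a * Lg z) / (z + 1)) <= exp (pi * \<bar>Im a\<bar>) * (norm (z - 1) powr (- Re a) * norm (z + 1) powr (Re a - 1))"
proof -
 let ?A = "norm (z - 1)" and ?B = "norm (z + 1)"
 have "z - 1 \<noteq> 0" "z + 1 \<noteq> 0" using z by (auto simp: complex_eq_iff)
 then have AB: "0 < ?A" "0 < ?B" by simp_all
 have q: "(?A / ?B) powr (- Re a) / ?B = ?A powr (- Re a) * ?B powr (Re a - 1)"
  using AB by (simp add: powr_divide powr_diff powr_minus field_simps)
 have "Im a * Im (Lg z) <= \<bar>Im a\<bar> * \<bar>Im (Lg z)\<bar>" by (metis abs_ge_self abs_mult)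
 also have "\<dots> <= \<bar>Im a\<bar> * pi" by (intro mult_left_mono Lg_Im z) auto
 finally have e: "exp (Im a * Im (Lg z)) <= exp (pi * \<bar>Im a\<bar>)" by (simp add: mult.commute)
 have "norm (exp (- a * Lg z) / (z + 1)) = (?A / ?B) powr (- Re a) / ?B * exp (Im a * Im (Lg z))"
  unfolding norm_divide norm_exp_Lg[OF z] by simp
 also have "\<dots> = (?A powr (- Re a) * ?B powr (Re a - 1)) * exp (Im a * Im (Lg z))" unfolding q ..
 also have "\<dots> <= (?A powr (- Re a) * ?B powr (Re a - 1)) * exp (pi * \<bar>Im a\<bar>)" by (intro mult_left_mono e) auto
 finally show ?thesis by (simp add: mult.commute)
qed

lemma bdry_Vfun:
 assumes a: "0 < Re a" "Re a < 1"
 shows "bdry (%z. exp (- a * Lg z) / (z + 1)) (%\<sigma> x. exp (- a * Lgb \<sigma> x) / of_real (x + 1))"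
 unfolding bdry_def
proof (intro conjI allI impI ballI)
 let ?E = "exp (pi * \<bar>Im a\<bar>)"
 let ?V = "%z. exp (- a * Lg z) / (z + 1)"
 define B where "B = (%x::real. \<bar>x - 1\<bar> powr (- Re a) + \<bar>x + 1\<bar> powr (Re a - 1))"
 have [measurable]: "B \<in> BM" unfolding B_def by measurable
 have "z + 1 \<noteq> 0" if "Im z \<noteq> 0" for z :: complex using that by (auto simp: complex_eq_iff)
 then show h: "?V holomorphic_on {z. Im z \<noteq> 0}" by (intro holomorphic_intros Lg_holomorphic) auto
 have mono: "u powr (- Re a) <= v powr (- Re a)" "u powr (Re a - 1) <= v powr (Re a - 1)" if "0 < v" "v <= u" for u v :: real
  using that a by (auto intro!: powr_mono2')
 have im: "\<bar>Im z\<bar> <= norm (z - 1)" "\<bar>Im z\<bar> <= norm (z + 1)" for z using abs_Im_le_cmod[of "z - 1"] abs_Im_le_cmod[of "z + 1"] by simp_all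
 have re: "\<bar>Re z - 1\<bar> <= norm (z - 1)" "\<bar>Re z + 1\<bar> <= norm (z + 1)" for z using abs_Re_le_cmod[of "z - 1"] abs_Re_le_cmod[of "z + 1"] by simp_all
 fix y :: real assume y: "0 < y"
 show "\<exists>M. \<forall>z. y <= \<bar>Im z\<bar> --> norm (?V z) <= M"
 proof (intro exI[of _ "?E * (y powr (- Re a) * y powr (Re a - 1))"] allI impI)
  fix z assume z: "y <= \<bar>Im z\<bar>"
  have "norm (?V z) <= ?E * (norm (z - 1) powr (- Re a) * norm (z + 1) powr (Re a - 1))"
   by (rule norm_Vfun) (use z y in auto)
  also have "\<dots> <= ?E * (y powr (- Re a) * y powr (Re a - 1))"
   by (intro mult_left_mono mult_mono mono y order_trans[OF z im(1)] order_trans[OF z im(2)]) auto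
  finally show "norm (?V z) <= ?E * (y powr (- Re a) * y powr (Re a - 1))" .
 qed
next
 let ?E = "exp (pi * \<bar>Im a\<bar>)"
 let ?V = "%z. exp (- a * Lg z) / (z + 1)"
 \<comment> \<open>At every point one of the distances to 1 and -1 is at least 1, so the product of
   the two singular factors is at most their sum. Both exponents are above -1, and \<open>B\<close>
   serves as a dominating function independent of \<open>n\<close>.\<close>
 define B where "B = (%x::real. \<bar>x - 1\<bar> powr (- Re a) + \<bar>x + 1\<bar> powr (Re a - 1))"
 have [measurable]: "B \<in> BM" unfolding B_def by measurable
 have Bm: "(%x. cr (B x)) \<in> BM" by measurable
 have Bpos: "0 <= B x" for x by (simp add: B_def)
 have "z + 1 \<noteq> 0" if "Im z \<noteq> 0" for z :: complex using that by (auto simp: complex_eq_iff)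
 then have h: "?V holomorphic_on {z. Im z \<noteq> 0}" by (intro holomorphic_intros Lg_holomorphic) auto
 have mono: "u powr (- Re a) <= v powr (- Re a)" "u powr (Re a - 1) <= v powr (Re a - 1)" if "0 < v" "v <= u" for u v :: real
  using that a by (auto intro!: powr_mono2')
 have re: "\<bar>Re z - 1\<bar> <= norm (z - 1)" "\<bar>Re z + 1\<bar> <= norm (z + 1)" for z using abs_Re_le_cmod[of "z - 1"] abs_Re_le_cmod[of "z + 1"] by simp_all
 fix \<sigma> :: real assume s: "\<sigma> \<in> {1, -1}"
 have sn: "\<sigma> * hgt n \<noteq> 0" for n using s by auto
 have dom: "norm (?V (Complex x (\<sigma> * hgt n))) <= ?E * (norm (cr (B x)) + 1)" if x: "x \<noteq> 1" "x \<noteq> -1" for x n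
 proof -
  let ?z = "Complex x (\<sigma> * hgt n)"
  have "norm (?V ?z) <= ?E * (norm (?z - 1) powr (- Re a) * norm (?z + 1) powr (Re a - 1))" by (rule norm_Vfun) (use sn in simp)
  also have "\<dots> <= ?E * (\<bar>x - 1\<bar> powr (- Re a) * \<bar>x + 1\<bar> powr (Re a - 1))"
   using re[of ?z] x by (intro mult_left_mono mult_mono mono) auto
  also have "\<bar>x - 1\<bar> powr (- Re a) * \<bar>x + 1\<bar> powr (Re a - 1) <= B x"
  proof (cases "1 <= \<bar>x - 1\<bar>")
   case True
   have "\<bar>x - 1\<bar> powr (- Re a) <= 1" using mono(1)[OF zero_less_one True] by simp
   then have "\<bar>x - 1\<bar> powr (- Re a) * \<bar>x + 1\<bar> powr (Re a - 1) <= 1 * \<bar>x + 1\<bar> powr (Re a - 1)" by (intro mult_right_mono) auto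
   then show ?thesis by (simp add: B_def add_increasing)
  next
   case False
   then have "1 <= \<bar>x + 1\<bar>" by linarith
   then have "\<bar>x + 1\<bar> powr (Re a - 1) <= 1" using mono(2)[OF zero_less_one, of "\<bar>x + 1\<bar>"] by simp
   then have "\<bar>x - 1\<bar> powr (- Re a) * \<bar>x + 1\<bar> powr (Re a - 1) <= \<bar>x - 1\<bar> powr (- Re a) * 1" by (intro mult_left_mono) auto
   then show ?thesis by (simp add: B_def add_increasing2)
  qed
  then have "?E * (\<bar>x - 1\<bar> powr (- Re a) * \<bar>x + 1\<bar> powr (Re a - 1)) <= ?E * (norm (cr (B x)) + 1)"
   using Bpos[of x] by (intro mult_left_mono) auto
  finally show ?thesis .
 qed
 have Bw: "winteg (%x. cr (B x))"
 proof -
  have "(\<integral>\<^sup>+x. ennreal (norm (cr (B x))) \<partial>wlb) = (\<integral>\<^sup>+x. ennreal (\<bar>x - 1\<bar> powr (- Re a)) + ennreal (\<bar>x - (-1)\<bar> powr (- (1 - Re a))) \<partial>wlb)"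
  proof (intro nn_integral_cong)
   fix x
   have "norm (cr (B x)) = \<bar>x - 1\<bar> powr (- Re a) + \<bar>x - (-1)\<bar> powr (- (1 - Re a))"
    unfolding norm_of_real abs_of_nonneg[OF Bpos] by (simp add: B_def)
   then show "ennreal (norm (cr (B x))) = ennreal (\<bar>x - 1\<bar> powr (- Re a)) + ennreal (\<bar>x - (-1)\<bar> powr (- (1 - Re a)))"
    by (simp add: ennreal_plus)
  qed
  also have "\<dots> = (\<integral>\<^sup>+x. ennreal (\<bar>x - 1\<bar> powr (- Re a)) \<partial>wlb) + (\<integral>\<^sup>+x. ennreal (\<bar>x - (-1)\<bar> powr (- (1 - Re a))) \<partial>wlb)"
   by (rule nn_integral_add) (auto simp: wlb_def)
  also have "\<dots> < \<infinity>" using nn_integral_powr_wlb[of "Re a" 1] nn_integral_powr_wlb[of "1 - Re a" "-1"] a by simp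
  finally show ?thesis using winteg_iff_wlb[OF Bm] by simp
 qed
 show m: "(%x. exp (- a * Lgb \<sigma> x) / of_real (x + 1)) \<in> BM" by measurable
 show L: "AE x in lborel. (%n. ?V (Complex x (\<sigma> * hgt n))) \<longlonglongrightarrow> exp (- a * Lgb \<sigma> x) / of_real (x + 1)"
  using AE_neq_pm1
 proof eventually_elim
  case (elim x)
  have l: "(%n. Lg (Complex x (\<sigma> * hgt n))) \<longlonglongrightarrow> Lgb \<sigma> x" using Lg_tendsto elim s by auto
  have "(%n. cr x + \<i> * cr (\<sigma> * hgt n)) \<longlonglongrightarrow> cr x + \<i> * cr (\<sigma> * 0)"
   using filterlim_mono[OF hgt_lim at_within_le_nhds order_refl] by (intro tendsto_intros)
  then have z: "(%n. Complex x (\<sigma> * hgt n)) \<longlonglongrightarrow> of_real x" by (simp add: Complex_eq)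
  have "cr x + 1 \<noteq> 0" using elim by (auto simp: complex_eq_iff)
  then have "(%n. ?V (Complex x (\<sigma> * hgt n))) \<longlonglongrightarrow> exp (- a * Lgb \<sigma> x) / (of_real x + 1)" by (intro tendsto_intros l z)
  then show ?case by simp
 qed
 have D: "AE x in lborel. norm (exp (- a * Lgb \<sigma> x) / of_real (x + 1)) <= ?E * (norm (cr (B x)) + 1)"
  using L AE_neq_pm1
 proof eventually_elim
  case (elim x)
  show ?case by (rule LIMSEQ_le_const2[OF tendsto_norm[OF elim(1)]]) (use dom elim in auto)
 qed
 note * = dominated_L1_convergence[where F="%n x. cr (B x)" and G="%n x. ?V (Complex x (\<sigma> * hgt n))",
   OF Bm Bm holomorphic_line_measurable[OF h sn] m Bw _ L _ _ D]
 have dom': "AE x in lborel. norm (?V (Complex x (\<sigma> * hgt n))) <= ?E * (norm (cr (B x)) + 1)" for n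
  using AE_neq_pm1 by eventually_elim (use dom in auto)
 show "(%n. \<integral>\<^sup>+x. ennreal (norm (?V (Complex x (\<sigma> * hgt n)) - exp (- a * Lgb \<sigma> x) / of_real (x + 1))) \<partial>wlb) \<longlonglongrightarrow> 0"
  by (rule *(1)) (use dom' in auto)
 show "winteg (%x. exp (- a * Lgb \<sigma> x) / of_real (x + 1))"
  by (rule *(2)) (use dom' in auto)
qed

text \<open>The branch of the exponent is fixed by taking the logarithm of
  \<open>(1 - z) / (1 + z)\<close> instead of its negative: for \<open>z\<close> other than 1 and -1
  the real part lies in (0,1], centred at 1/2.\<close>

definition expo :: "complex => complex" where
 "expo z = 1 / 2 - \<i> * Ln ((1 - z) / (1 + z)) / of_real (2 * pi)"

lemma Re_expo: "Re (expo z) = 1 / 2 + Im (Ln ((1 - z) / (1 + z))) / (2 * pi)"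
 unfolding expo_def by (simp add: Re_divide_of_real del: of_real_mult)

lemma exp_expo:
 assumes "z \<noteq> 1" "z \<noteq> -1"
 shows "exp (2 * of_real pi * \<i> * expo z) = (z - 1) / (z + 1)"
proof -
 have z: "1 - z \<noteq> 0" "1 + z \<noteq> 0" using assms by (auto simp: add_eq_0_iff)
 then have nz: "(1 - z) / (1 + z) \<noteq> 0" by simp
 have "2 * of_real pi * \<i> * expo z = of_real pi * \<i> + Ln ((1 - z) / (1 + z))"
  unfolding expo_def by (simp add: field_simps)
 then have "exp (2 * of_real pi * \<i> * expo z) = exp (of_real pi * \<i>) * exp (Ln ((1 - z) / (1 + z)))" by (simp only: exp_add)
 also have "\<dots> = - ((1 - z) / (1 + z))" unfolding exp_Ln[OF nz] exp_pi_i by (rule mult_minus1)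
 also have "\<dots> = (z - 1) / (z + 1)" by (metis add.commute minus_diff_eq minus_divide_left)
 finally show ?thesis .
qed

text \<open>\<open>(1 - z) / (1 + z)\<close> has the argument of
  \<open>(1 - z) * cnj (1 + z)\<close>, whose real part is \<open>1 - (norm z)\<^sup>2\<close> and
  whose imaginary part is \<open>- 2 * Im z\<close>; the square root is its modulus.\<close>

lemma cos_Im_Ln:
 assumes "z \<noteq> 1" "z \<noteq> -1"
 shows "0 < (1 - (norm z)\<^sup>2)\<^sup>2 + 4 * (Im z)\<^sup>2"
  "cos (Im (Ln ((1 - z) / (1 + z)))) * sqrt ((1 - (norm z)\<^sup>2)\<^sup>2 + 4 * (Im z)\<^sup>2) = 1 - (norm z)\<^sup>2"
proof -
 have z: "1 - z \<noteq> 0" "1 + z \<noteq> 0" using assms by (auto simp: add_eq_0_iff)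
 define \<zeta> where "\<zeta> = (1 - z) / (1 + z)"
 define v where "v = (1 - z) * cnj (1 + z)"
 have v0: "v \<noteq> 0" unfolding v_def using z by (simp add: complex_cnj_cancel_iff del: complex_cnj_add)
 have Rv: "Re v = 1 - (norm z)\<^sup>2" "Im v = - 2 * Im z" unfolding v_def cmod_power2 by (simp_all add: algebra_simps power2_eq_square)
 have D: "(norm v)\<^sup>2 = (1 - (norm z)\<^sup>2)\<^sup>2 + 4 * (Im z)\<^sup>2" unfolding cmod_power2[of v] Rv by (simp add: power2_eq_square)
 show "0 < (1 - (norm z)\<^sup>2)\<^sup>2 + 4 * (Im z)\<^sup>2" using v0 unfolding D[symmetric] by simp
 have nv: "sqrt ((1 - (norm z)\<^sup>2)\<^sup>2 + 4 * (Im z)\<^sup>2) = norm v" unfolding D[symmetric] by simp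
 define K where "K = (norm (1 + z))\<^sup>2"
 have K: "0 < K" unfolding K_def using z by simp
 have zv: "\<zeta> = v / of_real K" unfolding \<zeta>_def v_def K_def complex_div_cnj[of "1 - z"] by simp
 have \<zeta>0: "\<zeta> \<noteq> 0" unfolding \<zeta>_def using z by simp
 have "Re (exp (Ln \<zeta>)) = exp (Re (Ln \<zeta>)) * cos (Im (Ln \<zeta>))" by (rule Re_exp)
 then have "Re \<zeta> = norm \<zeta> * cos (Im (Ln \<zeta>))" using \<zeta>0 by simp
 moreover have "Re \<zeta> = Re v / K" "norm \<zeta> = norm v / K" unfolding zv using K by (simp_all add: norm_divide Re_divide_of_real)
 ultimately have "Re v = norm v * cos (Im (Ln \<zeta>))" using K by (simp add: field_simps)
 then show "cos (Im (Ln ((1 - z) / (1 + z)))) * sqrt ((1 - (norm z)\<^sup>2)\<^sup>2 + 4 * (Im z)\<^sup>2) = 1 - (norm z)\<^sup>2"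
  unfolding nv \<zeta>_def[symmetric] Rv by (simp add: mult.commute)
qed

text \<open>With \<open>L = (norm z)\<^sup>2\<close>, \<open>W = 4 * (Im z)\<^sup>2\<close> and
  \<open>t = \<alpha>\<^sup>2\<close> this says that the cosine of the argument does not decrease
  when \<open>z\<close> is replaced by \<open>\<alpha> * z\<close>.\<close>

lemma cos_compare:
 fixes L W t :: real
 assumes L: "0 <= L" and W: "0 <= W" and t: "0 <= t" "t <= 1"
 shows "(1 - L) * sqrt ((1 - t * L)\<^sup>2 + t * W) <= (1 - t * L) * sqrt ((1 - L)\<^sup>2 + W)"
proof -
 define X where "X = 1 - L"
 define X' where "X' = 1 - t * L"
 have XX: "X <= X'" unfolding X_def X'_def using mult_right_mono[OF t(2) L] by simp
 \<comment> \<open>The squares of the two sides differ by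
   \<open>(t * X\<^sup>2 - X'\<^sup>2) * W\<close>. For \<open>0 < X \<le> X'\<close> this is
   nonpositive. For \<open>X' < 0\<close> it factors through
   \<open>(1 - t) * (t * L * L - 1)\<close> and is nonnegative, which is the right direction because
   both sides are then negative.\<close>
 have key: "X\<^sup>2 * (X'\<^sup>2 + t * W) - X'\<^sup>2 * (X\<^sup>2 + W) = (t * X\<^sup>2 - X'\<^sup>2) * W" by (simp add: algebra_simps)
 have sq: "\<bar>c\<bar> * sqrt d = sqrt (c\<^sup>2 * d)" for c d :: real by (simp add: real_sqrt_mult)
 have "X * sqrt (X'\<^sup>2 + t * W) <= X' * sqrt (X\<^sup>2 + W)"
 proof (cases "0 <= X'")
  case True
  show ?thesis
  proof (cases "X <= 0")
   case Xn: True
   have "X * sqrt (X'\<^sup>2 + t * W) <= 0" using Xn t W by (intro mult_nonpos_nonneg) auto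
   also have "0 <= X' * sqrt (X\<^sup>2 + W)" using True W by (intro mult_nonneg_nonneg) auto
   finally show ?thesis .
  next
   case Xn: False
   then have "X\<^sup>2 <= X'\<^sup>2" using XX by (intro power_mono) auto
   moreover have "t * X\<^sup>2 <= 1 * X\<^sup>2" by (intro mult_right_mono t) auto
   ultimately have "(t * X\<^sup>2 - X'\<^sup>2) * W <= 0" by (intro mult_nonpos_nonneg W) linarith
   then have "sqrt (X\<^sup>2 * (X'\<^sup>2 + t * W)) <= sqrt (X'\<^sup>2 * (X\<^sup>2 + W))" using key by (intro real_sqrt_le_mono) linarith
   then show ?thesis unfolding sq[symmetric] using Xn True by simp
  qed
 next
  case False
  then have tL: "1 < t * L" unfolding X'_def by simp
  moreover have "t * L <= 1 * L" by (intro mult_right_mono t L)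
  ultimately have "1 * 1 <= (t * L) * L" by (intro mult_mono) auto
  then have "0 <= (1 - t) * (t * L * L - 1)" using t by (intro mult_nonneg_nonneg) auto
  moreover have "t * X\<^sup>2 - X'\<^sup>2 = (1 - t) * (t * L * L - 1)" unfolding X_def X'_def by (simp add: power2_eq_square algebra_simps)
  ultimately have "0 <= (t * X\<^sup>2 - X'\<^sup>2) * W" using W by (intro mult_nonneg_nonneg) auto
  then have "sqrt (X'\<^sup>2 * (X\<^sup>2 + W)) <= sqrt (X\<^sup>2 * (X'\<^sup>2 + t * W))" using key by (intro real_sqrt_le_mono) linarith
  then show ?thesis unfolding sq[symmetric] using False XX by simp
 qed
 then show ?thesis unfolding X_def X'_def .
qed

lemma abs_le_if_cos_ge:
 fixes \<theta> \<phi> :: real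
 assumes "cos \<theta> <= cos \<phi>" "\<bar>\<phi>\<bar> <= pi"
 shows "\<bar>\<phi>\<bar> <= \<bar>\<theta>\<bar>"
proof (rule ccontr)
 assume "\<not> ?thesis"
 then have "cos \<bar>\<phi>\<bar> < cos \<bar>\<theta>\<bar>" using assms(2) by (intro cos_monotone_0_pi) auto
 then show False using assms(1) by simp
qed

lemma abs_Im_Ln_le_pi: "z \<noteq> 0 ==> \<bar>Im (Ln z)\<bar> <= pi"
 using mpi_less_Im_Ln[of z] Im_Ln_le_pi[of z] by linarith

lemma Im_Ln_scale:
 assumes z: "z \<noteq> 1" "z \<noteq> -1" and w: "of_real \<alpha> * z \<noteq> 1" "of_real \<alpha> * z \<noteq> -1" and \<alpha>: "\<bar>\<alpha>\<bar> <= 1"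
 shows "\<bar>Im (Ln ((1 - of_real \<alpha> * z) / (1 + of_real \<alpha> * z)))\<bar> <= \<bar>Im (Ln ((1 - z) / (1 + z)))\<bar>"
proof -
 let ?w = "of_real \<alpha> * z"
 define D where "D = (1 - (norm z)\<^sup>2)\<^sup>2 + 4 * (Im z)\<^sup>2"
 define D' where "D' = (1 - (norm ?w)\<^sup>2)\<^sup>2 + 4 * (Im ?w)\<^sup>2"
 let ?c = "cos (Im (Ln ((1 - z) / (1 + z))))" and ?c' = "cos (Im (Ln ((1 - ?w) / (1 + ?w))))"
 have 1: "0 < sqrt D" "?c * sqrt D = 1 - (norm z)\<^sup>2" using cos_Im_Ln[OF z] unfolding D_def[symmetric] by simp_all
 have 2: "0 < sqrt D'" "?c' * sqrt D' = 1 - (norm ?w)\<^sup>2" using cos_Im_Ln[OF w] unfolding D'_def[symmetric] by simp_all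
 have nw: "(norm ?w)\<^sup>2 = \<alpha>\<^sup>2 * (norm z)\<^sup>2" by (simp add: norm_mult power_mult_distrib)
 have D': "D' = (1 - \<alpha>\<^sup>2 * (norm z)\<^sup>2)\<^sup>2 + \<alpha>\<^sup>2 * (4 * (Im z)\<^sup>2)" unfolding D'_def nw by (simp add: power_mult_distrib)
 have "\<alpha>\<^sup>2 <= 1" using \<alpha> by (simp add: abs_square_le_1)
 then have "(1 - (norm z)\<^sup>2) * sqrt D' <= (1 - (norm ?w)\<^sup>2) * sqrt D"
  unfolding D' nw D_def by (intro cos_compare) auto
 then have "?c * (sqrt D * sqrt D') <= ?c' * (sqrt D * sqrt D')" unfolding 1(2)[symmetric] 2(2)[symmetric] by (simp add: ac_simps)
 then have le: "?c <= ?c'" using 1(1) 2(1) by (simp only: mult_le_cancel_right_pos mult_pos_pos)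
 have "1 - ?w \<noteq> 0" "1 + ?w \<noteq> 0" using w by (auto simp: add_eq_0_iff)
 then have "(1 - ?w) / (1 + ?w) \<noteq> 0" by simp
 then show ?thesis by (intro abs_le_if_cos_ge le abs_Im_Ln_le_pi)
qed

text \<open>If \<open>\<alpha> * z\<close> were 1 or -1, then \<open>z\<close> would be real with
  \<open>norm z \<ge> 1\<close>, where \<open>(1 - z) / (1 + z)\<close> is negative and its argument
  is \<open>pi\<close>, contrary to \<open>lt\<close>.\<close>

lemma scale_neq:
 assumes z: "z \<noteq> 1" "z \<noteq> -1" and lt: "\<bar>Im (Ln ((1 - z) / (1 + z)))\<bar> < pi" and \<alpha>: "\<bar>\<alpha>\<bar> <= 1"
 shows "of_real \<alpha> * z \<noteq> 1" "of_real \<alpha> * z \<noteq> -1"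
proof -
 have False if e: "of_real \<alpha> * z = 1 \<or> of_real \<alpha> * z = -1"
 proof -
  have "\<alpha> \<noteq> 0" using e by auto
  moreover have "Im (of_real \<alpha> * z) = 0"
   by (rule disjE[OF e]) (simp only: one_complex.sel uminus_complex.sel minus_zero)+
  ultimately have im: "Im z = 0" by simp
  have "norm (of_real \<alpha> * z) = 1" using e by auto
  then have "\<bar>\<alpha>\<bar> * norm z = 1" by (simp add: norm_mult)
  moreover have "\<bar>\<alpha>\<bar> * norm z <= 1 * norm z" by (intro mult_right_mono \<alpha>) auto
  ultimately have "1\<^sup>2 <= (norm z)\<^sup>2" by (intro power_mono) auto
  then have X: "1 - (norm z)\<^sup>2 <= 0" by simp
  let ?X = "1 - (norm z)\<^sup>2"
  have c: "0 < ?X\<^sup>2" "cos (Im (Ln ((1 - z) / (1 + z)))) * sqrt (?X\<^sup>2) = ?X" using cos_Im_Ln[OF z] unfolding im by simp_all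
  have "sqrt (?X\<^sup>2) = - ?X" using X by simp
  then have "cos (Im (Ln ((1 - z) / (1 + z)))) * (- ?X) = (-1) * (- ?X)" using c(2) by simp
  moreover have "- ?X \<noteq> 0" using c(1) by (metis neg_0_equal_iff_equal less_irrefl zero_power2)
  ultimately have "cos (Im (Ln ((1 - z) / (1 + z)))) = -1" by (simp only: mult_cancel_right) simp
  moreover have "cos pi < cos \<bar>Im (Ln ((1 - z) / (1 + z)))\<bar>" using lt by (intro cos_monotone_0_pi) auto
  ultimately show False by simp
 qed
 then show "of_real \<alpha> * z \<noteq> 1" "of_real \<alpha> * z \<noteq> -1" by blast+
qed

text \<open>In classical notation \<open>1 - x\<close> to the power \<open>- a\<close> times
  \<open>1 + x\<close> to the power \<open>a - 1\<close>, written with one real logarithm. Being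
  Borel and 0 outside the interval, it can be used directly on the real line.\<close>

definition wfun :: "complex => real => complex" where
 "wfun a x = (if \<bar>x\<bar> < 1 then exp (- a * of_real (ln ((1 - x) / (1 + x)))) / of_real (1 + x) else 0)"

lemma wfun_measurable[measurable]: "wfun a \<in> BM"
 unfolding wfun_def by measurable

lemma norm_wfun:
 assumes x: "\<bar>x\<bar> < 1"
 shows "norm (wfun a x) = exp (Re a * (ln (1 + x) - ln (1 - x))) / (1 + x)"
proof -
 have p: "0 < 1 - x" "0 < 1 + x" using x by auto
 have "norm (exp (- a * of_real (ln ((1 - x) / (1 + x))))) = exp (- (Re a * ln ((1 - x) / (1 + x))))"
  unfolding norm_exp_eq_Re by simp
 moreover have "- (Re a * ln ((1 - x) / (1 + x))) = Re a * (ln (1 + x) - ln (1 - x))" using p by (simp add: ln_div algebra_simps)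
 ultimately have "norm (exp (- a * of_real (ln ((1 - x) / (1 + x))))) = exp (Re a * (ln (1 + x) - ln (1 - x)))" by (simp only:)
 then show ?thesis unfolding wfun_def if_P[OF x] norm_divide norm_of_real using p by (simp only: abs_of_pos)
qed

text \<open>With \<open>l = ln (1 + x) - ln (1 - x)\<close> the moduli of \<open>wfun a\<close> at
  \<open>x\<close> and \<open>- x\<close> are \<open>exp (Re a * l)\<close> and
  \<open>exp ((1 - Re a) * l)\<close> over \<open>1 + x\<close>. The hypothesis places
  \<open>Re a'\<close> between \<open>Re a\<close> and \<open>1 - Re a\<close>, so its exponential
  is at most one of the two.\<close>

lemma norm_wfun_le:
 assumes r: "\<bar>Re a' - 1 / 2\<bar> <= \<bar>Re a - 1 / 2\<bar>"
 shows "norm (wfun a' x) <= norm (wfun a x) + norm (wfun a (- x))"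
proof (cases "\<bar>x\<bar> < 1")
 case True
 define l where "l = ln (1 + x) - ln (1 - x)"
 have p: "0 < 1 - x" "0 < 1 + x" using True by auto
 have n: "norm (wfun b x) = exp (Re b * l) / (1 + x)" for b using norm_wfun[OF True] unfolding l_def .
 have el: "exp l = (1 + x) / (1 - x)" unfolding l_def using p by (simp add: exp_diff)
 have "norm (wfun a (- x)) = exp (Re a * (- l)) / (1 - x)" using norm_wfun[of "- x" a] True unfolding l_def by (simp add: algebra_simps)
 also have "\<dots> = exp ((1 - Re a) * l) / (1 + x)"
 proof -
  have "exp ((1 - Re a) * l) = exp l * exp (Re a * (- l))" by (simp add: exp_add[symmetric] algebra_simps)
  then show ?thesis unfolding el using p by (simp add: field_simps)
 qed
 finally have n2: "norm (wfun a (- x)) = exp ((1 - Re a) * l) / (1 + x)" .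
 have "exp (Re a' * l) <= exp (Re a * l) + exp ((1 - Re a) * l)"
 proof -
  have "Re a' * l <= Re a * l \<or> Re a' * l <= (1 - Re a) * l"
  proof (cases "0 <= l")
   case True
   have "Re a' <= Re a \<or> Re a' <= 1 - Re a" using r by (auto simp: abs_if split: if_splits)
   then show ?thesis using True by (auto intro: mult_right_mono)
  next
   case False
   have "Re a <= Re a' \<or> 1 - Re a <= Re a'" using r by (auto simp: abs_if split: if_splits)
   then show ?thesis using False by (auto intro: mult_right_mono_neg)
  qed
  moreover have "0 < exp (Re a * l)" "0 < exp ((1 - Re a) * l)" by simp_all
  moreover have "Re a' * l <= c ==> exp (Re a' * l) <= exp c" for c by simp
  ultimately show ?thesis by (smt (verit))
 qed
 then have "exp (Re a' * l) / (1 + x) <= (exp (Re a * l) + exp ((1 - Re a) * l)) / (1 + x)" using p by (intro divide_right_mono) auto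
 then show ?thesis unfolding n n2 by (simp add: add_divide_distrib)
qed (simp add: wfun_def)

text \<open>For \<open>Re a = 1\<close> the modulus is \<open>1 / (1 - x)\<close>, whose integral
  diverges logarithmically at 1.\<close>

lemma wfun_not_integrable:
 assumes a: "Re a = 1"
 shows "\<not> integrable lborel (wfun a)"
proof
 assume i: "integrable lborel (wfun a)"
 define I where "I = (\<integral>x. norm (wfun a x) \<partial>lborel)"
 have I: "0 <= I" unfolding I_def by simp
 have nI: "(\<integral>\<^sup>+x. ennreal (norm (wfun a x)) \<partial>lborel) = ennreal I"
  unfolding I_def by (rule nn_integral_eq_integral) (use i in auto)
 \<comment> \<open>Chosen so that the integral of \<open>1 / (1 - x)\<close> over [0,b] is
   \<open>I + 1\<close>, one more than the supposed total.\<close>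
 define b where "b = 1 - exp (- (I + 1))"
 have b: "0 < b" "b < 1" unfolding b_def using I by auto
 have d: "((%x. - ln (1 - x)) has_real_derivative 1 / (1 - x)) (at x within S)" "0 <= 1 / (1 - x)" if "x <= b" for x S
  using that b by (auto intro!: derivative_eq_intros)
 let ?g = "%x. if x <= b then 1 / (1 - x) else 0"
 have "(\<integral>\<^sup>+x. ennreal (1 / (1 - x)) * indicator {0..b} x \<partial>lborel) = (\<integral>\<^sup>+x. ennreal (?g x) * indicator {0..b} x \<partial>lborel)"
  by (intro nn_integral_cong) (auto simp: indicator_def)
 also have "\<dots> = ennreal (- ln (1 - b) - (- ln (1 - 0)))"
  by (rule nn_integral_FTC_Icc[where F="%x. - ln (1 - x)" and f="?g"]) (use d b in auto)
 also have "- ln (1 - b) - (- ln (1 - 0)) = I + 1" unfolding b_def by simp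
 finally have F: "(\<integral>\<^sup>+x. ennreal (1 / (1 - x)) * indicator {0..b} x \<partial>lborel) = ennreal (I + 1)" .
 have "(\<integral>\<^sup>+x. ennreal (1 / (1 - x)) * indicator {0..b} x \<partial>lborel) <= (\<integral>\<^sup>+x. ennreal (norm (wfun a x)) \<partial>lborel)"
 proof (intro nn_integral_mono)
  fix x show "ennreal (1 / (1 - x)) * indicator {0..b} x <= ennreal (norm (wfun a x))"
  proof (cases "x \<in> {0..b}")
   case True
   then have x: "\<bar>x\<bar> < 1" "0 < 1 - x" "0 < 1 + x" using b by auto
   have "norm (wfun a x) = 1 / (1 - x)" unfolding norm_wfun[OF x(1)] a using x by (simp add: exp_diff)
   then show ?thesis by (simp add: indicator_def)
  qed simp
 qed
 then show False unfolding F nI using I by (simp add: ennreal_le_iff)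
qed

text \<open>Up to a bounded factor the modulus is the geometric mean of \<open>norm (z - 1)\<close>
  and \<open>norm (z + 1)\<close> with weights \<open>Re a\<close> and \<open>1 - Re a\<close>. The
  decay of the Cauchy integral of a compactly supported function absorbs this linear growth.\<close>

lemma norm_Wfun:
 assumes z: "Im z \<noteq> 0" and r: "0 <= Re a" "Re a <= 1"
 shows "norm ((z + 1) * exp (a * Lg z)) <= exp (pi * \<bar>Im a\<bar>) * (1 + norm z)"
proof -
 let ?A = "norm (z - 1)" and ?B = "norm (z + 1)" and ?S = "1 + norm z"
 have "z - 1 \<noteq> 0" "z + 1 \<noteq> 0" using z by (auto simp: complex_eq_iff)
 then have AB: "0 < ?A" "0 < ?B" by simp_all
 have S: "?A <= ?S" "?B <= ?S" "0 < ?S" using norm_triangle_ineq4[of z 1] norm_triangle_ineq[of z 1] norm_ge_zero[of z] by (simp_all add: add_pos_nonneg)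
 have q: "?B * (?A / ?B) powr Re a = ?A powr Re a * ?B powr (1 - Re a)"
  using AB by (simp add: powr_divide powr_diff)
 have "- (Im a * Im (Lg z)) <= \<bar>Im a\<bar> * \<bar>Im (Lg z)\<bar>" by (metis abs_ge_minus_self abs_mult)
 also have "\<dots> <= \<bar>Im a\<bar> * pi" by (intro mult_left_mono Lg_Im z) auto
 finally have e: "exp (- (Im a * Im (Lg z))) <= exp (pi * \<bar>Im a\<bar>)" by (simp add: mult.commute)
 have "?A powr Re a * ?B powr (1 - Re a) <= ?S powr Re a * ?S powr (1 - Re a)"
  using AB S r by (intro mult_mono powr_mono2) auto
 also have "\<dots> = ?S" using S(3) by (simp add: powr_add[symmetric])
 finally have s: "?A powr Re a * ?B powr (1 - Re a) <= ?S" .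
 have "norm ((z + 1) * exp (a * Lg z)) = (?A powr Re a * ?B powr (1 - Re a)) * exp (- (Im a * Im (Lg z)))"
  unfolding norm_mult norm_exp_Lg[OF z] using q by simp
 also have "\<dots> <= ?S * exp (pi * \<bar>Im a\<bar>)" using S(3) by (intro mult_mono s e) auto
 finally show ?thesis by (simp add: mult.commute)
qed

lemma cauchyF_strip_bound:
 assumes f: "integrable lborel f" and y: "0 < y" "y <= \<bar>Im z\<bar>"
 shows "norm (cauchyF f z) <= (\<integral>s. norm (f s) \<partial>lborel) / (pi * y)"
 by (rule cauchyF_bound[OF f y(1)]) (rule order_trans[OF y(2) norm_of_real_minus_ge])

section \<open>The eigenvalue problem for the transform\<close>

context boyd_space
begin

text \<open>Outside (-1,1), where \<open>f\<close> vanishes, \<open>h\<close> is the common boundary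
  value from both sides. The integrability of a power of \<open>norm (f s)\<close> is inherited from
  the representative produced by \<open>hilbert_on_X\<close>, which agrees with \<open>f\<close>
  a.e.\<close>

lemma hilbert_bdry:
 assumes f: "f \<in> X" and fm[measurable]: "f \<in> BM" and supp: "\<And>s. s \<notin> {-1<..<1} ==> f s = 0"
 obtains h where "h \<in> BM" "integrable lborel f"
  "AE x in lborel. ((%e. ptrunc e f x) \<longlongrightarrow> h x) (at_right 0)"
  "bdry (cauchyF f) (%\<sigma> x. h x + of_real \<sigma> * f x)"
proof -
 obtain f' p where f'[measurable]: "f' \<in> BM" and f'0: "\<And>s. s \<notin> {-1<..<1} ==> f' s = 0"
  and eq: "AE x in lborel. x \<in> {-1<..<1} --> f x = f' x" and i': "integrable lborel f'"
  and p: "1 < p" "cos (p * pi / 2) \<noteq> 0" and fp': "(\<integral>\<^sup>+s. ennreal (norm (f' s) powr p) \<partial>lborel) < \<infinity>"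
  by (rule hilbert_on_X[OF ub lb f]) blast
 have ae: "AE x in lborel. f x = f' x" using eq by eventually_elim (metis supp f'0)
 have fi: "integrable lborel f" using i' integrable_cong_AE[of f lborel f'] ae by simp
 have "(\<integral>\<^sup>+s. ennreal (norm (f s) powr p) \<partial>lborel) = (\<integral>\<^sup>+s. ennreal (norm (f' s) powr p) \<partial>lborel)"
  by (rule nn_integral_cong_AE) (use ae in eventually_elim, simp)
 then have fp: "(\<integral>\<^sup>+s. ennreal (norm (f s) powr p) \<partial>lborel) < \<infinity>" using fp' by simp
 have supp1: "f s = 0" if "1 < \<bar>s\<bar>" for s using that by (intro supp) auto
 obtain h where h[measurable]: "h \<in> BM" and hw: "winteg h"
  and pt: "AE x in lborel. ((%e. ptrunc e f x) \<longlongrightarrow> h x) (at_right 0)"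
  and up: "AE x in lborel. ((%y. cauchyF f (Complex x y)) \<longlongrightarrow> h x + f x) (at_right 0)"
  and L: "(%n. \<integral>\<^sup>+x. ennreal (norm (cauchyF f (Complex x (hgt n)) - (h x + f x))) \<partial>wlb) \<longlonglongrightarrow> 0"
   "(%n. \<integral>\<^sup>+x. ennreal (norm (cauchyF f (Complex x (- hgt n)) - (h x - f x))) \<partial>wlb) \<longlonglongrightarrow> 0"
  by (rule hilbert_boundary[OF fm supp1 p fp])
 have fw: "winteg f" by (rule integrable_imp_winteg[OF fi])
 have upn: "AE x in lborel. (%n. cauchyF f (Complex x (hgt n))) \<longlonglongrightarrow> h x + f x"
  using up by eventually_elim (rule filterlim_compose[OF _ hgt_lim])
 have dnn: "AE x in lborel. (%n. cauchyF f (Complex x (- hgt n))) \<longlonglongrightarrow> h x - f x"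
  using upn winteg_AE_leb_pt[OF fw]
 proof eventually_elim
  case (elim x)
  have "(%n. poisson (hgt n) f x) \<longlonglongrightarrow> f x" by (rule filterlim_compose[OF poisson_tendsto[OF fw elim(2)] hgt_lim])
  then have "(%n. cauchyF f (Complex x (hgt n)) - 2 * poisson (hgt n) f x) \<longlonglongrightarrow> (h x + f x) - 2 * f x"
   by (intro tendsto_intros elim)
  then show ?case by (simp add: cauchyF_lower[OF fi])
 qed
 have "bdry (cauchyF f) (%\<sigma> x. h x + of_real \<sigma> * f x)"
  unfolding bdry_def
 proof (intro conjI allI impI ballI)
  show "cauchyF f holomorphic_on {z. Im z \<noteq> 0}" by (rule cauchyF_holomorphic[OF fi]) auto
  show "\<exists>M. \<forall>z. y <= \<bar>Im z\<bar> --> norm (cauchyF f z) <= M" if "0 < y" for y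
   using cauchyF_strip_bound[OF fi that] by blast
  fix \<sigma> :: real assume s: "\<sigma> \<in> {1, -1}"
  show "(%x. h x + of_real \<sigma> * f x) \<in> BM" by measurable
  show "winteg (%x. h x + of_real \<sigma> * f x)" using winteg_diff[OF h fm hw fw, of "- of_real \<sigma>"] by simp
  show "(%n. \<integral>\<^sup>+x. ennreal (norm (cauchyF f (Complex x (\<sigma> * hgt n)) - (h x + of_real \<sigma> * f x))) \<partial>wlb) \<longlonglongrightarrow> 0"
   using s L by auto
  show "AE x in lborel. (%n. cauchyF f (Complex x (\<sigma> * hgt n))) \<longlonglongrightarrow> h x + of_real \<sigma> * f x"
   using s upn dnn by auto
 qed
 with that[OF h fi pt] show thesis .
qed

lemma Lgb_outside: "\<not> \<bar>x\<bar> < 1 ==> Lgb \<sigma> x = Lgb \<tau> x" by (simp add: Lgb_def)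

text \<open>The eigenvalue relation \<open>h = z * f\<close> is available on the interval only: off
  it \<open>f\<close> vanishes while \<open>h\<close>, as boundary value of a Cauchy integral, in
  general does not.\<close>

lemma eigenfunction:
 assumes z: "z \<in> point_spectrum X T"
 obtains f h where "f \<in> X" "f \<in> BM" "\<And>s. s \<notin> {-1<..<1} ==> f s = 0" "integrable lborel f"
  "bdry (cauchyF f) (%\<sigma> x. h x + of_real \<sigma> * f x)" "AE x in lborel. \<bar>x\<bar> < 1 --> h x = z * f x"
  "\<not> (AE x in lborel. f x = 0)"
proof -
 obtain g where g: "g \<in> X" "\<not> ae_eq g (%x. 0)" "ae_eq (T g) (%x. z * g x)" using z unfolding point_spectrum_def by blast
 obtain f where f: "f \<in> BM" "\<And>s. s \<notin> {-1<..<1} ==> f s = 0"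
  and eq: "AE x in lborel. x \<in> {-1<..<1} --> g x = f x" by (rule borel_representative[OF XL0[OF g(1)]]) blast
 have "ae_eq g f" unfolding ae_eq_def AE_M11 by (rule eq)
 then have fX: "f \<in> X" using ae_closed[OF g(1) borel_L0[OF f(1)]] by blast
 obtain h where h: "h \<in> BM" "integrable lborel f"
  "AE x in lborel. ((%e. ptrunc e f x) \<longlongrightarrow> h x) (at_right 0)" "bdry (cauchyF f) (%\<sigma> x. h x + of_real \<sigma> * f x)"
  by (rule hilbert_bdry[OF fX f])
 have "AE x in M11. T g x = h x" by (rule hilbert_cong[OF XL0[OF g(1)] f h(2) eq h(3)])
 then have "AE x in lborel. x \<in> {-1<..<1} --> T g x = h x" unfolding AE_M11 .
 moreover have "AE x in lborel. x \<in> {-1<..<1} --> T g x = z * g x" using g(3) unfolding ae_eq_def AE_M11 .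
 ultimately have hz: "AE x in lborel. \<bar>x\<bar> < 1 --> h x = z * f x" using eq by eventually_elim (auto simp: abs_less_iff)
 have n0: "\<not> (AE x in lborel. f x = 0)"
 proof
  assume "AE x in lborel. f x = 0"
  then have "AE x in lborel. x \<in> {-1<..<1} --> g x = 0" using eq by eventually_elim auto
  then show False using g(2) unfolding ae_eq_def AE_M11 by blast
 qed
 show thesis by (rule that[OF fX f(1) _ h(2,4) hz n0]) (rule f(2))
qed

text \<open>If \<open>T f = f\<close>, the Cauchy integral \<open>F\<close> of \<open>f\<close> vanishes on \<open>(-1,1)\<close> from below. Multiplying by \<open>exp (\<i> s Lg)\<close> makes the
  jump on \<open>(-1,1)\<close> of size \<open>exp (- \<pi> s)\<close>, while inside the half plane the factor is only \<open>exp (- s \<theta>)\<close> with \<open>\<theta> < \<pi>\<close>;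
  \<open>s \<rightarrow> \<infinity>\<close> forces \<open>F = 0\<close>.\<close>

lemma one_not_eigenvalue: "1 \<notin> point_spectrum X T"
proof
 assume "1 \<in> point_spectrum X T"
 then obtain f h where fX: "f \<in> X" and f[measurable]: "f \<in> BM" and supp: "\<And>s. s \<notin> {-1<..<1} ==> f s = 0"
  and fi: "integrable lborel f" and b: "bdry (cauchyF f) (%\<sigma> x. h x + of_real \<sigma> * f x)"
  and hf: "AE x in lborel. \<bar>x\<bar> < 1 --> h x = 1 * f x" and nz: "\<not> (AE x in lborel. f x = 0)"
  by (rule eigenfunction) blast
 define A where "A = (\<integral>s. norm (f s) \<partial>lborel)"
 \<comment> \<open>The right side is independent of \<open>s\<close>, while
   \<open>Im (Lg z) < pi\<close> makes the exponential on the left unbounded in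
   \<open>s\<close>.\<close>
 have bound: "norm (cauchyF f z) * exp (s * (pi - Im (Lg z))) <= A / (pi * Im z)" if s: "0 < s" and z: "0 < Im z" for s z
 proof -
  define E where "E = (%z. exp (\<i> * of_real s * Lg z))"
  define e where "e = (%\<sigma> x. exp (\<i> * of_real s * Lgb \<sigma> x))"
  \<comment> \<open>The jump of \<open>cauchyF f * E\<close> on (-1,1): from above
    \<open>h + f = 2 * f\<close> times \<open>e 1\<close>, from below zero. As
    \<open>cauchyF u\<close> jumps by \<open>2 * u\<close>, half of it cancels this jump.\<close>
  define u where "u = (%x. 2 * f x * e 1 x)"
  have nE: "norm (E z) = exp (- (s * Im (Lg z)))" for z unfolding E_def norm_exp_eq_Re by simp
  have [measurable]: "e \<sigma> \<in> BM" for \<sigma> unfolding e_def by measurable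
  have um: "u \<in> BM" unfolding u_def by measurable
  have u0: "u x = 0" if "x \<notin> {-1<..<1}" for x using supp[OF that] by (simp add: u_def)
  have nu: "norm (u x) = 2 * exp (- (s * pi)) * norm (f x)" for x
  proof (cases "\<bar>x\<bar> < 1")
   case True
   then have "norm (e 1 x) = exp (- (s * pi))" unfolding e_def norm_exp_eq_Re Lgb_def by simp
   then show ?thesis by (simp add: u_def norm_mult)
  next
   case False
   then have "f x = 0" by (intro supp) auto
   then show ?thesis by (simp add: u_def)
  qed
  have uX: "u \<in> X"
  proof (rule lattice_mem(1)[OF borel_L0[OF um] scale_mem[OF fX, of 2]], intro AE_I2)
   fix x
   have "exp (- (s * pi)) * norm (f x) <= 1 * norm (f x)" using s by (intro mult_right_mono) auto
   then show "norm (u x) <= norm (2 * f x)" unfolding nu norm_mult by simp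
  qed
  obtain hu where hu: "integrable lborel u" "bdry (cauchyF u) (%\<sigma> x. hu x + of_real \<sigma> * u x)"
   by (rule hilbert_bdry[OF uX um u0])
  have Ah: "E holomorphic_on {z. Im z \<noteq> 0}" unfolding E_def by (intro holomorphic_intros Lg_holomorphic)
  have bm: "bdry (%z. cauchyF f z * E z) (%\<sigma> x. (h x + of_real \<sigma> * f x) * e \<sigma> x)"
  proof (rule bdry_mult[OF b Ah, where C="exp (s * pi)"])
   fix \<sigma> :: real assume sg: "\<sigma> \<in> {1, -1}"
   show "AE x in lborel. (%n. E (Complex x (\<sigma> * hgt n))) \<longlonglongrightarrow> e \<sigma> x" using AE_neq_pm1
   proof eventually_elim
    case (elim x)
    then have "(%n. Lg (Complex x (\<sigma> * hgt n))) \<longlonglongrightarrow> Lgb \<sigma> x" using Lg_tendsto sg by auto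
    then show ?case unfolding E_def e_def by (intro tendsto_intros)
   qed
  next
   fix z :: complex assume z: "Im z \<noteq> 0"
   have "- (s * Im (Lg z)) <= s * pi" using mult_left_mono[of "- Im (Lg z)" pi s] Lg_Im(2)[OF z] s by simp
   then have "norm (E z) <= exp (s * pi)" unfolding nE by simp
   then have "norm (cauchyF f z) * norm (E z) <= norm (cauchyF f z) * exp (s * pi)" by (intro mult_left_mono) auto
   then have "norm (cauchyF f z) * norm (E z) <= norm (cauchyF f z) * exp (s * pi) + exp (s * pi)"
    using exp_gt_zero[of "s * pi"] by linarith
   also have "\<dots> = exp (s * pi) * (norm (cauchyF f z) + 1)" by (simp add: algebra_simps)
   finally show "norm (cauchyF f z * E z) <= exp (s * pi) * (norm (cauchyF f z) + 1)" unfolding norm_mult .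
  qed auto
  have bd: "bdry (%z. cauchyF f z * E z - 1 / 2 * cauchyF u z) (%\<sigma> x. (h x + of_real \<sigma> * f x) * e \<sigma> x - 1 / 2 * (hu x + of_real \<sigma> * u x))"
   by (rule bdry_diff[OF bm hu(2)])
  define B where "B = (\<integral>s. norm (u s) \<partial>lborel)"
  have B: "B = 2 * exp (- (s * pi)) * A" unfolding B_def A_def nu by simp
  have zero: "cauchyF f z * E z - 1 / 2 * cauchyF u z = 0"
  proof (rule bdry_zero(1)[OF bd _ _ z])
   show "AE x in lborel. (h x + of_real 1 * f x) * e 1 x - 1 / 2 * (hu x + of_real 1 * u x) =
     (h x + of_real (-1) * f x) * e (-1) x - 1 / 2 * (hu x + of_real (-1) * u x)"
    using hf
   proof eventually_elim
    case (elim x)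
    show ?case
    proof (cases "\<bar>x\<bar> < 1")
     case True
     then show ?thesis using elim by (simp add: u_def field_simps)
    next
     case False
     have "f x = 0" by (rule supp) (use False in auto)
     moreover have "e 1 x = e (-1) x" unfolding e_def Lgb_outside[OF False, of 1 "-1"] ..
     ultimately show ?thesis by (simp add: u_def)
    qed
   qed
   fix y :: real assume y: "0 < y"
   let ?z = "Complex 0 y"
   have n: "norm (cauchyF f ?z) <= A / (pi * y)" "norm (cauchyF u ?z) <= B / (pi * y)"
    unfolding A_def B_def by (rule cauchyF_strip_bound; use y fi hu(1) in simp)+
   have nE1: "norm (E ?z) <= 1" unfolding nE using Lg_Im(1)[of ?z] y s by simp
   have "norm (cauchyF f ?z) * norm (E ?z) <= A / (pi * y) * 1"
    by (intro mult_mono n nE1) (use y in \<open>auto simp: A_def\<close>)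
   then have "norm (cauchyF f ?z * E ?z - 1 / 2 * cauchyF u ?z) <= A / (pi * y) + 1 / 2 * (B / (pi * y))"
    using n(2) norm_triangle_ineq4[of "cauchyF f ?z * E ?z" "1 / 2 * cauchyF u ?z"] by (simp add: norm_mult)
   also have "\<dots> = ((A + B / 2) / pi) / y" using y by (simp add: field_simps)
   finally show "norm (cauchyF f ?z * E ?z - 1 / 2 * cauchyF u ?z) <= ((A + B / 2) / pi) / y" .
  qed
  then have "cauchyF f z * E z = 1 / 2 * cauchyF u z" by simp
  then have "norm (cauchyF f z) * norm (E z) = 1 / 2 * norm (cauchyF u z)" by (metis norm_mult norm_divide norm_numeral norm_one)
  also have "\<dots> <= 1 / 2 * (B / (pi * Im z))" unfolding B_def
   by (intro mult_left_mono cauchyF_strip_bound hu(1)) (use z in auto)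
  also have "\<dots> = exp (- (s * pi)) * (A / (pi * Im z))" unfolding B by simp
  finally have le: "exp (s * pi) * (norm (cauchyF f z) * norm (E z)) <= exp (s * pi) * (exp (- (s * pi)) * (A / (pi * Im z)))"
   by (intro mult_left_mono) auto
  have e1: "exp (s * pi) * (exp (- (s * pi)) * (A / (pi * Im z))) = A / (pi * Im z)" by (simp add: exp_minus)
  have "exp (s * (pi - Im (Lg z))) = exp (s * pi) * exp (- (s * Im (Lg z)))" by (simp add: exp_add[symmetric] algebra_simps)
  then have "norm (cauchyF f z) * exp (s * (pi - Im (Lg z))) = exp (s * pi) * (norm (cauchyF f z) * norm (E z))"
   unfolding nE by (simp only: ac_simps)
  then show ?thesis using le unfolding e1 by (simp only:)
 qed
 have F0: "cauchyF f z = 0" if z: "0 < Im z" for z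
 proof (rule ccontr)
  assume "cauchyF f z \<noteq> 0"
  then have F: "0 < norm (cauchyF f z)" by simp
  define \<delta> where "\<delta> = pi - Im (Lg z)"
  have \<delta>: "0 < \<delta>" unfolding \<delta>_def using Lg_Im(1)[OF z] by simp
  \<comment> \<open>The bound measured relative to \<open>norm (cauchyF f z)\<close>. With
    \<open>s = (1 + Q) / \<delta>\<close> it would give \<open>exp (1 + Q) \<le> Q\<close>, against
    \<open>exp y \<ge> 1 + y\<close>.\<close>
  define Q where "Q = A / (pi * Im z) / norm (cauchyF f z)"
  have Q: "0 <= Q" unfolding Q_def A_def using z by simp
  have le: "norm (cauchyF f z) * exp ((1 + Q) / \<delta> * \<delta>) <= A / (pi * Im z)"
   using bound[OF _ z, of "(1 + Q) / \<delta>"] Q \<delta> unfolding \<delta>_def[symmetric] by simp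
  have e1: "(1 + Q) / \<delta> * \<delta> = 1 + Q" using \<delta> by simp
  have e2: "A / (pi * Im z) = norm (cauchyF f z) * Q" unfolding Q_def using F by simp
  have "norm (cauchyF f z) * exp (1 + Q) <= norm (cauchyF f z) * Q" using le unfolding e1 e2 .
  then have "exp (1 + Q) <= Q" using F by (simp only: mult_le_cancel_left_pos)
  then show False using exp_ge_add_one_self[of "1 + Q"] by linarith
 qed
 have "AE x in lborel. f x = 0"
  using bdryD(6)[OF b, of 1, simplified] hf
 proof eventually_elim
  case (elim x)
  have "(%n. cauchyF f (Complex x (hgt n))) \<longlonglongrightarrow> 0" by (simp add: F0)
  then have "h x + f x = 0" using elim(1) LIMSEQ_unique by blast
  show ?case
  proof (cases "\<bar>x\<bar> < 1")
   case True
   then show ?thesis using \<open>h x + f x = 0\<close> elim(2) by simp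
  next
   case False
   then show ?thesis by (intro supp) auto
  qed
 qed
 then show False using nz by simp
qed

text \<open>The symmetry of the point spectrum in 0 reduces the value -1 to the value 1.\<close>

lemma eigenvalue_neq:
 assumes "z \<in> point_spectrum X T" shows "z \<noteq> 1" "z \<noteq> -1"
proof -
 show "z \<noteq> 1" using one_not_eigenvalue assms by blast
 have "- z \<in> uminus ` point_spectrum X T" using assms by simp
 then have "- z \<in> point_spectrum X T" using spectra_symmetric[of "point_spectrum X T"] by simp
 then show "z \<noteq> -1" using one_not_eigenvalue by auto
qed

text \<open>The branch of \<open>expo\<close> yields \<open>0 < Re a \<le> 1\<close>. The strict
  bound on the argument is a consequence of integrability: \<open>wfun\<close> is a.e. a multiple of
  the eigenfunction, which excludes \<open>Re a = 1\<close>.\<close>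

lemma eigenvalue_wfun:
 assumes z: "z \<in> point_spectrum X T"
 shows "wfun (expo z) \<in> X" "\<bar>Im (Ln ((1 - z) / (1 + z)))\<bar> < pi"
proof -
 note zn = eigenvalue_neq[OF z]
 obtain f h where fX: "f \<in> X" and f[measurable]: "f \<in> BM" and supp: "\<And>s. s \<notin> {-1<..<1} ==> f s = 0"
  and fi: "integrable lborel f" and b: "bdry (cauchyF f) (%\<sigma> x. h x + of_real \<sigma> * f x)"
  and hf: "AE x in lborel. \<bar>x\<bar> < 1 --> h x = z * f x" and nz: "\<not> (AE x in lborel. f x = 0)"
  using z by (rule eigenfunction) blast
 define a where "a = expo z"
 have \<zeta>0: "(1 - z) / (1 + z) \<noteq> 0" using zn by (auto simp: add_eq_0_iff)
 have Re_a: "Re a = 1 / 2 + Im (Ln ((1 - z) / (1 + z))) / (2 * pi)" unfolding a_def by (rule Re_expo)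
 have r: "0 < Re a" "Re a <= 1" using mpi_less_Im_Ln[OF \<zeta>0] Im_Ln_le_pi[OF \<zeta>0] unfolding Re_a by (simp_all add: field_simps)
 define W where "W = (%z. (z + 1) * exp (a * Lg z))"
 define w where "w = (%\<sigma> x. (of_real x + 1) * exp (a * Lgb \<sigma> x))"
 define M where "M = exp (pi * \<bar>Im a\<bar>)"
 define A where "A = (\<integral>s. norm (f s) \<partial>lborel)"
 have A: "0 <= A" and M: "0 < M" unfolding A_def M_def by auto
 have bm: "bdry (%z. cauchyF f z * W z) (%\<sigma> x. (h x + of_real \<sigma> * f x) * w \<sigma> x)"
 \<comment> \<open>For \<open>norm v \<le> 3\<close> the multiplier is at most \<open>4 * M\<close>.
   Farther out the Cauchy integral is at most \<open>A / (pi * (norm v - 1))\<close> and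
   \<open>W\<close> at most \<open>M * (1 + norm v)\<close>; the ratio
   \<open>(1 + norm v) / (norm v - 1)\<close> is at most 2 there, whence
   \<open>2 * M * A / pi\<close>.\<close>
 proof (rule bdry_mult[OF b, where C="4 * M + 2 * M * A / pi"])
  show "W holomorphic_on {z. Im z \<noteq> 0}" unfolding W_def by (intro holomorphic_intros Lg_holomorphic)
  fix \<sigma> :: real assume sg: "\<sigma> \<in> {1, -1}"
  show "w \<sigma> \<in> BM" unfolding w_def by measurable
  show "AE x in lborel. (%n. W (Complex x (\<sigma> * hgt n))) \<longlonglongrightarrow> w \<sigma> x" using AE_neq_pm1
  proof eventually_elim
   case (elim x)
   then have l: "(%n. Lg (Complex x (\<sigma> * hgt n))) \<longlonglongrightarrow> Lgb \<sigma> x" using Lg_tendsto sg by auto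
   have "(%n. cr x + \<i> * cr (\<sigma> * hgt n)) \<longlonglongrightarrow> cr x + \<i> * cr (\<sigma> * 0)"
    using filterlim_mono[OF hgt_lim at_within_le_nhds order_refl] by (intro tendsto_intros)
   then have "(%n. Complex x (\<sigma> * hgt n)) \<longlonglongrightarrow> of_real x" by (simp add: Complex_eq)
   then show ?case unfolding W_def w_def by (intro tendsto_intros l)
  qed
 next
  show "0 <= 4 * M + 2 * M * A / pi" using A M by (intro add_nonneg_nonneg divide_nonneg_pos mult_nonneg_nonneg) auto
 next
  fix v :: complex assume v: "Im v \<noteq> 0"
  have Wv: "norm (W v) <= M * (1 + norm v)" unfolding W_def M_def by (rule norm_Wfun[OF v]) (use r in auto)
  have e: "(4 * M + 2 * M * A / pi) * (norm (cauchyF f v) + 1) = norm (cauchyF f v) * (M * 4) + 4 * M + 2 * M * A / pi * norm (cauchyF f v) + 2 * M * A / pi"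
   by (simp add: algebra_simps add_divide_distrib)
  have p: "0 <= 2 * M * A / pi" using A M by simp
  have p': "0 <= 2 * M * A / pi * norm (cauchyF f v)" by (intro mult_nonneg_nonneg p) auto
  show "norm (cauchyF f v * W v) <= (4 * M + 2 * M * A / pi) * (norm (cauchyF f v) + 1)"
  proof (cases "norm v <= 3")
   case True
   have "M * (1 + norm v) <= M * 4" using True M by (intro mult_left_mono) auto
   then have "norm (cauchyF f v) * norm (W v) <= norm (cauchyF f v) * (M * 4)" using Wv by (intro mult_left_mono) auto
   then show ?thesis unfolding norm_mult e using p p' M by linarith
  next
   case False
   have "norm (cauchyF f v) <= A / (pi * (norm v - 1))" unfolding A_def
   proof (rule cauchyF_bound[OF fi])
    fix s assume "f s \<noteq> 0"
    then have "\<bar>s\<bar> < 1" using supp[of s] by fastforce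
    then show "norm v - 1 <= norm (cr s - v)" using norm_triangle_ineq2[of v "cr s"] by (simp add: norm_minus_commute)
   qed (use False in simp)
   then have "norm (cauchyF f v) * norm (W v) <= A / (pi * (norm v - 1)) * (M * (1 + norm v))"
    using Wv A False by (intro mult_mono) auto
   also have "\<dots> = (M * A / pi) * ((1 + norm v) / (norm v - 1))" by simp
   also have "\<dots> <= (M * A / pi) * 2" using A M False by (intro mult_left_mono) (auto simp: divide_le_eq)
   also have "\<dots> = 2 * M * A / pi" by simp
   finally have "norm (cauchyF f v) * norm (W v) <= 2 * M * A / pi" .
   moreover have "0 <= norm (cauchyF f v) * (M * 4)" using M by simp
   ultimately show ?thesis unfolding norm_mult e using p' M by linarith
  qed
 qed
 have q: "exp (\<i> * of_real pi * a) * exp (\<i> * of_real pi * a) = (z - 1) / (z + 1)"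
  using exp_expo[OF zn] unfolding a_def by (simp add: exp_add[symmetric] algebra_simps)
 let ?q = "exp (\<i> * of_real pi * a)"
 have z1: "z + 1 \<noteq> 0" using zn eq_neg_iff_add_eq_0[of z 1] by simp
 \<comment> \<open>The purpose of the exponent: \<open>(z + 1) * f\<close> and
   \<open>(z - 1) * f\<close>, the boundary values from above and below, become equal after
   multiplication by the factors that \<open>W\<close> has at the angles \<open>pi\<close> and
   \<open>- pi\<close>.\<close>
 have q': "(z + 1) * ?q = (z - 1) * exp (- (\<i> * of_real pi * a))"
 proof -
  have "(z + 1) * (?q * ?q) = z - 1" unfolding q using z1 by simp
  moreover have "?q * exp (- (\<i> * of_real pi * a)) = 1" by (simp add: exp_add[symmetric])
  ultimately have "(z + 1) * ?q * (?q * exp (- (\<i> * of_real pi * a))) = (z - 1) * exp (- (\<i> * of_real pi * a))"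
   by (metis mult.assoc)
  then show ?thesis using \<open>?q * exp (- (\<i> * of_real pi * a)) = 1\<close> by (metis mult_1_right)
 qed
 have win: "w \<sigma> x = (of_real x + 1) * exp (a * of_real (ln ((1 - x) / (1 + x)))) * exp (of_real \<sigma> * (\<i> * of_real pi * a))" if "\<bar>x\<bar> < 1" for \<sigma> x
  using that unfolding w_def Lgb_def by (simp add: exp_add[symmetric] algebra_simps)
 have "\<exists>c. (\<forall>v. 0 < Im v --> cauchyF f v * W v = c) \<and> (AE x in lborel. (h x + of_real 1 * f x) * w 1 x = c)"
 proof (rule bdry_const[OF bm])
  show "AE x in lborel. (h x + of_real 1 * f x) * w 1 x = (h x + of_real (-1) * f x) * w (-1) x"
   using hf
  proof eventually_elim
   case (elim x)
   show ?case
   proof (cases "\<bar>x\<bar> < 1")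
    case True
    let ?R = "f x * (of_real x + 1) * exp (a * of_real (ln ((1 - x) / (1 + x))))"
    have "(h x + of_real 1 * f x) * w 1 x = ?R * ((z + 1) * ?q)" unfolding win[OF True] using elim True by (simp add: algebra_simps)
    also have "\<dots> = (h x + of_real (-1) * f x) * w (-1) x" unfolding q' win[OF True] using elim True by (simp add: algebra_simps)
    finally show ?thesis .
   next
    case False
    have "f x = 0" by (rule supp) (use False in auto)
    moreover have "w 1 x = w (-1) x" unfolding w_def Lgb_outside[OF False, of 1 "-1"] ..
    ultimately show ?thesis by simp
   qed
  qed
 qed
 then obtain c where c: "AE x in lborel. (h x + f x) * w 1 x = c" by auto
 define c' where "c' = c / ((z + 1) * ?q)"
 have fw: "AE x in lborel. f x = c' * wfun a x"
  using c hf
 proof eventually_elim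
  case (elim x)
  show ?case
  proof (cases "\<bar>x\<bar> < 1")
   case True
   then have "of_real (1 + x) \<noteq> (0::complex)" unfolding of_real_eq_0_iff by auto
   moreover define p where "p = exp (a * of_real (ln ((1 - x) / (1 + x))))"
   ultimately have nz: "cr (1 + x) \<noteq> 0" "p \<noteq> 0" "(z + 1) * ?q \<noteq> 0" using z1 by auto
   have aux: "F = C / K * (inverse P / R)" if "R \<noteq> 0" "P \<noteq> 0" "K \<noteq> 0" "C = F * (R * P) * K" for F C K P R :: complex
    using that by (simp add: field_simps)
   have ceq: "c = f x * (of_real (1 + x) * p) * ((z + 1) * ?q)"
    using elim True unfolding win[OF True] p_def[symmetric] by (simp add: algebra_simps)
   have weq: "wfun a x = inverse p / of_real (1 + x)" using True unfolding wfun_def p_def by (simp add: exp_minus)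
   show ?thesis unfolding c'_def weq by (rule aux[OF nz ceq])
  next
   case False
   have "f x = 0" by (rule supp) (use False in auto)
   then show ?thesis using False by (simp add: wfun_def)
  qed
 qed
 have "c' \<noteq> 0"
 proof
  assume "c' = 0"
  then show False using fw nz by simp
 qed
 then have wf: "AE x in lborel. wfun a x = inverse c' * f x" using fw by (auto elim!: eventually_mono)
 show "wfun (expo z) \<in> X"
 proof (rule ae_closed[OF scale_mem[OF fX, of "inverse c'"] borel_L0[OF wfun_measurable]])
  show "ae_eq (%x. inverse c' * f x) (wfun (expo z))"
   unfolding ae_eq_def AE_M11 using wf unfolding a_def by eventually_elim simp
 qed
 have "integrable lborel (%x. inverse c' * f x)" using fi by simp
 then have "integrable lborel (wfun a)" using integrable_cong_AE[of "wfun a" lborel "%x. inverse c' * f x"] wf by simp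
 then have "Re a \<noteq> 1" using wfun_not_integrable by blast
 then have "Im (Ln ((1 - z) / (1 + z))) \<noteq> pi" unfolding Re_a by auto
 then show "\<bar>Im (Ln ((1 - z) / (1 + z)))\<bar> < pi" using mpi_less_Im_Ln[OF \<zeta>0] Im_Ln_le_pi[OF \<zeta>0] by linarith
qed

text \<open>On (-1,1) the model function \<open>exp (- a * Lg v) / (v + 1)\<close> jumps by
  \<open>\<kappa> * w\<close> and \<open>cauchyF w\<close> by \<open>2 * w\<close>. The combination
  without a jump decays along the imaginary axis, so its boundary values vanish, and this gives
  \<open>h + w\<close> explicitly.\<close>

lemma wfun_eigenfunction:
 assumes zn: "z \<noteq> 1" "z \<noteq> -1" and lt: "\<bar>Im (Ln ((1 - z) / (1 + z)))\<bar> < pi" and wX: "wfun (expo z) \<in> X"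
 shows "z \<in> point_spectrum X T"
proof -
 define a where "a = expo z"
 define w where "w = wfun a"
 have wm[measurable]: "w \<in> BM" unfolding w_def by measurable
 have w0: "w x = 0" if "x \<notin> {-1<..<1}" for x using that by (auto simp: w_def wfun_def)
 have w1: "w x \<noteq> 0" if "\<bar>x\<bar> < 1" for x
 proof -
  have "0 < norm (w x)" unfolding w_def norm_wfun[OF that] using that by (intro divide_pos_pos) auto
  then show ?thesis by simp
 qed
 have r: "0 < Re a" "Re a < 1" using lt unfolding a_def Re_expo by (simp_all add: field_simps)
 have wX': "w \<in> X" using wX unfolding w_def a_def .
 obtain h where h: "h \<in> BM" "integrable lborel w"
  "AE x in lborel. ((%e. ptrunc e w x) \<longlongrightarrow> h x) (at_right 0)" "bdry (cauchyF w) (%\<sigma> x. h x + of_real \<sigma> * w x)"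
  by (rule hilbert_bdry[OF wX' wm w0])
 let ?q = "exp (\<i> * of_real pi * a)" and ?q' = "exp (- (\<i> * of_real pi * a))"
 define \<kappa> where "\<kappa> = ?q' - ?q"
 have z1: "z + 1 \<noteq> 0" using zn eq_neg_iff_add_eq_0[of z 1] by simp
 have qq': "?q * ?q' = 1" by (simp add: exp_add[symmetric])
 have qq: "?q * ?q = (z - 1) / (z + 1)"
  using exp_expo[OF zn] unfolding a_def by (simp add: exp_add[symmetric] algebra_simps)
 \<comment> \<open>Multiplying the boundary identity by \<open>?q\<close> leaves only
   \<open>?q * ?q\<close>, which is rational in \<open>z\<close>.\<close>
 have kq: "\<kappa> * ?q = 2 / (z + 1)"
 proof -
  have "\<kappa> * ?q = 1 - (z - 1) / (z + 1)" unfolding \<kappa>_def using qq' qq by (simp add: algebra_simps)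
  then show ?thesis using z1 by (simp add: field_simps)
 qed
 then have k0: "\<kappa> \<noteq> 0" using z1 by auto
 define A where "A = (\<integral>s. norm (w s) \<partial>lborel)"
 define M where "M = exp (pi * \<bar>Im a\<bar>)"
 have bd: "bdry (%v. exp (- a * Lg v) / (v + 1) - \<kappa> / 2 * cauchyF w v)
   (%\<sigma> x. exp (- a * Lgb \<sigma> x) / of_real (x + 1) - \<kappa> / 2 * (h x + of_real \<sigma> * w x))"
  by (rule bdry_diff[OF bdry_Vfun[OF r] h(4)])
 have Vin: "exp (- a * Lgb \<sigma> x) / of_real (x + 1) = w x * exp (- (of_real \<sigma> * (\<i> * of_real pi * a)))" if "\<bar>x\<bar> < 1" for \<sigma> x
 proof -
  have "exp (- a * Lgb \<sigma> x) = exp (- a * of_real (ln ((1 - x) / (1 + x)))) * exp (- (of_real \<sigma> * (\<i> * of_real pi * a)))"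
   unfolding Lgb_def if_P[OF that] exp_add[symmetric] by (rule arg_cong[where f=exp]) (simp add: algebra_simps)
  then show ?thesis unfolding w_def wfun_def if_P[OF that] by (simp add: add.commute)
 qed
 have "AE x in lborel. exp (- a * Lgb 1 x) / of_real (x + 1) - \<kappa> / 2 * (h x + of_real 1 * w x) = 0"
 proof (rule bdry_zero(2)[OF bd])
  show "AE x in lborel. exp (- a * Lgb 1 x) / of_real (x + 1) - \<kappa> / 2 * (h x + of_real 1 * w x) =
    exp (- a * Lgb (-1) x) / of_real (x + 1) - \<kappa> / 2 * (h x + of_real (-1) * w x)"
  proof (intro AE_I2)
   fix x show "exp (- a * Lgb 1 x) / of_real (x + 1) - \<kappa> / 2 * (h x + of_real 1 * w x) =
    exp (- a * Lgb (-1) x) / of_real (x + 1) - \<kappa> / 2 * (h x + of_real (-1) * w x)"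
   proof (cases "\<bar>x\<bar> < 1")
    case True
    show ?thesis unfolding Vin[OF True] \<kappa>_def by (simp add: field_simps)
   next
    case False
    have "w x = 0" by (rule w0) (use False in auto)
    then show ?thesis unfolding Lgb_outside[OF False, of 1 "-1"] by simp
   qed
  qed
  fix y :: real assume y: "0 < y"
  let ?v = "Complex 0 y"
  have "y <= norm (?v - 1)" "y <= norm (?v + 1)" using abs_Im_le_cmod[of "?v - 1"] abs_Im_le_cmod[of "?v + 1"] y by simp_all
  then have "norm (?v - 1) powr (- Re a) * norm (?v + 1) powr (Re a - 1) <= y powr (- Re a) * y powr (Re a - 1)"
   using y r by (intro mult_mono powr_mono2') auto
  \<comment> \<open>The two exponents add up to -1, whatever \<open>a\<close> is; this is the decay
    rate that \<open>bdry_zero\<close> asks for.\<close>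
  also have "\<dots> = y powr (- 1)" unfolding powr_add[symmetric] by (rule arg_cong[where f="%t. y powr t"]) simp
  also have "\<dots> = 1 / y" using y by (simp add: powr_minus_divide)
  finally have "M * (norm (?v - 1) powr (- Re a) * norm (?v + 1) powr (Re a - 1)) <= M * (1 / y)"
   by (intro mult_left_mono) (auto simp: M_def)
  moreover have "norm (exp (- a * Lg ?v) / (?v + 1)) <= M * (norm (?v - 1) powr (- Re a) * norm (?v + 1) powr (Re a - 1))"
   unfolding M_def by (rule norm_Vfun) (use y in simp)
  ultimately have V: "norm (exp (- a * Lg ?v) / (?v + 1)) <= M * (1 / y)" by linarith
  have "norm (cauchyF w ?v) <= A / (pi * y)" unfolding A_def by (rule cauchyF_strip_bound[OF h(2)]) (use y in auto)
  then have "norm (\<kappa> / 2) * norm (cauchyF w ?v) <= norm (\<kappa> / 2) * (A / (pi * y))" by (intro mult_left_mono) auto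
  then have "norm (exp (- a * Lg ?v) / (?v + 1) - \<kappa> / 2 * cauchyF w ?v) <= M * (1 / y) + norm (\<kappa> / 2) * (A / (pi * y))"
   using V norm_triangle_ineq4[of "exp (- a * Lg ?v) / (?v + 1)" "\<kappa> / 2 * cauchyF w ?v"] unfolding norm_mult[of "\<kappa> / 2"] by linarith
  also have "\<dots> = (M + norm (\<kappa> / 2) * A / pi) / y" using y by (simp add: add_divide_distrib)
  finally show "norm (exp (- a * Lg ?v) / (?v + 1) - \<kappa> / 2 * cauchyF w ?v) <= (M + norm (\<kappa> / 2) * A / pi) / y" .
 qed
 then have hz: "AE x in lborel. x \<in> {-1<..<1} --> h x = z * w x"
 proof eventually_elim
  case (elim x)
  show ?case
  proof
   assume "x \<in> {-1<..<1}"
   then have x: "\<bar>x\<bar> < 1" by auto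
   have "w x * ?q' = \<kappa> / 2 * (h x + w x)" using elim unfolding Vin[OF x] by simp
   then have "w x * ?q' * ?q = \<kappa> / 2 * (h x + w x) * ?q" by (simp only:)
   moreover have "w x * ?q' * ?q = w x * (?q * ?q')" by (simp only: ac_simps)
   moreover have "k / 2 * s * t = k * t / 2 * s" for k s t :: complex by (simp add: ac_simps)
   ultimately have "w x = \<kappa> * ?q / 2 * (h x + w x)" unfolding qq' mult_1_right by (simp only:)
   moreover have half: "2 / u / 2 = 1 / u" for u :: complex by simp
   ultimately have "w x = 1 / (z + 1) * (h x + w x)" unfolding kq half by (simp only:)
   then show "h x = z * w x" using z1 by (simp add: field_simps)
  qed
 qed
 have "AE x in M11. T w x = h x" by (rule hilbert_cong[OF XL0[OF wX'] wm w0 h(2) _ h(3)]) auto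
 moreover have "AE x in M11. h x = z * w x" unfolding AE_M11 by (rule hz)
 ultimately have "ae_eq (T w) (%x. z * w x)" unfolding ae_eq_def by eventually_elim simp
 moreover have "\<not> ae_eq w (%x. 0)"
 proof
  assume "ae_eq w (%x. 0)"
  then have "AE x in lborel. x \<notin> {-1<..<1::real}" unfolding ae_eq_def AE_M11 by eventually_elim (use w1 in auto)
  then have "{-1<..<1::real} \<in> null_sets lborel" by (subst AE_iff_null_sets) auto
  then have "emeasure lborel {-1<..<1::real} = 0" by (rule null_setsD1)
  then show False by simp
 qed
 ultimately show ?thesis using wX' unfolding point_spectrum_def by blast
qed

text \<open>The dominating function lies in \<open>X\<close> because \<open>X\<close> contains, with
  a Borel function, its modulus and its reflection. The strict bound on the argument is inherited by
  \<open>\<alpha> * z\<close>, so \<open>wfun_eigenfunction\<close> applies;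
  \<open>\<alpha> = 0\<close> is included, with exponent 1/2.\<close>

lemma point_spectrum_balanced:
 assumes z: "z \<in> point_spectrum X T" and \<alpha>: "\<bar>\<alpha>\<bar> <= 1"
 shows "cr \<alpha> * z \<in> point_spectrum X T"
proof -
 let ?w = "cr \<alpha> * z"
 note zn = eigenvalue_neq[OF z] and W = eigenvalue_wfun[OF z]
 note wn = scale_neq[OF zn W(2) \<alpha>]
 have le: "\<bar>Im (Ln ((1 - ?w) / (1 + ?w)))\<bar> <= \<bar>Im (Ln ((1 - z) / (1 + z)))\<bar>" by (rule Im_Ln_scale[OF zn wn \<alpha>])
 then have "\<bar>Re (expo ?w) - 1 / 2\<bar> <= \<bar>Re (expo z) - 1 / 2\<bar>" unfolding Re_expo by (simp add: abs_divide divide_right_mono)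
 note n = norm_wfun_le[OF this]
 define g where "g = (%x. of_real (norm (wfun (expo z) x)) + of_real (norm (wfun (expo z) (- x))) :: complex)"
 have abs: "(%x. cr (norm (f x))) \<in> X" if "f \<in> X" "f \<in> BM" for f
  by (rule lattice_mem(1)[OF borel_L0 that(1)]) (use that(2) in auto)
 have m: "(%x. wfun (expo z) (- x)) \<in> BM" by measurable
 have gX: "g \<in> X" unfolding g_def by (rule add_mem[OF abs[OF W(1) wfun_measurable] abs[OF hilbert_reflect(1)[OF W(1)] m]])
 have "wfun (expo ?w) \<in> X"
 proof (rule lattice_mem(1)[OF borel_L0[OF wfun_measurable] gX], intro AE_I2)
  fix x
  have "norm (g x) = norm (wfun (expo z) x) + norm (wfun (expo z) (- x))"
   unfolding g_def of_real_add[symmetric] norm_of_real by simp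
  then show "norm (wfun (expo ?w) x) <= norm (g x)" using n[of x] by simp
 qed
 then show ?thesis by (rule wfun_eigenfunction[OF wn order.strict_trans1[OF le W(2)]])
qed

end

theorem proposition3p1:
  fixes X :: "(real \<Rightarrow> complex) set" and N :: "(real \<Rightarrow> complex) \<Rightarrow> real"
  assumes "ri_space X N"
    and "0 < lower_Boyd X N"
    and "lower_Boyd X N \<le> upper_Boyd X N"
    and "upper_Boyd X N < 1"
  shows "(\<forall>S \<in> {spectrum X N finite_Hilbert, point_spectrum X finite_Hilbert,
                 continuous_spectrum X N finite_Hilbert, residual_spectrum X N finite_Hilbert}.
            axes_symmetric S \<and> uminus ` S = S) \<and>
         (\<forall>z \<in> point_spectrum X finite_Hilbert. \<forall>\<alpha>::real.
            \<bar>\<alpha>\<bar> \<le> 1 \<longrightarrow> complex_of_real \<alpha> * z \<in> point_spectrum X finite_Hilbert)"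
proof -
  interpret ri_space X N by (rule assms(1))
  interpret boyd_space X N by unfold_locales (rule assms(4), rule assms(2))
  show ?thesis
  proof (rule conjI; intro ballI allI impI)
    fix S assume "S \<in> {spectrum X N finite_Hilbert, point_spectrum X finite_Hilbert,
      continuous_spectrum X N finite_Hilbert, residual_spectrum X N finite_Hilbert}"
    then show "axes_symmetric S \<and> uminus ` S = S" by (rule spectra_symmetric)
  next
    fix z and \<alpha> :: real assume "z \<in> point_spectrum X finite_Hilbert" "\<bar>\<alpha>\<bar> \<le> 1"
    then show "complex_of_real \<alpha> * z \<in> point_spectrum X finite_Hilbert" by (rule point_spectrum_balanced)
  qed
qed

end
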